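(* Let $(t_n)$ be the sequence of jump times and $t_\infty=\lim_{n\to\infty}t_n$ the explosion time for the minimal PDMP $\{X(t)\}_{t\ge0}$ with characteristics $(\pi,\varphi,\mathcal J)$, and let $\{P(t)\}_{t\ge0}$ be the minimal semigroup on $L^1$ corresponding to $(\pi,\varphi,\mathcal J)$. Then the following hold: (1) For any $\lambda>0$, $$\lim_{n\to\infty}(P(\varphi R(\lambda,A)))^{*n}1(x)=\mathbb E_x(e^{-\lambda t_\infty})\quad \text{for } m\text{-a.e. } x .$$ (2) For any $B\in\mathcal B(E)$, $u\in\mathcal D(A)_+$ and $t>0$, $$\int_B P(t)u(x)\,m(dx)=\int_E\mathbb P_x(X(t)\in B,\ t<t_\infty)\,u(x)\,m(dx).$$ (3) The operator $K\colon L^1\to L^1$ defined by $Ku=\lim_{\lambda\downarrow0}P(\varphi R(\lambda,A)u)$, $u\in L^1$, is the transition operator corresponding to the discrete-time Markov process $(X(t_n))_{n\ge0}$ with stochastic kernel $$\mathcal K(x,B)=\int_0^\infty \mathcal J(\pi_sx,B)\,\varphi(\pi_sx)\,e^{-\int_0^s\varphi(\pi_rx)dr}\,ds,\quad x\in E,\ B\in\mathcal B(E).$$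
   Context: Convention: $e^{-\infty}=0$. Process. $E$ is a Borel subset of a Polish space with Borel $\sigma$-algebra $\mathcal B(E)$. The characteristics are: (i) a semidynamical system $\pi\colon\mathbb R_+\times E\to E$: $\pi_0x=x$, $\pi_{t+s}x=\pi_t(\pi_sx)$, and $(t,x)\mapsto\pi_tx$ is continuous; (ii) a Borel measurable jump rate function $\varphi\colon E\to\mathbb R_+$ such that for every $x\in E$, $t>0$ the function $s\mapsto\varphi(\pi_sx)$ is integrable on $[0,t)$, and $\lim_{t\to\infty}\int_0^t\varphi(\pi_sx)ds=+\infty$ for all $x\in E$; (iii) a stochastic transition kernel $\mathcal J\colon E\times\mathcal B(E)\to[0,1]$ ($\mathcal J(x,\cdot)$ a probability measure, $x\mapsto\mathcal J(x,B)$ measurable) with $\mathcal J(x,\{x\})=0$ for all $x\in E$. Put $\phi_x(t)=\int_0^t\varphi(\pi_sx)ds$, $\phi_x^{\leftarrow}(q)=\inf\{t:\phi_x(t)\ge q\}$, and let $\kappa\colon[0,1]\times E\to E$ be measurable with $\mathcal J(x,B)$ equal to the Lebesgue measure of $\{q\in[0,1]:\kappa(q,x)\in B\}$ for all $x,B$. Let $\varepsilon_n,\vartheta_n$, $n\ge1$, be independent, $\varepsilon_n$ exponential with mean $1$, $\vartheta_n$ uniform on $(0,1)$. Starting from $\xi_0=x$, define $\Delta t_n=\phi_{\xi_{n-1}}^{\leftarrow}(\varepsilon_n)$, $\xi_n=\kappa(\vartheta_n,\pi_{\Delta t_n}\xi_{n-1})$ for $n\ge 1$, jump times $t_0=0$,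 $t_n=\sum_{l=1}^n\Delta t_l$, and $t_\infty=\lim_n t_n$. The minimal PDMP is $X(t)=\pi_{t-t_n}(\xi_n)$ for $t_n\le t<t_{n+1}$, $n\ge0$, and $X(t)=\Delta$ (a cemetery state $\Delta\notin E$) for $t\ge t_\infty$. $\mathbb P_x,\mathbb E_x$ denote probability and expectation when $X(0)=\xi_0=x$. Semigroup. $m$ is a $\sigma$-finite measure on $\mathcal B(E)$, $L^1=L^1(E,\mathcal B(E),m)$, $L^1_+$ its nonnegative cone, $\mathcal D(A)_+=\mathcal D(A)\cap L^1_+$. Densities are elements of $L^1_+$ of norm 1; a stochastic operator on $L^1$ is a linear operator mapping densities to densities; a stochastic operator $T$ is the transition operator corresponding to a stochastic kernel $\mathcal N$ if $\int_E\mathcal N(x,B)u(x)m(dx)=\int_BTu(x)m(dx)$ for all $B\in\mathcal B(E)$ and all densities $u$. A substochastic semigroup is a strongly continuous semigroup of positive contractions on $L^1$. $L^1_\varphi=\{u\in L^1:\int_E\varphi|u|\,dm<\infty\}$. Assumptions: there is a stochastic operator $P$ on $L^1$ which is the transition operator corresponding to $\mathcal J$; and there is a substochastic semigroup $\{S(t)\}_{t\ge0}$ on $L^1$ with generator $(A,\mathcal D(A))$ such that $\mathcal D(A)\subseteq L^1_\varphi$, $\int_EAu\,dm=-\int_E\varphi u\,dm$ for $u\in\mathcal D(A)_+$, and $$\int_Ee^{-\int_0^t\varphi(\pi_rx)dr}1_B(\pi_tx)u(x)\,m(dx)=\int_BS(t)u(x)\,m(dx)\quad (t\ge0,\ u\in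 L^1_+,\ B\in\mathcal B(E)).$$ $R(\lambda,A)=(\lambda-A)^{-1}$, and $P(\varphi R(\lambda,A))$ denotes the (positive contraction) operator $u\mapsto P(\varphi R(\lambda,A)u)$ on $L^1$, with adjoint on $L^\infty$ denoted by $^*$. The minimal semigroup $\{P(t)\}_{t\ge0}$ corresponding to $(\pi,\varphi,\mathcal J)$ is the smallest substochastic semigroup on $L^1$ whose generator is an extension of the operator $u\mapsto Au+P(\varphi u)$, $u\in\mathcal D(A)$ (it exists by the Kato--Voigt perturbation theorem; smallest means $P(t)u\le\widetilde P(t)u$ for $t\ge0$, $u\in L^1_+$ and any other such semigroup $\widetilde P$); its generator $C$ satisfies $R(\lambda,C)u=\lim_{N\to\infty}R(\lambda,A)\sum_{n=0}^N(P(\varphi R(\lambda,A)))^nu$ for $\lambda>0$, $u\in L^1$. *)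

theory Defs
  imports "HOL-Probability.Probability"
begin

section \<open>The space $L^1$ and operators on it\<close>

text \<open>
  Elements of \<open>L\<^sup>1(m)\<close> are represented by integrable functions, and equality in \<open>L\<^sup>1(m)\<close> is equality
  \<open>m\<close>-almost everywhere. Operators act on representatives and are required to respect this equality.
\<close>

definition L1 :: "'a measure \<Rightarrow> ('a \<Rightarrow> real) set" where
  "L1 m = {u. integrable m u}"

definition L1_pos :: "'a measure \<Rightarrow> ('a \<Rightarrow> real) set" where
  "L1_pos m = {u \<in> L1 m. AE x in m. 0 \<le> u x}"

definition L1_norm :: "'a measure \<Rightarrow> ('a \<Rightarrow> real) \<Rightarrow> real" where
  "L1_norm m u = (\<integral>x. \<bar>u x\<bar> \<partial>m)"

definition densities :: "'a measure \<Rightarrow> ('a \<Rightarrow> real) set" where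
  "densities m = {u \<in> L1_pos m. L1_norm m u = 1}"

definition L1_weighted :: "'a measure \<Rightarrow> ('a \<Rightarrow> real) \<Rightarrow> ('a \<Rightarrow> real) set" where
  "L1_weighted m \<phi> = {u \<in> L1 m. (\<integral>\<^sup>+x. ennreal (\<phi> x * \<bar>u x\<bar>) \<partial>m) < \<infinity>}"

definition Linf :: "'a measure \<Rightarrow> ('a \<Rightarrow> real) set" where
  "Linf m = {f \<in> borel_measurable m. \<exists>c. AE x in m. \<bar>f x\<bar> \<le> c}"

definition L1_operator :: "'a measure \<Rightarrow> (('a \<Rightarrow> real) \<Rightarrow> ('a \<Rightarrow> real)) \<Rightarrow> bool" where
  "L1_operator m T \<longleftrightarrow>
     (\<forall>u\<in>L1 m. T u \<in> L1 m) \<and>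
     (\<forall>u\<in>L1 m. \<forall>v\<in>L1 m. (AE x in m. u x = v x) \<longrightarrow> (AE x in m. T u x = T v x)) \<and>
     (\<forall>u\<in>L1 m. \<forall>v\<in>L1 m. \<forall>a b. AE x in m. T (\<lambda>y. a * u y + b * v y) x = a * T u x + b * T v x)"

definition stochastic_operator :: "'a measure \<Rightarrow> (('a \<Rightarrow> real) \<Rightarrow> ('a \<Rightarrow> real)) \<Rightarrow> bool" where
  "stochastic_operator m T \<longleftrightarrow> L1_operator m T \<and> (\<forall>u\<in>densities m. T u \<in> densities m)"

definition stochastic_kernel :: "'a measure \<Rightarrow> ('a \<Rightarrow> 'a set \<Rightarrow> real) \<Rightarrow> bool" where
  "stochastic_kernel M N \<longleftrightarrow>
     (\<forall>x\<in>space M. \<exists>\<mu>. prob_space \<mu> \<and> sets \<mu> = sets M \<and> (\<forall>B\<in>sets M. N x B = measure \<mu> B)) \<and>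
     (\<forall>B\<in>sets M. (\<lambda>x. N x B) \<in> borel_measurable M)"

definition transition_operator ::
    "'a measure \<Rightarrow> (('a \<Rightarrow> real) \<Rightarrow> ('a \<Rightarrow> real)) \<Rightarrow> ('a \<Rightarrow> 'a set \<Rightarrow> real) \<Rightarrow> bool" where
  "transition_operator m T N \<longleftrightarrow> stochastic_operator m T \<and>
     (\<forall>B\<in>sets m. \<forall>u\<in>densities m. (\<integral>x. N x B * u x \<partial>m) = (LINT x:B|m. T u x))"

text \<open>
  The adjoint on \<open>L\<^sup>\<infinity>(m)\<close>; for \<open>\<sigma>\<close>-finite \<open>m\<close> the chosen representative is unique up to
  equality \<open>m\<close>-almost everywhere.
\<close>

definition adjoint_Linf ::
    "'a measure \<Rightarrow> (('a \<Rightarrow> real) \<Rightarrow> ('a \<Rightarrow> real)) \<Rightarrow> ('a \<Rightarrow> real) \<Rightarrow> ('a \<Rightarrow> real)" where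
  "adjoint_Linf m T f =
     (SOME g. g \<in> Linf m \<and> (\<forall>u\<in>L1 m. (\<integral>x. T u x * f x \<partial>m) = (\<integral>x. u x * g x \<partial>m)))"


section \<open>Substochastic semigroups, generators and resolvents\<close>

definition substochastic_semigroup ::
    "'a measure \<Rightarrow> (real \<Rightarrow> ('a \<Rightarrow> real) \<Rightarrow> ('a \<Rightarrow> real)) \<Rightarrow> bool" where
  "substochastic_semigroup m S \<longleftrightarrow>
     (\<forall>t\<ge>0. L1_operator m (S t) \<and>
            (\<forall>u\<in>L1_pos m. S t u \<in> L1_pos m) \<and>
            (\<forall>u\<in>L1 m. L1_norm m (S t u) \<le> L1_norm m u)) \<and>
     (\<forall>u\<in>L1 m. AE x in m. S 0 u x = u x) \<and>
     (\<forall>s\<ge>0. \<forall>t\<ge>0. \<forall>u\<in>L1 m. AE x in m. S (t + s) u x = S t (S s u) x) \<and>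
     (\<forall>u\<in>L1 m. ((\<lambda>t. L1_norm m (\<lambda>x. S t u x - u x)) \<longlongrightarrow> 0) (at_right 0))"

definition in_generator ::
    "'a measure \<Rightarrow> (real \<Rightarrow> ('a \<Rightarrow> real) \<Rightarrow> ('a \<Rightarrow> real)) \<Rightarrow> ('a \<Rightarrow> real) \<Rightarrow> ('a \<Rightarrow> real) \<Rightarrow> bool" where
  "in_generator m S u v \<longleftrightarrow> u \<in> L1 m \<and> v \<in> L1 m \<and>
     ((\<lambda>t. L1_norm m (\<lambda>x. (S t u x - u x) / t - v x)) \<longlongrightarrow> 0) (at_right 0)"

definition generator_dom ::
    "'a measure \<Rightarrow> (real \<Rightarrow> ('a \<Rightarrow> real) \<Rightarrow> ('a \<Rightarrow> real)) \<Rightarrow> ('a \<Rightarrow> real) set" where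
  "generator_dom m S = {u. \<exists>v. in_generator m S u v}"

definition generator ::
    "'a measure \<Rightarrow> (real \<Rightarrow> ('a \<Rightarrow> real) \<Rightarrow> ('a \<Rightarrow> real)) \<Rightarrow> ('a \<Rightarrow> real) \<Rightarrow> ('a \<Rightarrow> real)" where
  "generator m S u = (SOME v. in_generator m S u v)"

text \<open>\<open>R(l, A) = (l - A)\<^sup>-\<^sup>1\<close>, where \<open>A\<close> is the generator of the semigroup \<open>S\<close>. For a
  substochastic semigroup, \<open>l > 0\<close> and integrable \<open>u\<close>, the chosen element exists and is unique up to
  equality \<open>m\<close>-almost everywhere; the same uniqueness holds for the value of the generator.\<close>

definition resolvent ::
    "'a measure \<Rightarrow> (real \<Rightarrow> ('a \<Rightarrow> real) \<Rightarrow> ('a \<Rightarrow> real)) \<Rightarrow> real \<Rightarrow> ('a \<Rightarrow> real) \<Rightarrow> ('a \<Rightarrow> real)" where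
  "resolvent m S l u =
     (SOME w. w \<in> generator_dom m S \<and> (AE x in m. l * w x - generator m S w x = u x))"

definition jump_resolvent ::
    "'a measure \<Rightarrow> ('a \<Rightarrow> real) \<Rightarrow> (('a \<Rightarrow> real) \<Rightarrow> ('a \<Rightarrow> real)) \<Rightarrow>
     (real \<Rightarrow> ('a \<Rightarrow> real) \<Rightarrow> ('a \<Rightarrow> real)) \<Rightarrow> real \<Rightarrow> ('a \<Rightarrow> real) \<Rightarrow> ('a \<Rightarrow> real)" where
  "jump_resolvent m \<phi> P S l u = P (\<lambda>x. \<phi> x * resolvent m S l u x)"

definition is_jump_limit ::
    "'a measure \<Rightarrow> ('a \<Rightarrow> real) \<Rightarrow> (('a \<Rightarrow> real) \<Rightarrow> ('a \<Rightarrow> real)) \<Rightarrow>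
     (real \<Rightarrow> ('a \<Rightarrow> real) \<Rightarrow> ('a \<Rightarrow> real)) \<Rightarrow> ('a \<Rightarrow> real) \<Rightarrow> ('a \<Rightarrow> real) \<Rightarrow> bool" where
  "is_jump_limit m \<phi> P S u v \<longleftrightarrow> v \<in> L1 m \<and>
     ((\<lambda>l. L1_norm m (\<lambda>x. jump_resolvent m \<phi> P S l u x - v x)) \<longlongrightarrow> 0) (at_right 0)"

definition jump_limit ::
    "'a measure \<Rightarrow> ('a \<Rightarrow> real) \<Rightarrow> (('a \<Rightarrow> real) \<Rightarrow> ('a \<Rightarrow> real)) \<Rightarrow>
     (real \<Rightarrow> ('a \<Rightarrow> real) \<Rightarrow> ('a \<Rightarrow> real)) \<Rightarrow> ('a \<Rightarrow> real) \<Rightarrow> ('a \<Rightarrow> real)" where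
  "jump_limit m \<phi> P S u = (SOME v. is_jump_limit m \<phi> P S u v)"

definition perturbed_semigroup ::
    "'a measure \<Rightarrow> ('a \<Rightarrow> real) \<Rightarrow> (('a \<Rightarrow> real) \<Rightarrow> ('a \<Rightarrow> real)) \<Rightarrow>
     (real \<Rightarrow> ('a \<Rightarrow> real) \<Rightarrow> ('a \<Rightarrow> real)) \<Rightarrow>
     (real \<Rightarrow> ('a \<Rightarrow> real) \<Rightarrow> ('a \<Rightarrow> real)) \<Rightarrow> bool" where
  "perturbed_semigroup m \<phi> P S Q \<longleftrightarrow> substochastic_semigroup m Q \<and>
     (\<forall>u\<in>generator_dom m S.
        in_generator m Q u (\<lambda>x. generator m S u x + P (\<lambda>y. \<phi> y * u y) x))"

definition minimal_semigroup ::
    "'a measure \<Rightarrow> ('a \<Rightarrow> real) \<Rightarrow> (('a \<Rightarrow> real) \<Rightarrow> ('a \<Rightarrow> real)) \<Rightarrow>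
     (real \<Rightarrow> ('a \<Rightarrow> real) \<Rightarrow> ('a \<Rightarrow> real)) \<Rightarrow>
     (real \<Rightarrow> ('a \<Rightarrow> real) \<Rightarrow> ('a \<Rightarrow> real)) \<Rightarrow> bool" where
  "minimal_semigroup m \<phi> P S PT \<longleftrightarrow> perturbed_semigroup m \<phi> P S PT \<and>
     (\<forall>Q. perturbed_semigroup m \<phi> P S Q \<longrightarrow>
        (\<forall>t\<ge>0. \<forall>u\<in>L1_pos m. AE x in m. PT t u x \<le> Q t u x))"


section \<open>The minimal piecewise deterministic Markov process\<close>

definition cum_rate :: "(real \<Rightarrow> 'a \<Rightarrow> 'a) \<Rightarrow> ('a \<Rightarrow> real) \<Rightarrow> 'a \<Rightarrow> real \<Rightarrow> real" where
  "cum_rate \<pi> \<phi> x t = (LINT s:{0..t}|lborel. \<phi> (\<pi> s x))"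

definition cum_rate_inv :: "(real \<Rightarrow> 'a \<Rightarrow> 'a) \<Rightarrow> ('a \<Rightarrow> real) \<Rightarrow> 'a \<Rightarrow> real \<Rightarrow> real" where
  "cum_rate_inv \<pi> \<phi> x q = Inf {t. 0 \<le> t \<and> q \<le> cum_rate \<pi> \<phi> x t}"

context
  fixes \<pi> :: "real \<Rightarrow> 'a \<Rightarrow> 'a" and \<phi> :: "'a \<Rightarrow> real" and \<kappa> :: "real \<Rightarrow> 'a \<Rightarrow> 'a"
    and \<epsilon> \<theta> :: "nat \<Rightarrow> 'w \<Rightarrow> real"
    and x :: 'a
begin

primrec post_jump :: "nat \<Rightarrow> 'w \<Rightarrow> 'a" where
  "post_jump 0 \<omega> = x"
| "post_jump (Suc n) \<omega> =
     \<kappa> (\<theta> (Suc n) \<omega>) (\<pi> (cum_rate_inv \<pi> \<phi> (post_jump n \<omega>) (\<epsilon> (Suc n) \<omega>)) (post_jump n \<omega>))"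

text \<open>\<open>\<Delta>t\<^sub>n\<close>, meaningful for \<open>n \<ge> 1\<close>.\<close>

definition waiting_time :: "nat \<Rightarrow> 'w \<Rightarrow> real" where
  "waiting_time n \<omega> = cum_rate_inv \<pi> \<phi> (post_jump (n - 1) \<omega>) (\<epsilon> n \<omega>)"

definition jump_time :: "nat \<Rightarrow> 'w \<Rightarrow> real" where
  "jump_time n \<omega> = (\<Sum>l=1..n. waiting_time l \<omega>)"

definition explosion_time :: "'w \<Rightarrow> ereal" where
  "explosion_time \<omega> = lim (\<lambda>n. ereal (jump_time n \<omega>))"

text \<open>The process at time \<open>t \<ge> 0\<close>; \<open>None\<close> is the cemetery state.\<close>

definition pdmp_process :: "real \<Rightarrow> 'w \<Rightarrow> 'a option" where
  "pdmp_process t \<omega> =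
     (if ereal t < explosion_time \<omega> then
        let n = (THE n. jump_time n \<omega> \<le> t \<and> t < jump_time (Suc n) \<omega>)
        in Some (\<pi> (t - jump_time n \<omega>) (post_jump n \<omega>))
      else None)"

end

text \<open>\<open>exp (-a)\<close> for \<open>a > -\<infinity>\<close>, with the convention \<open>exp (-\<infinity>) = 0\<close>.\<close>

definition exp_neg :: "ereal \<Rightarrow> real" where
  "exp_neg a = (if a = \<infinity> then 0 else exp (- real_of_ereal a))"

definition embedded_kernel ::
    "(real \<Rightarrow> 'a \<Rightarrow> 'a) \<Rightarrow> ('a \<Rightarrow> real) \<Rightarrow> ('a \<Rightarrow> 'a set \<Rightarrow> real) \<Rightarrow> 'a \<Rightarrow> 'a set \<Rightarrow> real" where
  "embedded_kernel \<pi> \<phi> J x B =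
     (LINT s:{0..}|lborel. J (\<pi> s x) B * \<phi> (\<pi> s x) * exp (- cum_rate \<pi> \<phi> x s))"

text \<open>
  Discrete-time processes with values in a measurable space \<open>M\<close> extended by a cemetery state
  \<open>None\<close>. The preimages of the sets \<open>Some ` B\<close> generate the history up to time \<open>n\<close>, since
  the preimage of \<open>{None}\<close> is the complement of the preimage of \<open>Some ` space M\<close>.
\<close>

definition history ::
    "'w measure \<Rightarrow> 'a measure \<Rightarrow> (nat \<Rightarrow> 'w \<Rightarrow> 'a option) \<Rightarrow> nat \<Rightarrow> 'w measure" where
  "history W M Y n = sigma (space W) {Y i -` (Some ` B) \<inter> space W | i B. i \<le> n \<and> B \<in> sets M}"

definition markov_process_with_kernel ::
    "'w measure \<Rightarrow> 'a measure \<Rightarrow> (nat \<Rightarrow> 'w \<Rightarrow> 'a option) \<Rightarrow> ('a \<Rightarrow> 'a set \<Rightarrow> real) \<Rightarrow> bool" where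
  "markov_process_with_kernel W M Y N \<longleftrightarrow>
     stochastic_kernel M N \<and>
     (\<forall>n. \<forall>B\<in>sets M. Y n -` (Some ` B) \<inter> space W \<in> sets W) \<and>
     (\<forall>n. AE \<omega> in W. Y n \<omega> \<in> Some ` space M) \<and>
     (\<forall>n. \<forall>B\<in>sets M. AE \<omega> in W.
        real_cond_exp W (history W M Y n) (indicator (Y (Suc n) -` (Some ` B) \<inter> space W)) \<omega>
        = N (the (Y n \<omega>)) B)"


section \<open>Standing assumptions\<close>

abbreviation borel_on :: "'a::topological_space set \<Rightarrow> 'a measure" where
  "borel_on E \<equiv> restrict_space borel E"

locale pdmp_characteristics =
  fixes E :: "'a::polish_space set"
    and \<pi> :: "real \<Rightarrow> 'a \<Rightarrow> 'a"
    and \<phi> :: "'a \<Rightarrow> real"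
    and J :: "'a \<Rightarrow> 'a set \<Rightarrow> real"
  assumes E_borel: "E \<in> sets borel"
    and flow_in: "\<And>t x. 0 \<le> t \<Longrightarrow> x \<in> E \<Longrightarrow> \<pi> t x \<in> E"
    and flow_0: "\<And>x. x \<in> E \<Longrightarrow> \<pi> 0 x = x"
    and flow_add: "\<And>s t x. 0 \<le> s \<Longrightarrow> 0 \<le> t \<Longrightarrow> x \<in> E \<Longrightarrow> \<pi> (t + s) x = \<pi> t (\<pi> s x)"
    and flow_continuous: "continuous_on ({0..} \<times> E) (\<lambda>(t, x). \<pi> t x)"
    and rate_measurable: "\<phi> \<in> borel_measurable (borel_on E)"
    and rate_nonneg: "\<And>x. x \<in> E \<Longrightarrow> 0 \<le> \<phi> x"
    and rate_integrable:
      "\<And>x t. x \<in> E \<Longrightarrow> 0 < t \<Longrightarrow> set_integrable lborel {0..<t} (\<lambda>s. \<phi> (\<pi> s x))"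
    and rate_diverges: "\<And>x. x \<in> E \<Longrightarrow> filterlim (cum_rate \<pi> \<phi> x) at_top at_top"
    and jump_kernel: "stochastic_kernel (borel_on E) J"
    and jump_moves: "\<And>x. x \<in> E \<Longrightarrow> J x {x} = 0"

text \<open>
  The uniform variables take values in \<open>(0,1)\<close> everywhere, not just almost surely, because
  \<open>\<kappa>\<close> is only specified on \<open>[0,1] \<times> E\<close>. The index \<open>0\<close> of \<open>\<epsilon>\<close> and \<open>\<theta>\<close> is not used.
\<close>

locale pdmp_construction = pdmp_characteristics E \<pi> \<phi> J + prob_space W
  for E :: "'a::polish_space set" and \<pi> \<phi> J and W :: "'w measure" +
  fixes \<kappa> :: "real \<Rightarrow> 'a \<Rightarrow> 'a"
    and \<epsilon> \<theta> :: "nat \<Rightarrow> 'w \<Rightarrow> real"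
  assumes kappa_measurable:
      "(\<lambda>(q, x). \<kappa> q x) \<in> borel_on {0..1} \<Otimes>\<^sub>M borel_on E \<rightarrow>\<^sub>M borel_on E"
    and kappa_kernel:
      "\<And>x B. x \<in> E \<Longrightarrow> B \<in> sets (borel_on E) \<Longrightarrow>
         J x B = measure lborel {q \<in> {0..1}. \<kappa> q x \<in> B}"
    and drivers_indep: "indep_vars (\<lambda>_. borel) (case_sum \<epsilon> \<theta>) ({1..} <+> {1..})"
    and eps_exponential: "\<And>n. 1 \<le> n \<Longrightarrow> distributed W lborel (\<epsilon> n) (exponential_density 1)"
    and theta_uniform: "\<And>n. 1 \<le> n \<Longrightarrow> distr W lborel (\<theta> n) = uniform_measure lborel {0<..<1}"
    and theta_range: "\<And>n \<omega>. 1 \<le> n \<Longrightarrow> \<omega> \<in> space W \<Longrightarrow> \<theta> n \<omega> \<in> {0<..<1}"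

locale pdmp_semigroup = pdmp_characteristics E \<pi> \<phi> J + sigma_finite_measure m
  for E :: "'a::polish_space set" and \<pi> \<phi> J and m :: "'a measure" +
  fixes P :: "('a \<Rightarrow> real) \<Rightarrow> ('a \<Rightarrow> real)"
    and S :: "real \<Rightarrow> ('a \<Rightarrow> real) \<Rightarrow> ('a \<Rightarrow> real)"
  assumes sets_m: "sets m = sets (borel_on E)"
    and P_transition: "transition_operator m P J"
    and S_substochastic: "substochastic_semigroup m S"
    and dom_subset: "generator_dom m S \<subseteq> L1_weighted m \<phi>"
    and generator_integral:
      "\<And>u. u \<in> generator_dom m S \<inter> L1_pos m \<Longrightarrow>
         (\<integral>x. generator m S u x \<partial>m) = - (\<integral>x. \<phi> x * u x \<partial>m)"
    and S_formula:
      "\<And>t u B. 0 \<le> t \<Longrightarrow> u \<in> L1_pos m \<Longrightarrow> B \<in> sets (borel_on E) \<Longrightarrow>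
         (\<integral>x. exp (- cum_rate \<pi> \<phi> x t) * indicator B (\<pi> t x) * u x \<partial>m) = (LINT x:B|m. S t u x)"

end

theory Submission
  imports Defs

begin

text \<open>
  The proof looks at everything from the side of functions, where an object is a kernel acting by
  integration, and returns to \<open>L\<^sup>1\<close> by duality. A kernel \<open>V\<close> that does not charge null sets has
  a predual: a positive operator \<open>T\<close> on \<open>L\<^sup>1\<close> with
  \<open>\<integral> f \<cdot> T u dm = \<integral> V f \<cdot> u dm\<close>, obtained from Radon-Nikodym (\<open>predual_of_predual\<close>) and unique up
  to equality almost everywhere. Relations between operators on \<open>L\<^sup>1\<close> thus become identities
  between kernels that hold at every point of \<open>E\<close>.

  On the side of the process, let \<open>jump_law x\<close> be the law of the first jump time and the first
  post-jump state under \<open>P\<^sub>x\<close>. Since the driving variables are independent, the next waiting time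
  and post-jump state given the past have the law \<open>jump_law (\<xi>\<^sub>n)\<close> (\<open>integrate_next_jump\<close>). Hence
  \<open>E\<^sub>x (exp (-l t\<^sub>n) f(\<xi>\<^sub>n))\<close> is the \<open>n\<close>-th iterate at \<open>x\<close> of the kernel
  \<open>K\<^sub>l f(x) = E\<^sub>x (exp (-l t\<^sub>1) f(\<xi>\<^sub>1))\<close>, and \<open>U\<^sub>t f(x) = E\<^sub>x (f(X(t)); t < t\<^sub>\<infinity>)\<close> solves the
  renewal equation obtained by conditioning on the first jump; it is the increasing limit of the
  kernels that allow fewer than \<open>N\<close> jumps. The waiting time has the density
  \<open>\<phi>(\<pi>\<^sub>s x) exp (-\<phi>\<^sub>x(s))\<close>, although \<open>\<phi>\<close> is only locally integrable along the flow
  (\<open>waiting_time_law\<close>).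

  Now \<open>S(t)\<close> is the predual of motion along the flow with killing, so \<open>R(l, A)\<close> is the predual of
  its Laplace transform (\<open>laplace_predual_in_generator\<close> and \<open>resolvent_eq\<close>), and the waiting time
  density identifies \<open>P(\<phi> R(l, A))\<close> as the predual of \<open>K\<^sub>l\<close> (\<open>predual_jump_resolvent\<close>). Its adjoint
  therefore is \<open>K\<^sub>l\<close>, the iterates applied to \<open>1\<close> are \<open>E\<^sub>x exp (-l t\<^sub>n)\<close>, and dominated convergence
  gives the first claim. As \<open>l\<close> decreases to \<open>0\<close>, \<open>K\<^sub>l\<close> increases to the kernel \<open>K\<^sub>0\<close> of the
  embedded chain, which gives the third.

  For the second claim, let \<open>Q(t)\<close> be the predual of \<open>U\<^sub>t\<close>. Splitting at a time \<open>s\<close> makes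
  \<open>Q\<close> a substochastic semigroup, and the Laplace transform of the renewal equation,
  \<open>R\<^sub>Q = R(1, A) + R\<^sub>Q P(\<phi> R(1, A))\<close>, shows that its generator extends \<open>A + P\<phi>\<close>
  (\<open>Q_perturbed\<close>); by minimality the minimal semigroup lies below \<open>Q\<close>. Conversely, for every
  semigroup whose generator extends \<open>A + P\<phi>\<close> the Laplace transform \<open>L(u)\<close> of the mass satisfies
  \<open>L(u) = \<integral> R(1, A) u dm + L(P(\<phi> R(1, A) u))\<close>. Iterating this \<open>N\<close> times bounds \<open>L(u)\<close> below
  by the contribution of the paths with fewer than \<open>N\<close> jumps, hence by the Laplace transform of
  the mass of \<open>Q\<close> (\<open>laplace_Q_le_perturbed\<close>). So the minimal semigroup lies below \<open>Q\<close> and has at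
  least the same mass; the two agree (\<open>minimal_semigroup_eq\<close>).
\<close>

section \<open>Kernels as operators on nonnegative functions\<close>

definition integral_functional :: "'a measure \<Rightarrow> (('a \<Rightarrow> ennreal) \<Rightarrow> ennreal) \<Rightarrow> bool" where
  "integral_functional M L \<longleftrightarrow>
     (\<exists>N. sets N = sets M \<and> (\<forall>f\<in>borel_measurable M. L f = (\<integral>\<^sup>+y. f y \<partial>N)))"

text \<open>
  Kernels are built from mixtures: integrals over time, sums over the number of jumps and integrals
  against the law of the first jump all have this form at each point.
\<close>

lemma integral_functional_mixture:
  assumes L: "\<And>s. s \<in> space R \<Longrightarrow> integral_functional M (L s)"
    and meas: "\<And>f. f \<in> borel_measurable M \<Longrightarrow> (\<lambda>s. L s f) \<in> borel_measurable R"
  shows "integral_functional M (\<lambda>f. \<integral>\<^sup>+s. L s f \<partial>R)"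
proof -
  have "\<forall>s\<in>space R. \<exists>N. sets N = sets M \<and> (\<forall>f\<in>borel_measurable M. L s f = (\<integral>\<^sup>+y. f y \<partial>N))"
    using L unfolding integral_functional_def by blast
  then obtain N where N_sets: "\<And>s. s \<in> space R \<Longrightarrow> sets (N s) = sets M"
    and N: "\<And>s f. s \<in> space R \<Longrightarrow> f \<in> borel_measurable M \<Longrightarrow> L s f = (\<integral>\<^sup>+y. f y \<partial>N s)"
    by metis
  define \<mu> where "\<mu> B = (\<integral>\<^sup>+s. L s (indicator B) \<partial>R)" for B
  define \<nu> where "\<nu> = measure_of (space M) (sets M) \<mu>"
  have L_ind: "L s (indicator B) = emeasure (N s) B" if "s \<in> space R" "B \<in> sets M" for s B
    using N[OF that(1), of "indicator B"] N_sets[OF that(1)] that(2) by simp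
  have sets_\<nu>[measurable_cong]: "sets \<nu> = sets M"
    by (simp add: \<nu>_def)
  have em: "emeasure \<nu> B = \<mu> B" if "B \<in> sets M" for B
  proof (rule emeasure_measure_of[OF \<nu>_def])
    show "sets M \<subseteq> Pow (space M)" by (rule sets.space_closed)
    show "B \<in> sets \<nu>" using that by (simp add: sets_\<nu>)
    show "positive (sets \<nu>) \<mu>"
    proof -
      have "\<mu> {} = (\<integral>\<^sup>+s. 0 \<partial>R)"
        unfolding \<mu>_def by (rule nn_integral_cong) (subst L_ind, auto)
      then show ?thesis by (simp add: positive_def)
    qed
    show "countably_additive (sets \<nu>) \<mu>"
    proof (rule countably_additiveI)
      fix A :: "nat \<Rightarrow> 'b set"
      assume A: "range A \<subseteq> sets \<nu>" "disjoint_family A" "(\<Union>i. A i) \<in> sets \<nu>"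
      have Ai: "A i \<in> sets M" for i using A(1) by (auto simp: sets_\<nu>)
      have "(\<Sum>i. \<mu> (A i)) = (\<integral>\<^sup>+s. (\<Sum>i. L s (indicator (A i))) \<partial>R)"
        unfolding \<mu>_def using Ai by (intro nn_integral_suminf[symmetric] meas) auto
      also have "\<dots> = \<mu> (\<Union>i. A i)"
        unfolding \<mu>_def
      proof (rule nn_integral_cong)
        fix s assume s: "s \<in> space R"
        have "(\<Sum>i. emeasure (N s) (A i)) = emeasure (N s) (\<Union>i. A i)"
          using Ai A(2) N_sets[OF s] by (intro suminf_emeasure) auto
        then show "(\<Sum>i. L s (indicator (A i))) = L s (indicator (\<Union>i. A i))"
          using L_ind[OF s] Ai by (simp add: sets.countable_UN)
      qed
      finally show "(\<Sum>i. \<mu> (A i)) = \<mu> (\<Union>i. A i)" .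
    qed
  qed
  have "(\<integral>\<^sup>+s. L s f \<partial>R) = (\<integral>\<^sup>+y. f y \<partial>\<nu>)" if f: "f \<in> borel_measurable M" for f
    using f
  proof (induction rule: borel_measurable_induct)
    case (cong f g)
    have "(\<integral>\<^sup>+y. f y \<partial>\<nu>) = (\<integral>\<^sup>+y. g y \<partial>\<nu>)"
      using cong(3) by (intro nn_integral_cong) (simp add: sets_eq_imp_space_eq[OF sets_\<nu>])
    moreover have "(\<integral>\<^sup>+s. L s f \<partial>R) = (\<integral>\<^sup>+s. L s g \<partial>R)"
    proof (rule nn_integral_cong)
      fix s assume s: "s \<in> space R"
      show "L s f = L s g"
        unfolding N[OF s cong(1)] N[OF s cong(2)]
        using cong(3) by (intro nn_integral_cong) (simp add: sets_eq_imp_space_eq[OF N_sets[OF s]])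
    qed
    ultimately show ?case using cong by simp
  next
    case (set A)
    then show ?case using em[OF set] by (simp add: \<mu>_def sets_\<nu>)
  next
    case (mult u c)
    have "(\<integral>\<^sup>+s. L s (\<lambda>x. c * u x) \<partial>R) = (\<integral>\<^sup>+s. c * L s u \<partial>R)"
    proof (rule nn_integral_cong)
      fix s assume s: "s \<in> space R"
      have [measurable_cong]: "sets (N s) = sets M" using N_sets[OF s] .
      show "L s (\<lambda>x. c * u x) = c * L s u"
        using mult(2) by (subst (1 2) N[OF s]) (auto intro: nn_integral_cmult)
    qed
    then show ?case using mult meas[of u] by (simp add: nn_integral_cmult)
  next
    case (add u v)
    have "(\<integral>\<^sup>+s. L s (\<lambda>x. v x + u x) \<partial>R) = (\<integral>\<^sup>+s. L s v + L s u \<partial>R)"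
    proof (rule nn_integral_cong)
      fix s assume s: "s \<in> space R"
      have [measurable_cong]: "sets (N s) = sets M" using N_sets[OF s] .
      have [measurable]: "u \<in> borel_measurable M" "v \<in> borel_measurable M" using add by auto
      show "L s (\<lambda>x. v x + u x) = L s v + L s u"
        by (subst (1 2 3) N[OF s]) (auto intro: nn_integral_add)
    qed
    then show ?case using add meas[of u] meas[of v] by (simp add: nn_integral_add)
  next
    case (seq U)
    have "(\<integral>\<^sup>+s. L s (\<lambda>x. \<Squnion>i. U i x) \<partial>R) = (\<integral>\<^sup>+s. (\<Squnion>i. L s (U i)) \<partial>R)"
    proof (rule nn_integral_cong)
      fix s assume s: "s \<in> space R"
      have [measurable_cong]: "sets (N s) = sets M" using N_sets[OF s] .
      have [measurable]: "U i \<in> borel_measurable M" for i using seq by auto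
      show "L s (\<lambda>x. \<Squnion>i. U i x) = (\<Squnion>i. L s (U i))"
        using seq by (subst (1 2) N[OF s])
          (auto intro!: nn_integral_monotone_convergence_SUP)
    qed
    also have "\<dots> = (\<Squnion>i. \<integral>\<^sup>+s. L s (U i) \<partial>R)"
    proof (rule nn_integral_monotone_convergence_SUP_AE)
      show "(\<lambda>s. L s (U i)) \<in> borel_measurable R" for i using seq meas by auto
      show "AE s in R. L s (U i) \<le> L s (U (Suc i))" for i
      proof (rule AE_I2)
        fix s assume s: "s \<in> space R"
        show "L s (U i) \<le> L s (U (Suc i))"
          unfolding N[OF s seq(1)] using seq(3)
          by (intro nn_integral_mono) (auto simp: incseq_Suc_iff le_fun_def)
      qed
    qed
    also have "\<dots> = (\<Squnion>i. \<integral>\<^sup>+x. U i x \<partial>\<nu>)" using seq.IH by simp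
    also have "\<dots> = (\<integral>\<^sup>+x. (\<Squnion>i. U i x) \<partial>\<nu>)"
      using seq by (intro nn_integral_monotone_convergence_SUP[symmetric])
        (auto simp: measurable_cong_sets[OF sets_\<nu> refl])
    finally show ?case by (simp add: seq image_comp SUP_apply[abs_def])
  qed
  then show ?thesis unfolding integral_functional_def using sets_\<nu> by blast
qed

text \<open>
  The constant bounds the total mass of the kernel. All kernels below have mass at most \<open>1\<close>,
  except for Laplace transforms at \<open>l\<close>, whose mass is at most \<open>1 / l\<close>.
\<close>

definition kernel_operator :: "'a measure \<Rightarrow> real \<Rightarrow> (('a \<Rightarrow> ennreal) \<Rightarrow> ('a \<Rightarrow> ennreal)) \<Rightarrow> bool" where
  "kernel_operator M c V \<longleftrightarrow> 0 \<le> c \<and>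
     (\<forall>f\<in>borel_measurable M. V f \<in> borel_measurable M) \<and>
     (\<forall>x\<in>space M. integral_functional M (\<lambda>f. V f x) \<and> V (\<lambda>_. 1) x \<le> ennreal c)"

lemma kernel_operator_measurable:
  "kernel_operator M c V \<Longrightarrow> f \<in> borel_measurable M \<Longrightarrow> V f \<in> borel_measurable M"
  by (simp add: kernel_operator_def)

lemma kernel_operator_measureE:
  assumes "kernel_operator M c V" "x \<in> space M"
  obtains N where "sets N = sets M" "\<And>f. f \<in> borel_measurable M \<Longrightarrow> V f x = (\<integral>\<^sup>+y. f y \<partial>N)"
  using assms unfolding kernel_operator_def integral_functional_def by blast

lemma kernel_operator_mono:
  assumes V: "kernel_operator M c V" and x: "x \<in> space M"
    and [measurable]: "f \<in> borel_measurable M" "g \<in> borel_measurable M"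
    and le: "\<And>y. y \<in> space M \<Longrightarrow> f y \<le> g y"
  shows "V f x \<le> V g x"
proof -
  from V x obtain N where s: "sets N = sets M"
    and N: "\<And>f. f \<in> borel_measurable M \<Longrightarrow> V f x = (\<integral>\<^sup>+y. f y \<partial>N)"
    by (rule kernel_operator_measureE) blast
  show ?thesis using le by (auto simp: N sets_eq_imp_space_eq[OF s] intro!: nn_integral_mono)
qed

lemma kernel_operator_cong:
  assumes "kernel_operator M c V" "x \<in> space M" "f \<in> borel_measurable M" "g \<in> borel_measurable M"
    and "\<And>y. y \<in> space M \<Longrightarrow> f y = g y"
  shows "V f x = V g x"
  by (rule antisym; rule kernel_operator_mono[OF assms(1,2)]) (simp_all add: assms)

lemma kernel_operator_cmult:
  assumes V: "kernel_operator M c V" and x: "x \<in> space M"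
    and [measurable]: "f \<in> borel_measurable M"
  shows "V (\<lambda>y. a * f y) x = a * V f x"
proof -
  from V x obtain N where s[measurable_cong]: "sets N = sets M"
    and N: "\<And>f. f \<in> borel_measurable M \<Longrightarrow> V f x = (\<integral>\<^sup>+y. f y \<partial>N)"
    by (rule kernel_operator_measureE) blast
  show ?thesis by (simp add: N nn_integral_cmult)
qed

lemma kernel_operator_bound:
  assumes V: "kernel_operator M c V" and x: "x \<in> space M"
    and f: "f \<in> borel_measurable M" and le: "\<And>y. y \<in> space M \<Longrightarrow> f y \<le> b"
  shows "V f x \<le> b * ennreal c"
proof -
  have "V f x \<le> V (\<lambda>y. b * 1) x" by (rule kernel_operator_mono[OF V x f]) (simp_all add: le)
  also have "\<dots> = b * V (\<lambda>_. 1) x" by (rule kernel_operator_cmult[OF V x]) simp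
  also have "\<dots> \<le> b * ennreal c" using V x by (intro mult_left_mono) (auto simp: kernel_operator_def)
  finally show ?thesis .
qed

lemma integral_functional_point:
  assumes "y \<in> space M"
  shows "integral_functional M (\<lambda>f. c * f y)"
  unfolding integral_functional_def
proof (intro exI conjI ballI)
  show "sets (scale_measure c (return M y)) = sets M" by simp
  fix f :: "'a \<Rightarrow> ennreal" assume [measurable]: "f \<in> borel_measurable M"
  show "c * f y = (\<integral>\<^sup>+y. f y \<partial>scale_measure c (return M y))"
    using assms by (subst nn_integral_scale_measure) (auto simp: nn_integral_return)
qed

lemma integral_functional_sets_cong:
  "sets M = sets M' \<Longrightarrow> integral_functional M L = integral_functional M' L"
  unfolding integral_functional_def by (simp cong: measurable_cong_sets)

lemma kernel_operator_sets_cong: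
  assumes "sets M = sets M'" "kernel_operator M c V" shows "kernel_operator M' c V"
proof -
  have "borel_measurable M = (borel_measurable M' :: ('a \<Rightarrow> ennreal) set)"
    by (rule measurable_cong_sets) (simp_all add: assms)
  then show ?thesis
    using assms(2) sets_eq_imp_space_eq[OF assms(1)] integral_functional_sets_cong[OF assms(1)]
    by (simp add: kernel_operator_def)
qed

section \<open>The space of integrable functions and its operators\<close>

lemma diff_pos_neg_parts: "max 0 a - max 0 (- a) = (a::real)"
  unfolding max_def by (cases "0 \<le> a") auto

lemma mult_diff_pos_neg_parts: "b * max 0 a - b * max 0 (- a) = b * (a::real)"
  by (subst right_diff_distrib[symmetric], subst diff_pos_neg_parts) (rule refl)

lemma L1_lin: "u \<in> L1 m \<Longrightarrow> v \<in> L1 m \<Longrightarrow> (\<lambda>x. a * u x + b * v x) \<in> L1 m"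
  by (simp add: L1_def)

lemma L1_diff: "u \<in> L1 m \<Longrightarrow> v \<in> L1 m \<Longrightarrow> (\<lambda>x. u x - v x) \<in> L1 m"
  by (simp add: L1_def)

lemma L1_pos_L1: "u \<in> L1_pos m \<Longrightarrow> u \<in> L1 m"
  by (simp add: L1_pos_def)

lemma L1_norm_nonneg: "0 \<le> L1_norm m u"
  by (simp add: L1_norm_def)

lemma L1_norm_triangle:
  assumes "u \<in> L1 m" "v \<in> L1 m"
  shows "L1_norm m (\<lambda>x. u x + v x) \<le> L1_norm m u + L1_norm m v"
proof -
  have i: "integrable m u" "integrable m v" using assms by (auto simp: L1_def)
  have "L1_norm m (\<lambda>x. u x + v x) \<le> (\<integral>x. \<bar>u x\<bar> + \<bar>v x\<bar> \<partial>m)"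
    unfolding L1_norm_def using i
    by (intro integral_mono Bochner_Integration.integrable_add integrable_abs abs_triangle_ineq)
  also have "\<dots> = L1_norm m u + L1_norm m v"
    unfolding L1_norm_def using i by (intro Bochner_Integration.integral_add integrable_abs) auto
  finally show ?thesis .
qed

lemma L1_norm_cmult: "L1_norm m (\<lambda>x. a * u x) = \<bar>a\<bar> * L1_norm m u"
  by (simp add: L1_norm_def abs_mult)

lemma L1_norm_triangle_diff:
  "u \<in> L1 m \<Longrightarrow> v \<in> L1 m \<Longrightarrow> L1_norm m (\<lambda>x. u x - v x) \<le> L1_norm m u + L1_norm m v"
  using L1_norm_triangle[of u m "\<lambda>x. -1 * v x"] L1_norm_cmult[of m "-1" v]
  by (simp add: L1_def)

lemma L1_norm_cong_AE:
  "u \<in> L1 m \<Longrightarrow> v \<in> L1 m \<Longrightarrow> AE x in m. u x = v x \<Longrightarrow> L1_norm m u = L1_norm m v"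
  unfolding L1_norm_def L1_def by (intro integral_cong_AE) auto

lemma L1_pos_norm: "u \<in> L1_pos m \<Longrightarrow> L1_norm m u = (\<integral>x. u x \<partial>m)"
  unfolding L1_norm_def L1_pos_def L1_def by (intro integral_cong_AE) auto

lemma L1_indicator_integrable:
  "u \<in> L1 m \<Longrightarrow> B \<in> sets m \<Longrightarrow> integrable m (\<lambda>x. indicator B x * u x :: real)"
  using integrable_real_mult_indicator[of B m u] by (simp add: L1_def mult.commute)

lemma set_integral_le_L1_norm:
  assumes "u \<in> L1 m" "B \<in> sets m"
  shows "\<bar>LINT x:B|m. u x\<bar> \<le> L1_norm m u"
proof -
  have "\<bar>LINT x:B|m. u x\<bar> \<le> (\<integral>x. \<bar>indicator B x * u x\<bar> \<partial>m)"
    unfolding set_lebesgue_integral_def using integral_abs_bound[of m "\<lambda>x. indicator B x * u x"] by simp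
  also have "\<dots> \<le> L1_norm m u"
    unfolding L1_norm_def using assms
    by (intro integral_mono integrable_abs L1_indicator_integrable) (auto simp: L1_def indicator_def)
  finally show ?thesis .
qed

text \<open>
  The positive and the negative part are each integrals over one set. This reduces norm estimates
  to estimates of set integrals that are uniform in the set, and these can be computed by duality.
\<close>

lemma L1_norm_le_set_integrals:
  assumes u: "u \<in> L1 m" and le: "\<And>B. B \<in> sets m \<Longrightarrow> \<bar>LINT x:B|m. u x\<bar> \<le> c"
  shows "L1_norm m u \<le> 2 * c"
proof -
  have [measurable]: "u \<in> borel_measurable m" and int: "integrable m u" using u by (auto simp: L1_def)
  define A where "A = {x \<in> space m. 0 \<le> u x}"
  have A: "A \<in> sets m" unfolding A_def by measurable
  have "L1_norm m u = (\<integral>x. indicator A x * u x - indicator (space m - A) x * u x \<partial>m)"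
    unfolding L1_norm_def
    by (intro Bochner_Integration.integral_cong) (auto simp: A_def indicator_def)
  also have "\<dots> = (LINT x:A|m. u x) - (LINT x:(space m - A)|m. u x)"
    unfolding set_lebesgue_integral_def using A int
    by (simp, subst Bochner_Integration.integral_diff)
       (auto intro!: integrable_real_mult_indicator simp: mult.commute)
  also have "\<dots> \<le> c + c" using le[OF A] le[of "space m - A"] A by fastforce
  finally show ?thesis by simp
qed

text \<open>
  The norm is only assumed to be at most zero because this is the form in which limits of
  inequalities arrive.
\<close>

lemma AE_eq_of_L1_norm:
  assumes "u \<in> L1 m" "v \<in> L1 m" "L1_norm m (\<lambda>x. u x - v x) \<le> 0"
  shows "AE x in m. u x = v x"
proof -
  have "integrable m (\<lambda>x. u x - v x)" using assms by (simp add: L1_def)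
  moreover have "(\<integral>x. norm (u x - v x) \<partial>m) = 0"
    using assms(3) L1_norm_nonneg[of m "\<lambda>x. u x - v x"] by (intro antisym) (simp_all add: L1_norm_def)
  ultimately have "AE x in m. u x - v x = 0" using integral_nonneg_eq_0_iff_AE[of m "\<lambda>x. norm (u x - v x)"] by (simp add: integrable_norm)
  then show ?thesis by eventually_elim simp
qed

lemma AE_eq_of_set_integrals:
  assumes "u \<in> L1 m" "v \<in> L1 m" "\<And>B. B \<in> sets m \<Longrightarrow> (LINT x:B|m. u x) = (LINT x:B|m. v x)"
  shows "AE x in m. u x = v x"
proof (rule AE_eq_of_L1_norm[OF assms(1,2)])
  have "L1_norm m (\<lambda>x. u x - v x) \<le> 2 * 0"
    using assms by (intro L1_norm_le_set_integrals L1_diff)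
      (auto simp: L1_def set_integrable_def set_integral_diff integrable_real_mult_indicator mult.commute)
  then show "L1_norm m (\<lambda>x. u x - v x) \<le> 0" by simp
qed

lemma L1_pos_nn_integral:
  assumes "u \<in> L1_pos m"
  shows "(\<integral>\<^sup>+x. ennreal (u x) \<partial>m) = ennreal (L1_norm m u)"
  using assms L1_pos_norm[OF assms]
  by (simp add: L1_pos_def L1_def nn_integral_eq_integral)

lemma L1_pos_set_integral:
  assumes u: "u \<in> L1_pos m" and B: "B \<in> sets m"
  shows "(\<integral>\<^sup>+x. indicator B x * ennreal (u x) \<partial>m) = ennreal (LINT x:B|m. u x)"
    and "0 \<le> (LINT x:B|m. u x)"
proof -
  have i: "integrable m (\<lambda>x. indicator B x * u x)"
    using u B by (auto simp: L1_pos_def L1_def intro!: integrable_real_mult_indicator simp: mult.commute)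
  have p: "AE x in m. 0 \<le> indicator B x * u x"
    using u by (auto simp: L1_pos_def elim: eventually_mono)
  have "(\<integral>\<^sup>+x. indicator B x * ennreal (u x) \<partial>m) = (\<integral>\<^sup>+x. ennreal (indicator B x * u x) \<partial>m)"
    by (intro nn_integral_cong) (auto simp: indicator_def)
  then show "(\<integral>\<^sup>+x. indicator B x * ennreal (u x) \<partial>m) = ennreal (LINT x:B|m. u x)"
    using nn_integral_eq_integral[OF i p] by (simp add: set_lebesgue_integral_def)
  show "0 \<le> (LINT x:B|m. u x)"
    using integral_nonneg_AE[OF p] by (simp add: set_lebesgue_integral_def)
qed

lemma L1_pos_eq_of_nn_integrals:
  assumes u: "u \<in> L1_pos m" and v: "v \<in> L1_pos m"
    and "\<And>B. B \<in> sets m \<Longrightarrow>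
      (\<integral>\<^sup>+x. indicator B x * ennreal (u x) \<partial>m) = (\<integral>\<^sup>+x. indicator B x * ennreal (v x) \<partial>m)"
  shows "AE x in m. u x = v x"
  using assms L1_pos_set_integral[OF u] L1_pos_set_integral[OF v]
  by (intro AE_eq_of_set_integrals) (auto simp: L1_pos_L1)

lemma L1_pos_eq_of_le:
  assumes u: "u \<in> L1_pos m" and v: "v \<in> L1_pos m"
    and le: "AE x in m. u x \<le> v x" and int: "(\<integral>x. v x \<partial>m) \<le> (\<integral>x. u x \<partial>m)"
  shows "AE x in m. u x = v x"
proof (rule AE_eq_of_L1_norm)
  have "L1_norm m (\<lambda>x. u x - v x) = (\<integral>x. v x - u x \<partial>m)"
    unfolding L1_norm_def using le u v
    by (intro integral_cong_AE) (auto simp: L1_pos_def L1_def elim!: eventually_mono)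
  then show "L1_norm m (\<lambda>x. u x - v x) \<le> 0"
    using int u v by (simp add: L1_pos_def L1_def)
qed (use u v in \<open>auto simp: L1_pos_L1\<close>)

lemma L1_pos_parts:
  assumes "u \<in> L1 m"
  shows "(\<lambda>x. max 0 (u x)) \<in> L1_pos m" "(\<lambda>x. max 0 (- u x)) \<in> L1_pos m"
  using assms by (auto simp: L1_pos_def L1_def)

lemma L1_operatorD:
  assumes "L1_operator m T"
  shows "u \<in> L1 m \<Longrightarrow> T u \<in> L1 m"
    and "u \<in> L1 m \<Longrightarrow> v \<in> L1 m \<Longrightarrow> AE x in m. u x = v x \<Longrightarrow> AE x in m. T u x = T v x"
    and "u \<in> L1 m \<Longrightarrow> v \<in> L1 m \<Longrightarrow> AE x in m. T (\<lambda>y. a * u y + b * v y) x = a * T u x + b * T v x"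
  using assms by (auto simp: L1_operator_def)

lemma L1_operator_diff:
  assumes "L1_operator m T" "u \<in> L1 m" "v \<in> L1 m"
  shows "AE x in m. T (\<lambda>y. u y - v y) x = T u x - T v x"
  using L1_operatorD(3)[OF assms, of 1 "-1"] by simp

lemma L1_operator_cmult:
  assumes "L1_operator m T" "u \<in> L1 m"
  shows "AE x in m. T (\<lambda>y. a * u y) x = a * T u x"
  using L1_operatorD(3)[OF assms assms(2), of a 0] by simp

lemma L1_operator_parts:
  assumes "L1_operator m T" "u \<in> L1 m"
  shows "AE x in m. T u x = T (\<lambda>x. max 0 (u x)) x - T (\<lambda>x. max 0 (- u x)) x"
proof -
  have "(\<lambda>y. max 0 (u y) - max 0 (- u y)) = u" by (auto simp: max_def)
  then show ?thesis
    using L1_operator_diff[OF assms(1) L1_pos_L1[OF L1_pos_parts(1)] L1_pos_L1[OF L1_pos_parts(2)], OF assms(2) assms(2)]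
    by simp
qed

lemma L1_operator_eq_on_L1:
  assumes T: "L1_operator m T" and T': "L1_operator m T'"
    and eq: "\<And>u. u \<in> L1_pos m \<Longrightarrow> AE x in m. T u x = T' u x" and u: "u \<in> L1 m"
  shows "AE x in m. T u x = T' u x"
  using L1_operator_parts[OF T u] L1_operator_parts[OF T' u] eq[OF L1_pos_parts(1)[OF u]]
    eq[OF L1_pos_parts(2)[OF u]] by eventually_elim simp

lemma set_integral_L1_diff:
  assumes "u \<in> L1 m" "v \<in> L1 m" "B \<in> sets m"
  shows "(LINT x:B|m. u x - v x) = (LINT x:B|m. u x) - (LINT x:B|m. v x)"
  using L1_indicator_integrable[OF assms(1,3)] L1_indicator_integrable[OF assms(2,3)]
  by (simp add: set_lebesgue_integral_def right_diff_distrib)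

lemma set_integral_UNIV_space: "(LINT x:space m|m. f x) = (\<integral>x. f x \<partial>m)" for f :: "'a \<Rightarrow> real"
  unfolding set_lebesgue_integral_def by (intro Bochner_Integration.integral_cong) auto

section \<open>Preduals of kernels\<close>

text \<open>
  The defining identity is required for nonnegative elements only, where both sides make sense in
  the extended half-line for every measurable \<open>f\<close>. Linearity extends it to the real
  identity \<open>predual_integral\<close> for bounded \<open>f\<close>.
\<close>

definition predual_of :: "'a measure \<Rightarrow> (('a \<Rightarrow> ennreal) \<Rightarrow> ('a \<Rightarrow> ennreal)) \<Rightarrow> (('a \<Rightarrow> real) \<Rightarrow> ('a \<Rightarrow> real)) \<Rightarrow> bool" where
  "predual_of m V T \<longleftrightarrow> L1_operator m T \<and>
     (\<forall>u\<in>L1_pos m. T u \<in> L1_pos m \<and>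
        (\<forall>f\<in>borel_measurable m.
           (\<integral>\<^sup>+x. f x * ennreal (T u x) \<partial>m) = (\<integral>\<^sup>+x. V f x * ennreal (u x) \<partial>m)))"

lemma predual_ofD:
  assumes "predual_of m V T"
  shows "L1_operator m T" "u \<in> L1_pos m \<Longrightarrow> T u \<in> L1_pos m"
    "u \<in> L1_pos m \<Longrightarrow> f \<in> borel_measurable m \<Longrightarrow>
       (\<integral>\<^sup>+x. f x * ennreal (T u x) \<partial>m) = (\<integral>\<^sup>+x. V f x * ennreal (u x) \<partial>m)"
  using assms by (auto simp: predual_of_def)

lemma predual_unique_pos:
  assumes u: "u \<in> L1_pos m" and T: "predual_of m V T" and v: "v \<in> L1_pos m"
    and "\<And>B. B \<in> sets m \<Longrightarrow>
      (\<integral>\<^sup>+x. indicator B x * ennreal (v x) \<partial>m) = (\<integral>\<^sup>+x. V (indicator B) x * ennreal (u x) \<partial>m)"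
  shows "AE x in m. T u x = v x"
  using assms by (intro L1_pos_eq_of_nn_integrals) (auto simp: predual_of_def)

lemma predual_unique:
  assumes T: "predual_of m V T" and T': "predual_of m V' T'"
    and eq: "\<And>B x. B \<in> sets m \<Longrightarrow> x \<in> space m \<Longrightarrow> V (indicator B) x = V' (indicator B) x"
    and u: "u \<in> L1 m"
  shows "AE x in m. T u x = T' u x"
proof (rule L1_operator_eq_on_L1[OF predual_ofD(1)[OF T] predual_ofD(1)[OF T'] _ u])
  fix u assume u: "u \<in> L1_pos m"
  show "AE x in m. T u x = T' u x"
  proof (rule predual_unique_pos[OF u T predual_ofD(2)[OF T' u]])
    fix B assume B: "B \<in> sets m"
    show "(\<integral>\<^sup>+x. indicator B x * ennreal (T' u x) \<partial>m) = (\<integral>\<^sup>+x. V (indicator B) x * ennreal (u x) \<partial>m)"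
      using predual_ofD(3)[OF T' u, of "indicator B"] B eq by (simp cong: nn_integral_cong)
  qed
qed

lemma kernel_finite_integral:
  assumes V: "kernel_operator m c V" and u: "u \<in> L1_pos m"
    and f: "f \<in> borel_measurable m" and fb: "\<And>x. x \<in> space m \<Longrightarrow> f x \<le> ennreal b"
  shows "(\<integral>\<^sup>+x. V f x * ennreal (u x) \<partial>m) \<le> ennreal b * ennreal c * ennreal (L1_norm m u)"
    and "integrable m (\<lambda>x. enn2real (V f x) * u x)"
    and "(\<integral>\<^sup>+x. V f x * ennreal (u x) \<partial>m) = ennreal (\<integral>x. enn2real (V f x) * u x \<partial>m)"
    and "0 \<le> (\<integral>x. enn2real (V f x) * u x \<partial>m)"
proof -
  have [measurable]: "u \<in> borel_measurable m" "V f \<in> borel_measurable m"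
    using u V f by (auto simp: L1_pos_def L1_def kernel_operator_def)
  have bd: "V f x \<le> ennreal b * ennreal c" if "x \<in> space m" for x
    using kernel_operator_bound[OF V that f fb] by simp
  have "(\<integral>\<^sup>+x. V f x * ennreal (u x) \<partial>m) \<le> (\<integral>\<^sup>+x. ennreal b * ennreal c * ennreal (u x) \<partial>m)"
    using bd by (intro nn_integral_mono mult_right_mono) auto
  also have "\<dots> = ennreal b * ennreal c * ennreal (L1_norm m u)"
    using L1_pos_nn_integral[OF u] by (simp add: nn_integral_cmult)
  finally show 1: "(\<integral>\<^sup>+x. V f x * ennreal (u x) \<partial>m) \<le> ennreal b * ennreal c * ennreal (L1_norm m u)" .
  have fin: "V f x < \<top>" if "x \<in> space m" for x
    by (rule le_less_trans[OF bd[OF that]]) (simp add: ennreal_mult_less_top)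
  have eq: "(\<integral>\<^sup>+x. V f x * ennreal (u x) \<partial>m) = (\<integral>\<^sup>+x. ennreal (enn2real (V f x) * u x) \<partial>m)"
    using fin by (intro nn_integral_cong) (simp add: ennreal_mult' )
  have pos: "AE x in m. 0 \<le> enn2real (V f x) * u x"
    using u by (auto simp: L1_pos_def elim: eventually_mono)
  have "(\<integral>\<^sup>+x. ennreal (enn2real (V f x) * u x) \<partial>m) < \<infinity>"
    unfolding eq[symmetric] by (rule le_less_trans[OF 1]) (simp add: ennreal_mult_less_top)
  then show int: "integrable m (\<lambda>x. enn2real (V f x) * u x)"
    using pos by (intro integrableI_nonneg) auto
  show "(\<integral>\<^sup>+x. V f x * ennreal (u x) \<partial>m) = ennreal (\<integral>x. enn2real (V f x) * u x \<partial>m)"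
    unfolding eq by (rule nn_integral_eq_integral[OF int pos])
  show "0 \<le> (\<integral>x. enn2real (V f x) * u x \<partial>m)" by (rule integral_nonneg_AE[OF pos])
qed

lemma kernel_integrable:
  assumes V: "kernel_operator m c V" and u: "u \<in> L1 m"
    and f: "f \<in> borel_measurable m" "\<And>x. x \<in> space m \<Longrightarrow> f x \<le> ennreal b"
  shows "integrable m (\<lambda>x. enn2real (V f x) * u x)"
proof -
  have "(\<lambda>x. enn2real (V f x) * u x) = (\<lambda>x. enn2real (V f x) * max 0 (u x) - enn2real (V f x) * max 0 (- u x))"
    by (simp add: mult_diff_pos_neg_parts)
  then show ?thesis
    using kernel_finite_integral(2)[OF V L1_pos_parts(1)[OF u] f]
      kernel_finite_integral(2)[OF V L1_pos_parts(2)[OF u] f] by simp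
qed

lemma predual_integral:
  assumes T: "predual_of m V T" and V: "kernel_operator m c V" and u: "u \<in> L1 m"
    and f[measurable]: "f \<in> borel_measurable m" and fb: "\<And>x. 0 \<le> f x \<and> f x \<le> b"
  shows "(\<integral>x. f x * T u x \<partial>m) = (\<integral>x. enn2real (V (\<lambda>y. ennreal (f y)) x) * u x \<partial>m)"
proof -
  have ef: "(\<lambda>y. ennreal (f y)) \<in> borel_measurable m" "\<And>x. ennreal (f x) \<le> ennreal b"
    using fb by (auto intro: ennreal_leI)
  have int: "integrable m (\<lambda>x. f x * v x)" if "v \<in> L1 m" for v
  proof (rule Bochner_Integration.integrable_bound)
    show "integrable m (\<lambda>x. b * v x)" using that by (simp add: L1_def)
    show "(\<lambda>x. f x * v x) \<in> borel_measurable m" using that by (auto simp: L1_def)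
    show "AE x in m. norm (f x * v x) \<le> norm (b * v x)"
    proof (rule AE_I2)
      fix x
      have "\<bar>f x\<bar> \<le> \<bar>b\<bar>" using fb[of x] by linarith
      then show "norm (f x * v x) \<le> norm (b * v x)" by (simp add: abs_mult mult_right_mono)
    qed
  qed
  have pos: "(\<integral>x. f x * T v x \<partial>m) = (\<integral>x. enn2real (V (\<lambda>y. ennreal (f y)) x) * v x \<partial>m)"
    if v: "v \<in> L1_pos m" for v
  proof -
    have Tv: "T v \<in> L1_pos m" using predual_ofD(2)[OF T v] .
    have p: "AE x in m. 0 \<le> f x * T v x" using Tv fb by (auto simp: L1_pos_def elim!: eventually_mono)
    have "ennreal (\<integral>x. f x * T v x \<partial>m) = (\<integral>\<^sup>+x. ennreal (f x * T v x) \<partial>m)"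
      using int[OF L1_pos_L1[OF Tv]] p by (intro nn_integral_eq_integral[symmetric])
    also have "\<dots> = (\<integral>\<^sup>+x. ennreal (f x) * ennreal (T v x) \<partial>m)"
      using fb by (intro nn_integral_cong) (simp add: ennreal_mult')
    also have "\<dots> = (\<integral>\<^sup>+x. V (\<lambda>y. ennreal (f y)) x * ennreal (v x) \<partial>m)"
      by (rule predual_ofD(3)[OF T v ef(1)])
    also have "\<dots> = ennreal (\<integral>x. enn2real (V (\<lambda>y. ennreal (f y)) x) * v x \<partial>m)"
      by (rule kernel_finite_integral(3)[OF V v ef(1)]) (rule ef(2))
    finally show ?thesis
      using kernel_finite_integral(4)[OF V v ef(1) ef(2)] integral_nonneg_AE[OF p] by simp
  qed
  note up = L1_pos_parts(1)[OF u] and un = L1_pos_parts(2)[OF u]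
  have LT: "L1_operator m T" by (rule predual_ofD(1)[OF T])
  note Tp = predual_ofD(2)[OF T up] and Tn = predual_ofD(2)[OF T un]
  have "(\<integral>x. f x * T u x \<partial>m)
      = (\<integral>x. f x * T (\<lambda>x. max 0 (u x)) x - f x * T (\<lambda>x. max 0 (- u x)) x \<partial>m)"
    using L1_operator_parts[OF LT u] L1_operatorD(1)[OF LT u] L1_pos_L1[OF Tp] L1_pos_L1[OF Tn]
    by (intro integral_cong_AE) (auto simp: L1_def right_diff_distrib elim!: eventually_mono)
  also have "\<dots> = (\<integral>x. f x * T (\<lambda>x. max 0 (u x)) x \<partial>m) - (\<integral>x. f x * T (\<lambda>x. max 0 (- u x)) x \<partial>m)"
    using int[OF L1_pos_L1[OF Tp]] int[OF L1_pos_L1[OF Tn]] by simp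
  also have "\<dots> = (\<integral>x. enn2real (V (\<lambda>y. ennreal (f y)) x) * max 0 (u x)
       - enn2real (V (\<lambda>y. ennreal (f y)) x) * max 0 (- u x) \<partial>m)"
    unfolding pos[OF up] pos[OF un]
    by (rule Bochner_Integration.integral_diff[symmetric])
      (rule kernel_finite_integral(2)[OF V up ef(1)] kernel_finite_integral(2)[OF V un ef(1)], rule ef(2))+
  also have "\<dots> = (\<integral>x. enn2real (V (\<lambda>y. ennreal (f y)) x) * u x \<partial>m)"
    by (simp only: mult_diff_pos_neg_parts)
  finally show ?thesis .
qed

lemma predual_set_integral:
  assumes T: "predual_of m V T" and V: "kernel_operator m c V" and u: "u \<in> L1 m"
    and B: "B \<in> sets m"
  shows "(LINT x:B|m. T u x) = (\<integral>x. enn2real (V (indicator B) x) * u x \<partial>m)"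
proof -
  have "(\<lambda>y. ennreal (indicator B y)) = (indicator B :: 'a \<Rightarrow> ennreal)"
    by (auto simp: indicator_def)
  then show ?thesis
    using predual_integral[OF T V u, of "indicator B" 1] B
    by (simp add: set_lebesgue_integral_def)
qed

lemma predual_norm_le:
  assumes T: "predual_of m V T" and V: "kernel_operator m c V" and u: "u \<in> L1 m"
  shows "L1_norm m (T u) \<le> c * L1_norm m u"
proof -
  note up = L1_pos_parts(1)[OF u] and un = L1_pos_parts(2)[OF u]
  have c: "0 \<le> c" using V by (simp add: kernel_operator_def)
  have pos: "L1_norm m (T v) \<le> c * L1_norm m v" if v: "v \<in> L1_pos m" for v
  proof -
    have "ennreal (L1_norm m (T v)) = (\<integral>\<^sup>+x. V (\<lambda>_. 1) x * ennreal (v x) \<partial>m)"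
      using predual_ofD(3)[OF T v, of "\<lambda>_. 1"] L1_pos_nn_integral[OF predual_ofD(2)[OF T v]] by simp
    also have "\<dots> \<le> ennreal (c * L1_norm m v)"
      using kernel_finite_integral(1)[OF V v, of "\<lambda>_. 1" 1] c by (simp add: ennreal_mult')
    finally show ?thesis using c by (simp add: L1_norm_nonneg)
  qed
  have LT: "L1_operator m T" by (rule predual_ofD(1)[OF T])
  note Tp = L1_pos_L1[OF predual_ofD(2)[OF T up]] and Tn = L1_pos_L1[OF predual_ofD(2)[OF T un]]
  have "L1_norm m (T u) = L1_norm m (\<lambda>x. T (\<lambda>x. max 0 (u x)) x - T (\<lambda>x. max 0 (- u x)) x)"
    by (intro L1_norm_cong_AE L1_operator_parts LT u L1_operatorD(1)[OF LT] L1_diff Tp Tn)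
  also have "\<dots> \<le> L1_norm m (T (\<lambda>x. max 0 (u x))) + L1_norm m (T (\<lambda>x. max 0 (- u x)))"
    by (rule L1_norm_triangle_diff[OF Tp Tn])
  also have "\<dots> \<le> c * (L1_norm m (\<lambda>x. max 0 (u x)) + L1_norm m (\<lambda>x. max 0 (- u x)))"
    using pos[OF up] pos[OF un] by (simp add: distrib_left)
  also have "L1_norm m (\<lambda>x. max 0 (u x)) + L1_norm m (\<lambda>x. max 0 (- u x)) = L1_norm m u"
  proof -
    have "L1_norm m (\<lambda>x. max 0 (u x)) + L1_norm m (\<lambda>x. max 0 (- u x))
      = (\<integral>x. \<bar>max 0 (u x)\<bar> + \<bar>max 0 (- u x)\<bar> \<partial>m)"
      unfolding L1_norm_def using L1_pos_L1[OF up] L1_pos_L1[OF un]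
      by (intro Bochner_Integration.integral_add[symmetric]) (auto simp: L1_def)
    also have "(\<lambda>x. \<bar>max 0 (u x)\<bar> + \<bar>max 0 (- u x)\<bar>) = (\<lambda>x. \<bar>u x\<bar>)" by (rule ext) linarith
    finally show ?thesis by (simp add: L1_norm_def)
  qed
  finally show ?thesis .
qed

lemma predual_comp:
  assumes T: "predual_of m V T" and T': "predual_of m V' T'"
    and V: "\<And>f. f \<in> borel_measurable m \<Longrightarrow> V f \<in> borel_measurable m"
  shows "predual_of m (\<lambda>f. V' (V f)) (\<lambda>u. T (T' u))"
  unfolding predual_of_def
proof (intro conjI ballI)
  have LT: "L1_operator m T" and LT': "L1_operator m T'" using T T' by (auto simp: predual_of_def)
  show "L1_operator m (\<lambda>u. T (T' u))"
    unfolding L1_operator_def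
  proof (intro conjI ballI allI impI)
    fix u assume u: "u \<in> L1 m"
    show "T (T' u) \<in> L1 m" using LT LT' u by (simp add: L1_operator_def)
    fix v assume v: "v \<in> L1 m"
    show "AE x in m. u x = v x \<Longrightarrow> AE x in m. T (T' u) x = T (T' v) x"
      using LT LT' u v by (simp add: L1_operator_def)
    fix a b
    have 1: "AE x in m. T (T' (\<lambda>y. a * u y + b * v y)) x = T (\<lambda>y. a * T' u y + b * T' v y) x"
      by (intro L1_operatorD(2)[OF LT] L1_operatorD[OF LT'] L1_lin u v)
    have 2: "AE x in m. T (\<lambda>y. a * T' u y + b * T' v y) x = a * T (T' u) x + b * T (T' v) x"
      by (intro L1_operatorD(3)[OF LT] L1_operatorD[OF LT'] u v)
    from 1 2 show "AE x in m. T (T' (\<lambda>y. a * u y + b * v y)) x = a * T (T' u) x + b * T (T' v) x"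
      by eventually_elim simp
  qed
  fix u assume u: "u \<in> L1_pos m"
  show "T (T' u) \<in> L1_pos m" using T T' u by (simp add: predual_of_def)
  fix f :: "'a \<Rightarrow> ennreal" assume f: "f \<in> borel_measurable m"
  show "(\<integral>\<^sup>+x. f x * ennreal (T (T' u) x) \<partial>m) = (\<integral>\<^sup>+x. V' (V f) x * ennreal (u x) \<partial>m)"
    using T T' u f V[OF f] by (simp add: predual_of_def)
qed

text \<open>
  The integrals over sets determine the value up to equality almost everywhere and depend linearly
  on \<open>u\<close>, so that linearity of the operator needs no argument about positive parts.
\<close>

definition predual :: "'a measure \<Rightarrow> (('a \<Rightarrow> ennreal) \<Rightarrow> ('a \<Rightarrow> ennreal)) \<Rightarrow> (('a \<Rightarrow> real) \<Rightarrow> ('a \<Rightarrow> real))" where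
  "predual m V u = (SOME w. w \<in> L1 m \<and>
     (\<forall>B\<in>sets m. (LINT x:B|m. w x) = (\<integral>x. enn2real (V (indicator B) x) * u x \<partial>m)))"

text \<open>
  For nonnegative \<open>u\<close> the set function \<open>B \<mapsto> \<integral> V 1\<^sub>B \<cdot> u dm\<close> is a finite measure, by the mixture
  lemma, and it is absolutely continuous by assumption; its Radon-Nikodym density is the required
  element.
\<close>

theorem (in sigma_finite_measure) predual_of_predual:
  assumes V: "kernel_operator M c V"
    and ac: "\<And>B u. B \<in> null_sets M \<Longrightarrow> u \<in> L1_pos M \<Longrightarrow> (\<integral>\<^sup>+x. V (indicator B) x * ennreal (u x) \<partial>M) = 0"
  shows "predual_of M V (predual M V)"
proof -
  have ind: "indicator B \<in> borel_measurable M" "\<And>x. (indicator B x :: ennreal) \<le> ennreal 1"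
    if "B \<in> sets M" for B :: "'a set" using that by (auto simp: indicator_def)
  let ?char = "\<lambda>u w. w \<in> L1 M \<and>
     (\<forall>B\<in>sets M. (LINT x:B|M. w x) = (\<integral>x. enn2real (V (indicator B) x) * u x \<partial>M))"
  have ex_pos: "\<exists>w. w \<in> L1_pos M \<and> ?char u w \<and> (\<forall>f\<in>borel_measurable M.
           (\<integral>\<^sup>+x. f x * ennreal (w x) \<partial>M) = (\<integral>\<^sup>+x. V f x * ennreal (u x) \<partial>M))"
    if u: "u \<in> L1_pos M" for u
  proof -
    have [measurable]: "u \<in> borel_measurable M" using u by (auto simp: L1_pos_def L1_def)
    have [measurable]: "V f \<in> borel_measurable M" if "f \<in> borel_measurable M" for f
      using V that by (auto simp: kernel_operator_def)
    have "integral_functional M (\<lambda>f. \<integral>\<^sup>+x. V f x \<partial>density M u)"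
      using V by (intro integral_functional_mixture) (auto simp: kernel_operator_def)
    then obtain N where sN[measurable_cong]: "sets N = sets M"
      and "\<And>f. f \<in> borel_measurable M \<Longrightarrow> (\<integral>\<^sup>+x. V f x \<partial>density M u) = (\<integral>\<^sup>+y. f y \<partial>N)"
      unfolding integral_functional_def by blast
    then have N: "(\<integral>\<^sup>+y. f y \<partial>N) = (\<integral>\<^sup>+x. V f x * ennreal (u x) \<partial>M)" if "f \<in> borel_measurable M" for f
      using that by (simp add: nn_integral_density mult.commute)
    have "absolutely_continuous M N"
      unfolding absolutely_continuous_def
    proof
      fix B assume B: "B \<in> null_sets M"
      then have "emeasure N B = 0"
        using N[of "indicator B"] ac[OF B u] null_setsD2[OF B] by (simp add: sN)
      then show "B \<in> null_sets N" using B sN by auto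
    qed
    then obtain g where g[measurable]: "g \<in> borel_measurable M" and gN: "density M g = N"
      using Radon_Nikodym sN by blast
    have gf: "(\<integral>\<^sup>+x. f x * g x \<partial>M) = (\<integral>\<^sup>+x. V f x * ennreal (u x) \<partial>M)" if "f \<in> borel_measurable M" for f
      unfolding N[OF that, symmetric] gN[symmetric] using that by (simp add: nn_integral_density mult.commute)
    have fin: "(\<integral>\<^sup>+x. g x \<partial>M) < \<infinity>"
      using gf[of "\<lambda>_. 1"] kernel_finite_integral(3)[OF V u, of "\<lambda>_. 1" 1] by simp
    then have gfin: "AE x in M. ennreal (enn2real (g x)) = g x"
      using nn_integral_PInf_AE[of g M] by (auto elim!: eventually_mono simp: less_top)
    define w where "w x = enn2real (g x)" for x
    have [measurable]: "w \<in> borel_measurable M" unfolding w_def by measurable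
    have "integrable M w"
    proof (rule integrableI_nonneg)
      have "(\<integral>\<^sup>+x. ennreal (w x) \<partial>M) = (\<integral>\<^sup>+x. g x \<partial>M)"
        using gfin by (intro nn_integral_cong_AE) (auto simp: w_def)
      then show "(\<integral>\<^sup>+x. ennreal (w x) \<partial>M) < \<infinity>" using fin by simp
    qed (auto simp: w_def)
    then have w: "w \<in> L1_pos M" by (simp add: L1_pos_def L1_def w_def)
    have dual: "(\<integral>\<^sup>+x. f x * ennreal (w x) \<partial>M) = (\<integral>\<^sup>+x. V f x * ennreal (u x) \<partial>M)"
      if "f \<in> borel_measurable M" for f
      unfolding gf[OF that, symmetric] using gfin by (intro nn_integral_cong_AE) (auto simp: w_def)
    have "(LINT x:B|M. w x) = (\<integral>x. enn2real (V (indicator B) x) * u x \<partial>M)" if B: "B \<in> sets M" for B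
      using dual[OF ind(1)[OF B]] L1_pos_set_integral[OF w B]
        kernel_finite_integral(3,4)[OF V u ind[OF B]] by simp
    then show ?thesis using w dual L1_pos_L1 by blast
  qed
  have ex: "\<exists>w. ?char u w" if u: "u \<in> L1 M" for u
  proof -
    note up = L1_pos_parts(1)[OF u] and un = L1_pos_parts(2)[OF u]
    from ex_pos[OF up] obtain w1 where w1: "?char (\<lambda>x. max 0 (u x)) w1" by blast
    from ex_pos[OF un] obtain w2 where w2: "?char (\<lambda>x. max 0 (- u x)) w2" by blast
    have "?char u (\<lambda>x. w1 x - w2 x)"
    proof (intro conjI ballI)
      show "(\<lambda>x. w1 x - w2 x) \<in> L1 M" using w1 w2 L1_diff by blast
      fix B assume B: "B \<in> sets M"
      have "(LINT x:B|M. w1 x - w2 x) = (LINT x:B|M. w1 x) - (LINT x:B|M. w2 x)"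
        using w1 w2 B by (intro set_integral_diff)
          (auto simp: set_integrable_def L1_def integrable_real_mult_indicator mult.commute)
      also have "\<dots> = (\<integral>x. enn2real (V (indicator B) x) * max 0 (u x) \<partial>M)
          - (\<integral>x. enn2real (V (indicator B) x) * max 0 (- u x) \<partial>M)"
        using w1 w2 B by simp
      also have "\<dots> = (\<integral>x. enn2real (V (indicator B) x) * max 0 (u x)
          - enn2real (V (indicator B) x) * max 0 (- u x) \<partial>M)"
        by (rule Bochner_Integration.integral_diff[symmetric])
          (rule kernel_finite_integral(2)[OF V up ind[OF B]] kernel_finite_integral(2)[OF V un ind[OF B]])+
      also have "\<dots> = (\<integral>x. enn2real (V (indicator B) x) * u x \<partial>M)"
        by (simp only: mult_diff_pos_neg_parts)
      finally show "(LINT x:B|M. w1 x - w2 x) = (\<integral>x. enn2real (V (indicator B) x) * u x \<partial>M)" .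
    qed
    then show ?thesis by blast
  qed
  have pre: "?char u (predual M V u)" if "u \<in> L1 M" for u
    unfolding predual_def by (rule someI_ex[OF ex[OF that]])
  have uniq: "AE x in M. w x = predual M V u x" if "u \<in> L1 M" "?char u w" for u w
    using pre[OF that(1)] that by (intro AE_eq_of_set_integrals) auto
  show ?thesis
    unfolding predual_of_def L1_operator_def
  proof (intro conjI ballI allI impI)
    fix u assume u: "u \<in> L1 M"
    show "predual M V u \<in> L1 M" using pre[OF u] by simp
    fix v assume v: "v \<in> L1 M"
    {
      assume eq: "AE x in M. u x = v x"
      have "?char v (predual M V u)"
      proof (intro conjI ballI)
        show "predual M V u \<in> L1 M" using pre[OF u] by simp
        fix B assume B: "B \<in> sets M"
        have [measurable]: "V (indicator B) \<in> borel_measurable M" using V B by (simp add: kernel_operator_def)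
        have "(\<integral>x. enn2real (V (indicator B) x) * u x \<partial>M) = (\<integral>x. enn2real (V (indicator B) x) * v x \<partial>M)"
          using eq u v by (intro integral_cong_AE) (auto simp: L1_def)
        then show "(LINT x:B|M. predual M V u x) = (\<integral>x. enn2real (V (indicator B) x) * v x \<partial>M)"
          using pre[OF u] B by simp
      qed
      then show "AE x in M. predual M V u x = predual M V v x" using uniq[OF v] by blast
    }
    fix a b :: real
    have "?char (\<lambda>y. a * u y + b * v y) (\<lambda>x. a * predual M V u x + b * predual M V v x)"
    proof (intro conjI ballI)
      show "(\<lambda>x. a * predual M V u x + b * predual M V v x) \<in> L1 M" using pre u v L1_lin by blast
      fix B assume B: "B \<in> sets M"
      have i: "integrable M (\<lambda>x. indicator B x * predual M V u x)" "integrable M (\<lambda>x. indicator B x * predual M V v x)"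
        using pre[OF u] pre[OF v] B by (auto intro: L1_indicator_integrable)
      have "(LINT x:B|M. a * predual M V u x + b * predual M V v x)
        = (\<integral>x. a * (indicator B x * predual M V u x) + b * (indicator B x * predual M V v x) \<partial>M)"
        unfolding set_lebesgue_integral_def by (intro Bochner_Integration.integral_cong) (auto simp: algebra_simps)
      also have "\<dots> = a * (LINT x:B|M. predual M V u x) + b * (LINT x:B|M. predual M V v x)"
        unfolding set_lebesgue_integral_def using i by simp
      also have "\<dots> = a * (\<integral>x. enn2real (V (indicator B) x) * u x \<partial>M) + b * (\<integral>x. enn2real (V (indicator B) x) * v x \<partial>M)"
        using pre[OF u] pre[OF v] B by simp
      also have "\<dots> = (\<integral>x. a * (enn2real (V (indicator B) x) * u x) + b * (enn2real (V (indicator B) x) * v x) \<partial>M)"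
        using kernel_integrable[OF V u ind[OF B]] kernel_integrable[OF V v ind[OF B]] by simp
      also have "\<dots> = (\<integral>x. enn2real (V (indicator B) x) * (a * u x + b * v x) \<partial>M)"
        by (intro Bochner_Integration.integral_cong) (auto simp: algebra_simps)
      finally show "(LINT x:B|M. a * predual M V u x + b * predual M V v x)
          = (\<integral>x. enn2real (V (indicator B) x) * (a * u x + b * v x) \<partial>M)" .
    qed
    from uniq[OF L1_lin[OF u v] this]
    show "AE x in M. predual M V (\<lambda>y. a * u y + b * v y) x = a * predual M V u x + b * predual M V v x"
      by eventually_elim simp
  next
    fix u assume u: "u \<in> L1_pos M"
    from ex_pos[OF u] obtain w where w: "w \<in> L1_pos M" "?char u w"
      "\<And>f. f \<in> borel_measurable M \<Longrightarrow>
           (\<integral>\<^sup>+x. f x * ennreal (w x) \<partial>M) = (\<integral>\<^sup>+x. V f x * ennreal (u x) \<partial>M)" by blast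
    have eq: "AE x in M. w x = predual M V u x" by (rule uniq[OF L1_pos_L1[OF u] w(2)])
    have "AE x in M. 0 \<le> predual M V u x" using eq w(1) by (auto simp: L1_pos_def elim: eventually_elim2)
    then show "predual M V u \<in> L1_pos M" using pre[OF L1_pos_L1[OF u]] by (simp add: L1_pos_def)
    fix f :: "'a \<Rightarrow> ennreal" assume f: "f \<in> borel_measurable M"
    have "(\<integral>\<^sup>+x. f x * ennreal (predual M V u x) \<partial>M) = (\<integral>\<^sup>+x. f x * ennreal (w x) \<partial>M)"
      using eq by (intro nn_integral_cong_AE) (auto elim: eventually_mono)
    then show "(\<integral>\<^sup>+x. f x * ennreal (predual M V u x) \<partial>M) = (\<integral>\<^sup>+x. V f x * ennreal (u x) \<partial>M)"
      using w(3)[OF f] by simp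
  qed
qed

text \<open>
  Both sides are integrals of \<open>f\<close> against finite measures, and the hypothesis says that these
  measures agree.
\<close>

lemma dual_of_indicators:
  assumes V: "kernel_operator m c V" and u: "u \<in> L1_pos m" and w: "w \<in> L1_pos m"
    and eq: "\<And>B. B \<in> sets m \<Longrightarrow>
      (\<integral>\<^sup>+x. indicator B x * ennreal (w x) \<partial>m) = (\<integral>\<^sup>+x. V (indicator B) x * ennreal (u x) \<partial>m)"
    and f: "f \<in> borel_measurable m"
  shows "(\<integral>\<^sup>+x. f x * ennreal (w x) \<partial>m) = (\<integral>\<^sup>+x. V f x * ennreal (u x) \<partial>m)"
proof -
  have [measurable]: "u \<in> borel_measurable m" "w \<in> borel_measurable m" using u w by (auto simp: L1_pos_def L1_def)
  have Vm: "V g \<in> borel_measurable m" if "g \<in> borel_measurable m" for g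
    by (rule kernel_operator_measurable[OF V that])
  have "integral_functional m (\<lambda>f. \<integral>\<^sup>+x. V f x \<partial>density m u)"
    using V by (intro integral_functional_mixture) (auto simp: kernel_operator_def)
  then obtain N where sN: "sets N = sets m"
    and N0: "\<And>f. f \<in> borel_measurable m \<Longrightarrow> (\<integral>\<^sup>+x. V f x \<partial>density m u) = (\<integral>\<^sup>+y. f y \<partial>N)"
    unfolding integral_functional_def by blast
  have N: "(\<integral>\<^sup>+y. g y \<partial>N) = (\<integral>\<^sup>+x. V g x * ennreal (u x) \<partial>m)" if "g \<in> borel_measurable m" for g
    using N0[OF that] Vm[OF that] by (simp add: nn_integral_density mult.commute)
  have "N = density m w"
  proof (rule measure_eqI)
    fix B assume "B \<in> sets N"
    then have B: "B \<in> sets m" by (simp add: sN)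
    have "emeasure N B = (\<integral>\<^sup>+x. V (indicator B) x * ennreal (u x) \<partial>m)"
      using N[of "indicator B"] B by (simp add: sN)
    also have "\<dots> = emeasure (density m w) B"
      using eq[OF B] B by (simp add: emeasure_density mult.commute)
    finally show "emeasure N B = emeasure (density m w) B" .
  qed (simp add: sN)
  then show ?thesis using N[OF f] f by (simp add: nn_integral_density mult.commute)
qed

lemma L1_operator_cong:
  assumes T: "L1_operator m T" and T': "\<And>u. u \<in> L1 m \<Longrightarrow> T' u \<in> L1 m"
    and eq: "\<And>u. u \<in> L1 m \<Longrightarrow> AE x in m. T' u x = T u x"
  shows "L1_operator m T'"
  unfolding L1_operator_def
proof (intro conjI ballI allI impI T')
  fix u v a b assume u: "u \<in> L1 m" and v: "v \<in> L1 m"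
  show "AE x in m. T' u x = T' v x" if "AE x in m. u x = v x"
    using L1_operatorD(2)[OF T u v that] eq[OF u] eq[OF v] by eventually_elim simp
  show "AE x in m. T' (\<lambda>y. a * u y + b * v y) x = a * T' u x + b * T' v x"
    using L1_operatorD(3)[OF T u v, of a b] eq[OF u] eq[OF v] eq[OF L1_lin[OF u v, of a b]] by eventually_elim simp
qed

lemma predual_of_cong:
  assumes T: "predual_of m V T" and T': "\<And>u. u \<in> L1 m \<Longrightarrow> T' u \<in> L1 m"
    and eq: "\<And>u. u \<in> L1 m \<Longrightarrow> AE x in m. T' u x = T u x"
  shows "predual_of m V T'"
  unfolding predual_of_def
proof (intro conjI ballI)
  show "L1_operator m T'" by (rule L1_operator_cong[OF predual_ofD(1)[OF T] T' eq])
  fix u assume u: "u \<in> L1_pos m"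
  have uL: "u \<in> L1 m" by (rule L1_pos_L1[OF u])
  have "AE x in m. 0 \<le> T u x" using predual_ofD(2)[OF T u] by (simp add: L1_pos_def)
  then have "AE x in m. 0 \<le> T' u x" using eq[OF uL] by eventually_elim simp
  then show "T' u \<in> L1_pos m" using T'[OF uL] by (simp add: L1_pos_def)
  fix f :: "'a \<Rightarrow> ennreal" assume f: "f \<in> borel_measurable m"
  have "(\<integral>\<^sup>+x. f x * ennreal (T' u x) \<partial>m) = (\<integral>\<^sup>+x. f x * ennreal (T u x) \<partial>m)"
    using eq[OF uL] by (intro nn_integral_cong_AE) (auto elim: eventually_mono)
  then show "(\<integral>\<^sup>+x. f x * ennreal (T' u x) \<partial>m) = (\<integral>\<^sup>+x. V f x * ennreal (u x) \<partial>m)"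
    using predual_ofD(3)[OF T u f] by simp
qed

lemma predual_add:
  assumes T: "predual_of m V T" and T': "predual_of m V' T'"
    and V: "\<And>f. f \<in> borel_measurable m \<Longrightarrow> V f \<in> borel_measurable m"
      "\<And>f. f \<in> borel_measurable m \<Longrightarrow> V' f \<in> borel_measurable m"
  shows "predual_of m (\<lambda>f x. V f x + V' f x) (\<lambda>u x. T u x + T' u x)"
  unfolding predual_of_def
proof (intro conjI ballI)
  note LT = predual_ofD(1)[OF T] and LT' = predual_ofD(1)[OF T']
  show "L1_operator m (\<lambda>u x. T u x + T' u x)"
    unfolding L1_operator_def
  proof (intro conjI ballI allI impI)
    fix u v a b assume u: "u \<in> L1 m" and v: "v \<in> L1 m"
    show "(\<lambda>x. T u x + T' u x) \<in> L1 m" using L1_operatorD(1)[OF LT u] L1_operatorD(1)[OF LT' u] by (simp add: L1_def)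
    show "AE x in m. T u x + T' u x = T v x + T' v x" if "AE x in m. u x = v x"
      using L1_operatorD(2)[OF LT u v that] L1_operatorD(2)[OF LT' u v that] by eventually_elim simp
    show "AE x in m. T (\<lambda>y. a * u y + b * v y) x + T' (\<lambda>y. a * u y + b * v y) x = a * (T u x + T' u x) + b * (T v x + T' v x)"
      using L1_operatorD(3)[OF LT u v, of a b] L1_operatorD(3)[OF LT' u v, of a b]
      by eventually_elim (simp add: algebra_simps)
  qed
  fix u assume u: "u \<in> L1_pos m"
  note p = predual_ofD(2)[OF T u] predual_ofD(2)[OF T' u]
  show "(\<lambda>x. T u x + T' u x) \<in> L1_pos m"
    using p by (auto simp: L1_pos_def L1_def elim: eventually_elim2)
  fix f :: "'a \<Rightarrow> ennreal" assume f[measurable]: "f \<in> borel_measurable m"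
  have [measurable]: "u \<in> borel_measurable m" "T u \<in> borel_measurable m" "T' u \<in> borel_measurable m"
    using u p by (auto simp: L1_pos_def L1_def)
  have [measurable]: "V f \<in> borel_measurable m" "V' f \<in> borel_measurable m" using V f by auto
  have "(\<integral>\<^sup>+x. f x * ennreal (T u x + T' u x) \<partial>m) = (\<integral>\<^sup>+x. f x * ennreal (T u x) + f x * ennreal (T' u x) \<partial>m)"
    using p by (intro nn_integral_cong_AE)
      (auto simp: L1_pos_def distrib_left ennreal_plus elim: eventually_elim2)
  also have "\<dots> = (\<integral>\<^sup>+x. V f x * ennreal (u x) \<partial>m) + (\<integral>\<^sup>+x. V' f x * ennreal (u x) \<partial>m)"
    using predual_ofD(3)[OF T u f] predual_ofD(3)[OF T' u f] by (simp add: nn_integral_add)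
  also have "\<dots> = (\<integral>\<^sup>+x. (V f x + V' f x) * ennreal (u x) \<partial>m)"
    by (simp add: distrib_right nn_integral_add)
  finally show "(\<integral>\<^sup>+x. f x * ennreal (T u x + T' u x) \<partial>m) = (\<integral>\<^sup>+x. (V f x + V' f x) * ennreal (u x) \<partial>m)" .
qed

lemma (in sigma_finite_measure) AE_zero_of_L1_pos_integrals:
  assumes g[measurable]: "g \<in> borel_measurable M" and 0: "\<And>u. u \<in> L1_pos M \<Longrightarrow> (\<integral>\<^sup>+x. g x * ennreal (u x) \<partial>M) = 0"
  shows "AE x in M. g x = 0"
proof -
  obtain w :: "'a \<Rightarrow> real" where w: "w \<in> borel_measurable M" "\<And>x. 0 < w x" "integrable M w"
    using obtain_positive_integrable_function by metis
  note [measurable] = w(1)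
  have "w \<in> L1_pos M" using w by (simp add: L1_pos_def L1_def less_imp_le)
  from 0[OF this] have "AE x in M. g x * ennreal (w x) = 0" by (subst (asm) nn_integral_0_iff_AE) auto
  then show ?thesis
  proof eventually_elim
    case (elim x)
    then show ?case using w(2)[of x] by (simp add: ennreal_eq_0_iff)
  qed
qed

text \<open>
  For each set \<open>B\<close> the difference of the integrals over \<open>B\<close> has the same sign as the one over its
  complement, so it is at most the difference of the total masses. In this way convergence of masses
  turns into convergence in norm.
\<close>

lemma L1_norm_diff_dominated:
  assumes V: "predual_of m V T" and V': "predual_of m V' T'" and u: "u \<in> L1_pos m"
    and le: "\<And>B x. B \<in> sets m \<Longrightarrow> x \<in> space m \<Longrightarrow> V (indicator B) x \<le> V' (indicator B) x"
  shows "L1_norm m (\<lambda>x. T u x - T' u x) \<le> 2 * ((\<integral>x. T' u x \<partial>m) - (\<integral>x. T u x \<partial>m))"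
proof (rule L1_norm_le_set_integrals)
  note p = predual_ofD(2)[OF V u] and p' = predual_ofD(2)[OF V' u]
  show "(\<lambda>x. T u x - T' u x) \<in> L1 m" using p p' by (intro L1_diff L1_pos_L1)
  fix B assume B: "B \<in> sets m"
  have mono: "(LINT x:C|m. T u x) \<le> (LINT x:C|m. T' u x)" if C: "C \<in> sets m" for C
  proof -
    have "(\<integral>\<^sup>+x. indicator C x * ennreal (T u x) \<partial>m) \<le> (\<integral>\<^sup>+x. indicator C x * ennreal (T' u x) \<partial>m)"
      using predual_ofD(3)[OF V u, of "indicator C"] predual_ofD(3)[OF V' u, of "indicator C"] C le
      by (auto intro!: nn_integral_mono mult_right_mono)
    then show ?thesis
      using L1_pos_set_integral[OF p C] L1_pos_set_integral[OF p' C] by simp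
  qed
  have split: "(\<integral>x. v x \<partial>m) = (LINT x:B|m. v x) + (LINT x:space m - B|m. v x)" if v: "v \<in> L1 m" for v
  proof -
    have "(\<integral>x. v x \<partial>m) = (LINT x:B \<union> (space m - B)|m. v x)"
      using B sets.sets_into_space[OF B] set_integral_UNIV_space[of m v] by (simp add: Un_absorb1)
    also have "\<dots> = (LINT x:B|m. v x) + (LINT x:space m - B|m. v x)"
      using v B L1_indicator_integrable[OF v] by (intro set_integral_Un) (auto simp: set_integrable_def)
    finally show ?thesis .
  qed
  have "(LINT x:B|m. T u x - T' u x) = (LINT x:B|m. T u x) - (LINT x:B|m. T' u x)"
    using p p' B by (intro set_integral_L1_diff L1_pos_L1)
  then show "\<bar>LINT x:B|m. T u x - T' u x\<bar> \<le> (\<integral>x. T' u x \<partial>m) - (\<integral>x. T u x \<partial>m)"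
    using mono[OF B] mono[of "space m - B"] B split[OF L1_pos_L1[OF p]] split[OF L1_pos_L1[OF p']] by simp
qed

section \<open>Laplace transforms on the half-line\<close>

definition laplace :: "real \<Rightarrow> (real \<Rightarrow> real) \<Rightarrow> real" where
  "laplace l p = (LINT t:{0..}|lborel. exp (- l * t) * p t)"

lemma exp_integral:
  assumes "0 < l"
  shows "set_integrable lborel {0..} (\<lambda>t. exp (- l * t))"
    and "(LINT t:{0..}|lborel. exp (- l * t)) = 1 / l"
    and "(\<integral>\<^sup>+t. indicator {0..} t * ennreal (exp (- l * t)) \<partial>lborel) = ennreal (1 / l)"
proof -
  have "(\<integral>\<^sup>+t. ennreal (exponential_density l t) \<partial>lborel) = 1"
    using prob_space.emeasure_space_1[OF prob_space_exponential_density[OF assms]]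
    by (simp add: emeasure_density)
  then have 1: "has_bochner_integral lborel (exponential_density l) 1"
    by (intro has_bochner_integral_nn_integral) (auto simp: exponential_density_nonneg assms)
  have eq: "exponential_density l t / l = indicator {0..} t *\<^sub>R exp (- l * t)" for t
    using assms by (auto simp: exponential_density_def indicator_def mult.commute)
  have 2: "has_bochner_integral lborel (\<lambda>t. indicator {0..} t *\<^sub>R exp (- l * t)) (1 / l)"
    using has_bochner_integral_divide[OF 1, of l] by (simp add: eq)
  show "set_integrable lborel {0..} (\<lambda>t. exp (- l * t))"
    and 3: "(LINT t:{0..}|lborel. exp (- l * t)) = 1 / l"
    using 2 unfolding set_integrable_def set_lebesgue_integral_def has_bochner_integral_iff by auto
  have "(\<integral>\<^sup>+t. ennreal (indicator {0..} t *\<^sub>R exp (- l * t)) \<partial>lborel) = ennreal (1 / l)"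
    using 2 unfolding has_bochner_integral_iff by (subst nn_integral_eq_integral) auto
  then show "(\<integral>\<^sup>+t. indicator {0..} t * ennreal (exp (- l * t)) \<partial>lborel) = ennreal (1 / l)"
    by (auto simp: indicator_def intro!: nn_integral_cong elim!: trans[rotated])
qed

lemma laplace_integrable:
  assumes l: "0 < l" and p: "set_borel_measurable lborel {0..} p"
    and bd: "\<And>t. 0 \<le> t \<Longrightarrow> \<bar>p t\<bar> \<le> c"
  shows "set_integrable lborel {0..} (\<lambda>t. exp (- l * t) * p t)"
    and "\<bar>laplace l p\<bar> \<le> c / l"
proof -
  have i: "integrable lborel (\<lambda>t. c * (indicator {0..} t *\<^sub>R exp (- l * t)))"
    using exp_integral(1)[OF l] by (simp add: set_integrable_def)
  have [measurable]: "(\<lambda>t. indicator {0..} t *\<^sub>R p t) \<in> borel_measurable lborel"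
    using p by (simp add: set_borel_measurable_def)
  have le: "norm (indicator {0..} t *\<^sub>R (exp (- l * t) * p t)) \<le> c * (indicator {0..} t *\<^sub>R exp (- l * t))" for t
    using bd[of t] by (auto simp: indicator_def abs_mult mult.commute intro!: mult_right_mono)
  have m: "(\<lambda>t. indicator {0..} t *\<^sub>R (exp (- l * t) * p t)) \<in> borel_measurable lborel"
  proof -
    have "(\<lambda>t. exp (- l * t) * (indicator {0..} t *\<^sub>R p t)) \<in> borel_measurable lborel" by measurable
    then show ?thesis by (simp add: mult.left_commute)
  qed
  show s: "set_integrable lborel {0..} (\<lambda>t. exp (- l * t) * p t)"
    unfolding set_integrable_def
    by (rule Bochner_Integration.integrable_bound[OF i m])
       (rule AE_I2, rule order_trans[OF le], simp)
  have "\<bar>laplace l p\<bar> \<le> (\<integral>t. norm (indicator {0..} t *\<^sub>R (exp (- l * t) * p t)) \<partial>lborel)"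
    unfolding laplace_def set_lebesgue_integral_def 
    using integral_norm_bound[of lborel "\<lambda>t. indicator {0..} t *\<^sub>R (exp (- l * t) * p t)"]
    by (simp only: real_norm_def)
  also have "\<dots> \<le> (\<integral>t. c * (indicator {0..} t *\<^sub>R exp (- l * t)) \<partial>lborel)"
    using s by (intro integral_mono i le integrable_norm) (simp add: set_integrable_def)
  also have "\<dots> = c / l"
    using exp_integral(2)[OF l] by (simp add: set_lebesgue_integral_def)
  finally show "\<bar>laplace l p\<bar> \<le> c / l" .
qed

lemma laplace_shift:
  assumes l: "0 < l" and h: "0 \<le> h" and p: "set_borel_measurable lborel {0..} p"
    and bd: "\<And>t. 0 \<le> t \<Longrightarrow> \<bar>p t\<bar> \<le> c"
  shows "laplace l (\<lambda>t. p (t + h)) = exp (l * h) * (laplace l p - (LINT t:{0..<h}|lborel. exp (- l * t) * p t))"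
proof -
  have i: "set_integrable lborel {0..} (\<lambda>t. exp (- l * t) * p t)"
    by (rule laplace_integrable[OF l p bd])
  have "laplace l (\<lambda>t. p (t + h)) = (\<integral>t. indicator {0..} t *\<^sub>R (exp (- l * t) * p (t + h)) \<partial>lborel)"
    by (simp add: laplace_def set_lebesgue_integral_def)
  also have "\<dots> = (\<integral>t. exp (l * h) * (indicator {h..} (h + 1 * t) *\<^sub>R (exp (- l * (h + 1 * t)) * p (h + 1 * t))) \<partial>lborel)"
  proof (rule Bochner_Integration.integral_cong[OF refl])
    fix t :: real
    have e: "exp (l * h) * exp (- l * (h + t)) = exp (- l * t)"
      by (simp add: exp_add[symmetric] algebra_simps)
    show "indicator {0..} t *\<^sub>R (exp (- l * t) * p (t + h))
      = exp (l * h) * (indicator {h..} (h + 1 * t) *\<^sub>R (exp (- l * (h + 1 * t)) * p (h + 1 * t)))"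
      unfolding e[symmetric] by (simp add: indicator_def add.commute)
  qed
  also have "\<dots> = exp (l * h) * (\<integral>t. indicator {h..} (h + 1 * t) *\<^sub>R (exp (- l * (h + 1 * t)) * p (h + 1 * t)) \<partial>lborel)"
    by (rule integral_mult_right_zero)
  also have "(\<integral>t. indicator {h..} (h + 1 * t) *\<^sub>R (exp (- l * (h + 1 * t)) * p (h + 1 * t)) \<partial>lborel)
     = (LINT t:{h..}|lborel. exp (- l * t) * p t)"
    unfolding set_lebesgue_integral_def
    by (subst lborel_integral_real_affine[of 1 "\<lambda>t. indicator {h..} t *\<^sub>R (exp (- l * t) * p t)" h]) auto
  also have "laplace l p = (LINT t:{0..<h} \<union> {h..}|lborel. exp (- l * t) * p t)"
    unfolding laplace_def using h by (intro arg_cong[where f="\<lambda>A. LINT t:A|lborel. _ t"]) auto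
  moreover have "(LINT t:{0..<h} \<union> {h..}|lborel. exp (- l * t) * p t)
     = (LINT t:{0..<h}|lborel. exp (- l * t) * p t) + (LINT t:{h..}|lborel. exp (- l * t) * p t)"
    using h by (intro set_integral_Un set_integrable_subset[OF i]) auto
  ultimately show ?thesis by (simp add: algebra_simps)
qed

lemma abs_add_minus_minus_le: "\<bar>a + - b + - c\<bar> \<le> \<bar>a\<bar> + \<bar>b\<bar> + \<bar>c\<bar>" for a b c :: real
  by linarith

lemma laplace_difference_bound:
  assumes l: "0 < l" and h: "0 < h" and p: "set_borel_measurable lborel {0..} p"
    and bd: "\<And>t. 0 \<le> t \<Longrightarrow> \<bar>p t\<bar> \<le> c"
    and cont: "\<And>t. 0 \<le> t \<Longrightarrow> t < h \<Longrightarrow> \<bar>p t - p 0\<bar> \<le> w"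
  shows "\<bar>(laplace l (\<lambda>t. p (t + h)) - laplace l p) / h - (l * laplace l p - p 0)\<bar>
    \<le> \<bar>(exp (l * h) - 1) / h - l\<bar> * (c / l) + exp (l * h) * (w + (1 - exp (- l * h)) * c) + (exp (l * h) - 1) * c"
proof -
  define I where "I = (LINT t:{0..<h}|lborel. exp (- l * t) * p t)"
  define L where "L = laplace l p"
  have c: "0 \<le> c" using bd[of 0] by simp
  have iI: "set_integrable lborel {0..<h} (\<lambda>t. exp (- l * t) * p t)"
    by (rule set_integrable_subset[OF laplace_integrable(1)[OF l p bd]]) auto
  have i0: "set_integrable lborel {0..<h} (\<lambda>t. k)" for k :: real
    using h by (simp add: set_integrable_def)
  have c0: "(LINT t:{0..<h}|lborel. k) = h * k" for k :: real
    using h by (simp add: set_lebesgue_integral_def)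
  have "\<bar>I - h * p 0\<bar> = \<bar>LINT t:{0..<h}|lborel. exp (- l * t) * p t - p 0\<bar>"
    unfolding I_def by (subst set_integral_diff(2)[OF iI i0]) (simp add: c0)
  also have "\<dots> \<le> (LINT t:{0..<h}|lborel. \<bar>exp (- l * t) * p t - p 0\<bar>)"
    using set_integral_diff(1)[OF iI i0[of "p 0"]]
    unfolding set_lebesgue_integral_def set_integrable_def
    by (intro order_trans[OF integral_abs_bound]) (auto simp: abs_mult intro!: eq_refl)
  also have "\<dots> \<le> (LINT t:{0..<h}|lborel. w + (1 - exp (- l * h)) * c)"
  proof (rule set_integral_mono)
    show "set_integrable lborel {0..<h} (\<lambda>t. \<bar>exp (- l * t) * p t - p 0\<bar>)"
      using set_integral_diff(1)[OF iI i0] by (rule set_integrable_abs)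
    fix t assume t: "t \<in> {0..<h}"
    have e: "exp (- l * h) \<le> exp (- l * t)" "exp (- l * t) \<le> 1" using t l by auto
    have "exp (- l * t) * p t - p 0 = (p t - p 0) + (exp (- l * t) - 1) * p t" by (simp add: algebra_simps)
    also have "\<bar>\<dots>\<bar> \<le> \<bar>p t - p 0\<bar> + \<bar>(exp (- l * t) - 1) * p t\<bar>" by (rule abs_triangle_ineq)
    also have "\<dots> \<le> w + (1 - exp (- l * h)) * c"
      unfolding abs_mult using e t cont[of t] bd[of t] by (intro add_mono mult_mono) auto
    finally show "\<bar>exp (- l * t) * p t - p 0\<bar> \<le> w + (1 - exp (- l * h)) * c" .
  qed (rule i0)
  also have "\<dots> = h * (w + (1 - exp (- l * h)) * c)" by (rule c0)
  finally have I: "\<bar>I / h - p 0\<bar> \<le> w + (1 - exp (- l * h)) * c"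
    using h by (simp add: field_simps abs_le_iff)
  have "(laplace l (\<lambda>t. p (t + h)) - L) / h - (l * L - p 0)
      = ((exp (l * h) - 1) / h - l) * L + - (exp (l * h) * (I / h - p 0)) + - ((exp (l * h) - 1) * p 0)"
    unfolding L_def I_def using h
    by (subst laplace_shift[OF l _ p bd]) (auto simp: field_simps)
  also have "\<bar>\<dots>\<bar> \<le> \<bar>((exp (l * h) - 1) / h - l) * L\<bar> + \<bar>exp (l * h) * (I / h - p 0)\<bar> + \<bar>(exp (l * h) - 1) * p 0\<bar>"
    by (rule abs_add_minus_minus_le)
  also have "\<dots> \<le> \<bar>(exp (l * h) - 1) / h - l\<bar> * (c / l) + exp (l * h) * (w + (1 - exp (- l * h)) * c) + (exp (l * h) - 1) * c"
    unfolding abs_mult L_def using I bd[of 0] laplace_integrable(2)[OF l p bd] l h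
    by (intro add_mono mult_mono) auto
  finally show ?thesis by (simp add: L_def)
qed

text \<open>
  The difference quotient at \<open>0\<close> of \<open>h \<mapsto> laplace l (\<lambda>t. p (t + h))\<close> tends to
  \<open>l * laplace l p - p 0\<close>, uniformly over all \<open>p\<close> with a common bound and a common modulus of
  continuity at \<open>0\<close>. The uniformity is what makes a statement about all set integrals into one
  about the norm.
\<close>

lemma laplace_difference_eventually:
  assumes l: "0 < l" and w: "(w \<longlongrightarrow> 0) (at_right 0)" and e: "0 < e"
  shows "\<forall>\<^sub>F h in at_right 0. \<forall>p. set_borel_measurable lborel {0..} p \<longrightarrow>
     (\<forall>t\<ge>0. \<bar>p t\<bar> \<le> c) \<longrightarrow> (\<forall>t>0. \<bar>p t - p 0\<bar> \<le> w t) \<longrightarrow>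
     \<bar>(laplace l (\<lambda>t. p (t + h)) - laplace l p) / h - (l * laplace l p - p 0)\<bar> \<le> e"
proof -
  let ?b = "\<lambda>h. \<bar>(exp (l * h) - 1) / h - l\<bar> * (c / l) + exp (l * h) * (e / 2 + (1 - exp (- l * h)) * c) + (exp (l * h) - 1) * c"
  have "((\<lambda>h. exp (l * h)) has_real_derivative l) (at 0)"
    by (auto intro!: derivative_eq_intros)
  then have "((\<lambda>h. (exp (l * h) - 1) / h) \<longlongrightarrow> l) (at 0)"
    by (simp add: has_field_derivative_iff)
  then have "((\<lambda>h. (exp (l * h) - 1) / h) \<longlongrightarrow> l) (at_right 0)"
    by (rule filterlim_mono) (auto simp: at_le)
  then have "(?b \<longlongrightarrow> \<bar>l - l\<bar> * (c / l) + exp (l * 0) * (e / 2 + (1 - exp (- l * 0)) * c) + (exp (l * 0) - 1) * c) (at_right 0)"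
    by (intro tendsto_intros)
  then have "(?b \<longlongrightarrow> e / 2) (at_right 0)" by simp
  then have b: "\<forall>\<^sub>F h in at_right 0. ?b h < e" using e by (intro order_tendstoD(2)[of _ "e / 2"]) auto
  have "\<forall>\<^sub>F t in at_right 0. w t < e / 2" using e by (intro order_tendstoD(2)[OF w]) auto
  then obtain d where d: "0 < d" "\<And>t. 0 < t \<Longrightarrow> t < d \<Longrightarrow> w t < e / 2"
    unfolding eventually_at_right_field by auto
  have "\<forall>\<^sub>F h in at_right 0. h \<in> {0<..<d}" using d(1) by (rule eventually_at_right_real)
  with b show ?thesis
  proof eventually_elim
    case (elim h)
    show ?case
    proof (intro allI impI)
      fix p assume p: "set_borel_measurable lborel {0..} p" "\<forall>t\<ge>0. \<bar>p t\<bar> \<le> c" "\<forall>t>0. \<bar>p t - p 0\<bar> \<le> w t"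
      have "\<bar>p t - p 0\<bar> \<le> e / 2" if "0 \<le> t" "t < h" for t
      proof (cases "t = 0")
        case False
        then have t: "0 < t" "t < d" using that elim(2) by simp_all
        have "\<bar>p t - p 0\<bar> \<le> w t" using p(3) t(1) by blast
        with d(2)[OF t] show ?thesis by linarith
      qed (use e in simp)
      moreover have "0 < h" using elim(2) by simp
      moreover have "\<bar>p t\<bar> \<le> c" if "0 \<le> t" for t using p(2) that by blast
      ultimately have "\<bar>(laplace l (\<lambda>t. p (t + h)) - laplace l p) / h - (l * laplace l p - p 0)\<bar> \<le> ?b h"
        by (intro laplace_difference_bound[OF l _ p(1)])
      with elim(1) show "\<bar>(laplace l (\<lambda>t. p (t + h)) - laplace l p) / h - (l * laplace l p - p 0)\<bar> \<le> e"
        by linarith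
    qed
  qed
qed

section \<open>Substochastic semigroups, generators and resolvents\<close>

lemma semigroupD:
  assumes "substochastic_semigroup m S" "0 \<le> t"
  shows "L1_operator m (S t)" "u \<in> L1_pos m \<Longrightarrow> S t u \<in> L1_pos m"
    "u \<in> L1 m \<Longrightarrow> S t u \<in> L1 m"
    "u \<in> L1 m \<Longrightarrow> L1_norm m (S t u) \<le> L1_norm m u"
    "u \<in> L1 m \<Longrightarrow> AE x in m. S 0 u x = u x"
    "0 \<le> s \<Longrightarrow> u \<in> L1 m \<Longrightarrow> AE x in m. S (t + s) u x = S t (S s u) x"
    "u \<in> L1 m \<Longrightarrow> ((\<lambda>t. L1_norm m (\<lambda>x. S t u x - u x)) \<longlongrightarrow> 0) (at_right 0)"
  using assms L1_operatorD(1)[of m "S t"] by (auto simp: substochastic_semigroup_def)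

lemma semigroup_diff_norm:
  assumes S: "substochastic_semigroup m S" and t: "0 \<le> t" and u: "u \<in> L1 m" and v: "v \<in> L1 m"
  shows "L1_norm m (\<lambda>x. S t u x - S t v x) \<le> L1_norm m (\<lambda>x. u x - v x)"
proof -
  have "L1_norm m (\<lambda>x. S t u x - S t v x) = L1_norm m (S t (\<lambda>x. u x - v x))"
    using L1_operator_diff[OF semigroupD(1)[OF S t] u v]
    by (intro L1_norm_cong_AE L1_diff semigroupD[OF S t] u v) auto
  also have "\<dots> \<le> L1_norm m (\<lambda>x. u x - v x)" by (intro semigroupD(4)[OF S t] L1_diff u v)
  finally show ?thesis .
qed

lemma semigroup_increment_norm:
  assumes S: "substochastic_semigroup m S" and s: "0 \<le> s" and h: "0 \<le> h" and u: "u \<in> L1 m"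
  shows "L1_norm m (\<lambda>x. S (s + h) u x - S s u x) \<le> L1_norm m (\<lambda>x. S h u x - u x)"
proof -
  have "L1_norm m (\<lambda>x. S (s + h) u x - S s u x) = L1_norm m (\<lambda>x. S s (S h u) x - S s u x)"
    using semigroupD(6)[OF S s h u] s h
    by (intro L1_norm_cong_AE L1_diff semigroupD(3)[OF S] u) auto
  also have "\<dots> \<le> L1_norm m (\<lambda>x. S h u x - u x)"
    by (intro semigroup_diff_norm[OF S s] semigroupD[OF S h] u)
  finally show ?thesis .
qed

text \<open>
  Strong continuity at \<open>0\<close> bounds all increments by contractivity; beyond that only the scalar
  functions \<open>t \<mapsto> \<integral>\<^sub>B S(t)u dm\<close> are used, so no vector-valued integration is needed.
\<close>

lemma semigroup_set_integral_continuous: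
  assumes S: "substochastic_semigroup m S" and u: "u \<in> L1 m" and B: "B \<in> sets m"
  shows "continuous_on {0..} (\<lambda>t. LINT x:B|m. S t u x)"
  unfolding continuous_on_iff
proof (intro ballI allI impI)
  fix s e :: real assume s: "s \<in> {0..}" and e: "0 < e"
  have "\<forall>\<^sub>F h in at_right 0. L1_norm m (\<lambda>x. S h u x - u x) < e"
    using semigroupD(7)[OF S order_refl u] e by (rule order_tendstoD(2))
  then obtain d where d: "0 < d" "\<And>h. 0 < h \<Longrightarrow> h < d \<Longrightarrow> L1_norm m (\<lambda>x. S h u x - u x) < e"
    unfolding eventually_at_right_field by auto
  have inc: "\<bar>(LINT x:B|m. S (r + h) u x) - (LINT x:B|m. S r u x)\<bar> < e" if "0 \<le> r" "0 < h" "h < d" for r h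
  proof -
    have "\<bar>(LINT x:B|m. S (r + h) u x) - (LINT x:B|m. S r u x)\<bar> = \<bar>LINT x:B|m. S (r + h) u x - S r u x\<bar>"
      using that by (subst set_integral_L1_diff) (auto intro: semigroupD(3)[OF S] u B)
    also have "\<dots> \<le> L1_norm m (\<lambda>x. S (r + h) u x - S r u x)"
      using that by (intro set_integral_le_L1_norm L1_diff semigroupD(3)[OF S] u B) auto
    also have "\<dots> \<le> L1_norm m (\<lambda>x. S h u x - u x)"
      using that by (intro semigroup_increment_norm[OF S] u) auto
    finally show ?thesis using d(2)[OF that(2,3)] by simp
  qed
  show "\<exists>d>0. \<forall>t\<in>{0..}. dist t s < d \<longrightarrow> dist (LINT x:B|m. S t u x) (LINT x:B|m. S s u x) < e"
  proof (intro exI[of _ d] conjI d ballI impI)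
    fix t assume t: "t \<in> {0..}" "dist t s < d"
    consider "t = s" | "s < t" | "t < s" by linarith
    then show "dist (LINT x:B|m. S t u x) (LINT x:B|m. S s u x) < e"
    proof cases
      case 2 then show ?thesis using inc[of s "t - s"] s t by (simp add: dist_real_def)
    next
      case 3 then show ?thesis using inc[of t "s - t"] s t by (simp add: dist_real_def abs_minus_commute)
    qed (use e in simp)
  qed
qed

lemma semigroup_set_integral_laplace:
  assumes S: "substochastic_semigroup m S" and u: "u \<in> L1 m" and B: "B \<in> sets m"
  shows "set_borel_measurable lborel {0..} (\<lambda>t. LINT x:B|m. S t u x)"
    and "0 \<le> t \<Longrightarrow> \<bar>LINT x:B|m. S t u x\<bar> \<le> L1_norm m u"
    and "0 \<le> t \<Longrightarrow> \<bar>(LINT x:B|m. S t u x) - (LINT x:B|m. S 0 u x)\<bar> \<le> L1_norm m (\<lambda>x. S t u x - u x)"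
    and "(LINT x:B|m. S 0 u x) = (LINT x:B|m. u x)"
proof -
  show "set_borel_measurable lborel {0..} (\<lambda>t. LINT x:B|m. S t u x)"
    using borel_measurable_continuous_on_indicator[OF _ semigroup_set_integral_continuous[OF S u B]]
    by (simp add: set_borel_measurable_def)
  show "0 \<le> t \<Longrightarrow> \<bar>LINT x:B|m. S t u x\<bar> \<le> L1_norm m u"
    using set_integral_le_L1_norm[OF semigroupD(3)[OF S _ u] B] semigroupD(4)[OF S _ u] by force
  show 0: "(LINT x:B|m. S 0 u x) = (LINT x:B|m. u x)"
  proof -
    have "(\<integral>x. indicator B x *\<^sub>R S 0 u x \<partial>m) = (\<integral>x. indicator B x *\<^sub>R u x \<partial>m)"
      using semigroupD(5)[OF S order_refl u] L1_indicator_integrable[OF u B]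
        L1_indicator_integrable[OF semigroupD(3)[OF S order_refl u] B]
      by (intro integral_cong_AE) (auto dest: borel_measurable_integrable)
    then show ?thesis by (simp add: set_lebesgue_integral_def)
  qed
  show "\<bar>(LINT x:B|m. S t u x) - (LINT x:B|m. S 0 u x)\<bar> \<le> L1_norm m (\<lambda>x. S t u x - u x)" if t: "0 \<le> t"
    unfolding 0 using set_integral_le_L1_norm[OF L1_diff[OF semigroupD(3)[OF S t u] u] B]
    by (simp add: set_integral_L1_diff semigroupD(3)[OF S t u] u B)
qed

lemma in_generatorD:
  assumes "in_generator m S u v"
  shows "u \<in> L1 m" "v \<in> L1 m"
    "((\<lambda>t. L1_norm m (\<lambda>x. (S t u x - u x) / t - v x)) \<longlongrightarrow> 0) (at_right 0)"
  using assms by (auto simp: in_generator_def)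

lemma in_generator_diff:
  assumes S: "substochastic_semigroup m S" and 1: "in_generator m S u v" and 2: "in_generator m S u' v'"
    and w: "w \<in> L1 m" "AE x in m. w x = u x - u' x" and z: "z \<in> L1 m" "AE x in m. z x = v x - v' x"
  shows "in_generator m S w z"
  unfolding in_generator_def
proof (intro conjI w z)
  note g = in_generatorD[OF 1] in_generatorD[OF 2]
  have lim: "((\<lambda>t. L1_norm m (\<lambda>x. (S t u x - u x) / t - v x) + L1_norm m (\<lambda>x. (S t u' x - u' x) / t - v' x)) \<longlongrightarrow> 0) (at_right 0)"
    using tendsto_add[OF g(3) g(6)] by simp
  show "((\<lambda>t. L1_norm m (\<lambda>x. (S t w x - w x) / t - z x)) \<longlongrightarrow> 0) (at_right 0)"
  proof (rule tendsto_sandwich[OF _ _ tendsto_const lim])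
    show "\<forall>\<^sub>F t in at_right 0. 0 \<le> L1_norm m (\<lambda>x. (S t w x - w x) / t - z x)"
      by (simp add: L1_norm_nonneg)
    show "\<forall>\<^sub>F t in at_right 0. L1_norm m (\<lambda>x. (S t w x - w x) / t - z x) \<le>
        L1_norm m (\<lambda>x. (S t u x - u x) / t - v x) + L1_norm m (\<lambda>x. (S t u' x - u' x) / t - v' x)"
      using eventually_at_right_less[of "0::real"]
    proof eventually_elim
      case (elim t)
      then have t: "0 \<le> t" by simp
      note St = semigroupD(3)[OF S t]
      have L: "(\<lambda>x. (S t a x - a x) / t - b x) \<in> L1 m" if "a \<in> L1 m" "b \<in> L1 m" for a b
        using that St[OF that(1)] by (simp add: L1_def)
      have Sw: "AE x in m. S t w x = S t u x - S t u' x"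
        using L1_operatorD(2)[OF semigroupD(1)[OF S t] w(1) L1_diff[OF g(1) g(4)] w(2)]
          L1_operator_diff[OF semigroupD(1)[OF S t] g(1) g(4)] by eventually_elim simp
      have "L1_norm m (\<lambda>x. (S t w x - w x) / t - z x)
        = L1_norm m (\<lambda>x. ((S t u x - u x) / t - v x) - ((S t u' x - u' x) / t - v' x))"
      proof (rule L1_norm_cong_AE)
        show "AE x in m. (S t w x - w x) / t - z x = ((S t u x - u x) / t - v x) - ((S t u' x - u' x) / t - v' x)"
          using Sw w(2) z(2) by eventually_elim (simp add: diff_divide_distrib)
      qed (intro L L1_diff w z g)+
      also have "\<dots> \<le> L1_norm m (\<lambda>x. (S t u x - u x) / t - v x) + L1_norm m (\<lambda>x. (S t u' x - u' x) / t - v' x)"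
        by (intro L1_norm_triangle_diff L g)
      finally show ?case .
    qed
  qed
qed

lemma in_generator_zero:
  assumes "substochastic_semigroup m S" shows "in_generator m S (\<lambda>_. 0) (\<lambda>_. 0)"
proof -
  have z: "(\<lambda>_. 0) \<in> L1 m" by (simp add: L1_def)
  have n: "L1_norm m (\<lambda>_. 0) = 0" by (simp add: L1_norm_def)
  have "\<forall>\<^sub>F t in at_right 0. 0 = L1_norm m (\<lambda>x. (S t (\<lambda>_. 0) x - 0) / t - 0)"
    using eventually_at_right_less[of "0::real"]
  proof eventually_elim
    case (elim t)
    have "L1_norm m (S t (\<lambda>_. 0)) = 0"
      using semigroupD(4)[OF assms _ z, of t] elim L1_norm_nonneg[of m "S t (\<lambda>_. 0)"] n by simp
    then show ?case using L1_norm_cmult[of m "1/t" "S t (\<lambda>_. 0)"] by simp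
  qed
  then show ?thesis using z unfolding in_generator_def
    by (auto intro: Lim_transform_eventually[OF tendsto_const])
qed

lemma in_generator_cong:
  assumes "substochastic_semigroup m S" "in_generator m S u v"
    "w \<in> L1 m" "AE x in m. w x = u x" "z \<in> L1 m" "AE x in m. z x = v x"
  shows "in_generator m S w z"
  using in_generator_diff[OF assms(1,2) in_generator_zero[OF assms(1)] assms(3) _ assms(5)] assms(4,6) by simp

text \<open>
  From \<open>(1 + h l) w = S(h) w + h (l w - z) + o(h)\<close> and contractivity, after division by \<open>h\<close>.
\<close>

lemma dissipative:
  assumes S: "substochastic_semigroup m S" and g: "in_generator m S w z" and l: "0 < l"
  shows "l * L1_norm m w \<le> L1_norm m (\<lambda>x. l * w x - z x)"
proof -
  note gw = in_generatorD[OF g]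
  have L: "(\<lambda>x. l * w x - z x) \<in> L1 m" using gw by (simp add: L1_def)
  have "\<forall>\<^sub>F h in at_right 0. l * L1_norm m w \<le>
      L1_norm m (\<lambda>x. l * w x - z x) + L1_norm m (\<lambda>x. (S h w x - w x) / h - z x)"
    using eventually_at_right_less[of "0::real"]
  proof eventually_elim
    case (elim h)
    then have h: "0 \<le> h" by simp
    note Sw = semigroupD(3)[OF S h gw(1)]
    have r: "(\<lambda>x. (S h w x - w x) / h - z x) \<in> L1 m" using Sw gw by (simp add: L1_def)
    have "(1 + h * l) * L1_norm m w = L1_norm m (\<lambda>x. (1 + h * l) * w x)"
      using elim l by (simp add: L1_norm_cmult)
    also have "(\<lambda>x. (1 + h * l) * w x) = (\<lambda>x. (S h w x + h * (l * w x - z x)) - h * ((S h w x - w x) / h - z x))"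
      using elim by (auto simp: field_simps)
    also have "L1_norm m \<dots> \<le> L1_norm m (\<lambda>x. S h w x + h * (l * w x - z x)) + L1_norm m (\<lambda>x. h * ((S h w x - w x) / h - z x))"
      by (rule L1_norm_triangle_diff) (use Sw L r in \<open>auto simp: L1_def\<close>)
    also have "L1_norm m (\<lambda>x. S h w x + h * (l * w x - z x)) \<le> L1_norm m (S h w) + L1_norm m (\<lambda>x. h * (l * w x - z x))"
      by (rule L1_norm_triangle) (use Sw L in \<open>auto simp: L1_def\<close>)
    also have "L1_norm m (S h w) \<le> L1_norm m w" by (rule semigroupD(4)[OF S h gw(1)])
    finally have "h * (l * L1_norm m w) \<le> h * (L1_norm m (\<lambda>x. l * w x - z x) + L1_norm m (\<lambda>x. (S h w x - w x) / h - z x))"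
      using elim by (simp only: L1_norm_cmult) (simp add: algebra_simps)
    then show ?case using elim by simp
  qed
  moreover have "((\<lambda>h. L1_norm m (\<lambda>x. l * w x - z x) + L1_norm m (\<lambda>x. (S h w x - w x) / h - z x)) \<longlongrightarrow>
      L1_norm m (\<lambda>x. l * w x - z x) + 0) (at_right 0)"
    by (intro tendsto_intros gw)
  ultimately show ?thesis
    using tendsto_lowerbound[of _ _ "at_right 0" "l * L1_norm m w"] by force
qed

lemma in_generator_unique:
  assumes S: "substochastic_semigroup m S" and g: "in_generator m S u v" "in_generator m S u v'"
  shows "AE x in m. v x = v' x"
proof (rule AE_eq_of_L1_norm)
  show v: "v \<in> L1 m" "v' \<in> L1 m" using g in_generatorD by blast+
  have zero: "in_generator m S (\<lambda>_. 0) (\<lambda>x. v x - v' x)"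
    by (rule in_generator_diff[OF S g]) (use v in \<open>auto simp: L1_def\<close>)
  have "((\<lambda>t. L1_norm m (\<lambda>x. v x - v' x)) \<longlongrightarrow> 0) (at_right (0::real))"
  proof (rule Lim_transform_eventually[OF in_generatorD(3)[OF zero]])
    show "\<forall>\<^sub>F t in at_right 0. L1_norm m (\<lambda>x. (S t (\<lambda>_. 0) x - 0) / t - (v x - v' x)) = L1_norm m (\<lambda>x. v x - v' x)"
      using eventually_at_right_less[of "0::real"]
    proof eventually_elim
      case (elim t)
      have z: "(\<lambda>_. 0) \<in> L1 m" by (simp add: L1_def)
      have "AE x in m. S t (\<lambda>_. 0) x = 0"
        using L1_operator_cmult[OF semigroupD(1)[OF S], of t "\<lambda>_. 0" 0] elim z by simp
      then have "AE x in m. (S t (\<lambda>_. 0) x - 0) / t - (v x - v' x) = - 1 * (v x - v' x)"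
        by eventually_elim simp
      then have "L1_norm m (\<lambda>x. (S t (\<lambda>_. 0) x - 0) / t - (v x - v' x)) = L1_norm m (\<lambda>x. - 1 * (v x - v' x))"
        using elim v semigroupD(3)[OF S _ z, of t] by (intro L1_norm_cong_AE) (auto simp: L1_def)
      then show ?case unfolding L1_norm_cmult by simp
    qed
  qed
  then have "L1_norm m (\<lambda>x. v x - v' x) = 0" by (simp add: tendsto_const_iff)
  then show "L1_norm m (\<lambda>x. v x - v' x) \<le> 0" by simp
qed

lemma generator_eq:
  assumes S: "substochastic_semigroup m S" and g: "in_generator m S u v"
  shows "in_generator m S u (generator m S u)" "AE x in m. generator m S u x = v x"
proof -
  show 1: "in_generator m S u (generator m S u)"
    unfolding generator_def by (rule someI[of _ v]) (rule g)
  show "AE x in m. generator m S u x = v x" by (rule in_generator_unique[OF S 1 g])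
qed

text \<open>
  Dissipativity leaves at most one solution of the resolvent equation, so whatever solution has been
  constructed is the resolvent.
\<close>

lemma resolvent_eq:
  assumes S: "substochastic_semigroup m S" and l: "0 < l" and u: "u \<in> L1 m"
    and g: "in_generator m S w (\<lambda>x. l * w x - u x)"
  shows "resolvent m S l u \<in> generator_dom m S" "AE x in m. resolvent m S l u x = w x"
proof -
  have "w \<in> generator_dom m S \<and> (AE x in m. l * w x - generator m S w x = u x)"
    using g generator_eq(2)[OF S g] by (auto simp: generator_dom_def elim: eventually_mono)
  then have r: "resolvent m S l u \<in> generator_dom m S"
    "AE x in m. l * resolvent m S l u x - generator m S (resolvent m S l u) x = u x"
    unfolding resolvent_def
    using someI[of "\<lambda>w. w \<in> generator_dom m S \<and> (AE x in m. l * w x - generator m S w x = u x)"] by blast+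
  show "resolvent m S l u \<in> generator_dom m S" by fact
  let ?r = "resolvent m S l u"
  have gr: "in_generator m S ?r (generator m S ?r)"
    using r(1) generator_eq(1)[OF S] by (auto simp: generator_dom_def)
  let ?z = "\<lambda>x. generator m S ?r x - (l * w x - u x)"
  have g0: "in_generator m S (\<lambda>x. ?r x - w x) ?z"
    by (rule in_generator_diff[OF S gr g])
      (use in_generatorD(1,2)[OF gr] in_generatorD(1,2)[OF g] in \<open>auto simp: L1_def\<close>)
  have "AE x in m. l * (?r x - w x) - ?z x = 0"
    using r(2) by eventually_elim (simp add: algebra_simps)
  then have "L1_norm m (\<lambda>x. l * (?r x - w x) - ?z x) = L1_norm m (\<lambda>x. 0)"
    using in_generatorD(1,2)[OF g0] by (intro L1_norm_cong_AE) (auto simp: L1_def)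
  then have "l * L1_norm m (\<lambda>x. ?r x - w x) \<le> 0"
    using dissipative[OF S g0 l] by (simp add: L1_norm_def)
  then have "L1_norm m (\<lambda>x. ?r x - w x) \<le> 0" using l by (simp add: mult_le_0_iff)
  then show "AE x in m. ?r x = w x"
    by (intro AE_eq_of_L1_norm in_generatorD(1)[OF gr] in_generatorD(1)[OF g])
qed

lemma laplace_semigroup_mass_bound:
  assumes S: "substochastic_semigroup m S" and l: "0 < l" and u: "u \<in> L1 m"
  shows "\<bar>laplace l (\<lambda>t. \<integral>x. S t u x \<partial>m)\<bar> \<le> L1_norm m u / l"
    and "set_integrable lborel {0..} (\<lambda>t. exp (- l * t) * (\<integral>x. S t u x \<partial>m))"
  using laplace_integrable[OF l semigroup_set_integral_laplace(1)[OF S u sets.top]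
     semigroup_set_integral_laplace(2)[OF S u sets.top]]
  by (simp_all add: set_integral_UNIV_space)

lemma laplace_semigroup_mass_linear:
  assumes S: "substochastic_semigroup m S" and l: "0 < l" and u: "u \<in> L1 m" and v: "v \<in> L1 m"
  shows "laplace l (\<lambda>t. \<integral>x. S t (\<lambda>x. a * u x + b * v x) x \<partial>m)
     = a * laplace l (\<lambda>t. \<integral>x. S t u x \<partial>m) + b * laplace l (\<lambda>t. \<integral>x. S t v x \<partial>m)"
proof -
  have eq: "(\<integral>x. S t (\<lambda>x. a * u x + b * v x) x \<partial>m) = a * (\<integral>x. S t u x \<partial>m) + b * (\<integral>x. S t v x \<partial>m)"
    if t: "0 \<le> t" for t
  proof -
    have "(\<integral>x. S t (\<lambda>x. a * u x + b * v x) x \<partial>m) = (\<integral>x. a * S t u x + b * S t v x \<partial>m)"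
      using semigroupD(3)[OF S t u] semigroupD(3)[OF S t v] semigroupD(3)[OF S t L1_lin[OF u v, of a b]]
      by (intro integral_cong_AE L1_operatorD(3)[OF semigroupD(1)[OF S t] u v]) (auto simp: L1_def)
    then show ?thesis using semigroupD(3)[OF S t u] semigroupD(3)[OF S t v] by (simp add: L1_def)
  qed
  have "laplace l (\<lambda>t. \<integral>x. S t (\<lambda>x. a * u x + b * v x) x \<partial>m)
    = (LINT t:{0..}|lborel. a * (exp (- l * t) * (\<integral>x. S t u x \<partial>m)) + b * (exp (- l * t) * (\<integral>x. S t v x \<partial>m)))"
    unfolding laplace_def using eq by (intro set_lebesgue_integral_cong) (auto simp: algebra_simps)
  also have "\<dots> = a * laplace l (\<lambda>t. \<integral>x. S t u x \<partial>m) + b * laplace l (\<lambda>t. \<integral>x. S t v x \<partial>m)"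
    using laplace_semigroup_mass_bound(2)[OF S l u] laplace_semigroup_mass_bound(2)[OF S l v]
    by (simp add: laplace_def)
  finally show ?thesis .
qed

text \<open>
  This is \<open>\<integral> R(l, C) (l - C) y dm = \<integral> y dm\<close> for an arbitrary semigroup with generator
  \<open>C\<close>. Both sides come from the limit of the Laplace transform of the mass at the difference
  quotients \<open>(S(h) y - y) / h\<close>: once by contractivity, once by a shift in time.
\<close>

lemma laplace_generator_mass:
  assumes S: "substochastic_semigroup m S" and g: "in_generator m S y z" and l: "0 < l"
  shows "laplace l (\<lambda>t. \<integral>x. S t (\<lambda>x. l * y x - z x) x \<partial>m) = (\<integral>x. y x \<partial>m)"
proof -
  note y = in_generatorD(1)[OF g] and z = in_generatorD(2)[OF g]
  let ?F = "\<lambda>u. laplace l (\<lambda>t. \<integral>x. S t u x \<partial>m)"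
  define p where "p t = (\<integral>x. S t y x \<partial>m)" for t
  define D where "D h x = (S h y x - y x) / h" for h x
  have F_lin: "?F (\<lambda>x. a * u x + b * v x) = a * ?F u + b * ?F v" if "u \<in> L1 m" "v \<in> L1 m" for a b u v
    by (rule laplace_semigroup_mass_linear[OF S l that])
  have p0: "p 0 = (\<integral>x. y x \<partial>m)"
    using semigroup_set_integral_laplace(4)[OF S y sets.top] by (simp add: set_integral_UNIV_space p_def)
  have D_L1: "D h \<in> L1 m" if "0 < h" for h
    using semigroupD(3)[OF S _ y, of h] y that by (simp add: L1_def D_def[abs_def])
  have FD: "?F (D h) = (laplace l (\<lambda>t. p (t + h)) - laplace l p) / h" if h: "0 < h" for h
  proof -
    have "?F (\<lambda>x. 1/h * S h y x + (-1/h) * y x) = 1/h * ?F (S h y) + (-1/h) * ?F y"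
      using h by (intro F_lin semigroupD(3)[OF S _ y] y) auto
    moreover have "(\<lambda>x. 1/h * S h y x + (-1/h) * y x) = D h"
      by (auto simp: D_def diff_divide_distrib)
    moreover have "?F (S h y) = laplace l (\<lambda>t. p (t + h))"
      unfolding laplace_def
    proof (rule set_lebesgue_integral_cong, simp, intro allI impI)
      fix t :: real assume t: "t \<in> {0..}"
      have "(\<integral>x. S t (S h y) x \<partial>m) = p (t + h)"
        unfolding p_def
      proof (rule integral_cong_AE)
        have L: "S t (S h y) \<in> L1 m" "S (t + h) y \<in> L1 m" using t h y by (auto intro!: semigroupD(3)[OF S])
        then show "S t (S h y) \<in> borel_measurable m" "S (t + h) y \<in> borel_measurable m"
          by (auto simp: L1_def)
        show "AE x in m. S t (S h y) x = S (t + h) y x"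
          using semigroupD(6)[OF S, of t h y] t h y by (auto elim: eventually_mono)
      qed
      then show "exp (- l * t) * (\<integral>x. S t (S h y) x \<partial>m) = exp (- l * t) * p (t + h)" by simp
    qed
    ultimately show ?thesis by (simp add: p_def[abs_def] diff_divide_distrib)
  qed
  have lim1: "((\<lambda>h. ?F (D h)) \<longlongrightarrow> l * laplace l p - p 0) (at_right 0)"
    unfolding tendsto_iff dist_real_def
  proof (intro allI impI)
    fix e :: real assume e: "0 < e"
    from laplace_difference_eventually[OF l semigroupD(7)[OF S order_refl y], of "e/2" "L1_norm m y"] e
    have "\<forall>\<^sub>F h in at_right 0. \<forall>q. set_borel_measurable lborel {0..} q \<longrightarrow>
     (\<forall>t\<ge>0. \<bar>q t\<bar> \<le> L1_norm m y) \<longrightarrow> (\<forall>t>0. \<bar>q t - q 0\<bar> \<le> L1_norm m (\<lambda>x. S t y x - y x)) \<longrightarrow>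
     \<bar>(laplace l (\<lambda>t. q (t + h)) - laplace l q) / h - (l * laplace l q - q 0)\<bar> \<le> e/2" by simp
    then show "\<forall>\<^sub>F h in at_right 0. \<bar>?F (D h) - (l * laplace l p - p 0)\<bar> < e"
      using eventually_at_right_less[of "0::real"]
    proof eventually_elim
      case (elim h)
      have "\<bar>(laplace l (\<lambda>t. p (t + h)) - laplace l p) / h - (l * laplace l p - p 0)\<bar> \<le> e/2"
        using elim(1)[rule_format, of p]
          semigroup_set_integral_laplace[OF S y sets.top]
        by (simp add: p_def[abs_def] set_integral_UNIV_space)
      then show ?case using FD[OF elim(2)] e by simp
    qed
  qed
  have lim2: "((\<lambda>h. ?F (D h)) \<longlongrightarrow> ?F z) (at_right 0)"
  proof (rule Lim_null[THEN iffD2], rule Lim_null_comparison)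
    show "((\<lambda>h. L1_norm m (\<lambda>x. D h x - z x) / l) \<longlongrightarrow> 0) (at_right 0)"
      using tendsto_divide[OF in_generatorD(3)[OF g] tendsto_const[of l]] l by (simp add: D_def)
    show "\<forall>\<^sub>F h in at_right 0. norm (?F (D h) - ?F z) \<le> L1_norm m (\<lambda>x. D h x - z x) / l"
      using eventually_at_right_less[of "0::real"]
    proof eventually_elim
      case (elim h)
      have "?F (\<lambda>x. D h x - z x) = ?F (D h) - ?F z"
        using F_lin[OF D_L1[OF elim] z, of 1 "-1"] by simp
      then show ?case
        using laplace_semigroup_mass_bound(1)[OF S l L1_diff[OF D_L1[OF elim] z]] by simp
    qed
  qed
  have "?F z = l * laplace l p - p 0"
    using tendsto_unique[OF _ lim2 lim1] by simp
  moreover have "?F (\<lambda>x. l * y x - z x) = l * ?F y - ?F z"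
    using F_lin[OF y z, of l "-1"] by simp
  ultimately show ?thesis using p0 by (simp add: p_def[abs_def])
qed

section \<open>Resolvents as preduals of Laplace transforms\<close>

definition laplace_kernel :: "real \<Rightarrow> (real \<Rightarrow> ('a \<Rightarrow> ennreal) \<Rightarrow> 'a \<Rightarrow> ennreal) \<Rightarrow> ('a \<Rightarrow> ennreal) \<Rightarrow> 'a \<Rightarrow> ennreal" where
  "laplace_kernel l V f x = (\<integral>\<^sup>+t. indicator {0..} t * ennreal (exp (- l * t)) * V t f x \<partial>lborel)"

text \<open>
  Negative times are cut off by the indicator, so that nothing is required of \<open>V t\<close> there.
\<close>

definition kernel_family :: "'a measure \<Rightarrow> (real \<Rightarrow> ('a \<Rightarrow> ennreal) \<Rightarrow> 'a \<Rightarrow> ennreal) \<Rightarrow> bool" where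
  "kernel_family M V \<longleftrightarrow> (\<forall>t\<ge>0. kernel_operator M 1 (V t)) \<and>
     (\<forall>f\<in>borel_measurable M. (\<lambda>(t, x). indicator {0..} t * V t f x) \<in> borel_measurable (borel \<Otimes>\<^sub>M M))"

lemma kernel_family_sets_cong:
  assumes "sets M = sets M'" "kernel_family M V" shows "kernel_family M' V"
proof -
  have "borel_measurable M = (borel_measurable M' :: ('a \<Rightarrow> ennreal) set)"
    by (rule measurable_cong_sets) (simp_all add: assms)
  moreover have "borel_measurable (borel \<Otimes>\<^sub>M M) = (borel_measurable (borel \<Otimes>\<^sub>M M') :: (real \<times> 'a \<Rightarrow> ennreal) set)"
    by (rule measurable_cong_sets) (simp_all add: assms cong: sets_pair_measure_cong)
  ultimately show ?thesis
    using assms(2) kernel_operator_sets_cong[OF assms(1)] by (simp add: kernel_family_def)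
qed

lemma kernel_operator_laplace:
  assumes V: "kernel_family M V" and l: "0 < l"
  shows "kernel_operator M (1 / l) (laplace_kernel l V)"
  unfolding kernel_operator_def
proof (intro conjI ballI)
  have meas: "(\<lambda>(t, x). indicator {0..} t * ennreal (exp (- l * t)) * V t f x) \<in> borel_measurable (borel \<Otimes>\<^sub>M M)"
    if f: "f \<in> borel_measurable M" for f
  proof -
    have [measurable]: "(\<lambda>(t, x). indicator {0..} t * V t f x) \<in> borel_measurable (borel \<Otimes>\<^sub>M M)"
      using V f by (simp add: kernel_family_def)
    have "(\<lambda>(t, x). ennreal (exp (- l * t)) * (case (t, x) of (t, x) \<Rightarrow> indicator {0..} t * V t f x)) \<in> borel_measurable (borel \<Otimes>\<^sub>M M)"
      by measurable
    then show ?thesis by (simp add: mult_ac)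
  qed
  show "0 \<le> 1 / l" using l by simp
  fix f :: "'a \<Rightarrow> ennreal" assume f: "f \<in> borel_measurable M"
  have "(\<lambda>(x, t). indicator {0..} t * ennreal (exp (- l * t)) * V t f x) \<in> borel_measurable (M \<Otimes>\<^sub>M lborel)"
    using measurable_pair_swap[OF meas[OF f]] by (simp add: case_prod_beta)
  then show "laplace_kernel l V f \<in> borel_measurable M"
    unfolding laplace_kernel_def[abs_def] by (rule lborel.borel_measurable_nn_integral[where f="\<lambda>x t. _ x t", simplified])
next
  fix x assume x: "x \<in> space M"
  have meas: "(\<lambda>t. indicator {0..} t * V t f x) \<in> borel_measurable borel" if f: "f \<in> borel_measurable M" for f
  proof -
    have [measurable]: "(\<lambda>(t, x). indicator {0..} t * V t f x) \<in> borel_measurable (borel \<Otimes>\<^sub>M M)"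
      using V f by (simp add: kernel_family_def)
    have "(\<lambda>t. case (t, x) of (t, x) \<Rightarrow> indicator {0..} t * V t f x) \<in> borel_measurable borel"
      using x by measurable
    then show ?thesis by simp
  qed
  let ?R = "density (restrict_space lborel {0..}) (\<lambda>t. ennreal (exp (- l * t)))"
  have *: "laplace_kernel l V f x = (\<integral>\<^sup>+t. V t f x \<partial>?R)" if f: "f \<in> borel_measurable M" for f
  proof -
    have [measurable]: "(\<lambda>t. V t f x) \<in> borel_measurable (restrict_space lborel {0..})"
      using meas[OF f] by (subst borel_measurable_restrict_space_iff_ennreal) (auto simp: mult.commute)
    have [measurable]: "(\<lambda>t. ennreal (exp (- l * t))) \<in> borel_measurable (restrict_space lborel {0..})"
      by (rule measurable_restrict_space1) measurable
    have "(\<integral>\<^sup>+t. V t f x \<partial>?R) = (\<integral>\<^sup>+t. ennreal (exp (- l * t)) * V t f x \<partial>restrict_space lborel {0..})"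
      by (rule nn_integral_density) measurable
    also have "\<dots> = (\<integral>\<^sup>+t. ennreal (exp (- l * t)) * V t f x * indicator {0..} t \<partial>lborel)"
      by (rule nn_integral_restrict_space) simp
    finally show ?thesis
      unfolding laplace_kernel_def by (simp add: mult_ac)
  qed
  have "integral_functional M (\<lambda>f. \<integral>\<^sup>+t. V t f x \<partial>?R)"
  proof (rule integral_functional_mixture)
    show "integral_functional M (\<lambda>f. V t f x)" if "t \<in> space ?R" for t
      using that V x by (simp add: kernel_family_def kernel_operator_def space_restrict_space)
    show "(\<lambda>t. V t f x) \<in> borel_measurable ?R" if "f \<in> borel_measurable M" for f
      using meas[OF that] by (simp, subst borel_measurable_restrict_space_iff_ennreal) (auto simp: mult.commute)
  qed
  then show "integral_functional M (\<lambda>f. laplace_kernel l V f x)"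
    unfolding integral_functional_def using * by auto
  have "laplace_kernel l V (\<lambda>_. 1) x \<le> (\<integral>\<^sup>+t. indicator {0..} t * ennreal (exp (- l * t)) \<partial>lborel)"
    unfolding laplace_kernel_def
  proof (rule nn_integral_mono)
    fix t :: real
    show "indicator {0..} t * ennreal (exp (- l * t)) * V t (\<lambda>_. 1) x \<le> indicator {0..} t * ennreal (exp (- l * t))"
    proof (cases "0 \<le> t")
      case True
      then have "V t (\<lambda>_. 1) x \<le> 1" using V x by (simp add: kernel_family_def kernel_operator_def)
      then show ?thesis using mult_left_mono[of "V t (\<lambda>_. 1) x" 1 "indicator {0..} t * ennreal (exp (- l * t))"] by simp
    qed simp
  qed
  then show "laplace_kernel l V (\<lambda>_. 1) x \<le> ennreal (1 / l)" using exp_integral(3)[OF l] by simp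
qed

lemma (in sigma_finite_measure) laplace_kernel_dual:
  assumes V: "kernel_family M V" and u: "u \<in> borel_measurable M"
    and f: "f \<in> borel_measurable M"
  shows "(\<integral>\<^sup>+x. laplace_kernel l V f x * ennreal (u x) \<partial>M)
    = (\<integral>\<^sup>+t. indicator {0..} t * ennreal (exp (- l * t)) * (\<integral>\<^sup>+x. V t f x * ennreal (u x) \<partial>M) \<partial>lborel)"
proof -
  interpret pair_sigma_finite lborel M
    by (intro pair_sigma_finite.intro lborel.sigma_finite_measure_axioms sigma_finite_measure_axioms)
  have [measurable]: "u \<in> borel_measurable M" by fact
  have m1[measurable]: "(\<lambda>(t, x). indicator {0..} t * V t f x) \<in> borel_measurable (borel \<Otimes>\<^sub>M M)"
    using V f by (simp add: kernel_family_def)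
  have "(\<lambda>(t, x). ennreal (exp (- l * t)) * (case (t, x) of (t, x) \<Rightarrow> indicator {0..} t * V t f x) * ennreal (u x)) \<in> borel_measurable (borel \<Otimes>\<^sub>M M)"
    by measurable
  then have m: "(\<lambda>(t, x). indicator {0..} t * ennreal (exp (- l * t)) * V t f x * ennreal (u x)) \<in> borel_measurable (lborel \<Otimes>\<^sub>M M)"
    by (simp add: mult_ac)
  have mx: "(\<lambda>t. indicator {0..} t * ennreal (exp (- l * t)) * V t f x) \<in> borel_measurable lborel" if "x \<in> space M" for x
  proof -
    have "(\<lambda>t. ennreal (exp (- l * t)) * (case (t, x) of (t, x) \<Rightarrow> indicator {0..} t * V t f x)) \<in> borel_measurable lborel"
      using that by measurable
    then show ?thesis by (simp add: mult_ac)
  qed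
  have Vm: "0 \<le> t \<Longrightarrow> V t f \<in> borel_measurable M" for t
    using V f by (simp add: kernel_family_def kernel_operator_def)
  have "(\<integral>\<^sup>+x. laplace_kernel l V f x * ennreal (u x) \<partial>M)
    = (\<integral>\<^sup>+x. \<integral>\<^sup>+t. indicator {0..} t * ennreal (exp (- l * t)) * V t f x * ennreal (u x) \<partial>lborel \<partial>M)"
    unfolding laplace_kernel_def using mx by (intro nn_integral_cong nn_integral_multc[symmetric])
  also have "\<dots> = (\<integral>\<^sup>+t. \<integral>\<^sup>+x. indicator {0..} t * ennreal (exp (- l * t)) * V t f x * ennreal (u x) \<partial>M \<partial>lborel)"
    using m by (rule Fubini')
  also have "\<dots> = (\<integral>\<^sup>+t. indicator {0..} t * ennreal (exp (- l * t)) * (\<integral>\<^sup>+x. V t f x * ennreal (u x) \<partial>M) \<partial>lborel)"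
  proof (rule nn_integral_cong)
    fix t :: real
    show "(\<integral>\<^sup>+x. indicator {0..} t * ennreal (exp (- l * t)) * V t f x * ennreal (u x) \<partial>M)
      = indicator {0..} t * ennreal (exp (- l * t)) * (\<integral>\<^sup>+x. V t f x * ennreal (u x) \<partial>M)"
      using Vm[of t] by (cases "0 \<le> t") (simp_all add: mult.assoc nn_integral_cmult)
  qed
  finally show ?thesis .
qed

text \<open>
  If \<open>S(t)\<close> is the predual of \<open>V t\<close>, then every set integral of \<open>S(h) R u\<close> is the Laplace
  transform of the shifted function \<open>t \<mapsto> \<integral>\<^sub>B S(t + h) u dm\<close>, because \<open>V\<close> is a semigroup. The
  uniform limit of the difference quotients then shows that \<open>R u\<close> lies in the domain and solves
  the resolvent equation.
\<close>

lemma (in sigma_finite_measure) laplace_predual_in_generator: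
  assumes S: "substochastic_semigroup M S"
    and dual: "\<And>t. 0 \<le> t \<Longrightarrow> predual_of M (V t) (S t)"
    and V: "kernel_family M V"
    and V_add: "\<And>s t f x. 0 \<le> s \<Longrightarrow> 0 \<le> t \<Longrightarrow> f \<in> borel_measurable M \<Longrightarrow> x \<in> space M \<Longrightarrow>
       V (s + t) f x = V s (V t f) x"
    and l: "0 < l" and R: "predual_of M (laplace_kernel l V) R"
    and u: "u \<in> L1 M"
  shows "in_generator M S (R u) (\<lambda>x. l * R u x - u x)"
proof -
  have pos: "in_generator M S (R u) (\<lambda>x. l * R u x - u x)" if u: "u \<in> L1_pos M" for u
  proof -
    have uL: "u \<in> L1 M" and Ru: "R u \<in> L1_pos M"
      using u L1_pos_L1 predual_ofD(2)[OF R u] by auto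
    have um: "u \<in> borel_measurable M" using uL by (simp add: L1_def)
    have Vk: "0 \<le> t \<Longrightarrow> kernel_operator M 1 (V t)" for t using V by (simp add: kernel_family_def)
    have lap: "(\<integral>\<^sup>+x. V h (indicator B) x * ennreal (R u x) \<partial>M) = ennreal (laplace l (\<lambda>t. LINT x:B|M. S (t + h) u x))"
      if B: "B \<in> sets M" and h: "0 \<le> h" for B h
    proof -
      have ib: "indicator B \<in> borel_measurable M" using B by simp
      have Vm: "V h (indicator B) \<in> borel_measurable M" using kernel_operator_measurable[OF Vk[OF h] ib] .
      have "(\<integral>\<^sup>+x. V h (indicator B) x * ennreal (R u x) \<partial>M)
        = (\<integral>\<^sup>+t. indicator {0..} t * ennreal (exp (- l * t)) * (\<integral>\<^sup>+x. V t (V h (indicator B)) x * ennreal (u x) \<partial>M) \<partial>lborel)"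
        using predual_ofD(3)[OF R u Vm] laplace_kernel_dual[OF V um Vm] by simp
      also have "\<dots> = (\<integral>\<^sup>+t. ennreal (indicator {0..} t *\<^sub>R (exp (- l * t) * (LINT x:B|M. S (t + h) u x))) \<partial>lborel)"
      proof (rule nn_integral_cong)
        fix t :: real
        show "indicator {0..} t * ennreal (exp (- l * t)) * (\<integral>\<^sup>+x. V t (V h (indicator B)) x * ennreal (u x) \<partial>M)
          = ennreal (indicator {0..} t *\<^sub>R (exp (- l * t) * (LINT x:B|M. S (t + h) u x)))"
        proof (cases "0 \<le> t")
          case True
          then have th: "0 \<le> t + h" using h by simp
          have "(\<integral>\<^sup>+x. V t (V h (indicator B)) x * ennreal (u x) \<partial>M) = (\<integral>\<^sup>+x. V (t + h) (indicator B) x * ennreal (u x) \<partial>M)"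
            using V_add[OF True h ib] by (intro nn_integral_cong) simp
          also have "\<dots> = (\<integral>\<^sup>+x. indicator B x * ennreal (S (t + h) u x) \<partial>M)"
            using predual_ofD(3)[OF dual[OF th] u ib] by simp
          also have "\<dots> = ennreal (LINT x:B|M. S (t + h) u x)"
            by (rule L1_pos_set_integral(1)[OF semigroupD(2)[OF S th u] B])
          finally show ?thesis
            using True L1_pos_set_integral(2)[OF semigroupD(2)[OF S th u] B] by (simp add: ennreal_mult')
        qed simp
      qed
      also have "\<dots> = ennreal (laplace l (\<lambda>t. LINT x:B|M. S (t + h) u x))"
        unfolding laplace_def set_lebesgue_integral_def[of lborel]
      proof (rule nn_integral_eq_integral)
        have "set_integrable lborel {0..} (\<lambda>t. exp (- l * t) * (LINT x:B|M. S (t + h) u x))"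
        proof (rule laplace_integrable(1)[OF l])
          have c: "continuous_on {0..} (\<lambda>t. LINT x:B|M. S (t + h) u x)"
            by (rule continuous_on_compose2[OF semigroup_set_integral_continuous[OF S uL B]])
              (auto intro!: continuous_intros simp: h)
          show "set_borel_measurable lborel {0..} (\<lambda>t. LINT x:B|M. S (t + h) u x)"
            using borel_measurable_continuous_on_indicator[OF _ c] by (simp add: set_borel_measurable_def)
          show "\<bar>LINT x:B|M. S (t + h) u x\<bar> \<le> L1_norm M u" if "0 \<le> t" for t
            using semigroup_set_integral_laplace(2)[OF S uL B] that h by simp
        qed
        then show "integrable lborel (\<lambda>t. indicator {0..} t *\<^sub>R (exp (- l * t) * (LINT x:B|M. S (t + h) u x)))"
          by (simp add: set_integrable_def)
        show "AE t in lborel. 0 \<le> indicator {0..} t *\<^sub>R (exp (- l * t) * (LINT x:B|M. S (t + h) u x))"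
          using L1_pos_set_integral(2)[OF semigroupD(2)[OF S _ u] B] h
          by (intro AE_I2) (auto simp: indicator_def)
      qed
      finally show ?thesis .
    qed
    have lap_nonneg: "0 \<le> laplace l (\<lambda>t. LINT x:B|M. S (t + h) u x)" if "B \<in> sets M" "0 \<le> h" for B h
      unfolding laplace_def set_lebesgue_integral_def[of lborel]
      using L1_pos_set_integral(2)[OF semigroupD(2)[OF S _ u] that(1)] that(2)
      by (intro integral_nonneg_AE AE_I2) (auto simp: indicator_def)
    have SR: "(LINT x:B|M. S h (R u) x) = laplace l (\<lambda>t. LINT x:B|M. S (t + h) u x)"
      if B: "B \<in> sets M" and h: "0 \<le> h" for B h
    proof -
      note SRu = semigroupD(2)[OF S h Ru]
      have "ennreal (LINT x:B|M. S h (R u) x) = (\<integral>\<^sup>+x. V h (indicator B) x * ennreal (R u x) \<partial>M)"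
        using L1_pos_set_integral(1)[OF SRu B] predual_ofD(3)[OF dual[OF h] Ru, of "indicator B"] B by simp
      then show ?thesis
        using lap[OF B h] lap_nonneg[OF B h] L1_pos_set_integral(2)[OF SRu B] by simp
    qed
    have R0: "(LINT x:B|M. R u x) = laplace l (\<lambda>t. LINT x:B|M. S t u x)" if B: "B \<in> sets M" for B
      using SR[OF B order_refl] semigroup_set_integral_laplace(4)[OF S L1_pos_L1[OF Ru] B] by simp
    have RuL: "R u \<in> L1 M" using Ru by (rule L1_pos_L1)
    show ?thesis
      unfolding in_generator_def
    proof (intro conjI RuL)
      show "(\<lambda>x. l * R u x - u x) \<in> L1 M" using RuL uL by (simp add: L1_def)
      show "((\<lambda>t. L1_norm M (\<lambda>x. (S t (R u) x - R u x) / t - (l * R u x - u x))) \<longlongrightarrow> 0) (at_right 0)"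
        unfolding tendsto_iff dist_real_def
      proof (intro allI impI)
        fix e :: real assume e: "0 < e"
        \<comment> \<open>The norm is at most twice the bound for the set integrals.\<close>
        from laplace_difference_eventually[OF l semigroupD(7)[OF S order_refl uL], of "e/3" "L1_norm M u"] e
        have "\<forall>\<^sub>F h in at_right 0. \<forall>q. set_borel_measurable lborel {0..} q \<longrightarrow>
         (\<forall>t\<ge>0. \<bar>q t\<bar> \<le> L1_norm M u) \<longrightarrow> (\<forall>t>0. \<bar>q t - q 0\<bar> \<le> L1_norm M (\<lambda>x. S t u x - u x)) \<longrightarrow>
         \<bar>(laplace l (\<lambda>t. q (t + h)) - laplace l q) / h - (l * laplace l q - q 0)\<bar> \<le> e/3" by simp
        then show "\<forall>\<^sub>F h in at_right 0. \<bar>L1_norm M (\<lambda>x. (S h (R u) x - R u x) / h - (l * R u x - u x)) - 0\<bar> < e"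
          using eventually_at_right_less[of "0::real"]
        proof eventually_elim
          case (elim h)
          then have h: "0 \<le> h" by simp
          note SRu = semigroupD(3)[OF S h RuL]
          have "L1_norm M (\<lambda>x. (S h (R u) x - R u x) / h - (l * R u x - u x)) \<le> 2 * (e/3)"
          proof (rule L1_norm_le_set_integrals)
            show "(\<lambda>x. (S h (R u) x - R u x) / h - (l * R u x - u x)) \<in> L1 M"
              using SRu RuL uL by (simp add: L1_def)
            fix B assume B: "B \<in> sets M"
            let ?q = "\<lambda>t. LINT x:B|M. S t u x"
            have "(LINT x:B|M. (S h (R u) x - R u x) / h - (l * R u x - u x))
               = (\<integral>x. (indicator B x * S h (R u) x - indicator B x * R u x) / h - (l * (indicator B x * R u x) - indicator B x * u x) \<partial>M)"
              unfolding set_lebesgue_integral_def by (intro Bochner_Integration.integral_cong) (auto simp: indicator_def)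
            also have "\<dots> = ((LINT x:B|M. S h (R u) x) - (LINT x:B|M. R u x)) / h - (l * (LINT x:B|M. R u x) - (LINT x:B|M. u x))"
              using L1_indicator_integrable[OF SRu B] L1_indicator_integrable[OF RuL B] L1_indicator_integrable[OF uL B]
              by (simp add: set_lebesgue_integral_def)
            also have "\<dots> = (laplace l (\<lambda>t. ?q (t + h)) - laplace l ?q) / h - (l * laplace l ?q - ?q 0)"
              by (simp add: SR[OF B h] R0[OF B] semigroup_set_integral_laplace(4)[OF S uL B])
            finally show "\<bar>LINT x:B|M. (S h (R u) x - R u x) / h - (l * R u x - u x)\<bar> \<le> e/3"
              using elim(1)[rule_format, of ?q] semigroup_set_integral_laplace[OF S uL B] by simp
          qed
          then show ?case using e L1_norm_nonneg[of M "\<lambda>x. (S h (R u) x - R u x) / h - (l * R u x - u x)"] by simp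
        qed
      qed
    qed
  qed
  have LR: "L1_operator M R" by (rule predual_ofD(1)[OF R])
  have RL: "R u \<in> L1 M" using L1_operatorD(1)[OF LR u] .
  show ?thesis
  proof (rule in_generator_diff[OF S pos[OF L1_pos_parts(1)[OF u]] pos[OF L1_pos_parts(2)[OF u]] RL L1_operator_parts[OF LR u]])
    show "(\<lambda>x. l * R u x - u x) \<in> L1 M" using RL u by (simp add: L1_def)
    show "AE x in M. l * R u x - u x = l * R (\<lambda>x. max 0 (u x)) x - max 0 (u x) - (l * R (\<lambda>x. max 0 (- u x)) x - max 0 (- u x))"
      using L1_operator_parts[OF LR u]
    proof eventually_elim
      case (elim x)
      have "u x = max 0 (u x) - max 0 (- u x)" using diff_pos_neg_parts[of "u x"] by simp
      then have "l * R u x - u x = l * (R (\<lambda>x. max 0 (u x)) x - R (\<lambda>x. max 0 (- u x)) x) - (max 0 (u x) - max 0 (- u x))"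
        by (intro arg_cong2[where f="\<lambda>p q. l * p - q"] elim)
      also have "\<dots> = l * R (\<lambda>x. max 0 (u x)) x - max 0 (u x) - (l * R (\<lambda>x. max 0 (- u x)) x - max 0 (- u x))"
        by (simp add: right_diff_distrib)
      finally show ?case .
    qed
  qed
qed

section \<open>The standard exponential and uniform laws\<close>

abbreviation std_exponential :: "real measure" where
  "std_exponential \<equiv> density lborel (exponential_density 1)"

abbreviation std_uniform :: "real measure" where
  "std_uniform \<equiv> uniform_measure lborel {0<..<1}"

lemma prob_space_std_exponential: "prob_space std_exponential"
  by (rule prob_space_exponential_density) simp

lemma prob_space_std_uniform: "prob_space std_uniform"
  by (rule prob_space_uniform_measure) auto

lemma std_exponential_tail:
  assumes "0 \<le> a"
  shows "emeasure std_exponential {a<..} = ennreal (exp (- a))"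
proof -
  interpret prob_space std_exponential by (rule prob_space_std_exponential)
  have "distributed std_exponential lborel (\<lambda>x. x) (exponential_density 1)"
    unfolding distributed_def by (auto simp: distr_id2 exponential_density_nonneg)
  from exponential_distributedD_gt[OF this assms] show ?thesis
    by (simp add: emeasure_eq_measure greaterThan_def space_density)
qed

section \<open>The flow and the cumulative jump rate\<close>

context pdmp_characteristics
begin

abbreviation "M \<equiv> borel_on E"

lemma space_M[simp]: "space M = E"
  by (simp add: space_restrict_space)

lemma in_space_M: "x \<in> E \<Longrightarrow> x \<in> space M"
  by simp

text \<open>
  Truncating the time at \<open>0\<close> makes the flow jointly measurable on the whole line.
\<close>

definition flow :: "real \<Rightarrow> 'a \<Rightarrow> 'a" where "flow t x = \<pi> (max 0 t) x"

lemma flow_eq: "0 \<le> t \<Longrightarrow> flow t x = \<pi> t x"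
  by (simp add: flow_def max_def)

lemma flow_closed: "x \<in> E \<Longrightarrow> flow t x \<in> E"
  by (simp add: flow_def flow_in)

lemma flow_measurable_pair: "(\<lambda>(t, x). flow t x) \<in> borel \<Otimes>\<^sub>M M \<rightarrow>\<^sub>M M"
proof (rule measurable_restrict_space2)
  show "(\<lambda>(t, x). flow t x) \<in> space (borel \<Otimes>\<^sub>M M) \<rightarrow> E"
    by (auto simp: space_pair_measure flow_closed)
  have id: "(\<lambda>x. x) \<in> M \<rightarrow>\<^sub>M borel"
    by (rule measurable_restrict_space1) simp
  have [measurable]: "snd \<in> (borel :: real measure) \<Otimes>\<^sub>M M \<rightarrow>\<^sub>M borel"
    by (rule measurable_compose[OF measurable_snd id])
  have "(\<lambda>p. (max 0 (fst p :: real), snd p)) \<in> borel \<Otimes>\<^sub>M M \<rightarrow>\<^sub>M borel \<Otimes>\<^sub>M (borel :: 'a measure)"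
    by measurable
  then have 1: "(\<lambda>p. (max 0 (fst p :: real), snd p)) \<in> borel \<Otimes>\<^sub>M M \<rightarrow>\<^sub>M restrict_space borel ({0..} \<times> E)"
    by (intro measurable_restrict_space2) (auto simp: space_pair_measure borel_prod)
  have 2: "(\<lambda>(t, x). \<pi> t x) \<in> restrict_space borel ({0..} \<times> E) \<rightarrow>\<^sub>M borel"
    by (rule borel_measurable_continuous_on_restrict) (rule flow_continuous)
  show "(\<lambda>(t, x). flow t x) \<in> borel \<Otimes>\<^sub>M M \<rightarrow>\<^sub>M borel"
    using measurable_compose[OF 1 2] by (simp add: flow_def case_prod_beta)
qed

lemma flow_measurable[measurable]:
  assumes "f \<in> N \<rightarrow>\<^sub>M borel" "g \<in> N \<rightarrow>\<^sub>M M"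
  shows "(\<lambda>z. flow (f z) (g z)) \<in> N \<rightarrow>\<^sub>M M"
  using measurable_compose[OF measurable_Pair[OF assms] flow_measurable_pair] by simp

lemma rate_measurable'[measurable (raw)]:
  "g \<in> N \<rightarrow>\<^sub>M M \<Longrightarrow> (\<lambda>z. \<phi> (g z)) \<in> borel_measurable N"
  by (rule measurable_compose[OF _ rate_measurable])

abbreviation \<Phi> :: "'a \<Rightarrow> real \<Rightarrow> real" where "\<Phi> x t \<equiv> cum_rate \<pi> \<phi> x t"

lemma cum_rate_flow: "\<Phi> x t = (\<integral>s. indicator {0..t} s * \<phi> (flow s x) \<partial>lborel)"
  unfolding cum_rate_def set_lebesgue_integral_def
  by (intro Bochner_Integration.integral_cong) (auto simp: indicator_def flow_eq)

lemma cum_rate_measurable[measurable (raw)]: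
  assumes [measurable]: "f \<in> borel_measurable N" "g \<in> N \<rightarrow>\<^sub>M M"
  shows "(\<lambda>z. \<Phi> (g z) (f z)) \<in> borel_measurable N"
proof -
  have "(\<lambda>z. \<integral>s. (if 0 \<le> s \<and> s \<le> f z then \<phi> (flow s (g z)) else 0) \<partial>lborel) \<in> borel_measurable N"
    by measurable
  also have "(\<lambda>z. \<integral>s. (if 0 \<le> s \<and> s \<le> f z then \<phi> (flow s (g z)) else 0) \<partial>lborel) = (\<lambda>z. \<Phi> (g z) (f z))"
    unfolding cum_rate_flow by (intro ext Bochner_Integration.integral_cong) (auto simp: indicator_def)
  finally show ?thesis .
qed

lemma rate_set_integrable:
  assumes x: "x \<in> E" and A: "A \<in> sets borel" "A \<subseteq> {0..t}"
  shows "set_integrable lborel A (\<lambda>s. \<phi> (flow s x))"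
proof -
  have "set_integrable lborel {0..<max 0 t + 1} (\<lambda>s. \<phi> (\<pi> s x))" by (rule rate_integrable[OF x]) simp
  then have "set_integrable lborel {0..<max 0 t + 1} (\<lambda>s. \<phi> (flow s x))"
    by (subst set_integrable_cong[OF refl refl]) (auto simp: flow_eq)
  then show ?thesis by (rule set_integrable_subset) (use A in auto)
qed

lemma cum_rate_set: "\<Phi> x t = (LINT s:{0..t}|lborel. \<phi> (flow s x))"
  by (simp add: cum_rate_flow set_lebesgue_integral_def)

lemma cum_rate_nn_integral:
  assumes x: "x \<in> E"
  shows "(\<integral>\<^sup>+s. indicator {0..t} s * ennreal (\<phi> (flow s x)) \<partial>lborel) = ennreal (\<Phi> x t)"
proof -
  have "(\<integral>\<^sup>+s. ennreal (indicator {0..t} s * \<phi> (flow s x)) \<partial>lborel) = ennreal (\<Phi> x t)"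
    unfolding cum_rate_flow using rate_set_integrable[OF x, of "{0..t}" t] flow_closed[OF x] rate_nonneg
    by (intro nn_integral_eq_integral) (auto simp: set_integrable_def)
  then show ?thesis by (auto simp: indicator_def intro!: nn_integral_cong elim!: trans[rotated])
qed

lemma cum_rate_nonneg: "x \<in> E \<Longrightarrow> 0 \<le> \<Phi> x t"
  unfolding cum_rate_flow using flow_closed rate_nonneg by (intro integral_nonneg_AE) auto

lemma cum_rate_mono: 
  assumes x: "x \<in> E" and le: "s \<le> t" shows "\<Phi> x s \<le> \<Phi> x t"
  unfolding cum_rate_flow
  using rate_set_integrable[OF x, of "{0..t}" t] rate_set_integrable[OF x, of "{0..s}" s] flow_closed[OF x] rate_nonneg le
  by (intro integral_mono) (auto simp: set_integrable_def indicator_def)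

lemma cum_rate_neg: "t \<le> 0 \<Longrightarrow> \<Phi> x t = 0"
proof -
  assume t: "t \<le> 0"
  have "AE s in lborel. indicator {0..t} s * \<phi> (flow s x) = 0"
    using AE_lborel_singleton[of 0] by eventually_elim (use t in \<open>auto simp: indicator_def\<close>)
  then show ?thesis unfolding cum_rate_flow by (rule integral_eq_zero_AE)
qed

lemma flow_flow: "x \<in> E \<Longrightarrow> 0 \<le> s \<Longrightarrow> 0 \<le> t \<Longrightarrow> flow t (flow s x) = flow (s + t) x"
  using flow_add[of s t x] by (simp add: flow_eq add.commute)

lemma cum_rate_add:
  assumes x: "x \<in> E" and s: "0 \<le> s" and t: "0 \<le> t"
  shows "\<Phi> x (s + t) = \<Phi> x s + \<Phi> (flow s x) t"
proof -
  have "\<Phi> x (s + t) = (LINT r:{0..<s} \<union> {s..s+t}|lborel. \<phi> (flow r x))"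
    unfolding cum_rate_set using s t by (intro arg_cong[where f="\<lambda>A. LINT r:A|lborel. _ r"]) auto
  also have "\<dots> = (LINT r:{0..<s}|lborel. \<phi> (flow r x)) + (LINT r:{s..s+t}|lborel. \<phi> (flow r x))"
    using s t by (intro set_integral_Un rate_set_integrable[OF x, of _ "s+t"]) auto
  also have "(LINT r:{0..<s}|lborel. \<phi> (flow r x)) = \<Phi> x s"
    unfolding cum_rate_set set_lebesgue_integral_def
  proof (rule integral_cong_AE)
    show "AE r in lborel. indicator {0..<s} r *\<^sub>R \<phi> (flow r x) = indicator {0..s} r *\<^sub>R \<phi> (flow r x)"
      using AE_lborel_singleton[of s] by eventually_elim (auto simp: indicator_def)
  qed (use in_space_M[OF x] in measurable)
  also have "(LINT r:{s..s+t}|lborel. \<phi> (flow r x)) = \<Phi> (flow s x) t"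
    unfolding cum_rate_set set_lebesgue_integral_def
    by (subst lborel_integral_real_affine[of 1 _ s], simp)
      (auto intro!: Bochner_Integration.integral_cong simp: indicator_def flow_flow[OF x s])
  finally show ?thesis .
qed

lemma cum_rate_continuous:
  assumes x: "x \<in> E" shows "continuous_on {0..t} (\<Phi> x)"
proof -
  have i: "(\<lambda>s. \<phi> (flow s x)) integrable_on {0..t}"
    by (rule set_borel_integral_eq_integral[OF rate_set_integrable[OF x, of _ t]]) auto
  have "continuous_on {0..t} (\<lambda>r. integral {0..r} (\<lambda>s. \<phi> (flow s x)))"
    by (rule indefinite_integral_continuous_1[OF i])
  moreover have "integral {0..r} (\<lambda>s. \<phi> (flow s x)) = \<Phi> x r" for r
    unfolding cum_rate_set
    using set_borel_integral_eq_integral(2)[OF rate_set_integrable[OF x, of "{0..r}" r]] by simp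
  ultimately show ?thesis by simp
qed

abbreviation \<Psi> :: "'a \<Rightarrow> real \<Rightarrow> real" where "\<Psi> x q \<equiv> cum_rate_inv \<pi> \<phi> x q"

lemma cum_rate_attains:
  assumes x: "x \<in> E" and q: "0 \<le> q"
  obtains t where "0 \<le> t" "\<Phi> x t = q"
proof -
  have "\<forall>\<^sub>F t in at_top. q \<le> \<Phi> x t \<and> 0 \<le> t"
    using rate_diverges[OF x] eventually_ge_at_top[of "0::real"]
    by (auto simp: filterlim_at_top eventually_conj_iff)
  then obtain b where b: "q \<le> \<Phi> x b" "0 \<le> b" by (auto simp: eventually_at_top_linorder)
  have "\<exists>t\<ge>0. t \<le> b \<and> \<Phi> x t = q"
    using b q cum_rate_neg[of 0 x] by (intro IVT' cum_rate_continuous[OF x]) auto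
  then show ?thesis using that by blast
qed

text \<open>
  The infimum is attained because the cumulative rate is continuous and unbounded.
\<close>

lemma cum_rate_inv_props:
  assumes x: "x \<in> E"
  shows "0 \<le> \<Psi> x q" and "q \<le> \<Phi> x (\<Psi> x q)"
    and "0 \<le> t \<Longrightarrow> q \<le> \<Phi> x t \<Longrightarrow> \<Psi> x q \<le> t"
proof -
  let ?A = "{t. 0 \<le> t \<and> q \<le> \<Phi> x t}"
  from cum_rate_attains[OF x, of "max 0 q"] obtain b where b: "0 \<le> b" "\<Phi> x b = max 0 q" by auto
  then have bA: "b \<in> ?A" by auto
  have bdd: "bdd_below ?A" by (rule bdd_belowI[of _ 0]) auto
  show "0 \<le> \<Psi> x q" unfolding cum_rate_inv_def using bA by (intro cInf_greatest) auto
  have lower: "\<Psi> x q \<le> t" if "0 \<le> t" "q \<le> \<Phi> x t" for t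
    unfolding cum_rate_inv_def using that bdd by (intro cInf_lower) auto
  show "0 \<le> t \<Longrightarrow> q \<le> \<Phi> x t \<Longrightarrow> \<Psi> x q \<le> t" by (rule lower)
  \<comment> \<open>The part up to \<open>b\<close> is closed and has the same infimum.\<close>
  let ?C = "{t \<in> {0..b}. q \<le> \<Phi> x t}"
  have cl: "closed ?C"
  proof -
    have "closed ({0..b} \<inter> \<Phi> x -` {q..})"
      by (intro continuous_closed_preimage cum_rate_continuous[OF x]) auto
    moreover have "{0..b} \<inter> \<Phi> x -` {q..} = ?C" by auto
    ultimately show ?thesis by simp
  qed
  have "Inf ?C \<in> ?C" using bA by (intro closed_contains_Inf cl) (auto intro: bdd_belowI[of _ 0])
  moreover have "Inf ?C = Inf ?A"
  proof (rule antisym)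
    show "Inf ?A \<le> Inf ?C" using bA bdd by (intro cInf_superset_mono) auto
    show "Inf ?C \<le> Inf ?A"
    proof (rule cInf_greatest)
      fix t assume t: "t \<in> ?A"
      show "Inf ?C \<le> t"
      proof (cases "t \<le> b")
        case True then show ?thesis using t by (intro cInf_lower) (auto intro: bdd_belowI[of _ 0])
      next
        case False
        have "Inf ?C \<le> b" using bA by (intro cInf_lower) (auto intro: bdd_belowI[of _ 0])
        then show ?thesis using False by simp
      qed
    qed (use bA in auto)
  qed
  ultimately show "q \<le> \<Phi> x (\<Psi> x q)" unfolding cum_rate_inv_def by auto
qed

lemma cum_rate_inv_le_iff:
  assumes x: "x \<in> E" and t: "0 \<le> t"
  shows "\<Psi> x q \<le> t \<longleftrightarrow> q \<le> \<Phi> x t"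
proof
  assume "\<Psi> x q \<le> t"
  then show "q \<le> \<Phi> x t" using cum_rate_inv_props(2)[OF x, of q] cum_rate_mono[OF x] by (blast intro: order_trans)
qed (rule cum_rate_inv_props(3)[OF x t])

lemma cum_rate_inv_less_iff:
  assumes x: "x \<in> E" and t: "0 \<le> t"
  shows "t < \<Psi> x q \<longleftrightarrow> \<Phi> x t < q"
  using cum_rate_inv_le_iff[OF assms] by (meson not_le)

lemma cum_rate_inv_pos: "x \<in> E \<Longrightarrow> 0 < q \<Longrightarrow> 0 < \<Psi> x q"
  using cum_rate_inv_le_iff[of x 0 q] cum_rate_neg[of 0 x] by force

lemma cum_rate_of_inv:
  assumes x: "x \<in> E" and q: "0 \<le> q" shows "\<Phi> x (\<Psi> x q) = q"
proof -
  from cum_rate_attains[OF x q] obtain t where t: "0 \<le> t" "\<Phi> x t = q" .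
  then have "\<Psi> x q \<le> t" using cum_rate_inv_props(3)[OF x] by simp
  then have "\<Phi> x (\<Psi> x q) \<le> q" using cum_rate_mono[OF x] t(2) by blast
  then show ?thesis using cum_rate_inv_props(2)[OF x, of q] by simp
qed

lemma cum_rate_inv_measurable[measurable (raw)]:
  assumes f[measurable]: "f \<in> borel_measurable N" and g[measurable]: "g \<in> N \<rightarrow>\<^sub>M M"
  shows "(\<lambda>z. \<Psi> (g z) (f z)) \<in> borel_measurable N"
proof (subst borel_measurable_iff_le, intro allI)
  fix a
  have gE: "g z \<in> E" if "z \<in> space N" for z using measurable_space[OF g that] by simp
  show "{z \<in> space N. \<Psi> (g z) (f z) \<le> a} \<in> sets N"
  proof (cases "0 \<le> a")
    case True
    have "{z \<in> space N. \<Psi> (g z) (f z) \<le> a} = {z \<in> space N. f z \<le> \<Phi> (g z) a}"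
      using cum_rate_inv_le_iff[OF gE True] by auto
    also have "\<dots> \<in> sets N" by measurable
    finally show ?thesis .
  next
    case False
    then have "{z \<in> space N. \<Psi> (g z) (f z) \<le> a} = {}"
      using cum_rate_inv_props(1)[OF gE] by (auto dest: order_trans)
    then show ?thesis by (simp only: sets.empty_sets)
  qed
qed

section \<open>The law of the waiting time\<close>

definition rate_measure :: "'a \<Rightarrow> real measure" where
  "rate_measure x = density lborel (\<lambda>s. indicator {0..} s * ennreal (\<phi> (flow s x)))"

lemma rate_measure_lessThan:
  assumes x: "x \<in> E"
  shows "emeasure (rate_measure x) {s. 0 \<le> s \<and> \<Phi> x s < q} = ennreal q"
proof (cases "0 \<le> q")
  case True
  have eq: "0 \<le> s \<and> \<Phi> x s < q \<longleftrightarrow> 0 \<le> s \<and> s < \<Psi> x q" for s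
    using cum_rate_inv_less_iff[OF x, of s q] by blast
  have "emeasure (rate_measure x) {s. 0 \<le> s \<and> s < \<Psi> x q}
     = (\<integral>\<^sup>+s. indicator {0..} s * ennreal (\<phi> (flow s x)) * indicator {s. 0 \<le> s \<and> s < \<Psi> x q} s \<partial>lborel)"
    unfolding rate_measure_def using x by (subst emeasure_density) auto
  also have "\<dots> = (\<integral>\<^sup>+s. indicator {0..\<Psi> x q} s * ennreal (\<phi> (flow s x)) \<partial>lborel)"
  proof (rule nn_integral_cong_AE)
    show "AE s in lborel. indicator {0..} s * ennreal (\<phi> (flow s x)) * indicator {s. 0 \<le> s \<and> s < \<Psi> x q} s
       = indicator {0..\<Psi> x q} s * ennreal (\<phi> (flow s x))"
      using AE_lborel_singleton[of "\<Psi> x q"] by eventually_elim (auto simp: indicator_def)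
  qed
  also have "\<dots> = ennreal q"
    unfolding cum_rate_nn_integral[OF x] cum_rate_of_inv[OF x True] ..
  finally show ?thesis unfolding eq .
next
  case False
  then have "{s. 0 \<le> s \<and> \<Phi> x s < q} = {}" using cum_rate_nonneg[OF x] by (auto simp: not_less intro: order_trans[of q 0])
  then show ?thesis using False by (simp only: emeasure_empty) (simp add: ennreal_neg)
qed

text \<open>
  The cumulative rate transports the measure \<open>\<phi>(\<pi>\<^sub>s x) ds\<close> to Lebesgue measure on the half-line:
  the preimage of \<open>[0, q)\<close> is \<open>[0, \<Psi> x q)\<close>, whose mass is \<open>\<Phi> x (\<Psi> x q) = q\<close>. This replaces the
  change of variables, for which the cumulative rate need not be differentiable.
\<close>

lemma rate_measure_distr:
  assumes x: "x \<in> E"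
  shows "distr (rate_measure x) borel (\<Phi> x) = density lborel (indicator {0..})"
proof (rule measure_eqI_generator_eq[where E="range lessThan" and A="\<lambda>i. {..<real i}" and \<Omega>=UNIV])
  have m: "\<Phi> x \<in> borel_measurable (rate_measure x)"
    unfolding rate_measure_def using in_space_M[OF x] by measurable
  have ae: "AE s in rate_measure x. 0 \<le> s"
    unfolding rate_measure_def using x by (subst AE_density) (auto simp: indicator_def)
  have 1: "emeasure (distr (rate_measure x) borel (\<Phi> x)) {..<q} = ennreal q" for q
  proof -
    have "emeasure (distr (rate_measure x) borel (\<Phi> x)) {..<q} = emeasure (rate_measure x) {s \<in> space (rate_measure x). \<Phi> x s < q}"
      using m by (subst emeasure_distr) (auto intro!: arg_cong[where f="emeasure _"])
    also have "\<dots> = emeasure (rate_measure x) {s. 0 \<le> s \<and> \<Phi> x s < q}"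
    proof (rule emeasure_eq_AE)
      show "AE s in rate_measure x. (s \<in> {s \<in> space (rate_measure x). \<Phi> x s < q}) = (s \<in> {s. 0 \<le> s \<and> \<Phi> x s < q})"
        using ae by eventually_elim (simp add: rate_measure_def)
      show "{s \<in> space (rate_measure x). \<Phi> x s < q} \<in> sets (rate_measure x)" using m by measurable
      show "{s. 0 \<le> s \<and> \<Phi> x s < q} \<in> sets (rate_measure x)"
        unfolding rate_measure_def using x by simp
    qed
    also have "\<dots> = ennreal q" by (rule rate_measure_lessThan[OF x])
    finally show ?thesis .
  qed
  have 2: "emeasure (density lborel (indicator {0..})) {..<q} = ennreal q" for q :: real
  proof -
    have "emeasure (density lborel (indicator {0..})) {..<q} = (\<integral>\<^sup>+s. indicator {0..} s * indicator {..<q} s \<partial>lborel)"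
      by (subst emeasure_density) auto
    also have "\<dots> = (\<integral>\<^sup>+s. indicator {0..<q} s \<partial>lborel)"
      by (rule nn_integral_cong) (auto simp: indicator_def)
    also have "\<dots> = ennreal q" by (cases "0 \<le> q") (simp_all add: ennreal_neg)
    finally show ?thesis .
  qed
  show "emeasure (distr (rate_measure x) borel (\<Phi> x)) X = emeasure (density lborel (indicator {0..})) X"
    if "X \<in> range lessThan" for X using that 1 2 by auto
  show "emeasure (distr (rate_measure x) borel (\<Phi> x)) {..<real i} \<noteq> \<infinity>" for i using 1 by simp
  show "Int_stable (range lessThan :: real set set)"
  proof -
    have "{..<a} \<inter> {..<b} = {..<min a b}" for a b :: real by auto
    then show ?thesis by (auto simp: Int_stable_def)
  qed
  show "sets (distr (rate_measure x) borel (\<Phi> x)) = sigma_sets UNIV (range lessThan)"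
    "sets (density lborel (indicator {0..})) = sigma_sets UNIV (range (lessThan :: real \<Rightarrow> _))"
    by (simp_all add: borel_Iio)
  show "(\<Union>i. {..<real i}) = UNIV" using reals_Archimedean2 by auto
qed auto

definition jump_density :: "'a \<Rightarrow> real \<Rightarrow> ennreal" where
  "jump_density x s = indicator {0..} s * ennreal (\<phi> (flow s x) * exp (- \<Phi> x s))"

lemma jump_density_measurable[measurable (raw)]:
  assumes [measurable]: "f \<in> borel_measurable N" "g \<in> N \<rightarrow>\<^sub>M M"
  shows "(\<lambda>z. jump_density (g z) (f z)) \<in> borel_measurable N"
  unfolding jump_density_def by measurable

text \<open>
  Both sides have the same tails. The tail of the density is \<open>\<integral> exp (-\<Phi> x s)\<close> over the times
  after \<open>a\<close> with respect to \<open>\<phi>(\<pi>\<^sub>s x) ds\<close>; up to a null set these are the times with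
  \<open>\<Phi> x s > \<Phi> x a\<close>, and transport by \<open>\<Phi> x\<close> makes the integral the tail of the exponential law.
\<close>

theorem waiting_time_law:
  assumes x: "x \<in> E"
  shows "distr std_exponential borel (\<Psi> x) = density lborel (jump_density x)"
proof (rule measure_eqI_lessThan)
  interpret e: prob_space std_exponential by (rule prob_space_std_exponential)
  have m\<Psi>: "\<Psi> x \<in> borel_measurable std_exponential"
    using in_space_M[OF x] by measurable
  have m\<Phi>[measurable]: "\<Phi> x \<in> borel_measurable borel"
    using in_space_M[OF x] by measurable
  have dens: "density lborel (jump_density x) = density (rate_measure x) (\<lambda>s. ennreal (exp (- \<Phi> x s)))"
    unfolding rate_measure_def jump_density_def[abs_def] using x rate_nonneg flow_closed[OF x]
    by (subst density_density_eq) (auto simp: ennreal_mult' mult.assoc intro!: arg_cong[where f="density _"])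
  have exp_dens: "std_exponential = density (density lborel (indicator {0..})) (\<lambda>q. ennreal (exp (- q)))"
    by (subst density_density_eq) (auto intro!: arg_cong[where f="density _"] simp: exponential_density_def indicator_def)
  have \<Phi>_int: "(\<integral>\<^sup>+s. f (\<Phi> x s) \<partial>rate_measure x) = (\<integral>\<^sup>+q. f q \<partial>density lborel (indicator {0..}))"
    if [measurable]: "f \<in> borel_measurable borel" for f :: "real \<Rightarrow> ennreal"
    unfolding rate_measure_distr[OF x, symmetric]
    by (subst nn_integral_distr) (auto simp: rate_measure_def)
  have null: "AE s in rate_measure x. \<Phi> x s \<noteq> c" for c
  proof -
    have "AE q in distr (rate_measure x) borel (\<Phi> x). q \<noteq> c"
      unfolding rate_measure_distr[OF x] using AE_lborel_singleton[of c] by (subst AE_density) auto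
    then show ?thesis by (subst (asm) AE_distr_iff) (auto simp: rate_measure_def)
  qed
  have ae0: "AE s in rate_measure x. 0 \<le> s"
    unfolding rate_measure_def using x by (subst AE_density) (auto simp: indicator_def)
  fix a
  show "emeasure (distr std_exponential borel (\<Psi> x)) {a<..} < \<infinity>"
  proof -
    interpret d: prob_space "distr std_exponential borel (\<Psi> x)" by (rule e.prob_space_distr[OF m\<Psi>])
    show ?thesis by (simp add: d.emeasure_eq_measure)
  qed
  have L: "emeasure (distr std_exponential borel (\<Psi> x)) {a<..} = emeasure std_exponential {q. a < \<Psi> x q}"
    using m\<Psi> by (subst emeasure_distr) (auto intro!: arg_cong[where f="emeasure _"])
  \<comment> \<open>For negative \<open>a\<close> the waiting time always exceeds \<open>a\<close>.\<close>
  define A where "A = (if 0 \<le> a then {\<Phi> x a<..} else UNIV)"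
  have "{q. a < \<Psi> x q} = A"
  proof (cases "0 \<le> a")
    case True
    then show ?thesis using cum_rate_inv_less_iff[OF x True] by (auto simp: A_def)
  next
    case False
    then have "a < \<Psi> x q" for q using cum_rate_inv_props(1)[OF x, of q] by linarith
    then show ?thesis using False by (simp add: A_def)
  qed
  have A: "A \<in> sets borel" by (simp add: A_def)
  have "emeasure (density lborel (jump_density x)) {a<..} = (\<integral>\<^sup>+s. ennreal (exp (- \<Phi> x s)) * indicator {a<..} s \<partial>rate_measure x)"
    unfolding dens by (subst emeasure_density) (auto simp: rate_measure_def)
  also have "\<dots> = (\<integral>\<^sup>+s. ennreal (exp (- \<Phi> x s)) * indicator A (\<Phi> x s) \<partial>rate_measure x)"
  proof (rule nn_integral_cong_AE)
    show "AE s in rate_measure x. ennreal (exp (- \<Phi> x s)) * indicator {a<..} s = ennreal (exp (- \<Phi> x s)) * indicator A (\<Phi> x s)"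
      using ae0 null[of "\<Phi> x a"]
    proof eventually_elim
      case (elim s)
      have "s \<in> {a<..} \<longleftrightarrow> \<Phi> x s \<in> A"
      proof (cases "0 \<le> a")
        case True
        have "a < s \<Longrightarrow> \<Phi> x a < \<Phi> x s" using cum_rate_mono[OF x, of a s] elim(2) by simp
        moreover have "\<Phi> x a < \<Phi> x s \<Longrightarrow> a < s" using cum_rate_mono[OF x, of s a] by (force simp: not_less[symmetric])
        ultimately show ?thesis using True by (auto simp: A_def)
      qed (use elim in \<open>simp add: A_def\<close>)
      then show ?case by (simp add: indicator_def)
    qed
  qed
  also have "\<dots> = (\<integral>\<^sup>+q. ennreal (exp (- q)) * indicator A q \<partial>density lborel (indicator {0..}))"
    by (intro \<Phi>_int borel_measurable_times_ennreal borel_measurable_indicator A) measurable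
  also have "\<dots> = emeasure std_exponential A"
    unfolding exp_dens using A by (subst emeasure_density) auto
  finally show "emeasure (distr std_exponential borel (\<Psi> x)) {a<..} = emeasure (density lborel (jump_density x)) {a<..}"
    unfolding L \<open>{q. a < \<Psi> x q} = A\<close> ..
qed auto

lemma jump_density_shift:
  assumes x: "x \<in> E" and s: "0 \<le> s" and r: "0 \<le> r"
  shows "jump_density x (s + r) = ennreal (exp (- \<Phi> x s)) * jump_density (flow s x) r"
  unfolding jump_density_def cum_rate_add[OF x s r] flow_flow[OF x s r] minus_add_distrib exp_add
  using s r by (simp add: ennreal_mult'[symmetric] mult_ac)

end

section \<open>The law of the first jump\<close>

context pdmp_construction
begin

text \<open>
  The function \<open>\<kappa>\<close> is specified on the unit interval only; clamping its first argument gives a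
  map that is measurable on the whole line and agrees with \<open>\<kappa>\<close> on the values of the uniform
  variables.
\<close>

definition post :: "real \<Rightarrow> 'a \<Rightarrow> 'a" where "post q x = \<kappa> (max 0 (min 1 q)) x"

lemma post_measurable_pair: "(\<lambda>(q, x). post q x) \<in> borel \<Otimes>\<^sub>M M \<rightarrow>\<^sub>M M"
proof -
  have 1: "(\<lambda>q. max 0 (min 1 q)) \<in> borel \<rightarrow>\<^sub>M (borel_on {0..1} :: real measure)"
    by (rule measurable_restrict_space2) auto
  have [measurable]: "(\<lambda>p. max 0 (min 1 (fst p))) \<in> borel \<Otimes>\<^sub>M M \<rightarrow>\<^sub>M (borel_on {0..1} :: real measure)"
    by (rule measurable_compose[OF measurable_fst 1])
  have "(\<lambda>p. (max 0 (min 1 (fst p :: real)), snd p)) \<in> borel \<Otimes>\<^sub>M M \<rightarrow>\<^sub>M borel_on {0..1} \<Otimes>\<^sub>M M"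
    by measurable
  from measurable_compose[OF this kappa_measurable] show ?thesis
    by (simp add: post_def case_prod_beta)
qed

lemma post_measurable[measurable (raw)]:
  assumes "f \<in> N \<rightarrow>\<^sub>M borel" "g \<in> N \<rightarrow>\<^sub>M M"
  shows "(\<lambda>z. post (f z) (g z)) \<in> N \<rightarrow>\<^sub>M M"
  using measurable_compose[OF measurable_Pair[OF assms] post_measurable_pair] by simp

lemma post_in: "x \<in> E \<Longrightarrow> post q x \<in> E"
  using measurable_space[OF post_measurable_pair, of "(q, x)"] by (simp add: space_pair_measure)

definition jump_operator :: "('a \<Rightarrow> ennreal) \<Rightarrow> 'a \<Rightarrow> ennreal" where
  "jump_operator f x = (\<integral>\<^sup>+q. f (post q x) \<partial>std_uniform)"

lemma jump_operator_measurable[measurable (raw)]: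
  assumes "case_prod f \<in> borel_measurable (N \<Otimes>\<^sub>M M)" "g \<in> N \<rightarrow>\<^sub>M M"
  shows "(\<lambda>z. jump_operator (f z) (g z)) \<in> borel_measurable N"
proof -
  interpret u: prob_space std_uniform by (rule prob_space_std_uniform)
  note [measurable] = assms
  show ?thesis unfolding jump_operator_def by measurable
qed

lemma kernel_operator_jump: "kernel_operator M 1 jump_operator"
  unfolding kernel_operator_def
proof (intro conjI ballI)
  interpret u: prob_space std_uniform by (rule prob_space_std_uniform)
  show "jump_operator f \<in> borel_measurable M" if [measurable]: "f \<in> borel_measurable M" for f
    by measurable
  fix x assume x: "x \<in> space M"
  have [measurable]: "(\<lambda>q. post q x) \<in> std_uniform \<rightarrow>\<^sub>M M" using x by measurable
  show "integral_functional M (\<lambda>f. jump_operator f x)"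
    unfolding integral_functional_def jump_operator_def
    by (intro exI[of _ "distr std_uniform M (\<lambda>q. post q x)"]) (auto simp: nn_integral_distr)
  show "jump_operator (\<lambda>_. 1) x \<le> ennreal 1"
    using u.emeasure_space_1 by (simp add: jump_operator_def)
qed simp

lemma jump_operator_indicator:
  assumes x: "x \<in> E" and B: "B \<in> sets M"
  shows "jump_operator (indicator B) x = ennreal (J x B)"
proof -
  have m: "{q. post q x \<in> B} \<in> sets borel"
  proof -
    have "(\<lambda>q. post q x) \<in> borel \<rightarrow>\<^sub>M M" using in_space_M[OF x] by measurable
    from measurable_sets[OF this B] show ?thesis by (simp add: vimage_def)
  qed
  have "jump_operator (indicator B) x = emeasure std_uniform {q. post q x \<in> B}"
  proof -
    have "jump_operator (indicator B) x = (\<integral>\<^sup>+q. indicator {q. post q x \<in> B} q \<partial>std_uniform)"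
      unfolding jump_operator_def by (rule nn_integral_cong) (simp add: indicator_def)
    then show ?thesis using m by simp
  qed
  also have "\<dots> = emeasure lborel ({0<..<1} \<inter> {q. post q x \<in> B})"
    using m by (subst emeasure_uniform_measure) (auto simp: divide_ennreal_def)
  also have "\<dots> = emeasure lborel {q \<in> {0..1}. \<kappa> q x \<in> B}"
  proof (rule emeasure_eq_AE)
    have eq: "{q \<in> {0..1}. \<kappa> q x \<in> B} = {0..1} \<inter> {q. post q x \<in> B}" by (auto simp: post_def)
    show "{q \<in> {0..1}. \<kappa> q x \<in> B} \<in> sets lborel" unfolding eq using m by auto
    show "AE q in lborel. (q \<in> {0<..<1} \<inter> {q. post q x \<in> B}) = (q \<in> {q \<in> {0..1}. \<kappa> q x \<in> B})"
      unfolding eq using AE_lborel_singleton[of 0] AE_lborel_singleton[of 1] by eventually_elim auto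
    show "{0<..<1} \<inter> {q. post q x \<in> B} \<in> sets lborel" using m by auto
  qed
  also have "\<dots> = ennreal (measure lborel {q \<in> {0..1}. \<kappa> q x \<in> B})"
  proof (rule emeasure_eq_ennreal_measure)
    have "emeasure lborel {q \<in> {0..1}. \<kappa> q x \<in> B} \<le> emeasure lborel {0..1::real}"
      by (rule emeasure_mono) auto
    also have "\<dots> < \<top>" by simp
    finally show "emeasure lborel {q \<in> {0..1}. \<kappa> q x \<in> B} \<noteq> \<top>" by simp
  qed
  finally show ?thesis using kappa_kernel[OF x B] by simp
qed

definition jump_law :: "'a \<Rightarrow> (real \<times> 'a) measure" where
  "jump_law x = distr (std_exponential \<Otimes>\<^sub>M std_uniform) (borel \<Otimes>\<^sub>M M)
     (\<lambda>(e, q). (\<Psi> x e, post q (flow (\<Psi> x e) x)))"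

lemma jump_map_measurable[measurable]:
  assumes x: "x \<in> E"
  shows "(\<lambda>(e, q). (\<Psi> x e, post q (flow (\<Psi> x e) x))) \<in> std_exponential \<Otimes>\<^sub>M std_uniform \<rightarrow>\<^sub>M borel \<Otimes>\<^sub>M M"
  using in_space_M[OF x] by measurable

lemma prob_space_drivers: "prob_space (std_exponential \<Otimes>\<^sub>M std_uniform)"
proof -
  interpret e: prob_space std_exponential by (rule prob_space_std_exponential)
  interpret u: prob_space std_uniform by (rule prob_space_std_uniform)
  interpret pair_prob_space std_exponential std_uniform ..
  show ?thesis by (rule prob_space_axioms)
qed

lemma sets_jump_law[measurable_cong]: "sets (jump_law x) = sets (borel \<Otimes>\<^sub>M M)"
  by (simp add: jump_law_def)

lemma prob_space_jump_law: "x \<in> E \<Longrightarrow> prob_space (jump_law x)"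
  unfolding jump_law_def by (intro prob_space.prob_space_distr prob_space_drivers jump_map_measurable)

lemma jump_law_measurable: "jump_law \<in> M \<rightarrow>\<^sub>M subprob_algebra (borel \<Otimes>\<^sub>M M)"
  unfolding jump_law_def[abs_def]
proof (rule measurable_distr2)
  show "(\<lambda>(x, y). (case y of (e, q) \<Rightarrow> (\<Psi> x e, post q (flow (\<Psi> x e) x)))) \<in>
      M \<Otimes>\<^sub>M (std_exponential \<Otimes>\<^sub>M std_uniform) \<rightarrow>\<^sub>M borel \<Otimes>\<^sub>M M"
    by measurable
  show "(\<lambda>x. std_exponential \<Otimes>\<^sub>M std_uniform) \<in> M \<rightarrow>\<^sub>M subprob_algebra (std_exponential \<Otimes>\<^sub>M std_uniform)"
    using prob_space_imp_subprob_space[OF prob_space_drivers]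
    by (intro measurable_const) (simp add: space_subprob_algebra)
qed

lemma jump_law_nn_integral:
  assumes x: "x \<in> E" and h[measurable]: "h \<in> borel_measurable (borel \<Otimes>\<^sub>M M)"
  shows "(\<integral>\<^sup>+z. h z \<partial>jump_law x) = (\<integral>\<^sup>+e. \<integral>\<^sup>+q. h (\<Psi> x e, post q (flow (\<Psi> x e) x)) \<partial>std_uniform \<partial>std_exponential)"
    and "(\<integral>\<^sup>+z. h z \<partial>jump_law x) = (\<integral>\<^sup>+s. jump_density x s * jump_operator (\<lambda>y. h (s, y)) (flow s x) \<partial>lborel)"
proof -
  interpret u: prob_space std_uniform by (rule prob_space_std_uniform)
  have [measurable]: "(\<lambda>e. x) \<in> N \<rightarrow>\<^sub>M M" for N using x by simp
  have [measurable]: "(\<lambda>z. h (s, z)) \<in> borel_measurable M" for s by measurable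
  have "(\<integral>\<^sup>+z. h z \<partial>jump_law x) = (\<integral>\<^sup>+p. h (case p of (e, q) \<Rightarrow> (\<Psi> x e, post q (flow (\<Psi> x e) x))) \<partial>(std_exponential \<Otimes>\<^sub>M std_uniform))"
    unfolding jump_law_def by (rule nn_integral_distr[OF jump_map_measurable[OF x]]) measurable
  also have "\<dots> = (\<integral>\<^sup>+e. \<integral>\<^sup>+q. h (\<Psi> x e, post q (flow (\<Psi> x e) x)) \<partial>std_uniform \<partial>std_exponential)"
    by (subst u.nn_integral_fst[symmetric]) auto
  finally show 1: "(\<integral>\<^sup>+z. h z \<partial>jump_law x) = (\<integral>\<^sup>+e. \<integral>\<^sup>+q. h (\<Psi> x e, post q (flow (\<Psi> x e) x)) \<partial>std_uniform \<partial>std_exponential)" .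
  have gm[measurable]: "(\<lambda>s. jump_operator (\<lambda>y. h (s, y)) (flow s x)) \<in> borel_measurable borel"
    by measurable
  have "(\<integral>\<^sup>+e. \<integral>\<^sup>+q. h (\<Psi> x e, post q (flow (\<Psi> x e) x)) \<partial>std_uniform \<partial>std_exponential)
     = (\<integral>\<^sup>+e. jump_operator (\<lambda>y. h (\<Psi> x e, y)) (flow (\<Psi> x e) x) \<partial>std_exponential)"
    by (simp add: jump_operator_def)
  also have "\<dots> = (\<integral>\<^sup>+s. jump_operator (\<lambda>y. h (s, y)) (flow s x) \<partial>distr std_exponential borel (\<Psi> x))"
    by (rule nn_integral_distr[symmetric]) measurable
  also have "\<dots> = (\<integral>\<^sup>+s. jump_density x s * jump_operator (\<lambda>y. h (s, y)) (flow s x) \<partial>lborel)"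
    unfolding waiting_time_law[OF x] by (rule nn_integral_density) measurable
  finally show "(\<integral>\<^sup>+z. h z \<partial>jump_law x) = (\<integral>\<^sup>+s. jump_density x s * jump_operator (\<lambda>y. h (s, y)) (flow s x) \<partial>lborel)"
    using 1 by simp
qed

text \<open>
  Memorylessness: on the event that no jump occurs up to time \<open>s\<close>, the first jump is that of the
  process restarted from \<open>\<pi>\<^sub>s x\<close>.
\<close>

lemma jump_law_shift:
  assumes x: "x \<in> E" and s: "0 \<le> s" and h[measurable]: "h \<in> borel_measurable (borel \<Otimes>\<^sub>M M)"
  shows "(\<integral>\<^sup>+z. indicator {s<..} (fst z) * h z \<partial>jump_law x)
    = ennreal (exp (- \<Phi> x s)) * (\<integral>\<^sup>+z. h (s + fst z, snd z) \<partial>jump_law (flow s x))"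
proof -
  have [measurable]: "(\<lambda>e. x) \<in> N \<rightarrow>\<^sub>M M" for N using x by simp
  have fx: "flow s x \<in> E" using x by (rule flow_closed)
  then have [measurable]: "(\<lambda>e. flow s x) \<in> N \<rightarrow>\<^sub>M M" for N by simp
  let ?H = "\<lambda>r. jump_operator (\<lambda>y. h (r, y)) (flow r x)"
  have "(\<integral>\<^sup>+z. indicator {s<..} (fst z) * h z \<partial>jump_law x)
    = (\<integral>\<^sup>+r. jump_density x r * jump_operator (\<lambda>y. indicator {s<..} r * h (r, y)) (flow r x) \<partial>lborel)"
    by (subst jump_law_nn_integral(2)[OF x]) simp_all
  also have "\<dots> = (\<integral>\<^sup>+r. jump_density x r * (indicator {s<..} r * ?H r) \<partial>lborel)"
    using flow_closed[OF x]
    by (intro nn_integral_cong arg_cong2[where f="(*)"] refl kernel_operator_cmult[OF kernel_operator_jump]) auto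
  also have "\<dots> = (\<integral>\<^sup>+r. jump_density x (s + r) * (indicator {s<..} (s + r) * ?H (s + r)) \<partial>lborel)"
    by (subst nn_integral_real_affine[where c=1 and t=s]) simp_all
  also have "\<dots> = (\<integral>\<^sup>+r. ennreal (exp (- \<Phi> x s)) * (jump_density (flow s x) r * jump_operator (\<lambda>y. h (s + r, y)) (flow r (flow s x))) \<partial>lborel)"
  proof (rule nn_integral_cong_AE)
    \<comment> \<open>The two sides may differ only at \<open>r = 0\<close>, a jump exactly at time \<open>s\<close>.\<close>
    show "AE r in lborel. jump_density x (s + r) * (indicator {s<..} (s + r) * ?H (s + r))
      = ennreal (exp (- \<Phi> x s)) * (jump_density (flow s x) r * jump_operator (\<lambda>y. h (s + r, y)) (flow r (flow s x)))"
      using AE_lborel_singleton[of 0]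
    proof eventually_elim
      case (elim r)
      show ?case
      proof (cases "0 < r")
        case True
        then show ?thesis using jump_density_shift[OF x s, of r] flow_flow[OF x s, of r] by (simp add: mult.assoc)
      next
        case False
        then have "r < 0" using elim by simp
        then show ?thesis by (simp add: jump_density_def)
      qed
    qed
  qed
  also have "\<dots> = ennreal (exp (- \<Phi> x s)) * (\<integral>\<^sup>+r. jump_density (flow s x) r * jump_operator (\<lambda>y. h (s + r, y)) (flow r (flow s x)) \<partial>lborel)"
    by (rule nn_integral_cmult) measurable
  also have "(\<integral>\<^sup>+r. jump_density (flow s x) r * jump_operator (\<lambda>y. h (s + r, y)) (flow r (flow s x)) \<partial>lborel)
    = (\<integral>\<^sup>+z. h (s + fst z, snd z) \<partial>jump_law (flow s x))"
    by (subst jump_law_nn_integral(2)[OF fx]) simp_all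
  finally show ?thesis .
qed

text \<open>
  Motion along the flow, weighted by the probability that no jump has occurred yet.
\<close>

definition drift :: "real \<Rightarrow> ('a \<Rightarrow> ennreal) \<Rightarrow> 'a \<Rightarrow> ennreal" where
  "drift t f x = ennreal (exp (- \<Phi> x t)) * f (flow t x)"

lemma drift_measurable[measurable (raw)]:
  assumes [measurable]: "f \<in> borel_measurable M" "t \<in> borel_measurable N" "g \<in> N \<rightarrow>\<^sub>M M"
  shows "(\<lambda>z. drift (t z) f (g z)) \<in> borel_measurable N"
  unfolding drift_def by measurable

lemma drift_mono: "x \<in> E \<Longrightarrow> (\<And>y. y \<in> E \<Longrightarrow> f y \<le> g y) \<Longrightarrow> drift t f x \<le> drift t g x"
  unfolding drift_def by (intro mult_left_mono) (auto simp: flow_closed)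

lemma drift_add_time:
  assumes "x \<in> E" "0 \<le> s" "0 \<le> t"
  shows "drift (s + t) f x = drift s (drift t f) x"
  unfolding drift_def cum_rate_add[OF assms] flow_flow[OF assms] minus_add_distrib exp_add
  by (simp add: ennreal_mult' mult.assoc)

lemma kernel_operator_drift: "kernel_operator M 1 (drift t)"
  unfolding kernel_operator_def
proof (intro conjI ballI)
  fix x assume x: "x \<in> space M"
  show "integral_functional M (\<lambda>f. drift t f x)"
    unfolding drift_def using x flow_closed by (intro integral_functional_point) simp
  show "drift t (\<lambda>_. 1) x \<le> ennreal 1"
    using cum_rate_nonneg x by (simp add: drift_def)
qed auto

lemma kernel_family_drift: "kernel_family M drift"
  unfolding kernel_family_def
proof (intro conjI ballI allI impI kernel_operator_drift)
  fix f :: "'a \<Rightarrow> ennreal" assume [measurable]: "f \<in> borel_measurable M"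
  show "(\<lambda>(t, x). indicator {0..} t * drift t f x) \<in> borel_measurable (borel \<Otimes>\<^sub>M M)"
    by measurable
qed

lemma jump_law_integral_measurable:
  assumes "case_prod h \<in> borel_measurable (N \<Otimes>\<^sub>M (borel \<Otimes>\<^sub>M M))" and g: "g \<in> N \<rightarrow>\<^sub>M M"
  shows "(\<lambda>z. \<integral>\<^sup>+w. h z w \<partial>jump_law (g z)) \<in> borel_measurable N"
  by (rule nn_integral_measurable_subprob_algebra2[OF assms(1)])
     (rule measurable_compose[OF g jump_law_measurable])

lemma space_jump_law: "space (jump_law x) = UNIV \<times> E"
  by (simp add: jump_law_def space_pair_measure)

lemma jump_law_time_nonneg: 
  assumes x: "x \<in> E" shows "AE z in jump_law x. 0 \<le> fst z"
  unfolding jump_law_def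
  by (subst AE_distr_iff[OF jump_map_measurable[OF x]])
     (auto simp: cum_rate_inv_props(1)[OF x] intro!: AE_I2)

lemma jump_law_time_pos:
  assumes x: "x \<in> E" shows "AE z in jump_law x. 0 < fst z"
proof -
  interpret p: prob_space "jump_law x" by (rule prob_space_jump_law[OF x])
  have "emeasure (jump_law x) {z \<in> space (jump_law x). 0 < fst z} = 1"
  proof -
    have "{z \<in> space (borel \<Otimes>\<^sub>M M). (0::real) < fst z} \<in> sets (borel \<Otimes>\<^sub>M M)" by measurable
    then have [measurable]: "{z \<in> UNIV \<times> E. (0::real) < fst z} \<in> sets (jump_law x)"
      by (simp add: sets_jump_law space_pair_measure)
    have "emeasure (jump_law x) {z \<in> space (jump_law x). 0 < fst z} = (\<integral>\<^sup>+z. indicator {0<..} (fst z) * 1 \<partial>jump_law x)"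
    proof -
      have "(\<integral>\<^sup>+z. indicator {0<..} (fst z) * 1 \<partial>jump_law x) = (\<integral>\<^sup>+z. indicator {z \<in> UNIV \<times> E. 0 < fst z} z \<partial>jump_law x)"
        by (rule nn_integral_cong) (auto simp: indicator_def space_jump_law)
      then show ?thesis by (simp add: space_jump_law)
    qed
    also have "\<dots> = 1"
      using prob_space.emeasure_space_1[OF prob_space_jump_law[OF flow_closed[OF x]]] cum_rate_neg[of 0 x]
      by (subst jump_law_shift[OF x]) simp_all
    finally show ?thesis .
  qed
  then have "AE z in jump_law x. z \<in> {z \<in> space (jump_law x). 0 < fst z}"
    by (intro p.AE_prob_1) (simp add: p.emeasure_eq_measure)
  then show ?thesis by eventually_elim simp
qed

lemma jump_law_survival:
  assumes x: "x \<in> E" and t: "0 \<le> t"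
  shows "ennreal (exp (- \<Phi> x t)) + (\<integral>\<^sup>+z. indicator {..t} (fst z) \<partial>jump_law x) = 1"
proof -
  interpret p: prob_space "jump_law x" by (rule prob_space_jump_law[OF x])
  have "ennreal (exp (- \<Phi> x t)) = (\<integral>\<^sup>+z. indicator {t<..} (fst z) * 1 \<partial>jump_law x)"
    using prob_space.emeasure_space_1[OF prob_space_jump_law[OF flow_closed[OF x]]]
    by (subst jump_law_shift[OF x t]) simp_all
  then have "ennreal (exp (- \<Phi> x t)) + (\<integral>\<^sup>+z. indicator {..t} (fst z) \<partial>jump_law x)
    = (\<integral>\<^sup>+z. indicator {t<..} (fst z) + indicator {..t} (fst z) \<partial>jump_law x)"
    by (subst nn_integral_add) simp_all
  also have "\<dots> = (\<integral>\<^sup>+z. 1 \<partial>jump_law x)" by (intro nn_integral_cong) (auto simp: indicator_def)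
  also have "\<dots> = 1" using p.emeasure_space_1 by simp
  finally show ?thesis .
qed

text \<open>
  The same kernel \<open>drift\<close> describes the semigroup \<open>S\<close>, so this form of the law of the first jump
  links the process to the resolvent of \<open>A\<close>.
\<close>

lemma jump_law_drift:
  assumes x: "x \<in> E" and h[measurable]: "h \<in> borel_measurable (borel \<Otimes>\<^sub>M M)"
  shows "(\<integral>\<^sup>+z. h z \<partial>jump_law x)
    = (\<integral>\<^sup>+s. indicator {0..} s * drift s (\<lambda>y. ennreal (\<phi> y) * jump_operator (\<lambda>w. h (s, w)) y) x \<partial>lborel)"
  unfolding jump_law_nn_integral(2)[OF x h] jump_density_def drift_def
  using rate_nonneg[OF flow_closed[OF x]]
  by (intro nn_integral_cong) (simp add: ennreal_mult' mult_ac)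

section \<open>The transition kernels of the minimal process\<close>

text \<open>
  The expectation of \<open>F (t - t\<^sub>1) \<xi>\<^sub>1\<close> on the event \<open>t\<^sub>1 \<le> t\<close>.
\<close>

definition after_jump :: "(real \<Rightarrow> 'a \<Rightarrow> ennreal) \<Rightarrow> real \<Rightarrow> 'a \<Rightarrow> ennreal" where
  "after_jump F t x = (\<integral>\<^sup>+z. indicator {..t} (fst z) * F (t - fst z) (snd z) \<partial>jump_law x)"

text \<open>
  The expectation of \<open>f (X(t))\<close> on the event of exactly \<open>n\<close> jumps up to time \<open>t\<close>, by recursion
  on the first jump.
\<close>

primrec jump_part :: "nat \<Rightarrow> real \<Rightarrow> ('a \<Rightarrow> ennreal) \<Rightarrow> 'a \<Rightarrow> ennreal" where
  "jump_part 0 t f x = drift t f x"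
| "jump_part (Suc n) t f x = after_jump (\<lambda>s. jump_part n s f) t x"

definition pdmp_kernel :: "real \<Rightarrow> ('a \<Rightarrow> ennreal) \<Rightarrow> 'a \<Rightarrow> ennreal" where
  "pdmp_kernel t f x = (\<Sum>n. jump_part n t f x)"

text \<open>
  The expectation of \<open>f (X(t))\<close> on the event of fewer than \<open>N\<close> jumps up to time \<open>t\<close>.
\<close>

definition truncated_kernel :: "nat \<Rightarrow> real \<Rightarrow> ('a \<Rightarrow> ennreal) \<Rightarrow> 'a \<Rightarrow> ennreal" where
  "truncated_kernel N t f x = (\<Sum>n<N. jump_part n t f x)"

lemma after_jump_measurable:
  assumes F: "case_prod F \<in> borel_measurable (borel \<Otimes>\<^sub>M M)"
  shows "case_prod (after_jump F) \<in> borel_measurable (borel \<Otimes>\<^sub>M M)"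
proof -
  note [measurable] = F
  have [measurable]: "(\<lambda>z. F (f z) (g z)) \<in> borel_measurable N"
    if "f \<in> borel_measurable N" "g \<in> N \<rightarrow>\<^sub>M M" for f g and N :: "'d measure"
    using measurable_compose[OF measurable_Pair[OF that] F] by simp
  have "(\<lambda>p. \<integral>\<^sup>+z. indicator {..fst p} (fst z) * F (fst p - fst z) (snd z) \<partial>jump_law (snd p))
    \<in> borel_measurable (borel \<Otimes>\<^sub>M M)"
  proof (rule jump_law_integral_measurable)
    have "(\<lambda>(p, z). (if fst z \<le> fst p then F (fst p - fst z) (snd z) else 0))
      \<in> borel_measurable ((borel \<Otimes>\<^sub>M M) \<Otimes>\<^sub>M borel \<Otimes>\<^sub>M M)" by measurable
    also have "(\<lambda>(p, z). (if fst z \<le> fst p then F (fst p - fst z) (snd z) else 0))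
       = (\<lambda>(p, z). indicator {..fst p} (fst z) * F (fst p - fst z) (snd z))"
      by (auto simp: indicator_def)
    finally show "(\<lambda>(p, z). indicator {..fst p} (fst z) * F (fst p - fst z) (snd z))
      \<in> borel_measurable ((borel \<Otimes>\<^sub>M M) \<Otimes>\<^sub>M borel \<Otimes>\<^sub>M M)" .
  qed measurable
  then show ?thesis unfolding after_jump_def[abs_def] by (simp add: case_prod_beta')
qed

lemma after_jump_integrand_measurable:
  fixes F :: "real \<Rightarrow> 'a \<Rightarrow> ennreal"
  assumes F: "case_prod F \<in> borel_measurable (borel \<Otimes>\<^sub>M M)"
  shows "(\<lambda>z. indicator {..t} (fst z) * F (t - fst z) (snd z)) \<in> borel_measurable (borel \<Otimes>\<^sub>M M)"
proof -
  have [measurable]: "(\<lambda>z. F (t - fst z) (snd z)) \<in> borel_measurable (borel \<Otimes>\<^sub>M M)"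
  proof -
    have "(\<lambda>z. (t - fst z, snd z)) \<in> (borel \<Otimes>\<^sub>M M) \<rightarrow>\<^sub>M (borel \<Otimes>\<^sub>M M)" by measurable
    from measurable_compose[OF this F] show ?thesis by simp
  qed
  show ?thesis by measurable
qed

lemma jump_part_measurable:
  assumes [measurable]: "f \<in> borel_measurable M"
  shows "(\<lambda>(t, x). jump_part n t f x) \<in> borel_measurable (borel \<Otimes>\<^sub>M M)"
proof (induction n)
  case 0 then show ?case by simp
next
  case (Suc n)
  from after_jump_measurable[OF Suc] show ?case by simp
qed

lemma pdmp_kernel_measurable:
  assumes [measurable]: "f \<in> borel_measurable M"
  shows "(\<lambda>(t, x). pdmp_kernel t f x) \<in> borel_measurable (borel \<Otimes>\<^sub>M M)"
proof -
  note [measurable] = jump_part_measurable[OF assms]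
  have "(\<lambda>p. \<Sum>n. (case p of (t, x) \<Rightarrow> jump_part n t f x)) \<in> borel_measurable (borel \<Otimes>\<^sub>M M)" by measurable
  then show ?thesis unfolding pdmp_kernel_def by (simp add: case_prod_beta')
qed

lemma truncated_kernel_measurable:
  assumes [measurable]: "f \<in> borel_measurable M"
  shows "(\<lambda>(t, x). truncated_kernel N t f x) \<in> borel_measurable (borel \<Otimes>\<^sub>M M)"
proof -
  note [measurable] = jump_part_measurable[OF assms]
  have "(\<lambda>p. \<Sum>n<N. (case p of (t, x) \<Rightarrow> jump_part n t f x)) \<in> borel_measurable (borel \<Otimes>\<^sub>M M)" by measurable
  then show ?thesis unfolding truncated_kernel_def by (simp add: case_prod_beta')
qed

lemma joint_measurable_section:
  assumes "case_prod F \<in> borel_measurable (borel \<Otimes>\<^sub>M M)"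
  shows "F t \<in> borel_measurable M"
  using measurable_compose[OF measurable_Pair1' assms, of t] by simp

lemma pdmp_kernel_SUP: "pdmp_kernel t f x = (\<Squnion>N. truncated_kernel N t f x)"
  unfolding pdmp_kernel_def truncated_kernel_def by (rule suminf_eq_SUP)

lemma truncated_kernel_le: "truncated_kernel N t f x \<le> pdmp_kernel t f x"
  unfolding pdmp_kernel_SUP by (rule SUP_upper) simp

lemma truncated_kernel_mono_Suc: "truncated_kernel N t f x \<le> truncated_kernel (Suc N) t f x"
  by (simp add: truncated_kernel_def)

lemma truncated_kernel_0: "truncated_kernel 0 t f x = 0"
  by (simp add: truncated_kernel_def)

lemma truncated_kernel_Suc:
  assumes f: "f \<in> borel_measurable M"
  shows "truncated_kernel (Suc N) t f x = drift t f x + after_jump (\<lambda>s. truncated_kernel N s f) t x"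
proof -
  have "(\<Sum>n<N. jump_part (Suc n) t f x) = after_jump (\<lambda>s. truncated_kernel N s f) t x"
    unfolding jump_part.simps after_jump_def truncated_kernel_def sum_distrib_left
    by (rule nn_integral_sum[symmetric])
       (simp add: after_jump_integrand_measurable[OF jump_part_measurable[OF f]] measurable_cong_sets[OF sets_jump_law refl])
  then show ?thesis
    unfolding truncated_kernel_def[of "Suc N"] by (simp only: sum.lessThan_Suc_shift jump_part.simps(1))
qed

lemma pdmp_kernel_rec:
  assumes f: "f \<in> borel_measurable M"
  shows "pdmp_kernel t f x = drift t f x + after_jump (\<lambda>s. pdmp_kernel s f) t x"
proof -
  have "(\<Sum>n. jump_part (Suc n) t f x) = after_jump (\<lambda>s. pdmp_kernel s f) t x"
    unfolding jump_part.simps after_jump_def pdmp_kernel_def ennreal_suminf_cmult[symmetric]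
    by (rule nn_integral_suminf[symmetric])
       (simp add: after_jump_integrand_measurable[OF jump_part_measurable[OF f]] measurable_cong_sets[OF sets_jump_law refl])
  moreover have "(\<Sum>n. jump_part n t f x) = (\<Sum>n. jump_part (Suc n) t f x) + jump_part 0 t f x"
    by (rule sums_unique[symmetric, OF sums_Suc[OF summable_sums[OF summableI]]])
  ultimately show ?thesis unfolding pdmp_kernel_def by (simp add: add.commute)
qed

lemma after_jump_mono:
  assumes x: "x \<in> E" and le: "\<And>s y. 0 \<le> s \<Longrightarrow> y \<in> E \<Longrightarrow> F s y \<le> G s y"
  shows "after_jump F t x \<le> after_jump G t x"
  unfolding after_jump_def
  by (rule nn_integral_mono) (auto simp: space_jump_law indicator_def intro: le)

lemma truncated_kernel_one:
  "x \<in> E \<Longrightarrow> 0 \<le> t \<Longrightarrow> truncated_kernel N t (\<lambda>_. 1) x \<le> 1"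
proof (induction N arbitrary: t x)
  case 0 then show ?case by (simp add: truncated_kernel_0)
next
  case (Suc N)
  have "after_jump (\<lambda>s. truncated_kernel N s (\<lambda>_. 1)) t x \<le> after_jump (\<lambda>_ _. 1) t x"
    using Suc by (intro after_jump_mono) auto
  then have "truncated_kernel (Suc N) t (\<lambda>_. 1) x \<le> ennreal (exp (- \<Phi> x t)) + after_jump (\<lambda>_ _. 1) t x"
    by (simp add: truncated_kernel_Suc drift_def)
  also have "\<dots> = 1" using jump_law_survival[OF Suc.prems] by (simp add: after_jump_def)
  finally show ?case .
qed

lemma pdmp_kernel_one: "x \<in> E \<Longrightarrow> 0 \<le> t \<Longrightarrow> pdmp_kernel t (\<lambda>_. 1) x \<le> 1"
  unfolding pdmp_kernel_SUP by (rule SUP_least) (rule truncated_kernel_one)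

lemma integral_functional_after_jump:
  assumes x: "x \<in> E" and F: "\<And>s y. 0 \<le> s \<Longrightarrow> y \<in> E \<Longrightarrow> integral_functional M (\<lambda>f. F f s y)"
    and m: "\<And>f. f \<in> borel_measurable M \<Longrightarrow> case_prod (F f) \<in> borel_measurable (borel \<Otimes>\<^sub>M M)"
  shows "integral_functional M (\<lambda>f. after_jump (F f) t x)"
proof -
  let ?R = "jump_law x"
  show ?thesis
    unfolding after_jump_def
  proof (rule integral_functional_mixture)
    fix z assume z: "z \<in> space ?R"
    show "integral_functional M (\<lambda>f. indicator {..t} (fst z) * F f (t - fst z) (snd z))"
    proof (cases "fst z \<le> t")
      case True
      then show ?thesis using F[of "t - fst z" "snd z"] z by (simp add: space_jump_law mem_Times_iff)
    next
      case False
      have "integral_functional M (\<lambda>f. 0 * f x)" by (rule integral_functional_point) (simp add: x)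
      then show ?thesis using False by simp
    qed
  next
    show "(\<lambda>z. indicator {..t} (fst z) * F f (t - fst z) (snd z)) \<in> borel_measurable ?R" if "f \<in> borel_measurable M" for f
      using after_jump_integrand_measurable[OF m[OF that]] by (simp add: measurable_cong_sets[OF sets_jump_law refl])
  qed
qed

lemma jump_part_functional: "x \<in> E \<Longrightarrow> integral_functional M (\<lambda>f. jump_part n t f x)"
proof (induction n arbitrary: t x)
  case 0
  then show ?case unfolding jump_part.simps drift_def by (intro integral_functional_point) (simp add: flow_closed)
next
  case (Suc n)
  show ?case unfolding jump_part.simps
    by (rule integral_functional_after_jump[OF Suc.prems Suc.IH jump_part_measurable])
qed

lemma kernel_operator_pdmp: "0 \<le> t \<Longrightarrow> kernel_operator M 1 (pdmp_kernel t)"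
  unfolding kernel_operator_def
proof (intro conjI ballI)
  assume t: "0 \<le> t"
  show "pdmp_kernel t f \<in> borel_measurable M" if "f \<in> borel_measurable M" for f
    using joint_measurable_section[OF pdmp_kernel_measurable[OF that]] .
  fix x assume x: "x \<in> space M"
  then show "pdmp_kernel t (\<lambda>_. 1) x \<le> ennreal 1" using pdmp_kernel_one t by simp
  have "integral_functional M (\<lambda>f. \<integral>\<^sup>+n. jump_part n t f x \<partial>count_space UNIV)"
    using x by (intro integral_functional_mixture jump_part_functional) auto
  then show "integral_functional M (\<lambda>f. pdmp_kernel t f x)"
    by (simp add: pdmp_kernel_def nn_integral_count_space_nat)
qed simp

lemma kernel_family_pdmp: "kernel_family M pdmp_kernel"
  unfolding kernel_family_def
proof (intro conjI ballI allI impI kernel_operator_pdmp)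
  fix f :: "'a \<Rightarrow> ennreal" assume f: "f \<in> borel_measurable M"
  note [measurable] = pdmp_kernel_measurable[OF f]
  have "(\<lambda>p. indicator {0..} (fst p) * (case p of (t, x) \<Rightarrow> pdmp_kernel t f x)) \<in> borel_measurable (borel \<Otimes>\<^sub>M M)"
    by measurable
  then show "(\<lambda>(t, x). indicator {0..} t * pdmp_kernel t f x) \<in> borel_measurable (borel \<Otimes>\<^sub>M M)"
    by (simp add: case_prod_beta')
qed

lemma pdmp_kernel_0:
  assumes x: "x \<in> E" and f: "f \<in> borel_measurable M"
  shows "pdmp_kernel 0 f x = f x"
proof -
  have "after_jump (\<lambda>s. pdmp_kernel s f) 0 x = (\<integral>\<^sup>+z. 0 \<partial>jump_law x)"
    unfolding after_jump_def
    using jump_law_time_pos[OF x] by (intro nn_integral_cong_AE) (auto elim: eventually_mono)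
  then show ?thesis
    using x flow_0 cum_rate_neg[of 0 x] by (simp add: pdmp_kernel_rec[OF f] drift_def flow_eq)
qed

lemma drift_le_pdmp_kernel: "f \<in> borel_measurable M \<Longrightarrow> drift t f x \<le> pdmp_kernel t f x"
  by (simp add: pdmp_kernel_rec)

section \<open>The Chapman-Kolmogorov equation\<close>

text \<open>
  Split at the time \<open>s\<close>: either the first jump occurs by \<open>s\<close>, or memorylessness restarts the
  renewal equation at \<open>\<pi>\<^sub>s x\<close>.
\<close>

lemma renewal_split:
  assumes x: "x \<in> E" and s: "0 \<le> s" and t: "0 \<le> t"
    and F: "case_prod F \<in> borel_measurable (borel \<Otimes>\<^sub>M M)"
  shows "drift (s + t) f x + after_jump F (s + t) x
    = drift s (\<lambda>y. drift t f y + after_jump F t y) x + after_jump (\<lambda>r. F (r + t)) s x"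
proof -
  let ?h = "\<lambda>z. indicator {..s + t} (fst z) * F (s + t - fst z) (snd z)"
  have hm[measurable]: "?h \<in> borel_measurable (borel \<Otimes>\<^sub>M M)"
    by (rule after_jump_integrand_measurable[OF F])
  have [measurable]: "indicator {s<..} \<in> borel_measurable (borel :: real measure)" by simp
  have m2: "(\<lambda>z. indicator {..s} (fst z) * ?h z) \<in> borel_measurable (jump_law x)"
    "(\<lambda>z. indicator {s<..} (fst z) * ?h z) \<in> borel_measurable (jump_law x)" by measurable
  have "after_jump F (s + t) x = (\<integral>\<^sup>+z. indicator {..s} (fst z) * ?h z + indicator {s<..} (fst z) * ?h z \<partial>jump_law x)"
    unfolding after_jump_def by (intro nn_integral_cong) (auto simp: indicator_def)
  also have "\<dots> = (\<integral>\<^sup>+z. indicator {..s} (fst z) * ?h z \<partial>jump_law x) + (\<integral>\<^sup>+z. indicator {s<..} (fst z) * ?h z \<partial>jump_law x)"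
    by (rule nn_integral_add[OF m2])
  also have "(\<integral>\<^sup>+z. indicator {..s} (fst z) * ?h z \<partial>jump_law x) = after_jump (\<lambda>r. F (r + t)) s x"
    unfolding after_jump_def using t by (intro nn_integral_cong) (auto simp: indicator_def algebra_simps)
  also have "(\<integral>\<^sup>+z. indicator {s<..} (fst z) * ?h z \<partial>jump_law x) = ennreal (exp (- \<Phi> x s)) * after_jump F t (flow s x)"
    unfolding jump_law_shift[OF x s hm] after_jump_def
    by (intro arg_cong2[where f="(*)"] refl nn_integral_cong) (auto simp: indicator_def)
  finally have "after_jump F (s + t) x = after_jump (\<lambda>r. F (r + t)) s x + ennreal (exp (- \<Phi> x s)) * after_jump F t (flow s x)" .
  then show ?thesis
    unfolding drift_add_time[OF x s t] by (simp add: drift_def distrib_left add_ac)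
qed

lemma pdmp_kernel_split:
  assumes "x \<in> E" "0 \<le> s" "0 \<le> t" and f: "f \<in> borel_measurable M"
  shows "pdmp_kernel (s + t) f x = drift s (pdmp_kernel t f) x + after_jump (\<lambda>r. pdmp_kernel (r + t) f) s x"
  using renewal_split[OF assms(1-3) pdmp_kernel_measurable[OF f], of f]
  by (simp add: pdmp_kernel_rec[OF f, symmetric])

lemma truncated_kernel_split:
  assumes "x \<in> E" "0 \<le> s" "0 \<le> t" and f: "f \<in> borel_measurable M"
  shows "truncated_kernel (Suc N) (s + t) f x
    = drift s (truncated_kernel (Suc N) t f) x + after_jump (\<lambda>r. truncated_kernel N (r + t) f) s x"
  using renewal_split[OF assms(1-3) truncated_kernel_measurable[OF f], of f N]
  by (simp add: truncated_kernel_Suc[OF f, symmetric])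

text \<open>
  Each inequality is an induction on the number of jumps allowed on its smaller side. The split at
  time \<open>s\<close> has the same shape as the renewal equation up to time \<open>s\<close>, with the value at time \<open>s\<close>
  as the function to be evaluated.
\<close>

theorem pdmp_kernel_add_time:
  assumes s: "0 \<le> s" and t: "0 \<le> t" and f: "f \<in> borel_measurable M" and x: "x \<in> E"
  shows "pdmp_kernel (s + t) f x = pdmp_kernel s (pdmp_kernel t f) x"
proof (rule antisym)
  have Uf: "pdmp_kernel t f \<in> borel_measurable M"
    by (rule kernel_operator_measurable[OF kernel_operator_pdmp[OF t] f])
  have "truncated_kernel N (s + t) f x \<le> pdmp_kernel s (pdmp_kernel t f) x" if "x \<in> E" "0 \<le> s" for N s x
    using that
  proof (induction N arbitrary: s x)
    case 0 show ?case by (simp add: truncated_kernel_0)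
  next
    case (Suc N)
    have "truncated_kernel (Suc N) (s + t) f x
      \<le> drift s (pdmp_kernel t f) x + after_jump (\<lambda>r. pdmp_kernel r (pdmp_kernel t f)) s x"
      unfolding truncated_kernel_split[OF Suc.prems t f]
      using Suc by (intro add_mono drift_mono truncated_kernel_le after_jump_mono) auto
    then show ?case by (simp add: pdmp_kernel_rec[OF Uf, symmetric])
  qed
  then show "pdmp_kernel (s + t) f x \<le> pdmp_kernel s (pdmp_kernel t f) x"
    unfolding pdmp_kernel_SUP[of "s + t"] using x s by (intro SUP_least) auto
  have "truncated_kernel N s (pdmp_kernel t f) x \<le> pdmp_kernel (s + t) f x" if "x \<in> E" "0 \<le> s" for N s x
    using that
  proof (induction N arbitrary: s x)
    case 0 show ?case by (simp add: truncated_kernel_0)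
  next
    case (Suc N)
    have "truncated_kernel (Suc N) s (pdmp_kernel t f) x
      \<le> drift s (pdmp_kernel t f) x + after_jump (\<lambda>r. pdmp_kernel (r + t) f) s x"
      unfolding truncated_kernel_Suc[OF Uf]
      using Suc by (intro add_mono order_refl after_jump_mono) auto
    then show ?case using pdmp_kernel_split[OF Suc.prems t f] by simp
  qed
  then show "pdmp_kernel s (pdmp_kernel t f) x \<le> pdmp_kernel (s + t) f x"
    unfolding pdmp_kernel_SUP[of s] using x s by (intro SUP_least) auto
qed

section \<open>Discounted jumps and Laplace transforms\<close>

definition discounted_jump :: "real \<Rightarrow> ('a \<Rightarrow> ennreal) \<Rightarrow> 'a \<Rightarrow> ennreal" where
  "discounted_jump l f x = (\<integral>\<^sup>+z. ennreal (exp (- l * fst z)) * f (snd z) \<partial>jump_law x)"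

lemma discounted_jump_one_le:
  assumes x: "x \<in> E" and l: "0 \<le> l" shows "discounted_jump l (\<lambda>_. 1) x \<le> 1"
proof -
  interpret p: prob_space "jump_law x" by (rule prob_space_jump_law[OF x])
  have "discounted_jump l (\<lambda>_. 1) x \<le> (\<integral>\<^sup>+z. 1 \<partial>jump_law x)"
    unfolding discounted_jump_def using jump_law_time_nonneg[OF x] l
    by (intro nn_integral_mono_AE) (auto elim!: eventually_mono)
  then show ?thesis using p.emeasure_space_1 by simp
qed

lemma kernel_operator_discounted_jump:
  assumes l: "0 \<le> l" shows "kernel_operator M 1 (discounted_jump l)"
  unfolding kernel_operator_def
proof (intro conjI ballI)
  show "discounted_jump l f \<in> borel_measurable M" if [measurable]: "f \<in> borel_measurable M" for f
    unfolding discounted_jump_def[abs_def] by (rule jump_law_integral_measurable) measurable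
  fix x assume "x \<in> space M" then have x: "x \<in> E" by simp
  show "integral_functional M (\<lambda>f. discounted_jump l f x)"
    unfolding discounted_jump_def
    by (intro integral_functional_mixture integral_functional_point) (auto simp: space_jump_law)
  show "discounted_jump l (\<lambda>_. 1) x \<le> ennreal 1" using discounted_jump_one_le[OF x l] by simp
qed simp

text \<open>
  Here the law of the waiting time enters: discounting the first jump amounts to a Laplace
  transform in time of the flow with killing, evaluated at \<open>\<phi> \<cdot> J f\<close>.
\<close>

lemma discounted_jump_laplace:
  assumes x: "x \<in> E" and f[measurable]: "f \<in> borel_measurable M"
  shows "discounted_jump l f x = laplace_kernel l drift (\<lambda>y. ennreal (\<phi> y) * jump_operator f y) x"
proof -
  have "discounted_jump l f x = (\<integral>\<^sup>+s. indicator {0..} s * drift s (\<lambda>y. ennreal (\<phi> y) * jump_operator (\<lambda>w. ennreal (exp (- l * s)) * f w) y) x \<partial>lborel)"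
    unfolding discounted_jump_def by (subst jump_law_drift[OF x]) simp_all
  also have "\<dots> = (\<integral>\<^sup>+s. indicator {0..} s * ennreal (exp (- l * s)) * drift s (\<lambda>y. ennreal (\<phi> y) * jump_operator f y) x \<partial>lborel)"
    unfolding drift_def kernel_operator_cmult[OF kernel_operator_jump in_space_M[OF flow_closed[OF x]] f]
    by (intro nn_integral_cong) (simp add: mult_ac)
  finally show ?thesis by (simp add: laplace_kernel_def)
qed

text \<open>
  The renewal equation is a convolution in time, which the Laplace transform turns into a
  composition.
\<close>

lemma laplace_renewal:
  assumes x: "x \<in> E" and f[measurable]: "f \<in> borel_measurable M"
    and F: "case_prod F \<in> borel_measurable (borel \<Otimes>\<^sub>M M)"
  shows "(\<integral>\<^sup>+t. indicator {0..} t * ennreal (exp (- l * t)) * (drift t f x + after_jump F t x) \<partial>lborel)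
    = laplace_kernel l drift f x
      + discounted_jump l (\<lambda>y. \<integral>\<^sup>+t. indicator {0..} t * ennreal (exp (- l * t)) * F t y \<partial>lborel) x"
proof -
  interpret p: prob_space "jump_law x" by (rule prob_space_jump_law[OF x])
  interpret pair_sigma_finite "jump_law x" lborel ..
  note [measurable] = in_space_M[OF x]
  have [measurable]: "(\<lambda>z. F (f z) (g z)) \<in> borel_measurable N"
    if "f \<in> borel_measurable N" "g \<in> N \<rightarrow>\<^sub>M M" for f g and N :: "'d measure"
    using measurable_compose[OF measurable_Pair[OF that] F] by simp
  let ?e = "\<lambda>t. indicator {0..} t * ennreal (exp (- l * t))"
  have [measurable]: "(\<lambda>t. after_jump F t x) \<in> borel_measurable borel"
    using measurable_compose[OF measurable_Pair2'[OF in_space_M[OF x]] after_jump_measurable[OF F]] by simp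
  have "(\<integral>\<^sup>+t. ?e t * (drift t f x + after_jump F t x) \<partial>lborel)
    = (\<integral>\<^sup>+t. ?e t * drift t f x \<partial>lborel) + (\<integral>\<^sup>+t. ?e t * after_jump F t x \<partial>lborel)"
    unfolding distrib_left by (rule nn_integral_add) measurable
  also have "(\<integral>\<^sup>+t. ?e t * drift t f x \<partial>lborel) = laplace_kernel l drift f x" by (simp add: laplace_kernel_def)
  also have "(\<integral>\<^sup>+t. ?e t * after_jump F t x \<partial>lborel)
     = (\<integral>\<^sup>+t. \<integral>\<^sup>+z. ?e t * (indicator {..t} (fst z) * F (t - fst z) (snd z)) \<partial>jump_law x \<partial>lborel)"
    unfolding after_jump_def
    using after_jump_integrand_measurable[OF F]
    by (intro nn_integral_cong nn_integral_cmult[symmetric]) (simp add: measurable_cong_sets[OF sets_jump_law refl])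
  also have "\<dots> = (\<integral>\<^sup>+z. \<integral>\<^sup>+t. ?e t * (indicator {..t} (fst z) * F (t - fst z) (snd z)) \<partial>lborel \<partial>jump_law x)"
  proof (rule Fubini')
    have "(\<lambda>(z, t). ?e t * (if fst z \<le> t then F (t - fst z) (snd z) else 0)) \<in> borel_measurable (jump_law x \<Otimes>\<^sub>M lborel)"
      by measurable
    also have "(\<lambda>(z, t). ?e t * (if fst z \<le> t then F (t - fst z) (snd z) else 0))
       = (\<lambda>(z, t). ?e t * (indicator {..t} (fst z) * F (t - fst z) (snd z)))"
      by (auto simp: indicator_def fun_eq_iff)
    finally show "(\<lambda>(z, t). ?e t * (indicator {..t} (fst z) * F (t - fst z) (snd z))) \<in> borel_measurable (jump_law x \<Otimes>\<^sub>M lborel)" .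
  qed
  also have "\<dots> = (\<integral>\<^sup>+z. ennreal (exp (- l * fst z)) * (\<integral>\<^sup>+t. ?e t * F t (snd z) \<partial>lborel) \<partial>jump_law x)"
  proof (rule nn_integral_cong_AE)
    show "AE z in jump_law x. (\<integral>\<^sup>+t. ?e t * (indicator {..t} (fst z) * F (t - fst z) (snd z)) \<partial>lborel)
       = ennreal (exp (- l * fst z)) * (\<integral>\<^sup>+t. ?e t * F t (snd z) \<partial>lborel)"
      using jump_law_time_nonneg[OF x] AE_space
    proof eventually_elim
      case (elim z)
      then have y[measurable]: "snd z \<in> space M" by (simp add: space_jump_law mem_Times_iff)
      have m[measurable]: "(\<lambda>t. F t (snd z)) \<in> borel_measurable borel"
        using measurable_compose[OF measurable_Pair2'[OF y] F] by simp
      have m': "(\<lambda>t. ?e t * (indicator {..t} (fst z) * F (t - fst z) (snd z))) \<in> borel_measurable borel"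
      proof -
        have "(\<lambda>t. ?e t * (indicator {fst z..} t * F (t - fst z) (snd z))) \<in> borel_measurable borel" by measurable
        also have "(\<lambda>t. ?e t * (indicator {fst z..} t * F (t - fst z) (snd z)))
          = (\<lambda>t. ?e t * (indicator {..t} (fst z) * F (t - fst z) (snd z)))" by (auto simp: indicator_def fun_eq_iff)
        finally show ?thesis .
      qed
      have "(\<integral>\<^sup>+t. ?e t * (indicator {..t} (fst z) * F (t - fst z) (snd z)) \<partial>lborel)
        = (\<integral>\<^sup>+t. ?e (fst z + 1 * t) * (indicator {..fst z + 1 * t} (fst z) * F (fst z + 1 * t - fst z) (snd z)) \<partial>lborel)"
        by (subst nn_integral_real_affine[OF m', where c=1 and t="fst z"]) simp_all
      also have "\<dots> = (\<integral>\<^sup>+t. ennreal (exp (- l * fst z)) * (?e t * F t (snd z)) \<partial>lborel)"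
      proof (rule nn_integral_cong)
        fix t :: real
        have "exp (- l * (fst z + t)) = exp (- l * fst z) * exp (- l * t)"
          by (simp add: exp_add[symmetric] algebra_simps)
        then show "?e (fst z + 1 * t) * (indicator {..fst z + 1 * t} (fst z) * F (fst z + 1 * t - fst z) (snd z))
          = ennreal (exp (- l * fst z)) * (?e t * F t (snd z))"
          using elim(1) by (cases "0 \<le> t") (simp_all add: ennreal_mult' mult_ac)
      qed
      also have "\<dots> = ennreal (exp (- l * fst z)) * (\<integral>\<^sup>+t. ?e t * F t (snd z) \<partial>lborel)"
        by (rule nn_integral_cmult) measurable
      finally show ?case .
    qed
  qed
  finally show ?thesis by (simp add: discounted_jump_def)
qed

lemma laplace_pdmp_kernel:
  assumes x: "x \<in> E" and f: "f \<in> borel_measurable M"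
  shows "laplace_kernel l pdmp_kernel f x = laplace_kernel l drift f x + discounted_jump l (laplace_kernel l pdmp_kernel f) x"
  using laplace_renewal[OF x f pdmp_kernel_measurable[OF f], of l]
  by (simp add: pdmp_kernel_rec[OF f, symmetric] laplace_kernel_def[abs_def])

lemma laplace_truncated_kernel:
  assumes x: "x \<in> E" and f: "f \<in> borel_measurable M"
  shows "laplace_kernel l (truncated_kernel 0) f x = 0"
    "laplace_kernel l (truncated_kernel (Suc N)) f x
     = laplace_kernel l drift f x + discounted_jump l (laplace_kernel l (truncated_kernel N) f) x"
  using laplace_renewal[OF x f truncated_kernel_measurable[OF f], of l N]
  by (simp_all add: truncated_kernel_Suc[OF f, symmetric] laplace_kernel_def[abs_def] truncated_kernel_0)

lemma laplace_pdmp_kernel_SUP: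
  assumes x: "x \<in> E" and f: "f \<in> borel_measurable M"
  shows "laplace_kernel l pdmp_kernel f x = (\<Squnion>N. laplace_kernel l (truncated_kernel N) f x)"
proof -
  have m: "(\<lambda>t. truncated_kernel N t f x) \<in> borel_measurable lborel" for N
    using measurable_compose[OF measurable_Pair2'[OF in_space_M[OF x]] truncated_kernel_measurable[OF f]] by simp
  have "laplace_kernel l pdmp_kernel f x
    = (\<integral>\<^sup>+t. (\<Squnion>N. indicator {0..} t * ennreal (exp (- l * t)) * truncated_kernel N t f x) \<partial>lborel)"
    unfolding laplace_kernel_def pdmp_kernel_SUP by (simp add: SUP_mult_left_ennreal)
  also have "\<dots> = (\<Squnion>N. laplace_kernel l (truncated_kernel N) f x)"
    unfolding laplace_kernel_def
  proof (rule nn_integral_monotone_convergence_SUP)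
    show "incseq (\<lambda>N t. indicator {0..} t * ennreal (exp (- l * t)) * truncated_kernel N t f x)"
      by (intro incseq_SucI le_funI mult_left_mono truncated_kernel_mono_Suc) simp
    show "(\<lambda>t. indicator {0..} t * ennreal (exp (- l * t)) * truncated_kernel N t f x) \<in> borel_measurable lborel" for N
      using m[of N] by measurable
  qed
  finally show ?thesis .
qed

lemma truncated_kernel_laplace_measurable:
  assumes f: "f \<in> borel_measurable M"
  shows "laplace_kernel l (truncated_kernel N) f \<in> borel_measurable M"
proof -
  note [measurable] = truncated_kernel_measurable[OF f]
  have "(\<lambda>x. \<integral>\<^sup>+t. indicator {0..} t * ennreal (exp (- l * t)) * (case (t, x) of (t, x) \<Rightarrow> truncated_kernel N t f x) \<partial>lborel) \<in> borel_measurable M"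
    by measurable
  then show ?thesis unfolding laplace_kernel_def[abs_def] by simp
qed

text \<open>
  At discount rate \<open>0\<close> the formula for the discounted jump is the integral that defines the
  embedded kernel.
\<close>

lemma embedded_kernel_eq:
  assumes x: "x \<in> E" and B: "B \<in> sets M"
  shows "discounted_jump 0 (indicator B) x = ennreal (embedded_kernel \<pi> \<phi> J x B)"
    and "0 \<le> embedded_kernel \<pi> \<phi> J x B"
proof -
  have JB: "jump_operator (indicator B) y = ennreal (J y B)" if "y \<in> E" for y
    by (rule jump_operator_indicator[OF that B])
  have Jm: "(\<lambda>y. J y B) \<in> borel_measurable M" using jump_kernel B by (simp add: stochastic_kernel_def)
  have Jn: "0 \<le> J y B" if "y \<in> E" for y using kappa_kernel[OF that B] by simp
  let ?g = "\<lambda>s. indicator {0..} s *\<^sub>R (J (flow s x) B * \<phi> (flow s x) * exp (- \<Phi> x s))"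
  have gm: "?g \<in> borel_measurable lborel"
  proof -
    note [measurable] = in_space_M[OF x]
    have [measurable]: "(\<lambda>s. J (flow s x) B) \<in> borel_measurable borel"
      by (rule measurable_compose[OF _ Jm]) measurable
    show ?thesis by measurable
  qed
  have g0: "0 \<le> ?g s" for s using Jn[OF flow_closed[OF x]] rate_nonneg[OF flow_closed[OF x]] by simp
  have ek: "embedded_kernel \<pi> \<phi> J x B = (\<integral>s. ?g s \<partial>lborel)"
    unfolding embedded_kernel_def set_lebesgue_integral_def
    by (intro Bochner_Integration.integral_cong) (auto simp: indicator_def flow_eq)
  have "discounted_jump 0 (indicator B) x = (\<integral>\<^sup>+s. ennreal (?g s) \<partial>lborel)"
    unfolding discounted_jump_laplace[OF x borel_measurable_indicator[OF B]] laplace_kernel_def drift_def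
    using flow_closed[OF x] rate_nonneg[OF flow_closed[OF x]]
    by (intro nn_integral_cong) (auto simp: JB Jn ennreal_mult' indicator_def mult_ac)
  moreover have "(\<integral>\<^sup>+s. ennreal (?g s) \<partial>lborel) \<le> 1"
    using calculation kernel_operator_bound[OF kernel_operator_discounted_jump[OF order_refl] in_space_M[OF x], of "indicator B" 1] B
    by (simp add: indicator_def)
  then have "(\<integral>\<^sup>+s. ennreal (?g s) \<partial>lborel) = ennreal (\<integral>s. ?g s \<partial>lborel)"
    using gm g0 by (intro nn_integral_eq_integral integrableI_nonneg) (auto simp: less_top[symmetric] top_unique)
  ultimately show "discounted_jump 0 (indicator B) x = ennreal (embedded_kernel \<pi> \<phi> J x B)" using ek by simp
  show "0 \<le> embedded_kernel \<pi> \<phi> J x B" unfolding ek using g0 by (intro integral_nonneg_AE) auto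
qed

lemma discounted_jump_0_one: "x \<in> E \<Longrightarrow> discounted_jump 0 (\<lambda>_. 1) x = 1"
  using prob_space.emeasure_space_1[OF prob_space_jump_law] by (simp add: discounted_jump_def)

lemma stochastic_embedded_kernel: "stochastic_kernel M (embedded_kernel \<pi> \<phi> J)"
  unfolding stochastic_kernel_def
proof (intro conjI ballI)
  fix x assume "x \<in> space M" then have x: "x \<in> E" by simp
  interpret p: prob_space "jump_law x" by (rule prob_space_jump_law[OF x])
  have sm: "snd \<in> jump_law x \<rightarrow>\<^sub>M M" by measurable
  show "\<exists>\<mu>. prob_space \<mu> \<and> sets \<mu> = sets M \<and> (\<forall>B\<in>sets M. embedded_kernel \<pi> \<phi> J x B = Sigma_Algebra.measure \<mu> B)"
  proof (intro exI conjI ballI)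
    show "prob_space (distr (jump_law x) M snd)" by (rule p.prob_space_distr[OF sm])
    interpret d: prob_space "distr (jump_law x) M snd" by (rule p.prob_space_distr[OF sm])
    fix B assume B: "B \<in> sets M"
    have "ennreal (embedded_kernel \<pi> \<phi> J x B) = (\<integral>\<^sup>+z. indicator B (snd z) \<partial>jump_law x)"
      unfolding embedded_kernel_eq(1)[OF x B, symmetric] by (simp add: discounted_jump_def)
    also have "\<dots> = emeasure (distr (jump_law x) M snd) B"
      using nn_integral_distr[OF sm, of "indicator B"] B by simp
    finally show "embedded_kernel \<pi> \<phi> J x B = Sigma_Algebra.measure (distr (jump_law x) M snd) B"
      using embedded_kernel_eq(2)[OF x B] by (simp add: d.emeasure_eq_measure)
  qed simp
next
  fix B assume B: "B \<in> sets M"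
  have "(\<lambda>x. enn2real (discounted_jump 0 (indicator B) x)) \<in> borel_measurable M"
    using kernel_operator_measurable[OF kernel_operator_discounted_jump[OF order_refl], of "indicator B"] B by simp
  then show "(\<lambda>x. embedded_kernel \<pi> \<phi> J x B) \<in> borel_measurable M"
    by (rule measurable_cong[THEN iffD1, rotated]) (simp add: embedded_kernel_eq[OF _ B])
qed

section \<open>Conditioning on the past of the driving variables\<close>

abbreviation "driver \<equiv> case_sum \<epsilon> \<theta>"

abbreviation "all_drivers \<equiv> {1::nat..} <+> {1::nat..}"

definition driver_events :: "nat + nat \<Rightarrow> 'w set set" where
  "driver_events i = {driver i -` B \<inter> space W | B. B \<in> sets borel}"

definition driver_algebra :: "(nat + nat) set \<Rightarrow> 'w measure" where
  "driver_algebra I = sigma (space W) (\<Union>i\<in>I. driver_events i)"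

lemma space_driver_algebra[simp]: "space (driver_algebra I) = space W"
  by (simp add: driver_algebra_def space_measure_of_conv)

lemma sets_driver_algebra:
  "sets (driver_algebra I) = sigma_sets (space W) (\<Union>i\<in>I. driver_events i)"
  unfolding driver_algebra_def by (rule sets_measure_of) (auto simp: driver_events_def)

lemma driver_measurable: "i \<in> all_drivers \<Longrightarrow> driver i \<in> W \<rightarrow>\<^sub>M borel"
  using drivers_indep by (auto simp: indep_vars_def)

lemma driver_measurable_algebra: "i \<in> I \<Longrightarrow> driver i \<in> driver_algebra I \<rightarrow>\<^sub>M borel"
  by (rule measurableI) (auto simp: sets_driver_algebra driver_events_def)

lemma driver_algebra_mono: "I \<subseteq> I' \<Longrightarrow> (\<lambda>\<omega>. \<omega>) \<in> driver_algebra I' \<rightarrow>\<^sub>M driver_algebra I"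
proof (rule measurableI)
  assume "I \<subseteq> I'"
  then have "sets (driver_algebra I) \<subseteq> sets (driver_algebra I')"
    unfolding sets_driver_algebra by (intro sigma_sets_mono') auto
  then show "(\<lambda>\<omega>. \<omega>) -` A \<inter> space (driver_algebra I') \<in> sets (driver_algebra I')"
    if "A \<in> sets (driver_algebra I)" for A
    using that sets.sets_into_space[OF that] by (auto simp: Int_absorb2)
qed simp

lemma driver_algebra_sub: "I \<subseteq> all_drivers \<Longrightarrow> (\<lambda>\<omega>. \<omega>) \<in> W \<rightarrow>\<^sub>M driver_algebra I"
proof (rule measurableI)
  assume I: "I \<subseteq> all_drivers"
  have "sets (driver_algebra I) \<subseteq> sets W"
    unfolding sets_driver_algebra
  proof (rule sets.sigma_sets_subset)
    show "(\<Union>i\<in>I. driver_events i) \<subseteq> sets W"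
      using I driver_measurable by (fastforce simp: driver_events_def intro: measurable_sets)
  qed
  then show "(\<lambda>\<omega>. \<omega>) -` A \<inter> space W \<in> sets W" if "A \<in> sets (driver_algebra I)" for A
    using that sets.sets_into_space[OF that] by (auto simp: Int_absorb2)
qed simp

lemma indep_set_driver:
  assumes I: "I \<subseteq> all_drivers" and j: "j \<in> all_drivers" "j \<notin> I"
  shows "indep_set (sets (driver_algebra I)) (sigma_sets (space W) (driver_events j))"
proof -
  let ?I = "case_bool I {j}"
  have "indep_sets driver_events all_drivers"
    using drivers_indep unfolding indep_vars_def2 driver_events_def by simp
  then have "indep_sets driver_events (\<Union>b\<in>UNIV. ?I b)"
    by (rule indep_sets_mono_index[rotated]) (use I j in \<open>auto simp: UNIV_bool\<close>)
  then have "indep_sets (\<lambda>b. sigma_sets (space W) (\<Union>i\<in>?I b. driver_events i)) UNIV"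
  proof (rule indep_sets_collect_sigma)
    show "Int_stable (driver_events i)" for i
      unfolding Int_stable_def driver_events_def
    proof safe
      fix A B :: "real set" assume "A \<in> sets borel" "B \<in> sets borel"
      then show "\<exists>C. driver i -` A \<inter> space W \<inter> (driver i -` B \<inter> space W) = driver i -` C \<inter> space W \<and> C \<in> sets borel"
        by (intro exI[of _ "A \<inter> B"]) auto
    qed
    show "disjoint_family_on ?I UNIV" using j by (auto simp: disjoint_family_on_def UNIV_bool)
  qed
  moreover have "(\<lambda>b. sigma_sets (space W) (\<Union>i\<in>?I b. driver_events i))
     = case_bool (sigma_sets (space W) (\<Union>i\<in>I. driver_events i)) (sigma_sets (space W) (driver_events j))"
    by (rule ext) (simp split: bool.split)
  ultimately show ?thesis
    by (simp add: indep_set_def sets_driver_algebra)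
qed

text \<open>
  Independence of an algebra of events and one further variable: the joint law of the outcome, seen
  through the algebra, and of the variable is a product.
\<close>

lemma integrate_driver:
  assumes I: "I \<subseteq> all_drivers" and j: "j \<in> all_drivers" "j \<notin> I"
    and h: "h \<in> borel_measurable (driver_algebra I \<Otimes>\<^sub>M borel)"
  shows "(\<integral>\<^sup>+\<omega>. h (\<omega>, driver j \<omega>) \<partial>W) = (\<integral>\<^sup>+\<omega>. \<integral>\<^sup>+y. h (\<omega>, y) \<partial>distr W borel (driver j) \<partial>W)"
proof -
  note sub = driver_algebra_sub[OF I] and dj = driver_measurable[OF j(1)]
  interpret d: prob_space "distr W borel (driver j)" by (rule prob_space_distr[OF dj])
  interpret i: prob_space "distr W (driver_algebra I) (\<lambda>\<omega>. \<omega>)" by (rule prob_space_distr[OF sub])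
  have pm[measurable]: "(\<lambda>\<omega>. (\<omega>, driver j \<omega>)) \<in> W \<rightarrow>\<^sub>M driver_algebra I \<Otimes>\<^sub>M borel"
    by (rule measurable_Pair[OF sub dj])
  have eq: "distr W (driver_algebra I) (\<lambda>\<omega>. \<omega>) \<Otimes>\<^sub>M distr W borel (driver j)
      = distr W (driver_algebra I \<Otimes>\<^sub>M borel) (\<lambda>\<omega>. (\<omega>, driver j \<omega>))"
  proof (rule pair_measure_eqI)
    show "sigma_finite_measure (distr W (driver_algebra I) (\<lambda>\<omega>. \<omega>))" by unfold_locales
    show "sigma_finite_measure (distr W borel (driver j))" by unfold_locales
    show "sets (distr W (driver_algebra I) (\<lambda>\<omega>. \<omega>) \<Otimes>\<^sub>M distr W borel (driver j))
      = sets (distr W (driver_algebra I \<Otimes>\<^sub>M borel) (\<lambda>\<omega>. (\<omega>, driver j \<omega>)))"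
      by (simp cong: sets_pair_measure_cong)
    fix A B assume A: "A \<in> sets (distr W (driver_algebra I) (\<lambda>\<omega>. \<omega>))" and B: "B \<in> sets (distr W borel (driver j))"
    have AW: "A \<inter> space W = A" using sets.sets_into_space[of A "driver_algebra I"] A by auto
    have AB: "(\<lambda>\<omega>. (\<omega>, driver j \<omega>)) -` (A \<times> B) \<inter> space W = A \<inter> (driver j -` B \<inter> space W)" using AW by auto
    have "prob (A \<inter> (driver j -` B \<inter> space W)) = prob A * prob (driver j -` B \<inter> space W)"
      using A B by (intro indep_setD[OF indep_set_driver[OF assms(1-3)]] sigma_sets.Basic)
        (auto simp: driver_events_def)
    then show "emeasure (distr W (driver_algebra I) (\<lambda>\<omega>. \<omega>)) A * emeasure (distr W borel (driver j)) B
      = emeasure (distr W (driver_algebra I \<Otimes>\<^sub>M borel) (\<lambda>\<omega>. (\<omega>, driver j \<omega>))) (A \<times> B)"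
      using A B sub dj by (simp add: emeasure_distr AB AW emeasure_eq_measure ennreal_mult')
  qed
  have h2: "h \<in> borel_measurable (driver_algebra I \<Otimes>\<^sub>M distr W borel (driver j))"
    using h by (simp cong: measurable_cong_sets add: measurable_cong_sets[OF sets_pair_measure_cong[OF refl sets_distr] refl])
  have "(\<integral>\<^sup>+\<omega>. h (\<omega>, driver j \<omega>) \<partial>W) = (\<integral>\<^sup>+p. h p \<partial>distr W (driver_algebra I \<Otimes>\<^sub>M borel) (\<lambda>\<omega>. (\<omega>, driver j \<omega>)))"
    by (rule nn_integral_distr[symmetric]) (use sub dj h in measurable)
  also have "\<dots> = (\<integral>\<^sup>+\<omega>. \<integral>\<^sup>+y. h (\<omega>, y) \<partial>distr W borel (driver j) \<partial>distr W (driver_algebra I) (\<lambda>\<omega>. \<omega>))"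
    unfolding eq[symmetric]
    by (rule d.nn_integral_fst[symmetric])
       (use h in \<open>simp add: measurable_cong_sets[OF sets_pair_measure_cong[OF sets_distr sets_distr] refl]\<close>)
  also have "\<dots> = (\<integral>\<^sup>+\<omega>. \<integral>\<^sup>+y. h (\<omega>, y) \<partial>distr W borel (driver j) \<partial>W)"
    using d.borel_measurable_nn_integral_fst[OF h2] by (subst nn_integral_distr[OF sub]) simp_all
  finally show ?thesis .
qed

lemma distr_eps: "1 \<le> n \<Longrightarrow> distr W borel (\<epsilon> n) = std_exponential"
  using distributed_distr_eq_density[OF eps_exponential[of n]] distr_cong[of W W borel lborel "\<epsilon> n" "\<epsilon> n"]
  by simp

lemma distr_theta: "1 \<le> n \<Longrightarrow> distr W borel (\<theta> n) = std_uniform"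
  using theta_uniform[of n] distr_cong[of W W borel lborel "\<theta> n" "\<theta> n"] by simp

definition drivers_upto :: "nat \<Rightarrow> (nat + nat) set" where
  "drivers_upto n = {1..n} <+> {1..n}"

abbreviation "past n \<equiv> driver_algebra (drivers_upto n)"

lemma integrate_next_drivers:
  assumes h: "h \<in> borel_measurable (past n \<Otimes>\<^sub>M (borel \<Otimes>\<^sub>M borel))"
  shows "(\<integral>\<^sup>+\<omega>. h (\<omega>, \<epsilon> (Suc n) \<omega>, \<theta> (Suc n) \<omega>) \<partial>W)
    = (\<integral>\<^sup>+\<omega>. \<integral>\<^sup>+e. \<integral>\<^sup>+q. h (\<omega>, e, q) \<partial>std_uniform \<partial>std_exponential \<partial>W)"
proof -
  interpret u: prob_space std_uniform by (rule prob_space_std_uniform)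
  let ?I = "drivers_upto n" and ?I' = "insert (Inl (Suc n)) (drivers_upto n)"
  have I: "?I \<subseteq> all_drivers" "?I' \<subseteq> all_drivers" by (auto simp: drivers_upto_def)
  have j: "Inl (Suc n) \<in> all_drivers" "Inl (Suc n) \<notin> ?I" "Inr (Suc n) \<in> all_drivers" "Inr (Suc n) \<notin> ?I'"
    by (auto simp: drivers_upto_def)
  note [measurable] = h
  have [measurable]: "(\<lambda>\<omega>. \<omega>) \<in> driver_algebra ?I' \<rightarrow>\<^sub>M past n" by (rule driver_algebra_mono) auto
  have [measurable]: "\<epsilon> (Suc n) \<in> driver_algebra ?I' \<rightarrow>\<^sub>M borel"
    using driver_measurable_algebra[of "Inl (Suc n)" ?I'] by simp
  have "(\<lambda>p. h (fst p, \<epsilon> (Suc n) (fst p), snd p)) \<in> borel_measurable (driver_algebra ?I' \<Otimes>\<^sub>M borel)"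
  proof (rule measurable_compose[OF _ h])
    have "fst \<in> driver_algebra ?I' \<Otimes>\<^sub>M borel \<rightarrow>\<^sub>M past n"
      using measurable_compose[OF measurable_fst \<open>(\<lambda>\<omega>. \<omega>) \<in> driver_algebra ?I' \<rightarrow>\<^sub>M past n\<close>] by simp
    then show "(\<lambda>p. (fst p, \<epsilon> (Suc n) (fst p), snd p)) \<in> driver_algebra ?I' \<Otimes>\<^sub>M borel \<rightarrow>\<^sub>M past n \<Otimes>\<^sub>M borel \<Otimes>\<^sub>M borel"
      by (intro measurable_Pair) measurable
  qed
  from integrate_driver[OF I(2) j(3,4) this]
  have 1: "(\<integral>\<^sup>+\<omega>. h (\<omega>, \<epsilon> (Suc n) \<omega>, \<theta> (Suc n) \<omega>) \<partial>W) = (\<integral>\<^sup>+\<omega>. \<integral>\<^sup>+q. h (\<omega>, \<epsilon> (Suc n) \<omega>, q) \<partial>std_uniform \<partial>W)"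
    by (simp add: distr_theta)
  have "(\<lambda>p. \<integral>\<^sup>+q. h (fst p, snd p, q) \<partial>std_uniform) \<in> borel_measurable (past n \<Otimes>\<^sub>M borel)"
    by measurable
  from integrate_driver[OF I(1) j(1,2) this]
  show ?thesis unfolding 1 by (simp add: distr_eps)
qed

section \<open>The law of the minimal process\<close>

context
  fixes x assumes x: "x \<in> E"
begin

abbreviation "\<xi> \<equiv> post_jump \<pi> \<phi> \<kappa> \<epsilon> \<theta> x"

abbreviation "\<Delta> \<equiv> waiting_time \<pi> \<phi> \<kappa> \<epsilon> \<theta> x"

abbreviation "\<tau> \<equiv> jump_time \<pi> \<phi> \<kappa> \<epsilon> \<theta> x"

abbreviation "\<zeta> \<equiv> explosion_time \<pi> \<phi> \<kappa> \<epsilon> \<theta> x"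

abbreviation "X \<equiv> pdmp_process \<pi> \<phi> \<kappa> \<epsilon> \<theta> x"

lemma waiting_time_Suc: "\<Delta> (Suc n) \<omega> = \<Psi> (\<xi> n \<omega>) (\<epsilon> (Suc n) \<omega>)"
  by (simp add: waiting_time_def)

lemma jump_time_Suc: "\<tau> (Suc n) \<omega> = \<tau> n \<omega> + \<Delta> (Suc n) \<omega>"
  by (simp add: jump_time_def)

lemma jump_time_0[simp]: "\<tau> 0 \<omega> = 0"
  by (simp add: jump_time_def)

lemma post_jump_in: "\<omega> \<in> space W \<Longrightarrow> \<xi> n \<omega> \<in> E"
  and post_jump_Suc': "\<omega> \<in> space W \<Longrightarrow> \<xi> (Suc n) \<omega> = post (\<theta> (Suc n) \<omega>) (flow (\<Delta> (Suc n) \<omega>) (\<xi> n \<omega>))"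
proof -
  assume \<omega>: "\<omega> \<in> space W"
  have step: "\<xi> (Suc n) \<omega> = post (\<theta> (Suc n) \<omega>) (flow (\<Delta> (Suc n) \<omega>) (\<xi> n \<omega>))" if "\<xi> n \<omega> \<in> E" for n
    using theta_range[of "Suc n" \<omega>] \<omega> cum_rate_inv_props(1)[OF that]
    by (simp add: post_def flow_eq waiting_time_def min_def max_def)
  have all: "\<xi> n \<omega> \<in> E" for n
  proof (induction n)
    case (Suc n) show ?case unfolding step[OF Suc] by (intro post_in flow_closed Suc)
  qed (simp add: x)
  show "\<xi> n \<omega> \<in> E" by (rule all)
  show "\<xi> (Suc n) \<omega> = post (\<theta> (Suc n) \<omega>) (flow (\<Delta> (Suc n) \<omega>) (\<xi> n \<omega>))" by (rule step[OF all])
qed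

lemma waiting_time_nonneg: "\<omega> \<in> space W \<Longrightarrow> 0 \<le> \<Delta> (Suc n) \<omega>"
  unfolding waiting_time_Suc by (intro cum_rate_inv_props post_jump_in)

lemma jump_time_mono_Suc: "\<omega> \<in> space W \<Longrightarrow> \<tau> n \<omega> \<le> \<tau> (Suc n) \<omega>"
  using waiting_time_nonneg by (simp add: jump_time_Suc)

lemma jump_time_mono: "\<omega> \<in> space W \<Longrightarrow> i \<le> j \<Longrightarrow> \<tau> i \<omega> \<le> \<tau> j \<omega>"
  by (rule lift_Suc_mono_le[of "\<lambda>n. \<tau> n \<omega>"]) (auto intro: jump_time_mono_Suc)

lemma jump_time_nonneg: "\<omega> \<in> space W \<Longrightarrow> 0 \<le> \<tau> n \<omega>"
  using jump_time_mono[of \<omega> 0 n] by simp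

lemma past_mono: "(\<lambda>\<omega>. \<omega>) \<in> past (Suc n) \<rightarrow>\<^sub>M past n"
  by (rule driver_algebra_mono) (auto simp: drivers_upto_def)

lemma past_sub: "(\<lambda>\<omega>. \<omega>) \<in> W \<rightarrow>\<^sub>M past n"
  by (rule driver_algebra_sub) (auto simp: drivers_upto_def)

lemma jump_chain_measurable:
  "\<xi> n \<in> past n \<rightarrow>\<^sub>M M" "\<tau> n \<in> borel_measurable (past n)"
proof (induction n)
  case 0
  { case 1 show ?case using x by simp }
  { case 2 show ?case by simp }
next
  case (Suc n)
  note [measurable] = measurable_compose[OF past_mono Suc(1)] measurable_compose[OF past_mono Suc(2)]
  have "Inl (Suc n) \<in> drivers_upto (Suc n)" "Inr (Suc n) \<in> drivers_upto (Suc n)"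
    by (auto simp: drivers_upto_def)
  then have [measurable]: "\<epsilon> (Suc n) \<in> past (Suc n) \<rightarrow>\<^sub>M borel" "\<theta> (Suc n) \<in> past (Suc n) \<rightarrow>\<^sub>M borel"
    using driver_measurable_algebra[of "Inl (Suc n)" "drivers_upto (Suc n)"]
      driver_measurable_algebra[of "Inr (Suc n)" "drivers_upto (Suc n)"] by simp_all
  have [measurable]: "\<Delta> (Suc n) \<in> borel_measurable (past (Suc n))"
    unfolding waiting_time_Suc[abs_def] by measurable
  { case 1
    have "(\<lambda>\<omega>. post (\<theta> (Suc n) \<omega>) (flow (\<Delta> (Suc n) \<omega>) (\<xi> n \<omega>))) \<in> past (Suc n) \<rightarrow>\<^sub>M M" by measurable
    then show ?case by (rule measurable_cong[THEN iffD1, rotated]) (simp add: post_jump_Suc' del: post_jump.simps) }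
  { case 2
    show ?case unfolding jump_time_Suc[abs_def] by measurable }
qed

lemma jump_chain_measurable_W[measurable]: "\<xi> n \<in> W \<rightarrow>\<^sub>M M" "\<tau> n \<in> borel_measurable W" "\<Delta> (Suc n) \<in> borel_measurable W"
proof -
  show t: "\<tau> n \<in> borel_measurable W" for n by (rule measurable_compose[OF past_sub jump_chain_measurable(2)])
  show "\<xi> n \<in> W \<rightarrow>\<^sub>M M" by (rule measurable_compose[OF past_sub jump_chain_measurable(1)])
  have "(\<lambda>\<omega>. \<tau> (Suc n) \<omega> - \<tau> n \<omega>) \<in> borel_measurable W" using t by measurable
  then show "\<Delta> (Suc n) \<in> borel_measurable W" by (simp add: jump_time_Suc)
qed

text \<open>
  The jump chain is Markov with respect to the driving variables used so far: \<open>\<xi> n\<close> depends on the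
  first \<open>n\<close> pairs, and the next pair is independent of them. The test function may depend on the
  whole past, which serves the jump times, the process at a fixed time and the Markov property.
\<close>

theorem integrate_next_jump:
  assumes h: "h \<in> borel_measurable (past n \<Otimes>\<^sub>M (borel \<Otimes>\<^sub>M M))"
  shows "(\<integral>\<^sup>+\<omega>. h (\<omega>, \<Delta> (Suc n) \<omega>, \<xi> (Suc n) \<omega>) \<partial>W) = (\<integral>\<^sup>+\<omega>. \<integral>\<^sup>+w. h (\<omega>, w) \<partial>jump_law (\<xi> n \<omega>) \<partial>W)"
proof -
  note [measurable] = jump_chain_measurable(1)[of n]
  let ?g = "\<lambda>(\<omega>, e, q). (\<omega>, \<Psi> (\<xi> n \<omega>) e, post q (flow (\<Psi> (\<xi> n \<omega>) e) (\<xi> n \<omega>)))"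
  have "?g \<in> past n \<Otimes>\<^sub>M (borel \<Otimes>\<^sub>M borel) \<rightarrow>\<^sub>M past n \<Otimes>\<^sub>M (borel \<Otimes>\<^sub>M M)" by measurable
  from measurable_compose[OF this h]
  have gm: "(\<lambda>p. h (?g p)) \<in> borel_measurable (past n \<Otimes>\<^sub>M (borel \<Otimes>\<^sub>M borel))" .
  have "(\<integral>\<^sup>+\<omega>. h (\<omega>, \<Delta> (Suc n) \<omega>, \<xi> (Suc n) \<omega>) \<partial>W) = (\<integral>\<^sup>+\<omega>. h (?g (\<omega>, \<epsilon> (Suc n) \<omega>, \<theta> (Suc n) \<omega>)) \<partial>W)"
    by (intro nn_integral_cong) (simp add: post_jump_Suc' waiting_time_Suc del: post_jump.simps)
  also have "\<dots> = (\<integral>\<^sup>+\<omega>. \<integral>\<^sup>+e. \<integral>\<^sup>+q. h (?g (\<omega>, e, q)) \<partial>std_uniform \<partial>std_exponential \<partial>W)"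
    by (rule integrate_next_drivers[OF gm])
  also have "\<dots> = (\<integral>\<^sup>+\<omega>. \<integral>\<^sup>+w. h (\<omega>, w) \<partial>jump_law (\<xi> n \<omega>) \<partial>W)"
  proof (rule nn_integral_cong)
    fix \<omega> assume \<omega>: "\<omega> \<in> space W"
    have "(\<lambda>w. h (\<omega>, w)) \<in> borel_measurable (borel \<Otimes>\<^sub>M M)"
      using measurable_compose[OF measurable_Pair1' h, of \<omega>] \<omega> by simp
    from jump_law_nn_integral(1)[OF post_jump_in[OF \<omega>] this]
    show "(\<integral>\<^sup>+e. \<integral>\<^sup>+q. h (?g (\<omega>, e, q)) \<partial>std_uniform \<partial>std_exponential) = (\<integral>\<^sup>+w. h (\<omega>, w) \<partial>jump_law (\<xi> n \<omega>))"
      by simp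
  qed
  finally show ?thesis .
qed

lemma discounted_chain:
  assumes f: "f \<in> borel_measurable M"
  shows "(\<integral>\<^sup>+\<omega>. ennreal (exp (- l * \<tau> n \<omega>)) * f (\<xi> n \<omega>) \<partial>W) = (discounted_jump l ^^ n) f x"
  using f
proof (induction n arbitrary: f)
  case 0
  then show ?case using emeasure_space_1 by simp
next
  case (Suc n)
  note [measurable] = Suc.prems jump_chain_measurable[of n]
  have [measurable]: "discounted_jump l f \<in> borel_measurable M"
    unfolding discounted_jump_def[abs_def] by (rule jump_law_integral_measurable) measurable
  let ?h = "\<lambda>(\<omega>, s, y). ennreal (exp (- l * (\<tau> n \<omega> + s))) * f y"
  have hm: "?h \<in> borel_measurable (past n \<Otimes>\<^sub>M (borel \<Otimes>\<^sub>M M))" by measurable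
  have "(\<integral>\<^sup>+\<omega>. ennreal (exp (- l * \<tau> (Suc n) \<omega>)) * f (\<xi> (Suc n) \<omega>) \<partial>W) = (\<integral>\<^sup>+\<omega>. ?h (\<omega>, \<Delta> (Suc n) \<omega>, \<xi> (Suc n) \<omega>) \<partial>W)"
    by (simp add: jump_time_Suc)
  also have "\<dots> = (\<integral>\<^sup>+\<omega>. \<integral>\<^sup>+w. ?h (\<omega>, w) \<partial>jump_law (\<xi> n \<omega>) \<partial>W)" by (rule integrate_next_jump[OF hm])
  also have "\<dots> = (\<integral>\<^sup>+\<omega>. ennreal (exp (- l * \<tau> n \<omega>)) * discounted_jump l f (\<xi> n \<omega>) \<partial>W)"
  proof (rule nn_integral_cong)
    fix \<omega>
    have "(\<integral>\<^sup>+w. ?h (\<omega>, w) \<partial>jump_law (\<xi> n \<omega>))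
      = (\<integral>\<^sup>+w. ennreal (exp (- l * \<tau> n \<omega>)) * (ennreal (exp (- l * fst w)) * f (snd w)) \<partial>jump_law (\<xi> n \<omega>))"
    proof (rule nn_integral_cong)
      fix w :: "real \<times> 'a"
      have "exp (- l * (\<tau> n \<omega> + fst w)) = exp (- l * \<tau> n \<omega>) * exp (- l * fst w)"
        by (simp add: exp_add[symmetric] algebra_simps)
      then show "?h (\<omega>, w) = ennreal (exp (- l * \<tau> n \<omega>)) * (ennreal (exp (- l * fst w)) * f (snd w))"
        by (simp add: case_prod_beta ennreal_mult' mult.assoc)
    qed
    then show "(\<integral>\<^sup>+w. ?h (\<omega>, w) \<partial>jump_law (\<xi> n \<omega>)) = ennreal (exp (- l * \<tau> n \<omega>)) * discounted_jump l f (\<xi> n \<omega>)"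
      by (simp add: discounted_jump_def nn_integral_cmult)
  qed
  also have "\<dots> = (discounted_jump l ^^ n) (discounted_jump l f) x"
    by (rule Suc.IH) measurable
  finally show ?case by (simp add: funpow_swap1)
qed

lemma after_jump_chain:
  assumes F: "case_prod F \<in> borel_measurable (borel \<Otimes>\<^sub>M M)"
  shows "(\<integral>\<^sup>+\<omega>. indicator {..t} (\<tau> (Suc n) \<omega>) * F (t - \<tau> (Suc n) \<omega>) (\<xi> (Suc n) \<omega>) \<partial>W)
    = (\<integral>\<^sup>+\<omega>. indicator {..t} (\<tau> n \<omega>) * after_jump F (t - \<tau> n \<omega>) (\<xi> n \<omega>) \<partial>W)"
proof -
  note [measurable] = jump_chain_measurable[of n]
  have [measurable]: "(\<lambda>z. F (f z) (g z)) \<in> borel_measurable N"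
    if "f \<in> borel_measurable N" "g \<in> N \<rightarrow>\<^sub>M M" for f g and N :: "'d measure"
    using measurable_compose[OF measurable_Pair[OF that] F] by simp
  let ?h = "\<lambda>(\<omega>, s, y). indicator {..t} (\<tau> n \<omega> + s) * F (t - (\<tau> n \<omega> + s)) y"
  have hm: "?h \<in> borel_measurable (past n \<Otimes>\<^sub>M (borel \<Otimes>\<^sub>M M))" by measurable
  have "(\<integral>\<^sup>+\<omega>. indicator {..t} (\<tau> (Suc n) \<omega>) * F (t - \<tau> (Suc n) \<omega>) (\<xi> (Suc n) \<omega>) \<partial>W)
    = (\<integral>\<^sup>+\<omega>. ?h (\<omega>, \<Delta> (Suc n) \<omega>, \<xi> (Suc n) \<omega>) \<partial>W)"
    by (simp add: jump_time_Suc)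
  also have "\<dots> = (\<integral>\<^sup>+\<omega>. \<integral>\<^sup>+w. ?h (\<omega>, w) \<partial>jump_law (\<xi> n \<omega>) \<partial>W)" by (rule integrate_next_jump[OF hm])
  also have "\<dots> = (\<integral>\<^sup>+\<omega>. indicator {..t} (\<tau> n \<omega>) * after_jump F (t - \<tau> n \<omega>) (\<xi> n \<omega>) \<partial>W)"
  proof (rule nn_integral_cong)
    fix \<omega> assume \<omega>: "\<omega> \<in> space W"
    have "(\<integral>\<^sup>+w. ?h (\<omega>, w) \<partial>jump_law (\<xi> n \<omega>))
      = (\<integral>\<^sup>+w. indicator {..t} (\<tau> n \<omega>) * (indicator {..t - \<tau> n \<omega>} (fst w) * F (t - \<tau> n \<omega> - fst w) (snd w)) \<partial>jump_law (\<xi> n \<omega>))"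
    proof (rule nn_integral_cong_AE)
      show "AE w in jump_law (\<xi> n \<omega>). ?h (\<omega>, w) = indicator {..t} (\<tau> n \<omega>) * (indicator {..t - \<tau> n \<omega>} (fst w) * F (t - \<tau> n \<omega> - fst w) (snd w))"
        using jump_law_time_nonneg[OF post_jump_in[OF \<omega>]]
        by eventually_elim (auto simp: indicator_def case_prod_beta diff_diff_eq algebra_simps)
    qed
    then show "(\<integral>\<^sup>+w. ?h (\<omega>, w) \<partial>jump_law (\<xi> n \<omega>)) = indicator {..t} (\<tau> n \<omega>) * after_jump F (t - \<tau> n \<omega>) (\<xi> n \<omega>)"
      using after_jump_integrand_measurable[OF F, of "t - \<tau> n \<omega>"]
      by (simp add: after_jump_def nn_integral_cmult measurable_cong_sets[OF sets_jump_law refl])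
  qed
  finally show ?thesis .
qed

text \<open>
  The recursion of \<open>jump_part\<close> starts from the first jump, whereas conditioning on the past removes
  the last one. Starting the recursion at the \<open>n\<close>-th jump reconciles the two directions.
\<close>

lemma jump_part_chain:
  assumes f: "f \<in> borel_measurable M"
  shows "(\<integral>\<^sup>+\<omega>. indicator {..t} (\<tau> n \<omega>) * jump_part k (t - \<tau> n \<omega>) f (\<xi> n \<omega>) \<partial>W)
    = (\<integral>\<^sup>+\<omega>. indicator {..t} (\<tau> (n + k) \<omega>) * drift (t - \<tau> (n + k) \<omega>) f (\<xi> (n + k) \<omega>) \<partial>W)"
proof (induction k arbitrary: n)
  case (Suc k)
  show ?case
    using after_jump_chain[OF jump_part_measurable[OF f, of k], of t n] Suc.IH[of "Suc n"] by simp
qed simp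

text \<open>
  The value \<open>f (X(t))\<close> on the event that exactly \<open>n\<close> jumps have occurred by time \<open>t\<close>.
\<close>

definition occupation :: "nat \<Rightarrow> real \<Rightarrow> ('a \<Rightarrow> ennreal) \<Rightarrow> 'w \<Rightarrow> ennreal" where
  "occupation n t f \<omega> = indicator {\<tau> n \<omega>..<\<tau> (Suc n) \<omega>} t * f (flow (t - \<tau> n \<omega>) (\<xi> n \<omega>))"

lemma occupation_measurable[measurable]:
  assumes [measurable]: "f \<in> borel_measurable M"
  shows "occupation n t f \<in> borel_measurable W"
proof -
  have "(\<lambda>\<omega>. if \<tau> n \<omega> \<le> t \<and> t < \<tau> (Suc n) \<omega> then f (flow (t - \<tau> n \<omega>) (\<xi> n \<omega>)) else 0) \<in> borel_measurable W"
    by measurable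
  also have "(\<lambda>\<omega>. if \<tau> n \<omega> \<le> t \<and> t < \<tau> (Suc n) \<omega> then f (flow (t - \<tau> n \<omega>) (\<xi> n \<omega>)) else 0) = occupation n t f"
    by (auto simp: occupation_def indicator_def)
  finally show ?thesis .
qed

lemma occupation_integral:
  assumes f[measurable]: "f \<in> borel_measurable M"
  shows "(\<integral>\<^sup>+\<omega>. occupation n t f \<omega> \<partial>W)
    = (\<integral>\<^sup>+\<omega>. indicator {..t} (\<tau> n \<omega>) * drift (t - \<tau> n \<omega>) f (\<xi> n \<omega>) \<partial>W)"
proof -
  note [measurable] = jump_chain_measurable[of n]
  \<comment> \<open>The jump that ends the stay is integrated out; its survival probability is the factor in \<open>drift\<close>.\<close>
  let ?h = "\<lambda>(\<omega>, s, y::'a). indicator {..t} (\<tau> n \<omega>) * f (flow (t - \<tau> n \<omega>) (\<xi> n \<omega>)) * (if t - \<tau> n \<omega> < s then 1 else 0)"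
  have hm: "?h \<in> borel_measurable (past n \<Otimes>\<^sub>M (borel \<Otimes>\<^sub>M M))" by measurable
  have "(\<integral>\<^sup>+\<omega>. occupation n t f \<omega> \<partial>W) = (\<integral>\<^sup>+\<omega>. ?h (\<omega>, \<Delta> (Suc n) \<omega>, \<xi> (Suc n) \<omega>) \<partial>W)"
    by (intro nn_integral_cong) (auto simp: occupation_def jump_time_Suc indicator_def)
  also have "\<dots> = (\<integral>\<^sup>+\<omega>. \<integral>\<^sup>+w. ?h (\<omega>, w) \<partial>jump_law (\<xi> n \<omega>) \<partial>W)" by (rule integrate_next_jump[OF hm])
  also have "\<dots> = (\<integral>\<^sup>+\<omega>. indicator {..t} (\<tau> n \<omega>) * drift (t - \<tau> n \<omega>) f (\<xi> n \<omega>) \<partial>W)"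
  proof (rule nn_integral_cong)
    fix \<omega> assume \<omega>: "\<omega> \<in> space W"
    note \<xi>E = post_jump_in[OF \<omega>]
    show "(\<integral>\<^sup>+w. ?h (\<omega>, w) \<partial>jump_law (\<xi> n \<omega>)) = indicator {..t} (\<tau> n \<omega>) * drift (t - \<tau> n \<omega>) f (\<xi> n \<omega>)"
    proof (cases "\<tau> n \<omega> \<le> t")
      case True
      have "(\<integral>\<^sup>+w. ?h (\<omega>, w) \<partial>jump_law (\<xi> n \<omega>))
        = (\<integral>\<^sup>+w. f (flow (t - \<tau> n \<omega>) (\<xi> n \<omega>)) * (indicator {t - \<tau> n \<omega><..} (fst w) * 1) \<partial>jump_law (\<xi> n \<omega>))"
        using True by (intro nn_integral_cong) (auto simp: indicator_def)
      also have "\<dots> = f (flow (t - \<tau> n \<omega>) (\<xi> n \<omega>)) * (\<integral>\<^sup>+w. indicator {t - \<tau> n \<omega><..} (fst w) * 1 \<partial>jump_law (\<xi> n \<omega>))"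
        by (rule nn_integral_cmult) measurable
      also have "(\<integral>\<^sup>+w. indicator {t - \<tau> n \<omega><..} (fst w) * 1 \<partial>jump_law (\<xi> n \<omega>)) = ennreal (exp (- \<Phi> (\<xi> n \<omega>) (t - \<tau> n \<omega>)))"
        using True prob_space.emeasure_space_1[OF prob_space_jump_law[OF flow_closed[OF \<xi>E]]]
        by (subst jump_law_shift[OF \<xi>E]) simp_all
      finally show ?thesis using True by (simp add: drift_def mult.commute)
    qed (simp add: case_prod_beta)
  qed
  finally show ?thesis .
qed

lemma pdmp_kernel_occupation:
  assumes f[measurable]: "f \<in> borel_measurable M" and t: "0 \<le> t"
  shows "pdmp_kernel t f x = (\<integral>\<^sup>+\<omega>. (\<Sum>n. occupation n t f \<omega>) \<partial>W)"
proof -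
  have "jump_part n t f x = (\<integral>\<^sup>+\<omega>. occupation n t f \<omega> \<partial>W)" for n
    using jump_part_chain[OF f, of t 0 n] t emeasure_space_1 by (simp add: occupation_integral)
  then show ?thesis unfolding pdmp_kernel_def by (simp add: nn_integral_suminf)
qed

lemma explosion_time_SUP: "\<omega> \<in> space W \<Longrightarrow> \<zeta> \<omega> = (\<Squnion>n. ereal (\<tau> n \<omega>))"
  and jump_time_LIMSEQ: "\<omega> \<in> space W \<Longrightarrow> (\<lambda>n. ereal (\<tau> n \<omega>)) \<longlonglongrightarrow> \<zeta> \<omega>"
proof -
  assume \<omega>: "\<omega> \<in> space W"
  have "(\<lambda>n. ereal (\<tau> n \<omega>)) \<longlonglongrightarrow> (\<Squnion>n. ereal (\<tau> n \<omega>))"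
    by (rule LIMSEQ_SUP) (auto simp: incseq_def jump_time_mono[OF \<omega>])
  then show "\<zeta> \<omega> = (\<Squnion>n. ereal (\<tau> n \<omega>))" "(\<lambda>n. ereal (\<tau> n \<omega>)) \<longlonglongrightarrow> \<zeta> \<omega>"
    unfolding explosion_time_def by (simp_all add: limI)
qed

lemma current_jump_unique:
  assumes \<omega>: "\<omega> \<in> space W" and "\<tau> i \<omega> \<le> t" "t < \<tau> (Suc i) \<omega>" "\<tau> j \<omega> \<le> t" "t < \<tau> (Suc j) \<omega>"
  shows "i = j"
proof (rule ccontr)
  assume "i \<noteq> j"
  then consider "Suc i \<le> j" | "Suc j \<le> i" by linarith
  then show False
    using jump_time_mono[OF \<omega>, of "Suc i" j] jump_time_mono[OF \<omega>, of "Suc j" i] assms by cases auto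
qed

lemma current_jump_exists:
  assumes \<omega>: "\<omega> \<in> space W" and t: "0 \<le> t" and lt: "ereal t < \<zeta> \<omega>"
  obtains n where "\<tau> n \<omega> \<le> t" "t < \<tau> (Suc n) \<omega>"
proof -
  from lt obtain k where k: "t < \<tau> k \<omega>" unfolding explosion_time_SUP[OF \<omega>] less_SUP_iff by auto
  \<comment> \<open>\<open>\<tau> 0 = 0 \<le> t\<close>, so the least index is a successor.\<close>
  define n where "n = (LEAST k. t < \<tau> k \<omega>)"
  have n: "t < \<tau> n \<omega>" unfolding n_def by (rule LeastI[of _ k]) (rule k)
  then obtain i where i: "n = Suc i" using t by (cases n) auto
  have "\<not> t < \<tau> i \<omega>" using not_less_Least[of i "\<lambda>k. t < \<tau> k \<omega>"] i by (simp add: n_def)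
  then show ?thesis using that[of i] n i by (simp add: not_less)
qed

lemma process_eq:
  assumes \<omega>: "\<omega> \<in> space W" and n: "\<tau> n \<omega> \<le> t" "t < \<tau> (Suc n) \<omega>"
  shows "X t \<omega> = Some (flow (t - \<tau> n \<omega>) (\<xi> n \<omega>))" and "ereal t < \<zeta> \<omega>"
proof -
  have "ereal t < ereal (\<tau> (Suc n) \<omega>)" using n by simp
  also have "\<dots> \<le> \<zeta> \<omega>" unfolding explosion_time_SUP[OF \<omega>] by (rule SUP_upper) simp
  finally show lt: "ereal t < \<zeta> \<omega>" .
  have "(THE n. \<tau> n \<omega> \<le> t \<and> t < \<tau> (Suc n) \<omega>) = n"
    using n current_jump_unique[OF \<omega>] by (intro the_equality) blast+
  then show "X t \<omega> = Some (flow (t - \<tau> n \<omega>) (\<xi> n \<omega>))"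
    using lt n by (simp add: pdmp_process_def flow_eq)
qed

lemma process_in_iff:
  assumes \<omega>: "\<omega> \<in> space W" and t: "0 \<le> t"
  shows "X t \<omega> \<in> Some ` B \<longleftrightarrow> (\<exists>n. \<tau> n \<omega> \<le> t \<and> t < \<tau> (Suc n) \<omega> \<and> flow (t - \<tau> n \<omega>) (\<xi> n \<omega>) \<in> B)"
proof
  assume X: "X t \<omega> \<in> Some ` B"
  then have "ereal t < \<zeta> \<omega>" by (auto simp: pdmp_process_def split: if_splits)
  from current_jump_exists[OF \<omega> t this] obtain n where n: "\<tau> n \<omega> \<le> t" "t < \<tau> (Suc n) \<omega>" .
  with X process_eq(1)[OF \<omega> n] show "\<exists>n. \<tau> n \<omega> \<le> t \<and> t < \<tau> (Suc n) \<omega> \<and> flow (t - \<tau> n \<omega>) (\<xi> n \<omega>) \<in> B"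
    by auto
next
  assume "\<exists>n. \<tau> n \<omega> \<le> t \<and> t < \<tau> (Suc n) \<omega> \<and> flow (t - \<tau> n \<omega>) (\<xi> n \<omega>) \<in> B"
  then show "X t \<omega> \<in> Some ` B" using process_eq(1)[OF \<omega>] by auto
qed

lemma occupation_sum:
  assumes \<omega>: "\<omega> \<in> space W" and t: "0 \<le> t"
  shows "(\<Sum>n. occupation n t (indicator B) \<omega>) = indicator {\<omega>. X t \<omega> \<in> Some ` B \<and> ereal t < \<zeta> \<omega>} \<omega>"
proof (cases "ereal t < \<zeta> \<omega>")
  case True
  from current_jump_exists[OF \<omega> t True] obtain n where n: "\<tau> n \<omega> \<le> t" "t < \<tau> (Suc n) \<omega>" .
  have "(\<Sum>k. occupation k t (indicator B) \<omega>) = (\<Sum>k\<in>{n}. occupation k t (indicator B) \<omega>)"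
  proof (rule suminf_finite)
    fix k assume "k \<notin> {n}"
    then show "occupation k t (indicator B) \<omega> = 0"
      using current_jump_unique[OF \<omega> n, of k] by (auto simp: occupation_def indicator_def)
  qed simp
  also have "\<dots> = indicator {\<omega>. X t \<omega> \<in> Some ` B \<and> ereal t < \<zeta> \<omega>} \<omega>"
    using n process_eq[OF \<omega> n] by (auto simp: occupation_def indicator_def)
  finally show ?thesis .
next
  case False
  then have "occupation k t (indicator B) \<omega> = 0" for k
    using process_eq(2)[OF \<omega>, of k t] by (auto simp: occupation_def indicator_def)
  then show ?thesis using False by simp
qed

lemma process_event:
  assumes B: "B \<in> sets M" and T: "T \<in> borel_measurable W" and Tn: "\<And>\<omega>. \<omega> \<in> space W \<Longrightarrow> 0 \<le> T \<omega>"
  shows "{\<omega> \<in> space W. X (T \<omega>) \<omega> \<in> Some ` B} \<in> sets W"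
proof -
  note [measurable] = B T
  have "{\<omega> \<in> space W. X (T \<omega>) \<omega> \<in> Some ` B}
    = (\<Union>n. {\<omega> \<in> space W. \<tau> n \<omega> \<le> T \<omega> \<and> T \<omega> < \<tau> (Suc n) \<omega> \<and> flow (T \<omega> - \<tau> n \<omega>) (\<xi> n \<omega>) \<in> B})"
    using process_in_iff[OF _ Tn] by blast
  also have "\<dots> \<in> sets W" by measurable
  finally show ?thesis .
qed

text \<open>
  Before the explosion time exactly one stay between consecutive jumps contains \<open>t\<close>, so the
  occupations of the indicator of \<open>B\<close> add up to the indicator of the event.
\<close>

theorem process_law:
  assumes B: "B \<in> sets M" and t: "0 \<le> t"
  shows "ennreal (measure W {\<omega> \<in> space W. X t \<omega> \<in> Some ` B \<and> ereal t < \<zeta> \<omega>}) = pdmp_kernel t (indicator B) x"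
proof -
  let ?A = "{\<omega> \<in> space W. X t \<omega> \<in> Some ` B \<and> ereal t < \<zeta> \<omega>}"
  have "?A = {\<omega> \<in> space W. X t \<omega> \<in> Some ` B}"
    by (auto simp: pdmp_process_def split: if_splits)
  then have A: "?A \<in> sets W" using process_event[OF B, of "\<lambda>_. t"] t by simp
  have "pdmp_kernel t (indicator B) x = (\<integral>\<^sup>+\<omega>. indicator ?A \<omega> \<partial>W)"
    using B t by (subst pdmp_kernel_occupation)
      (auto intro!: nn_integral_cong simp: occupation_sum indicator_def)
  then show ?thesis using A by (simp add: emeasure_eq_measure)
qed

lemma exp_neg_limit:
  assumes a: "a \<longlonglongrightarrow> b" and fin: "\<And>n. a n = ereal (r n)" and nn: "\<And>n. 0 \<le> r n"
  shows "(\<lambda>n. exp (- r n)) \<longlonglongrightarrow> exp_neg b"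
proof (cases b)
  case (real c)
  then have "r \<longlonglongrightarrow> c" using a unfolding fin[abs_def] by simp
  then show ?thesis using real by (auto simp: exp_neg_def intro!: tendsto_intros)
next
  case PInf
  then have "filterlim r at_top sequentially" using a unfolding fin[abs_def] by (simp add: tendsto_PInfty_eq_at_top)
  then have "(\<lambda>n. exp (- r n)) \<longlonglongrightarrow> 0"
    by (intro filterlim_compose[OF exp_at_bot]) (simp add: filterlim_uminus_at_bot)
  then show ?thesis using PInf by (simp add: exp_neg_def)
next
  case MInf
  have "0 \<le> b" by (rule LIMSEQ_le_const[OF a]) (simp add: fin nn)
  then show ?thesis using MInf by simp
qed

text \<open>
  Dominated convergence; on explosion-free paths the discount factors tend to \<open>0\<close>, which is the
  convention for \<open>exp_neg \<infinity>\<close>.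
\<close>

theorem discounted_chain_limit:
  assumes l: "0 < l"
  shows "(\<lambda>n. enn2real ((discounted_jump l ^^ n) (\<lambda>_. 1) x)) \<longlonglongrightarrow> (\<integral>\<omega>. exp_neg (ereal l * \<zeta> \<omega>) \<partial>W)"
proof -
  have eq: "enn2real ((discounted_jump l ^^ n) (\<lambda>_. 1) x) = (\<integral>\<omega>. exp (- (l * \<tau> n \<omega>)) \<partial>W)" for n
  proof -
    have "ennreal (\<integral>\<omega>. exp (- (l * \<tau> n \<omega>)) \<partial>W) = (\<integral>\<^sup>+\<omega>. ennreal (exp (- (l * \<tau> n \<omega>))) \<partial>W)"
    proof (rule nn_integral_eq_integral[symmetric])
      show "integrable W (\<lambda>\<omega>. exp (- (l * \<tau> n \<omega>)))"
        using l jump_time_nonneg by (intro integrable_const_bound[of _ 1]) (auto intro!: AE_I2)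
    qed simp
    also have "\<dots> = (discounted_jump l ^^ n) (\<lambda>_. 1) x"
      using discounted_chain[of "\<lambda>_. 1" l n] by simp
    finally show ?thesis by (metis enn2real_ennreal integral_nonneg_AE AE_I2 exp_ge_zero)
  qed
  have lim: "(\<lambda>n. exp (- (l * \<tau> n \<omega>))) \<longlonglongrightarrow> exp_neg (ereal l * \<zeta> \<omega>)" if \<omega>: "\<omega> \<in> space W" for \<omega>
  proof (rule exp_neg_limit)
    show "(\<lambda>n. ereal l * ereal (\<tau> n \<omega>)) \<longlonglongrightarrow> ereal l * \<zeta> \<omega>"
      by (intro tendsto_cmult_ereal jump_time_LIMSEQ \<omega>) simp
  qed (use l jump_time_nonneg[OF \<omega>] in auto)
  show ?thesis
    unfolding eq
  proof (rule integral_dominated_convergence[where w="\<lambda>_. 1"])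
    show "AE \<omega> in W. (\<lambda>n. exp (- (l * \<tau> n \<omega>))) \<longlonglongrightarrow> exp_neg (ereal l * \<zeta> \<omega>)"
      using lim by (rule AE_I2)
    show "AE \<omega> in W. norm (exp (- (l * \<tau> n \<omega>))) \<le> 1" for n
      using l jump_time_nonneg by (auto intro!: AE_I2)
    show "(\<lambda>\<omega>. exp_neg (ereal l * \<zeta> \<omega>)) \<in> borel_measurable W"
      by (rule borel_measurable_LIMSEQ_metric[OF _ lim]) simp_all
  qed simp_all
qed

section \<open>The embedded Markov chain\<close>

lemma eps_pos: "AE \<omega> in W. 0 < \<epsilon> (Suc n) \<omega>"
proof -
  have m: "\<epsilon> (Suc n) \<in> W \<rightarrow>\<^sub>M borel" using driver_measurable[of "Inl (Suc n)"] by auto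
  have "emeasure std_exponential {0<..} = 1" using std_exponential_tail[of 0] by simp
  then have "emeasure W (\<epsilon> (Suc n) -` {0<..} \<inter> space W) = 1"
    unfolding distr_eps[of "Suc n", simplified, symmetric] using m by (simp add: emeasure_distr)
  then have "AE \<omega> in W. \<omega> \<in> \<epsilon> (Suc n) -` {0<..} \<inter> space W"
    by (intro AE_prob_1) (simp add: emeasure_eq_measure)
  then show ?thesis by eventually_elim simp
qed

text \<open>
  Almost surely all waiting times are positive, so the process sits at \<open>\<xi> n\<close> at the \<open>n\<close>-th jump
  time. Where an exponential variable is not positive, several jumps may coincide.
\<close>

lemma process_at_jump: "AE \<omega> in W. X (\<tau> n \<omega>) \<omega> = Some (\<xi> n \<omega>)"
  using eps_pos[of n] AE_space
proof eventually_elim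
  case (elim \<omega>)
  have "0 < \<Delta> (Suc n) \<omega>" unfolding waiting_time_Suc
    by (rule cum_rate_inv_pos[OF post_jump_in[OF elim(2)] elim(1)])
  then have "\<tau> n \<omega> < \<tau> (Suc n) \<omega>" by (simp add: jump_time_Suc)
  from process_eq(1)[OF elim(2) order_refl this]
  show ?case using flow_0[OF post_jump_in[OF elim(2)]] by (simp add: flow_eq)
qed

abbreviation "Y n \<omega> \<equiv> X (\<tau> n \<omega>) \<omega>"

lemma chain_event: "B \<in> sets M \<Longrightarrow> {\<omega> \<in> space W. Y n \<omega> \<in> Some ` B} \<in> sets W"
  by (rule process_event) (auto intro: jump_time_nonneg)

lemma process_cases: "\<omega> \<in> space W \<Longrightarrow> 0 \<le> t \<Longrightarrow> X t \<omega> \<in> Some ` E \<or> X t \<omega> = None"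
proof (cases "ereal t < \<zeta> \<omega>")
  case True
  assume \<omega>: "\<omega> \<in> space W" and t: "0 \<le> t"
  from current_jump_exists[OF \<omega> t True] obtain n where "\<tau> n \<omega> \<le> t" "t < \<tau> (Suc n) \<omega>" .
  from process_eq(1)[OF \<omega> this] show ?thesis using flow_closed[OF post_jump_in[OF \<omega>]] by auto
qed (simp add: pdmp_process_def)

abbreviation "H n \<equiv> history W M Y n"

lemma space_history: "space (H n) = space W"
  by (simp add: history_def space_measure_of_conv)

lemma sets_history: "sets (H n) = sigma_sets (space W) {Y i -` (Some ` B) \<inter> space W | i B. i \<le> n \<and> B \<in> sets M}"
  unfolding history_def by (rule sets_measure_of) auto

lemma chain_event': "B \<in> sets M \<Longrightarrow> Y n -` (Some ` B) \<inter> space W \<in> sets W"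
  using chain_event[of B n] by (simp add: vimage_def Collect_conj_eq Int_commute)

lemma subalgebra_history: "subalgebra W (H n)"
  unfolding subalgebra_def
proof
  show "sets (H n) \<subseteq> sets W"
    unfolding sets_history by (rule sets.sigma_sets_subset) (auto intro: chain_event')
qed (rule space_history)

text \<open>
  The history of \<open>Y\<close> need not be contained in the past of the driving variables, because at coinciding
  jump times \<open>Y\<close> looks at later variables. It is contained in it up to null sets.
\<close>

lemma history_approx:
  assumes "A \<in> sets (H n)"
  shows "\<exists>A'\<in>sets (past n). AE \<omega> in W. \<omega> \<in> A \<longleftrightarrow> \<omega> \<in> A'"
  using assms unfolding sets_history
proof (induction rule: sigma_sets.induct)
  case (Basic a)
  then obtain i B where i: "i \<le> n" and B: "B \<in> sets M" and a: "a = Y i -` (Some ` B) \<inter> space W" by auto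
  have "\<xi> i \<in> past n \<rightarrow>\<^sub>M M"
    by (rule measurable_compose[OF driver_algebra_mono jump_chain_measurable(1)]) (use i in \<open>auto simp: drivers_upto_def\<close>)
  from measurable_sets[OF this B] have "\<xi> i -` B \<inter> space W \<in> sets (past n)" by simp
  moreover have "AE \<omega> in W. \<omega> \<in> a \<longleftrightarrow> \<omega> \<in> \<xi> i -` B \<inter> space W"
    using process_at_jump[of i] by eventually_elim (auto simp: a)
  ultimately show ?case by blast
next
  case Empty
  then show ?case by (intro bexI[of _ "{}"]) auto
next
  case (Compl a)
  then obtain A' where A': "A' \<in> sets (past n)" "AE \<omega> in W. \<omega> \<in> a \<longleftrightarrow> \<omega> \<in> A'" by blast
  from A'(2) have "AE \<omega> in W. \<omega> \<in> space W - a \<longleftrightarrow> \<omega> \<in> space W - A'" by eventually_elim simp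
  moreover have "space W - A' \<in> sets (past n)" using sets.compl_sets[OF A'(1)] by simp
  ultimately show ?case by (rule bexI)
next
  case (Union a)
  then obtain A' where A': "\<And>i. A' i \<in> sets (past n)" "\<And>i. AE \<omega> in W. \<omega> \<in> a i \<longleftrightarrow> \<omega> \<in> A' i" by metis
  then have "AE \<omega> in W. \<forall>i. \<omega> \<in> a i \<longleftrightarrow> \<omega> \<in> A' i" by (simp add: AE_all_countable)
  then have "AE \<omega> in W. \<omega> \<in> (\<Union>i. a i) \<longleftrightarrow> \<omega> \<in> (\<Union>i. A' i)" by eventually_elim (simp only: UN_iff)
  moreover have "(\<Union>i. A' i) \<in> sets (past n)" using A'(1) by (intro sets.countable_UN) auto
  ultimately show ?case by (rule bexI)
qed

lemma embedded_kernel_history_measurable: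
  assumes B: "B \<in> sets M"
  shows "(\<lambda>\<omega>. embedded_kernel \<pi> \<phi> J (the (Y n \<omega>)) B) \<in> borel_measurable (H n)"
proof (subst borel_measurable_iff_le, intro allI)
  fix a
  let ?N = "\<lambda>y. embedded_kernel \<pi> \<phi> J y B"
  have Nm: "?N \<in> borel_measurable M" using stochastic_embedded_kernel B by (simp add: stochastic_kernel_def)
  have gen: "Y n -` (Some ` C) \<inter> space W \<in> sets (H n)" if "C \<in> sets M" for C
    unfolding sets_history using that by (intro sigma_sets.Basic) blast
  have C: "{y \<in> E. ?N y \<le> a} \<in> sets M" using Nm unfolding borel_measurable_iff_le by simp
  have "E \<in> sets M" using sets.top[of M] by simp
  \<comment> \<open>At the cemetery the kernel is evaluated at \<open>the None\<close>, an unspecified but fixed point.\<close>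
  let ?S = "if ?N (the None) \<le> a then space W - (Y n -` (Some ` E) \<inter> space W) else {}"
  have "{\<omega> \<in> space (H n). ?N (the (Y n \<omega>)) \<le> a} = (Y n -` (Some ` {y \<in> E. ?N y \<le> a}) \<inter> space W) \<union> ?S"
  proof -
    have "(\<omega> \<in> space (H n) \<and> ?N (the (Y n \<omega>)) \<le> a) \<longleftrightarrow> \<omega> \<in> (Y n -` (Some ` {y \<in> E. ?N y \<le> a}) \<inter> space W) \<union> ?S" for \<omega>
    proof (cases "\<omega> \<in> space W")
      case True
      then have c: "Y n \<omega> \<in> Some ` E \<or> Y n \<omega> = None" by (intro process_cases jump_time_nonneg)
      show ?thesis
      proof (cases "Y n \<omega>")
        case None then show ?thesis using True by (simp add: space_history)
      next
        case (Some y)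
        then have "y \<in> E" using c by auto
        then show ?thesis using True Some by (simp add: space_history image_iff)
      qed
    qed (simp add: space_history)
    then show ?thesis by blast
  qed
  also have "\<dots> \<in> sets (H n)"
  proof (rule sets.Un[OF gen[OF C]])
    have "space W - (Y n -` (Some ` E) \<inter> space W) \<in> sets (H n)"
      using sets.compl_sets[OF gen[OF \<open>E \<in> sets M\<close>]] by (simp only: space_history)
    then show "?S \<in> sets (H n)" by simp
  qed
  finally show "{\<omega> \<in> space (H n). ?N (the (Y n \<omega>)) \<le> a} \<in> sets (H n)" .
qed

lemma chain_step:
  assumes A: "A \<in> sets (past n)" and B[measurable]: "B \<in> sets M"
  shows "(\<integral>\<^sup>+\<omega>. indicator A \<omega> * indicator B (\<xi> (Suc n) \<omega>) \<partial>W)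
     = (\<integral>\<^sup>+\<omega>. indicator A \<omega> * ennreal (embedded_kernel \<pi> \<phi> J (\<xi> n \<omega>) B) \<partial>W)"
proof -
  let ?h = "\<lambda>(\<omega>, s::real, y). indicator A \<omega> * indicator B y :: ennreal"
  note [measurable] = A
  have hm: "?h \<in> borel_measurable (past n \<Otimes>\<^sub>M (borel \<Otimes>\<^sub>M M))" by measurable
  have "(\<integral>\<^sup>+\<omega>. ?h (\<omega>, \<Delta> (Suc n) \<omega>, \<xi> (Suc n) \<omega>) \<partial>W) = (\<integral>\<^sup>+\<omega>. \<integral>\<^sup>+w. ?h (\<omega>, w) \<partial>jump_law (\<xi> n \<omega>) \<partial>W)"
    by (rule integrate_next_jump[OF hm])
  also have "\<dots> = (\<integral>\<^sup>+\<omega>. indicator A \<omega> * ennreal (embedded_kernel \<pi> \<phi> J (\<xi> n \<omega>) B) \<partial>W)"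
  proof (rule nn_integral_cong)
    fix \<omega> assume \<omega>: "\<omega> \<in> space W"
    have "(\<integral>\<^sup>+w. ?h (\<omega>, w) \<partial>jump_law (\<xi> n \<omega>)) = (\<integral>\<^sup>+w. indicator A \<omega> * indicator B (snd w) \<partial>jump_law (\<xi> n \<omega>))"
      by (intro nn_integral_cong) (simp add: case_prod_beta)
    also have "\<dots> = indicator A \<omega> * (\<integral>\<^sup>+w. indicator B (snd w) \<partial>jump_law (\<xi> n \<omega>))"
      by (rule nn_integral_cmult) measurable
    also have "(\<integral>\<^sup>+w. indicator B (snd w) \<partial>jump_law (\<xi> n \<omega>)) = ennreal (embedded_kernel \<pi> \<phi> J (\<xi> n \<omega>) B)"
      unfolding embedded_kernel_eq(1)[OF post_jump_in[OF \<omega>] B, symmetric] by (simp add: discounted_jump_def)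
    finally show "(\<integral>\<^sup>+w. ?h (\<omega>, w) \<partial>jump_law (\<xi> n \<omega>)) = indicator A \<omega> * ennreal (embedded_kernel \<pi> \<phi> J (\<xi> n \<omega>) B)" .
  qed
  finally show ?thesis by simp
qed

lemma embedded_kernel_bounds:
  assumes "y \<in> E" "B \<in> sets M" shows "0 \<le> embedded_kernel \<pi> \<phi> J y B" "embedded_kernel \<pi> \<phi> J y B \<le> 1"
proof -
  show "0 \<le> embedded_kernel \<pi> \<phi> J y B" by (rule embedded_kernel_eq(2)[OF assms])
  from stochastic_embedded_kernel assms obtain \<mu> where "prob_space \<mu>" "embedded_kernel \<pi> \<phi> J y B = Sigma_Algebra.measure \<mu> B"
    unfolding stochastic_kernel_def by force
  then show "embedded_kernel \<pi> \<phi> J y B \<le> 1" using prob_space.prob_le_1 by metis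
qed

text \<open>
  The conditional expectation is tested on an event of the history, which may be replaced by an event
  of the past of the driving variables; there one step of the chain is an integration against the
  law of the next jump.
\<close>

theorem embedded_chain_markov:
  "markov_process_with_kernel W M (\<lambda>n \<omega>. X (\<tau> n \<omega>) \<omega>) (embedded_kernel \<pi> \<phi> J)"
  unfolding markov_process_with_kernel_def
proof (intro conjI allI ballI stochastic_embedded_kernel)
  show "Y n -` Some ` B \<inter> space W \<in> sets W" if "B \<in> sets M" for n B by (rule chain_event'[OF that])
  show "AE \<omega> in W. Y n \<omega> \<in> Some ` space M" for n
    using process_at_jump[of n] AE_space by eventually_elim (auto simp: post_jump_in)
  fix n B assume B: "B \<in> sets M"
  interpret fs: finite_measure_subalgebra W "H n"
    by (intro finite_measure_subalgebra.intro finite_measure_subalgebra_axioms.intro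
        finite_measure_axioms subalgebra_history)
  let ?Z = "Y (Suc n) -` Some ` B \<inter> space W"
  let ?g = "\<lambda>\<omega>. embedded_kernel \<pi> \<phi> J (the (Y n \<omega>)) B"
  have Z: "?Z \<in> sets W" by (rule chain_event'[OF B])
  have gH: "?g \<in> borel_measurable (H n)" by (rule embedded_kernel_history_measurable[OF B])
  have gW: "?g \<in> borel_measurable W" by (rule measurable_from_subalg[OF subalgebra_history gH])
  have geq: "AE \<omega> in W. ?g \<omega> = embedded_kernel \<pi> \<phi> J (\<xi> n \<omega>) B"
    using process_at_jump[of n] by eventually_elim simp
  have gbd: "AE \<omega> in W. 0 \<le> ?g \<omega> \<and> ?g \<omega> \<le> 1"
    using geq AE_space by eventually_elim (simp add: embedded_kernel_bounds[OF post_jump_in B])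
  have gint: "integrable W ?g"
    using gbd gW by (intro integrable_const_bound[of _ 1]) (auto elim: eventually_mono)
  show "AE \<omega> in W. real_cond_exp W (H n) (indicator ?Z) \<omega> = ?g \<omega>"
  proof (rule fs.real_cond_exp_charact)
    show "integrable W (indicator ?Z :: _ \<Rightarrow> real)" using Z by (simp add: emeasure_eq_measure)
    show "integrable W ?g" by (rule gint)
    show "?g \<in> borel_measurable (H n)" by (rule gH)
    fix A assume A: "A \<in> sets (H n)"
    have AW: "A \<in> sets W" using A subalgebra_history by (auto simp: subalgebra_def)
    from history_approx[OF A] obtain A' where A': "A' \<in> sets (past n)" "AE \<omega> in W. \<omega> \<in> A \<longleftrightarrow> \<omega> \<in> A'" by blast
    have "ennreal (LINT \<omega>:A|W. indicator ?Z \<omega>) = (\<integral>\<^sup>+\<omega>. ennreal (indicator A \<omega> * indicator ?Z \<omega>) \<partial>W)"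
      unfolding set_lebesgue_integral_def real_scaleR_def
      using AW Z by (intro nn_integral_eq_integral[symmetric] L1_indicator_integrable)
        (auto simp: L1_def emeasure_eq_measure)
    also have "\<dots> = (\<integral>\<^sup>+\<omega>. indicator A' \<omega> * indicator B (\<xi> (Suc n) \<omega>) \<partial>W)"
    proof (rule nn_integral_cong_AE)
      show "AE \<omega> in W. ennreal (indicator A \<omega> * indicator ?Z \<omega>) = indicator A' \<omega> * indicator B (\<xi> (Suc n) \<omega>)"
        using A'(2) process_at_jump[of "Suc n"] AE_space
        by eventually_elim (auto simp: indicator_def simp del: post_jump.simps)
    qed
    also have "\<dots> = (\<integral>\<^sup>+\<omega>. indicator A' \<omega> * ennreal (embedded_kernel \<pi> \<phi> J (\<xi> n \<omega>) B) \<partial>W)"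
      by (rule chain_step[OF A'(1) B])
    also have "\<dots> = (\<integral>\<^sup>+\<omega>. ennreal (indicator A \<omega> * ?g \<omega>) \<partial>W)"
    proof (rule nn_integral_cong_AE)
      show "AE \<omega> in W. indicator A' \<omega> * ennreal (embedded_kernel \<pi> \<phi> J (\<xi> n \<omega>) B) = ennreal (indicator A \<omega> * ?g \<omega>)"
        using A'(2) geq by eventually_elim (auto simp: indicator_def)
    qed
    also have "\<dots> = ennreal (LINT \<omega>:A|W. ?g \<omega>)"
      unfolding set_lebesgue_integral_def real_scaleR_def
      using AW gint gbd by (intro nn_integral_eq_integral L1_indicator_integrable)
        (auto elim!: eventually_mono simp: L1_def indicator_def)
    finally have "ennreal (LINT \<omega>:A|W. indicator ?Z \<omega>) = ennreal (LINT \<omega>:A|W. ?g \<omega>)" .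
    moreover have "0 \<le> (LINT \<omega>:A|W. indicator ?Z \<omega> :: real)"
      unfolding set_lebesgue_integral_def by (intro integral_nonneg_AE AE_I2) (auto simp: indicator_def)
    moreover have "0 \<le> (LINT \<omega>:A|W. ?g \<omega>)"
      unfolding set_lebesgue_integral_def using gbd by (intro integral_nonneg_AE) (auto elim!: eventually_mono simp: indicator_def)
    ultimately show "(LINT \<omega>:A|W. indicator ?Z \<omega>) = (LINT \<omega>:A|W. ?g \<omega>)" by simp
  qed
qed

end

end

section \<open>The operators on integrable functions as preduals\<close>

locale pdmp_with_semigroup =
  pdmp_construction E \<pi> \<phi> J W \<kappa> \<epsilon> \<theta> + sg: pdmp_semigroup E \<pi> \<phi> J m P S
  for E :: "'a::polish_space set" and \<pi> \<phi> J and W :: "'w measure" and \<kappa> \<epsilon> \<theta> m P S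
begin

lemmas sets_m = sg.sets_m

lemma sets_M: "sets M = sets m" by (simp add: sets_m)

lemma space_m: "space m = E" using sets_eq_imp_space_eq[OF sets_m] by simp

lemma measurable_m: "borel_measurable m = borel_measurable M"
  by (rule measurable_cong_sets[OF sets_m refl])

lemmas kernel_m = kernel_operator_sets_cong[OF sets_M]

lemmas S_semigroup = sg.S_substochastic

lemma rate_borel_m: "\<phi> \<in> borel_measurable m"
  unfolding measurable_m by (rule rate_measurable)

lemma predual_drift:
  assumes t: "0 \<le> t" shows "predual_of m (drift t) (S t)"
  unfolding predual_of_def
proof (intro conjI ballI)
  show "L1_operator m (S t)" by (rule semigroupD(1)[OF S_semigroup t])
  fix u assume u: "u \<in> L1_pos m"
  show Su: "S t u \<in> L1_pos m" by (rule semigroupD(2)[OF S_semigroup t u])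
  fix f :: "'a \<Rightarrow> ennreal" assume f: "f \<in> borel_measurable m"
  show "(\<integral>\<^sup>+x. f x * ennreal (S t u x) \<partial>m) = (\<integral>\<^sup>+x. drift t f x * ennreal (u x) \<partial>m)"
  proof (rule dual_of_indicators[OF kernel_m[OF kernel_operator_drift] u Su _ f])
    fix B assume B: "B \<in> sets m"
    then have BM: "B \<in> sets M" by (simp add: sets_m)
    have bound: "(indicator B x :: ennreal) \<le> ennreal 1" for x by (simp add: indicator_def)
    have iB: "indicator B \<in> borel_measurable m" using B by simp
    have "(\<integral>\<^sup>+x. drift t (indicator B) x * ennreal (u x) \<partial>m)
      = ennreal (\<integral>x. enn2real (drift t (indicator B) x) * u x \<partial>m)"
      by (rule kernel_finite_integral(3)[OF kernel_m[OF kernel_operator_drift] u iB bound])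
    also have "(\<integral>x. enn2real (drift t (indicator B) x) * u x \<partial>m)
      = (\<integral>x. exp (- cum_rate \<pi> \<phi> x t) * indicator B (\<pi> t x) * u x \<partial>m)"
      using t by (intro Bochner_Integration.integral_cong) (auto simp: drift_def flow_eq enn2real_mult indicator_def)
    also have "\<dots> = (LINT x:B|m. S t u x)" by (rule sg.S_formula[OF t u BM])
    also have "ennreal \<dots> = (\<integral>\<^sup>+x. indicator B x * ennreal (S t u x) \<partial>m)"
      by (rule L1_pos_set_integral(1)[OF Su B, symmetric])
    finally show "(\<integral>\<^sup>+x. indicator B x * ennreal (S t u x) \<partial>m) = (\<integral>\<^sup>+x. drift t (indicator B) x * ennreal (u x) \<partial>m)" ..
  qed
qed

lemma P_stochastic: "L1_operator m P" "u \<in> densities m \<Longrightarrow> P u \<in> densities m"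
  "u \<in> densities m \<Longrightarrow> B \<in> sets m \<Longrightarrow> (\<integral>x. J x B * u x \<partial>m) = (LINT x:B|m. P u x)"
  using sg.P_transition by (auto simp: transition_operator_def stochastic_operator_def)

text \<open>
  The transition operator is given on densities only, so a nonnegative element is first divided by
  its norm. If the norm is zero, the value of \<open>P\<close> is zero by linearity.
\<close>

lemma predual_jump: "predual_of m jump_operator P"
  unfolding predual_of_def
proof (intro conjI ballI P_stochastic)
  note kj = kernel_m[OF kernel_operator_jump]
  fix u assume u: "u \<in> L1_pos m"
  define c where "c = L1_norm m u"
  have c: "0 \<le> c" by (simp add: c_def L1_norm_nonneg)
  have uL: "u \<in> L1 m" by (rule L1_pos_L1[OF u])
  obtain v where v: "v \<in> L1_pos m" "P v \<in> L1_pos m" "AE x in m. u x = c * v x"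
    "c > 0 \<Longrightarrow> v \<in> densities m"
  proof (cases "c = 0")
    case True
    have z: "(\<lambda>_. 0) \<in> L1 m" by (simp add: L1_def)
    have "AE x in m. u x = 0" by (rule AE_eq_of_L1_norm[OF uL z]) (use True in \<open>simp add: c_def\<close>)
    moreover have "AE x in m. P (\<lambda>_. 0) x = 0"
      using L1_operator_cmult[OF P_stochastic(1) z, of 0] by simp
    then have "P (\<lambda>_. 0) \<in> L1_pos m"
      using L1_operatorD(1)[OF P_stochastic(1) z] by (auto simp: L1_pos_def elim: eventually_mono)
    ultimately show ?thesis using True z by (intro that[of "\<lambda>_. 0"]) (auto simp: L1_pos_def)
  next
    case False
    then have cp: "0 < c" using c by simp
    have "(\<lambda>x. (1 / c) * u x) \<in> densities m"
    proof -
      have "L1_norm m (\<lambda>x. (1 / c) * u x) = 1"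
        unfolding L1_norm_cmult using cp by (simp add: c_def[symmetric])
      then show ?thesis using u cp by (auto simp: densities_def L1_pos_def L1_def elim!: eventually_mono)
    qed
    moreover from this have "P (\<lambda>x. (1 / c) * u x) \<in> L1_pos m" using P_stochastic(2) by (auto simp: densities_def)
    ultimately show ?thesis using cp by (intro that[of "\<lambda>x. (1 / c) * u x"]) (auto simp: densities_def)
  qed
  have vL: "v \<in> L1 m" by (rule L1_pos_L1[OF v(1)])
  have cvL: "(\<lambda>x. c * v x) \<in> L1 m" using vL by (simp add: L1_def)
  have Pu: "AE x in m. P u x = c * P v x"
    using L1_operatorD(2)[OF P_stochastic(1) uL cvL v(3)] L1_operator_cmult[OF P_stochastic(1) vL, of c] by eventually_elim simp
  have PuL: "P u \<in> L1 m" by (rule L1_operatorD(1)[OF P_stochastic(1) uL])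
  have "AE x in m. 0 \<le> P v x" using v(2) by (simp add: L1_pos_def)
  then have "AE x in m. 0 \<le> P u x" using Pu by eventually_elim (simp add: c)
  then show Pup: "P u \<in> L1_pos m" using PuL by (simp add: L1_pos_def)
  fix f :: "'a \<Rightarrow> ennreal" assume f: "f \<in> borel_measurable m"
  show "(\<integral>\<^sup>+x. f x * ennreal (P u x) \<partial>m) = (\<integral>\<^sup>+x. jump_operator f x * ennreal (u x) \<partial>m)"
  proof (rule dual_of_indicators[OF kj u Pup _ f])
    fix B assume B: "B \<in> sets m"
    then have BM: "B \<in> sets M" by (simp add: sets_m)
    have iB: "indicator B \<in> borel_measurable m" using B by simp
    have bound: "(indicator B x :: ennreal) \<le> ennreal 1" for x by (simp add: indicator_def)
    have PuB: "(LINT x:B|m. P u x) = c * (LINT x:B|m. P v x)"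
    proof -
      have "(LINT x:B|m. P u x) = (\<integral>x. c * (indicator B x * P v x) \<partial>m)"
        unfolding set_lebesgue_integral_def
        using Pu L1_indicator_integrable[OF PuL B] L1_indicator_integrable[OF L1_pos_L1[OF v(2)] B]
        by (intro integral_cong_AE) (auto elim!: eventually_mono)
      then show ?thesis by (simp add: set_lebesgue_integral_def)
    qed
    have ju: "(\<integral>x. enn2real (jump_operator (indicator B) x) * u x \<partial>m) = c * (\<integral>x. J x B * v x \<partial>m)"
    proof -
      have [measurable]: "jump_operator (indicator B) \<in> borel_measurable m" using kernel_operator_measurable[OF kj iB] .
      have "(\<integral>x. enn2real (jump_operator (indicator B) x) * u x \<partial>m) = (\<integral>x. enn2real (jump_operator (indicator B) x) * (c * v x) \<partial>m)"
        using v(3) uL vL by (intro integral_cong_AE) (auto simp: L1_def elim!: eventually_mono)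
      also have "\<dots> = (\<integral>x. c * (J x B * v x) \<partial>m)"
        using jump_operator_indicator[OF _ BM] kappa_kernel[OF _ BM]
        by (intro Bochner_Integration.integral_cong) (auto simp: space_m)
      finally show ?thesis by simp
    qed
    have "(\<integral>x. enn2real (jump_operator (indicator B) x) * u x \<partial>m) = (LINT x:B|m. P u x)"
      unfolding ju PuB using P_stochastic(3)[OF v(4) B] c by (cases "c = 0") auto
    then show "(\<integral>\<^sup>+x. indicator B x * ennreal (P u x) \<partial>m) = (\<integral>\<^sup>+x. jump_operator (indicator B) x * ennreal (u x) \<partial>m)"
      using kernel_finite_integral(3)[OF kj u iB bound] L1_pos_set_integral(1)[OF Pup B] by simp
  qed
qed

lemma kernel_family_m: "kernel_family M V \<Longrightarrow> kernel_family m V"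
  by (rule kernel_family_sets_cong[OF sets_M])

lemma laplace_kernel_predual:
  assumes V: "kernel_family M V" and l: "0 < l"
    and dual: "\<And>t. 0 \<le> t \<Longrightarrow> predual_of m (V t) (Q t)"
  shows "predual_of m (laplace_kernel l V) (predual m (laplace_kernel l V))"
proof (rule sg.predual_of_predual)
  show "kernel_operator m (1 / l) (laplace_kernel l V)" by (rule kernel_operator_laplace[OF kernel_family_m[OF V] l])
  fix B and u :: "'a \<Rightarrow> real" assume B: "B \<in> null_sets m" and u: "u \<in> L1_pos m"
  have iB: "indicator B \<in> borel_measurable m" using null_setsD2[OF B] by simp
  have um: "u \<in> borel_measurable m" using u by (auto simp: L1_pos_def L1_def)
  have z: "(\<integral>\<^sup>+x. V t (indicator B) x * ennreal (u x) \<partial>m) = 0" if t: "0 \<le> t" for t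
  proof -
    have "(\<integral>\<^sup>+x. V t (indicator B) x * ennreal (u x) \<partial>m) = (\<integral>\<^sup>+x. indicator B x * ennreal (Q t u x) \<partial>m)"
      using predual_ofD(3)[OF dual[OF t] u iB] by simp
    also have "\<dots> = (\<integral>\<^sup>+x. 0 \<partial>m)"
      using AE_not_in[OF B] by (intro nn_integral_cong_AE) (auto elim: eventually_mono)
    finally show ?thesis by simp
  qed
  have "(\<integral>\<^sup>+x. laplace_kernel l V (indicator B) x * ennreal (u x) \<partial>m) = (\<integral>\<^sup>+t. 0 \<partial>(lborel :: real measure))"
    unfolding sg.laplace_kernel_dual[OF kernel_family_m[OF V] um iB]
    using z by (intro nn_integral_cong) (auto simp: indicator_def)
  then show "(\<integral>\<^sup>+x. laplace_kernel l V (indicator B) x * ennreal (u x) \<partial>m) = 0" by simp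
qed

definition drift_resolvent :: "real \<Rightarrow> ('a \<Rightarrow> real) \<Rightarrow> 'a \<Rightarrow> real" where
  "drift_resolvent l = predual m (laplace_kernel l drift)"

lemma predual_drift_resolvent: "0 < l \<Longrightarrow> predual_of m (laplace_kernel l drift) (drift_resolvent l)"
  unfolding drift_resolvent_def by (rule laplace_kernel_predual[OF kernel_family_drift _ predual_drift])

lemma drift_resolvent_generator:
  assumes l: "0 < l" and u: "u \<in> L1 m"
  shows "in_generator m S (drift_resolvent l u) (\<lambda>x. l * drift_resolvent l u x - u x)"
  by (rule sg.laplace_predual_in_generator[OF S_semigroup predual_drift kernel_family_m[OF kernel_family_drift] _ l
        predual_drift_resolvent[OF l] u])
     (simp_all add: drift_add_time space_m)

lemma resolvent_dom: "0 < l \<Longrightarrow> u \<in> L1 m \<Longrightarrow> resolvent m S l u \<in> generator_dom m S"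
  and resolvent_drift: "0 < l \<Longrightarrow> u \<in> L1 m \<Longrightarrow> AE x in m. resolvent m S l u x = drift_resolvent l u x"
  using resolvent_eq[OF S_semigroup _ _ drift_resolvent_generator] by blast+

lemma dom_weighted: 
  assumes "u \<in> generator_dom m S" shows "(\<lambda>x. \<phi> x * u x) \<in> L1 m"
proof -
  have w: "(\<integral>\<^sup>+x. ennreal (\<phi> x * \<bar>u x\<bar>) \<partial>m) < \<infinity>" "u \<in> L1 m"
    using assms sg.dom_subset by (auto simp: L1_weighted_def)
  have "(\<integral>\<^sup>+x. ennreal (norm (\<phi> x * u x)) \<partial>m) = (\<integral>\<^sup>+x. ennreal (\<phi> x * \<bar>u x\<bar>) \<partial>m)"
    using rate_nonneg by (intro nn_integral_cong) (simp add: space_m abs_mult)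
  then show ?thesis
    using w borel_measurable_times[OF rate_borel_m, of u] by (simp add: L1_def integrable_iff_bounded)
qed

abbreviation "T \<equiv> jump_resolvent m \<phi> P S"

text \<open>
  Moving \<open>P\<close>, the multiplication by \<open>\<phi>\<close> and the resolvent to the other side one after the other
  gives the Laplace transform of \<open>drift\<close> at \<open>\<phi> \<cdot> J f\<close>, which is \<open>discounted_jump l f\<close>.
\<close>

lemma predual_jump_resolvent:
  assumes l: "0 < l" shows "predual_of m (discounted_jump l) (T l)"
  unfolding predual_of_def
proof (intro conjI ballI)
  note R = predual_drift_resolvent[OF l]
  note LR = predual_ofD(1)[OF R]
  let ?r = "\<lambda>u x. \<phi> x * resolvent m S l u x"
  have rL: "?r u \<in> L1 m" if "u \<in> L1 m" for u
    by (rule dom_weighted[OF resolvent_dom[OF l that]])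
  show "L1_operator m (T l)"
    unfolding jump_resolvent_def L1_operator_def
  proof (intro conjI ballI allI impI)
    fix u v a b assume u: "u \<in> L1 m" and v: "v \<in> L1 m"
    show "P (?r u) \<in> L1 m" by (rule L1_operatorD(1)[OF P_stochastic(1) rL[OF u]])
    show "AE x in m. P (?r u) x = P (?r v) x" if "AE x in m. u x = v x"
    proof (rule L1_operatorD(2)[OF P_stochastic(1) rL[OF u] rL[OF v]])
      show "AE x in m. ?r u x = ?r v x"
        using L1_operatorD(2)[OF LR u v that] resolvent_drift[OF l u] resolvent_drift[OF l v] by eventually_elim simp
    qed
    have "AE x in m. ?r (\<lambda>y. a * u y + b * v y) x = a * ?r u x + b * ?r v x"
      using L1_operatorD(3)[OF LR u v, of a b] resolvent_drift[OF l u] resolvent_drift[OF l v]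
        resolvent_drift[OF l L1_lin[OF u v, of a b]] by eventually_elim (simp add: algebra_simps)
    from L1_operatorD(2)[OF P_stochastic(1) rL[OF L1_lin[OF u v]] L1_lin[OF rL[OF u] rL[OF v]] this]
      L1_operatorD(3)[OF P_stochastic(1) rL[OF u] rL[OF v], of a b]
    show "AE x in m. P (?r (\<lambda>y. a * u y + b * v y)) x = a * P (?r u) x + b * P (?r v) x"
      by eventually_elim simp
  qed
  fix u assume u: "u \<in> L1_pos m"
  have uL: "u \<in> L1 m" by (rule L1_pos_L1[OF u])
  have Rp: "AE x in m. 0 \<le> drift_resolvent l u x" using predual_ofD(2)[OF R u] by (simp add: L1_pos_def)
  have rp: "?r u \<in> L1_pos m"
  proof -
    have "AE x in m. x \<in> E" using AE_space[of m] by (simp add: space_m)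
    then have "AE x in m. 0 \<le> ?r u x"
      using Rp resolvent_drift[OF l uL] by eventually_elim (simp add: rate_nonneg)
    then show ?thesis using rL[OF uL] by (simp add: L1_pos_def)
  qed
  show "T l u \<in> L1_pos m" unfolding jump_resolvent_def by (rule predual_ofD(2)[OF predual_jump rp])
  fix f :: "'a \<Rightarrow> ennreal" assume f: "f \<in> borel_measurable m"
  then have fM: "f \<in> borel_measurable M" by (simp add: measurable_m)
  have jf[measurable]: "jump_operator f \<in> borel_measurable m"
    by (rule kernel_operator_measurable[OF kernel_m[OF kernel_operator_jump] f])
  note [measurable] = rate_borel_m
  have "(\<integral>\<^sup>+x. f x * ennreal (T l u x) \<partial>m) = (\<integral>\<^sup>+x. jump_operator f x * ennreal (?r u x) \<partial>m)"
    unfolding jump_resolvent_def by (rule predual_ofD(3)[OF predual_jump rp f])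
  also have "\<dots> = (\<integral>\<^sup>+x. (ennreal (\<phi> x) * jump_operator f x) * ennreal (drift_resolvent l u x) \<partial>m)"
  proof (rule nn_integral_cong_AE)
    have "AE x in m. x \<in> E" using AE_space[of m] by (simp add: space_m)
    then show "AE x in m. jump_operator f x * ennreal (?r u x) = (ennreal (\<phi> x) * jump_operator f x) * ennreal (drift_resolvent l u x)"
      using resolvent_drift[OF l uL] by eventually_elim (simp add: rate_nonneg ennreal_mult' mult_ac)
  qed
  also have "\<dots> = (\<integral>\<^sup>+x. laplace_kernel l drift (\<lambda>y. ennreal (\<phi> y) * jump_operator f y) x * ennreal (u x) \<partial>m)"
    by (rule predual_ofD(3)[OF R u]) measurable
  also have "\<dots> = (\<integral>\<^sup>+x. discounted_jump l f x * ennreal (u x) \<partial>m)"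
    by (intro nn_integral_cong) (simp add: space_m discounted_jump_laplace[OF _ fM])
  finally show "(\<integral>\<^sup>+x. f x * ennreal (T l u x) \<partial>m) = (\<integral>\<^sup>+x. discounted_jump l f x * ennreal (u x) \<partial>m)" .
qed

section \<open>The semigroup of the minimal process\<close>

text \<open>
  The law of the first jump is built from \<open>drift\<close> and \<open>J\<close>, and these have the preduals
  \<open>S\<close> and \<open>P\<close>; hence it inherits from them that null sets are not charged.
\<close>

lemma jump_law_null:
  assumes h: "h \<in> borel_measurable (borel \<Otimes>\<^sub>M M)" and null: "\<And>s. 0 \<le> s \<Longrightarrow> AE y in m. h (s, y) = 0"
    and u: "u \<in> L1_pos m"
  shows "(\<integral>\<^sup>+x. (\<integral>\<^sup>+z. h z \<partial>jump_law x) * ennreal (u x) \<partial>m) = 0"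
proof -
  interpret pf: pair_sigma_finite m lborel
    by (intro pair_sigma_finite.intro lborel.sigma_finite_measure_axioms sg.sigma_finite_measure_axioms)
  note [measurable_cong] = sets_m
  note [measurable] = h
  have [measurable]: "u \<in> borel_measurable m" using u by (auto simp: L1_pos_def L1_def)
  let ?g = "\<lambda>s y. ennreal (\<phi> y) * jump_operator (\<lambda>w. h (s, w)) y"
  have hs: "(\<lambda>w. h (s, w)) \<in> borel_measurable m" for s
    using measurable_compose[OF measurable_Pair1' h, of s] by (simp add: measurable_m)
  have gm: "?g s \<in> borel_measurable m" for s
    using kernel_operator_measurable[OF kernel_m[OF kernel_operator_jump] hs[of s]] rate_borel_m by measurable
  have dm: "(\<lambda>p. indicator {0..} (snd p) * drift (snd p) (?g (snd p)) (fst p) * ennreal (u (fst p))) \<in> borel_measurable (m \<Otimes>\<^sub>M lborel)"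
    unfolding drift_def by measurable
  have "(\<integral>\<^sup>+x. (\<integral>\<^sup>+z. h z \<partial>jump_law x) * ennreal (u x) \<partial>m)
    = (\<integral>\<^sup>+x. (\<integral>\<^sup>+s. indicator {0..} s * drift s (?g s) x \<partial>lborel) * ennreal (u x) \<partial>m)"
    by (intro nn_integral_cong) (simp add: space_m jump_law_drift[OF _ h])
  also have "\<dots> = (\<integral>\<^sup>+x. \<integral>\<^sup>+s. indicator {0..} s * drift s (?g s) x * ennreal (u x) \<partial>lborel \<partial>m)"
  proof (intro nn_integral_cong nn_integral_multc[symmetric])
    fix x assume "x \<in> space m"
    then have [measurable]: "x \<in> space M" by (simp add: space_m)
    show "(\<lambda>s. indicator {0..} s * drift s (?g s) x) \<in> borel_measurable lborel"
      unfolding drift_def by measurable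
  qed
  also have "\<dots> = (\<integral>\<^sup>+s. \<integral>\<^sup>+x. indicator {0..} s * drift s (?g s) x * ennreal (u x) \<partial>m \<partial>lborel)"
    by (rule pf.Fubini'[symmetric]) (use dm in \<open>simp add: case_prod_beta'\<close>)
  also have "\<dots> = (\<integral>\<^sup>+s. 0 \<partial>(lborel :: real measure))"
  proof (rule nn_integral_cong)
    fix s :: real
    show "(\<integral>\<^sup>+x. indicator {0..} s * drift s (?g s) x * ennreal (u x) \<partial>m) = 0"
    proof (cases "0 \<le> s")
      case True
      have Ssu: "S s u \<in> L1_pos m" by (rule semigroupD(2)[OF S_semigroup True u])
      have [measurable]: "S s u \<in> borel_measurable m" using Ssu by (auto simp: L1_pos_def L1_def)
      have [measurable]: "jump_operator (\<lambda>w. h (s, w)) \<in> borel_measurable m"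
        by (rule kernel_operator_measurable[OF kernel_m[OF kernel_operator_jump] hs])
      have "(\<integral>\<^sup>+x. jump_operator (\<lambda>w. h (s, w)) x * ennreal (S s u x) \<partial>m) = (\<integral>\<^sup>+x. h (s, x) * ennreal (P (S s u) x) \<partial>m)"
        using predual_ofD(3)[OF predual_jump Ssu hs] by simp
      also have "\<dots> = (\<integral>\<^sup>+x. 0 \<partial>m)"
        using null[OF True] by (intro nn_integral_cong_AE) (auto elim: eventually_mono)
      finally have "AE x in m. jump_operator (\<lambda>w. h (s, w)) x * ennreal (S s u x) = 0"
        using nn_integral_0_iff_AE[of "\<lambda>x. jump_operator (\<lambda>w. h (s, w)) x * ennreal (S s u x)" m] by simp
      then have "(\<integral>\<^sup>+x. ?g s x * ennreal (S s u x) \<partial>m) = (\<integral>\<^sup>+x. 0 \<partial>m)"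
        by (intro nn_integral_cong_AE) (auto elim!: eventually_mono simp: mult.assoc)
      then show ?thesis using True predual_ofD(3)[OF predual_drift[OF True] u gm[of s]] by simp
    qed simp
  qed
  finally show ?thesis by simp
qed

lemma jump_part_null:
  assumes B: "B \<in> null_sets m"
  shows "0 \<le> t \<Longrightarrow> AE x in m. jump_part n t (indicator B) x = 0"
proof (induction n arbitrary: t)
  have iB: "indicator B \<in> borel_measurable m" using null_setsD2[OF B] by simp
  then have iBM: "indicator B \<in> borel_measurable M" by (simp add: measurable_m)
  have meas: "jump_part n t (indicator B) \<in> borel_measurable m" for n t
    unfolding measurable_m by (rule joint_measurable_section[OF jump_part_measurable[OF iBM]])
  {
    case 0
    show ?case
    proof (rule sg.AE_zero_of_L1_pos_integrals[OF meas])
      fix u assume u: "u \<in> L1_pos m"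
      have "(\<integral>\<^sup>+x. drift t (indicator B) x * ennreal (u x) \<partial>m) = (\<integral>\<^sup>+x. indicator B x * ennreal (S t u x) \<partial>m)"
        using predual_ofD(3)[OF predual_drift[OF 0] u iB] by simp
      also have "\<dots> = (\<integral>\<^sup>+x. 0 \<partial>m)"
        using AE_not_in[OF B] by (intro nn_integral_cong_AE) (auto elim: eventually_mono)
      finally show "(\<integral>\<^sup>+x. jump_part 0 t (indicator B) x * ennreal (u x) \<partial>m) = 0" by simp
    qed
  next
    case (Suc n)
    show ?case
    proof (rule sg.AE_zero_of_L1_pos_integrals[OF meas])
      fix u assume u: "u \<in> L1_pos m"
      let ?h = "\<lambda>z. indicator {..t} (fst z) * jump_part n (t - fst z) (indicator B) (snd z)"
      have "(\<integral>\<^sup>+x. (\<integral>\<^sup>+z. ?h z \<partial>jump_law x) * ennreal (u x) \<partial>m) = 0"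
      proof (rule jump_law_null[OF after_jump_integrand_measurable[OF jump_part_measurable[OF iBM]] _ u])
        fix s :: real assume s: "0 \<le> s"
        show "AE y in m. indicator {..t} (fst (s, y)) * jump_part n (t - fst (s, y)) (indicator B) (snd (s, y)) = 0"
        proof (cases "s \<le> t")
          case True
          then have "AE y in m. jump_part n (t - s) (indicator B) y = 0" by (intro Suc.IH) simp
          then show ?thesis by eventually_elim simp
        qed simp
      qed
      then show "(\<integral>\<^sup>+x. jump_part (Suc n) t (indicator B) x * ennreal (u x) \<partial>m) = 0"
        by (simp add: after_jump_def)
    qed
  }
qed

text \<open>
  The semigroup on integrable functions that moves an initial density to the density of the
  minimal process. It turns out to be the minimal semigroup
  (\<open>minimal_semigroup_eq\<close>).
\<close>

definition Q :: "real \<Rightarrow> ('a \<Rightarrow> real) \<Rightarrow> 'a \<Rightarrow> real" where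
  "Q t = predual m (pdmp_kernel t)"

lemma predual_Q: "0 \<le> t \<Longrightarrow> predual_of m (pdmp_kernel t) (Q t)"
  unfolding Q_def
proof (rule sg.predual_of_predual[OF kernel_m[OF kernel_operator_pdmp]])
  assume t: "0 \<le> t"
  fix B and u :: "'a \<Rightarrow> real" assume B: "B \<in> null_sets m"
  have "AE x in m. \<forall>n. jump_part n t (indicator B) x = 0"
    using jump_part_null[OF B t] by (simp add: AE_all_countable)
  then have "AE x in m. pdmp_kernel t (indicator B) x * ennreal (u x) = 0"
    by eventually_elim (simp add: pdmp_kernel_def)
  then have "(\<integral>\<^sup>+x. pdmp_kernel t (indicator B) x * ennreal (u x) \<partial>m) = (\<integral>\<^sup>+x. 0 \<partial>m)"
    by (rule nn_integral_cong_AE)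
  then show "(\<integral>\<^sup>+x. pdmp_kernel t (indicator B) x * ennreal (u x) \<partial>m) = 0" by simp
qed

definition embedded_operator :: "('a \<Rightarrow> real) \<Rightarrow> 'a \<Rightarrow> real" where
  "embedded_operator = predual m (discounted_jump 0)"

lemma predual_embedded: "predual_of m (discounted_jump 0) embedded_operator"
  unfolding embedded_operator_def
proof (rule sg.predual_of_predual[OF kernel_m[OF kernel_operator_discounted_jump[OF order_refl]]])
  fix B and u :: "'a \<Rightarrow> real" assume B: "B \<in> null_sets m" and u: "u \<in> L1_pos m"
  have [measurable]: "B \<in> sets M" using null_setsD2[OF B] by (simp add: sets_m)
  have "(\<lambda>z::real \<times> 'a. indicator B (snd z) :: ennreal) \<in> borel_measurable (borel \<Otimes>\<^sub>M M)" by measurable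
  moreover have "AE y in m. (indicator B y :: ennreal) = 0" using AE_not_in[OF B] by eventually_elim simp
  ultimately have "(\<integral>\<^sup>+x. (\<integral>\<^sup>+z. indicator B (snd z) \<partial>jump_law x) * ennreal (u x) \<partial>m) = 0"
    by (intro jump_law_null[OF _ _ u]) simp_all
  then show "(\<integral>\<^sup>+x. discounted_jump 0 (indicator B) x * ennreal (u x) \<partial>m) = 0"
    by (simp add: discounted_jump_def)
qed

lemma Q_norm: "0 \<le> t \<Longrightarrow> u \<in> L1 m \<Longrightarrow> L1_norm m (Q t u) \<le> L1_norm m u"
  using predual_norm_le[OF predual_Q kernel_m[OF kernel_operator_pdmp]] by simp

text \<open>
  \<open>Q(t) u\<close> lies above \<open>S(t) u\<close>, and its mass is at most that of \<open>u\<close>, so strong continuity at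
  \<open>0\<close> is inherited from \<open>S\<close>.
\<close>

lemma Q_continuous_bound:
  assumes t: "0 \<le> t" and u: "u \<in> L1_pos m"
  shows "L1_norm m (\<lambda>x. Q t u x - u x) \<le> 3 * L1_norm m (\<lambda>x. S t u x - u x)"
proof -
  note Su = semigroupD(2)[OF S_semigroup t u] and Qu = predual_ofD(2)[OF predual_Q[OF t] u]
  have uL: "u \<in> L1 m" by (rule L1_pos_L1[OF u])
  have "L1_norm m (\<lambda>x. S t u x - Q t u x) \<le> 2 * ((\<integral>x. Q t u x \<partial>m) - (\<integral>x. S t u x \<partial>m))"
    using drift_le_pdmp_kernel by (intro L1_norm_diff_dominated[OF predual_drift[OF t] predual_Q[OF t] u])
      (simp add: sets_m)
  also have "(\<integral>x. Q t u x \<partial>m) \<le> (\<integral>x. u x \<partial>m)"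
    using Q_norm[OF t uL] L1_pos_norm[OF Qu] L1_pos_norm[OF u] by simp
  also have "(\<integral>x. u x \<partial>m) - (\<integral>x. S t u x \<partial>m) = - (\<integral>x. S t u x - u x \<partial>m)"
    using L1_pos_L1[OF Su] uL by (simp add: L1_def)
  also have "\<dots> \<le> L1_norm m (\<lambda>x. S t u x - u x)"
    unfolding L1_norm_def using integral_abs_bound[of m "\<lambda>x. S t u x - u x"] by linarith
  finally have 1: "L1_norm m (\<lambda>x. S t u x - Q t u x) \<le> 2 * L1_norm m (\<lambda>x. S t u x - u x)" by simp
  have "(\<lambda>x. Q t u x - u x) = (\<lambda>x. (S t u x - u x) - (S t u x - Q t u x))" by auto
  then have "L1_norm m (\<lambda>x. Q t u x - u x) \<le> L1_norm m (\<lambda>x. S t u x - u x) + L1_norm m (\<lambda>x. S t u x - Q t u x)"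
    using L1_norm_triangle_diff[of "\<lambda>x. S t u x - u x" m "\<lambda>x. S t u x - Q t u x"]
      L1_diff[OF L1_pos_L1[OF Su] uL] L1_diff[OF L1_pos_L1[OF Su] L1_pos_L1[OF Qu]] by simp
  with 1 show ?thesis by simp
qed

theorem Q_semigroup: "substochastic_semigroup m Q"
  unfolding substochastic_semigroup_def
proof (intro conjI ballI allI impI)
  fix t :: real assume t: "0 \<le> t"
  show "L1_operator m (Q t)" by (rule predual_ofD(1)[OF predual_Q[OF t]])
  show "u \<in> L1_pos m \<Longrightarrow> Q t u \<in> L1_pos m" for u by (rule predual_ofD(2)[OF predual_Q[OF t]])
  show "u \<in> L1 m \<Longrightarrow> L1_norm m (Q t u) \<le> L1_norm m u" for u by (rule Q_norm[OF t])
next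
  fix u assume u: "u \<in> L1 m"
  have id: "predual_of m (\<lambda>f. f) (\<lambda>u. u)" by (simp add: predual_of_def L1_operator_def L1_lin)
  show "AE x in m. Q 0 u x = u x"
    by (rule predual_unique[OF predual_Q[OF order_refl] id _ u]) (simp add: pdmp_kernel_0 space_m sets_m)
next
  fix s t u assume s: "(0::real) \<le> s" and t: "(0::real) \<le> t" and u: "u \<in> L1 m"
  have comp: "predual_of m (\<lambda>f. pdmp_kernel s (pdmp_kernel t f)) (\<lambda>u. Q t (Q s u))"
    by (rule predual_comp[OF predual_Q[OF t] predual_Q[OF s] kernel_operator_measurable[OF kernel_m[OF kernel_operator_pdmp[OF t]]]])
  show "AE x in m. Q (t + s) u x = Q t (Q s u) x"
    using s t by (intro predual_unique[OF predual_Q comp _ u])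
      (auto simp: add.commute[of t s] pdmp_kernel_add_time space_m sets_m)
next
  fix u assume u: "u \<in> L1 m"
  note up = L1_pos_parts(1)[OF u] and un = L1_pos_parts(2)[OF u]
  let ?p = "\<lambda>x. max 0 (u x)" and ?n = "\<lambda>x. max 0 (- u x)"
  let ?b = "\<lambda>t. 3 * L1_norm m (\<lambda>x. S t ?p x - ?p x) + 3 * L1_norm m (\<lambda>x. S t ?n x - ?n x)"
  have "(?b \<longlongrightarrow> 3 * 0 + 3 * 0) (at_right 0)"
    by (intro tendsto_intros semigroupD(7)[OF S_semigroup order_refl] L1_pos_L1 up un)
  then have lim: "(?b \<longlongrightarrow> 0) (at_right 0)" by simp
  show "((\<lambda>t. L1_norm m (\<lambda>x. Q t u x - u x)) \<longlongrightarrow> 0) (at_right 0)"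
  proof (rule tendsto_sandwich[OF _ _ tendsto_const lim])
    show "\<forall>\<^sub>F t in at_right 0. 0 \<le> L1_norm m (\<lambda>x. Q t u x - u x)" by (simp add: L1_norm_nonneg)
    show "\<forall>\<^sub>F t in at_right 0. L1_norm m (\<lambda>x. Q t u x - u x) \<le> ?b t"
      using eventually_at_right_less[of "0::real"]
    proof eventually_elim
      case (elim t)
      then have t: "0 \<le> t" by simp
      note LQ = predual_ofD(1)[OF predual_Q[OF t]]
      note Lp = L1_diff[OF L1_operatorD(1)[OF LQ L1_pos_L1[OF up]] L1_pos_L1[OF up]]
      note Ln = L1_diff[OF L1_operatorD(1)[OF LQ L1_pos_L1[OF un]] L1_pos_L1[OF un]]
      have "L1_norm m (\<lambda>x. Q t u x - u x) = L1_norm m (\<lambda>x. (Q t ?p x - ?p x) - (Q t ?n x - ?n x))"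
      proof (rule L1_norm_cong_AE[OF L1_diff[OF L1_operatorD(1)[OF LQ u] u] L1_diff[OF Lp Ln]])
        show "AE x in m. Q t u x - u x = (Q t ?p x - ?p x) - (Q t ?n x - ?n x)"
          using L1_operator_parts[OF LQ u]
        proof eventually_elim
          case (elim x)
          then show ?case using diff_pos_neg_parts[of "u x"] by linarith
        qed
      qed
      also have "\<dots> \<le> L1_norm m (\<lambda>x. Q t ?p x - ?p x) + L1_norm m (\<lambda>x. Q t ?n x - ?n x)"
        by (rule L1_norm_triangle_diff[OF Lp Ln])
      also have "\<dots> \<le> ?b t" by (intro add_mono Q_continuous_bound t up un)
      finally show ?case .
    qed
  qed
qed

definition pdmp_resolvent :: "('a \<Rightarrow> real) \<Rightarrow> 'a \<Rightarrow> real" where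
  "pdmp_resolvent = predual m (laplace_kernel 1 pdmp_kernel)"

lemma predual_pdmp_resolvent: "predual_of m (laplace_kernel 1 pdmp_kernel) pdmp_resolvent"
  unfolding pdmp_resolvent_def by (rule laplace_kernel_predual[OF kernel_family_pdmp _ predual_Q]) simp_all

lemma pdmp_resolvent_generator:
  assumes u: "u \<in> L1 m"
  shows "in_generator m Q (pdmp_resolvent u) (\<lambda>x. pdmp_resolvent u x - u x)"
  using sg.laplace_predual_in_generator[OF Q_semigroup predual_Q kernel_family_m[OF kernel_family_pdmp] _ zero_less_one
        predual_pdmp_resolvent u]
  by (simp add: pdmp_kernel_add_time space_m measurable_m)

text \<open>
  The predual of the Laplace transform of the renewal equation.
\<close>

lemma pdmp_resolvent_eq:
  assumes v: "v \<in> L1 m"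
  shows "AE x in m. pdmp_resolvent v x = drift_resolvent 1 v x + pdmp_resolvent (T 1 v) x"
proof -
  have lm: "laplace_kernel 1 pdmp_kernel f \<in> borel_measurable m" if "f \<in> borel_measurable m" for f
    using kernel_operator_measurable[OF kernel_operator_laplace[OF kernel_family_m[OF kernel_family_pdmp] zero_less_one] that] .
  have dm: "laplace_kernel 1 drift f \<in> borel_measurable m" if "f \<in> borel_measurable m" for f
    using kernel_operator_measurable[OF kernel_operator_laplace[OF kernel_family_m[OF kernel_family_drift] zero_less_one] that] .
  have km: "discounted_jump 1 f \<in> borel_measurable m" if "f \<in> borel_measurable m" for f
    using kernel_operator_measurable[OF kernel_m[OF kernel_operator_discounted_jump] that] by simp
  have c: "predual_of m (\<lambda>f. discounted_jump 1 (laplace_kernel 1 pdmp_kernel f)) (\<lambda>u. pdmp_resolvent (T 1 u))"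
    by (rule predual_comp[OF predual_pdmp_resolvent predual_jump_resolvent lm]) simp_all
  have "predual_of m (\<lambda>f x. laplace_kernel 1 drift f x + discounted_jump 1 (laplace_kernel 1 pdmp_kernel f) x)
      (\<lambda>u x. drift_resolvent 1 u x + pdmp_resolvent (T 1 u) x)"
    by (rule predual_add[OF predual_drift_resolvent c dm km[OF lm]]) simp_all
  then show ?thesis
    by (rule predual_unique[OF predual_pdmp_resolvent _ _ v])
      (rule laplace_pdmp_kernel, simp_all add: space_m sets_m)
qed

text \<open>
  Elements of the domain are resolvents. This is how identities for \<open>T 1 v\<close> become statements
  about \<open>P(\<phi> u)\<close>.
\<close>

lemma domain_as_resolvent:
  assumes u: "u \<in> generator_dom m S"
  defines "v \<equiv> \<lambda>x. u x - generator m S u x"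
  shows "v \<in> L1 m" "AE x in m. drift_resolvent 1 v x = u x" "AE x in m. T 1 v x = P (\<lambda>y. \<phi> y * u y) x"
proof -
  have g: "in_generator m S u (generator m S u)"
    using u generator_eq(1)[OF S_semigroup] by (auto simp: generator_dom_def)
  note uL = in_generatorD(1)[OF g]
  show v: "v \<in> L1 m" unfolding v_def by (rule L1_diff[OF in_generatorD(1,2)[OF g]])
  have "in_generator m S u (\<lambda>x. 1 * u x - v x)" using g by (simp add: v_def)
  from resolvent_eq(2)[OF S_semigroup zero_less_one v this]
  have r: "AE x in m. resolvent m S 1 v x = u x" .
  then show "AE x in m. drift_resolvent 1 v x = u x"
    using resolvent_drift[OF zero_less_one v] by eventually_elim simp
  show "AE x in m. T 1 v x = P (\<lambda>y. \<phi> y * u y) x"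
    unfolding jump_resolvent_def
  proof (rule L1_operatorD(2)[OF P_stochastic(1) dom_weighted dom_weighted[OF u]])
    show "resolvent m S 1 v \<in> generator_dom m S" by (rule resolvent_dom[OF zero_less_one v])
    show "AE x in m. \<phi> x * resolvent m S 1 v x = \<phi> x * u x" using r by eventually_elim simp
  qed
qed

text \<open>
  Put \<open>v = u - A u\<close>. The resolvent identity gives \<open>R\<^sub>Q (v - T v) = R(1, A) v = u\<close>, so \<open>u\<close> lies in
  the domain of the generator of \<open>Q\<close>, where the generator has the value
  \<open>u - (v - T v) = A u + P(\<phi> u)\<close>.
\<close>

theorem Q_perturbed: "perturbed_semigroup m \<phi> P S Q"
  unfolding perturbed_semigroup_def
proof (intro conjI ballI Q_semigroup)
  fix u assume u: "u \<in> generator_dom m S"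
  define v where "v x = u x - generator m S u x" for x
  note v = domain_as_resolvent[OF u, folded v_def[abs_def]]
  have LT: "L1_operator m (T 1)" by (rule predual_ofD(1)[OF predual_jump_resolvent]) simp
  have LR: "L1_operator m pdmp_resolvent" by (rule predual_ofD(1)[OF predual_pdmp_resolvent])
  have Tv: "T 1 v \<in> L1 m" by (rule L1_operatorD(1)[OF LT v(1)])
  have y: "(\<lambda>x. v x - T 1 v x) \<in> L1 m" by (rule L1_diff[OF v(1) Tv])
  have Ry: "AE x in m. pdmp_resolvent (\<lambda>x. v x - T 1 v x) x = u x"
    using L1_operator_diff[OF LR v(1) Tv] pdmp_resolvent_eq[OF v(1)] v(2) by eventually_elim simp
  have g: "in_generator m S u (generator m S u)"
    using u generator_eq(1)[OF S_semigroup] by (auto simp: generator_dom_def)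
  show "in_generator m Q u (\<lambda>x. generator m S u x + P (\<lambda>y. \<phi> y * u y) x)"
  proof (rule in_generator_cong[OF Q_semigroup pdmp_resolvent_generator[OF y] in_generatorD(1)[OF g]])
    show "AE x in m. u x = pdmp_resolvent (\<lambda>x. v x - T 1 v x) x" using Ry by eventually_elim simp
    show "(\<lambda>x. generator m S u x + P (\<lambda>y. \<phi> y * u y) x) \<in> L1 m"
      using in_generatorD(2)[OF g] L1_operatorD(1)[OF P_stochastic(1) dom_weighted[OF u]] by (simp add: L1_def)
    show "AE x in m. generator m S u x + P (\<lambda>y. \<phi> y * u y) x
       = pdmp_resolvent (\<lambda>x. v x - T 1 v x) x - (v x - T 1 v x)"
      using Ry v(3)
    proof eventually_elim
      case (elim x)
      then show ?case using v_def[of x] by linarith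
    qed
  qed
qed

section \<open>Minimality\<close>

text \<open>
  For \<open>y = R(1, A) u\<close> the perturbed generator gives \<open>y - (A + P\<phi>) y = u - T u\<close>, and the mass
  identity for generators applies to \<open>y\<close>.
\<close>

lemma perturbed_laplace:
  assumes Q': "perturbed_semigroup m \<phi> P S Q'" and u: "u \<in> L1 m"
  shows "laplace 1 (\<lambda>t. \<integral>x. Q' t u x \<partial>m) = laplace 1 (\<lambda>t. \<integral>x. Q' t (T 1 u) x \<partial>m) + (\<integral>x. drift_resolvent 1 u x \<partial>m)"
proof -
  have sgQ: "substochastic_semigroup m Q'" using Q' by (simp add: perturbed_semigroup_def)
  define y where "y = drift_resolvent 1 u"
  have yg: "in_generator m S y (\<lambda>x. 1 * y x - u x)" unfolding y_def by (rule drift_resolvent_generator[OF zero_less_one u])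
  then have yd: "y \<in> generator_dom m S" by (auto simp: generator_dom_def)
  let ?z = "\<lambda>x. generator m S y x + P (\<lambda>w. \<phi> w * y w) x"
  have gz: "in_generator m Q' y ?z" using Q' yd by (simp add: perturbed_semigroup_def)
  have Tu: "T 1 u \<in> L1 m" by (rule L1_operatorD(1)[OF predual_ofD(1)[OF predual_jump_resolvent] u]) simp
  have rz: "AE x in m. T 1 u x = P (\<lambda>w. \<phi> w * y w) x"
    unfolding jump_resolvent_def
  proof (rule L1_operatorD(2)[OF P_stochastic(1) dom_weighted[OF resolvent_dom[OF zero_less_one u]] dom_weighted[OF yd]])
    show "AE x in m. \<phi> x * resolvent m S 1 u x = \<phi> x * y x"
      using resolvent_drift[OF zero_less_one u] by eventually_elim (simp add: y_def)
  qed
  have yzL: "(\<lambda>x. 1 * y x - ?z x) \<in> L1 m" using in_generatorD(1,2)[OF gz] by (simp add: L1_def)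
  have uTL: "(\<lambda>x. 1 * u x + (-1) * T 1 u x) \<in> L1 m" by (rule L1_lin[OF u Tu])
  have eq: "AE x in m. 1 * u x + (-1) * T 1 u x = 1 * y x - ?z x"
    using rz generator_eq(2)[OF S_semigroup yg] by eventually_elim simp
  have "(\<integral>x. y x \<partial>m) = laplace 1 (\<lambda>t. \<integral>x. Q' t (\<lambda>x. 1 * y x - ?z x) x \<partial>m)"
    by (rule laplace_generator_mass[OF sgQ gz zero_less_one, symmetric])
  also have "\<dots> = laplace 1 (\<lambda>t. \<integral>x. Q' t (\<lambda>x. 1 * u x + (-1) * T 1 u x) x \<partial>m)"
    unfolding laplace_def
  proof (rule set_lebesgue_integral_cong, simp, intro allI impI)
    fix t :: real assume "t \<in> {0..}"
    then have t: "0 \<le> t" by simp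
    have "(\<integral>x. Q' t (\<lambda>x. 1 * y x - ?z x) x \<partial>m) = (\<integral>x. Q' t (\<lambda>x. 1 * u x + (-1) * T 1 u x) x \<partial>m)"
      using L1_operatorD(2)[OF semigroupD(1)[OF sgQ t] uTL yzL eq]
        semigroupD(3)[OF sgQ t uTL] semigroupD(3)[OF sgQ t yzL]
      by (intro integral_cong_AE) (auto simp: L1_def elim: eventually_mono)
    then show "exp (- 1 * t) * (\<integral>x. Q' t (\<lambda>x. 1 * y x - ?z x) x \<partial>m)
      = exp (- 1 * t) * (\<integral>x. Q' t (\<lambda>x. 1 * u x + (-1) * T 1 u x) x \<partial>m)" by simp
  qed
  also have "\<dots> = 1 * laplace 1 (\<lambda>t. \<integral>x. Q' t u x \<partial>m) + (-1) * laplace 1 (\<lambda>t. \<integral>x. Q' t (T 1 u) x \<partial>m)"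
    by (rule laplace_semigroup_mass_linear[OF sgQ zero_less_one u Tu])
  finally show ?thesis by (simp add: y_def)
qed

lemma laplace_mass_nonneg:
  assumes Q': "substochastic_semigroup m Q'" and u: "u \<in> L1_pos m"
  shows "0 \<le> laplace 1 (\<lambda>t. \<integral>x. Q' t u x \<partial>m)"
proof -
  have "0 \<le> (\<integral>x. Q' t u x \<partial>m)" if "0 \<le> t" for t
    using semigroupD(2)[OF Q' that u] by (intro integral_nonneg_AE) (simp add: L1_pos_def)
  then show ?thesis
    unfolding laplace_def set_lebesgue_integral_def
    by (intro integral_nonneg_AE AE_I2) (auto simp: indicator_def)
qed

text \<open>
  Iterate \<open>perturbed_laplace\<close>, discarding the remainder, which is nonnegative. The Laplace transforms
  of the truncated kernels satisfy the same recursion.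
\<close>

lemma truncated_kernel_le_perturbed:
  assumes Q': "perturbed_semigroup m \<phi> P S Q'"
  shows "u \<in> L1_pos m \<Longrightarrow>
    (\<integral>\<^sup>+x. laplace_kernel 1 (truncated_kernel N) (\<lambda>_. 1) x * ennreal (u x) \<partial>m) \<le> ennreal (laplace 1 (\<lambda>t. \<integral>x. Q' t u x \<partial>m))"
proof (induction N arbitrary: u)
  have one: "(\<lambda>_. 1) \<in> borel_measurable M" "(\<lambda>_. 1) \<in> borel_measurable m" by simp_all
  {
    case 0
    have "(\<integral>\<^sup>+x. laplace_kernel 1 (truncated_kernel 0) (\<lambda>_. 1) x * ennreal (u x) \<partial>m) = (\<integral>\<^sup>+x. 0 \<partial>m)"
      by (intro nn_integral_cong) (simp add: space_m laplace_truncated_kernel(1)[OF _ one(1)])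
    then show ?case by simp
  next
    case (Suc N)
    have sgQ: "substochastic_semigroup m Q'" using Q' by (simp add: perturbed_semigroup_def)
    have um[measurable]: "u \<in> borel_measurable m" using Suc.prems by (auto simp: L1_pos_def L1_def)
    have Tu: "T 1 u \<in> L1_pos m" by (rule predual_ofD(2)[OF predual_jump_resolvent[OF zero_less_one] Suc.prems])
    let ?V = "laplace_kernel 1 (truncated_kernel N) (\<lambda>_. 1)"
    have Vm: "?V \<in> borel_measurable m"
      unfolding measurable_m by (rule truncated_kernel_laplace_measurable[OF one(1)])
    have [measurable]: "laplace_kernel 1 drift (\<lambda>_. 1) \<in> borel_measurable m"
      using kernel_operator_measurable[OF kernel_operator_laplace[OF kernel_family_m[OF kernel_family_drift] zero_less_one] one(2)] .
    have [measurable]: "discounted_jump 1 ?V \<in> borel_measurable m"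
      using kernel_operator_measurable[OF kernel_m[OF kernel_operator_discounted_jump] Vm] by simp
    have Rp: "drift_resolvent 1 u \<in> L1_pos m" by (rule predual_ofD(2)[OF predual_drift_resolvent[OF zero_less_one] Suc.prems])
    have "(\<integral>\<^sup>+x. laplace_kernel 1 (truncated_kernel (Suc N)) (\<lambda>_. 1) x * ennreal (u x) \<partial>m)
      = (\<integral>\<^sup>+x. laplace_kernel 1 drift (\<lambda>_. 1) x * ennreal (u x) + discounted_jump 1 ?V x * ennreal (u x) \<partial>m)"
      by (intro nn_integral_cong) (simp add: space_m laplace_truncated_kernel(2)[OF _ one(1)] distrib_right)
    also have "\<dots> = (\<integral>\<^sup>+x. laplace_kernel 1 drift (\<lambda>_. 1) x * ennreal (u x) \<partial>m) + (\<integral>\<^sup>+x. discounted_jump 1 ?V x * ennreal (u x) \<partial>m)"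
      by (rule nn_integral_add) measurable
    also have "(\<integral>\<^sup>+x. laplace_kernel 1 drift (\<lambda>_. 1) x * ennreal (u x) \<partial>m) = ennreal (\<integral>x. drift_resolvent 1 u x \<partial>m)"
      using predual_ofD(3)[OF predual_drift_resolvent[OF zero_less_one] Suc.prems one(2)] L1_pos_nn_integral[OF Rp] L1_pos_norm[OF Rp] by simp
    also have "(\<integral>\<^sup>+x. discounted_jump 1 ?V x * ennreal (u x) \<partial>m) = (\<integral>\<^sup>+x. ?V x * ennreal (T 1 u x) \<partial>m)"
      using predual_ofD(3)[OF predual_jump_resolvent[OF zero_less_one] Suc.prems Vm] by simp
    also have "ennreal (\<integral>x. drift_resolvent 1 u x \<partial>m) + (\<integral>\<^sup>+x. ?V x * ennreal (T 1 u x) \<partial>m)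
      \<le> ennreal (\<integral>x. drift_resolvent 1 u x \<partial>m) + ennreal (laplace 1 (\<lambda>t. \<integral>x. Q' t (T 1 u) x \<partial>m))"
      by (intro add_left_mono Suc.IH Tu)
    also have "\<dots> = ennreal (laplace 1 (\<lambda>t. \<integral>x. Q' t u x \<partial>m))"
      using perturbed_laplace[OF Q' L1_pos_L1[OF Suc.prems]] laplace_mass_nonneg[OF sgQ Tu]
        L1_norm_nonneg[of m "drift_resolvent 1 u"] L1_pos_norm[OF Rp]
      by (simp add: ennreal_plus[symmetric] add.commute del: ennreal_plus)
    finally show ?case .
  }
qed

lemma laplace_Q:
  assumes u: "u \<in> L1_pos m"
  shows "ennreal (laplace 1 (\<lambda>t. \<integral>x. Q t u x \<partial>m)) = (\<integral>\<^sup>+x. laplace_kernel 1 pdmp_kernel (\<lambda>_. 1) x * ennreal (u x) \<partial>m)"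
proof -
  have one: "(\<lambda>_. 1) \<in> borel_measurable m" by simp
  have um: "u \<in> borel_measurable m" using u by (auto simp: L1_pos_def L1_def)
  have uL: "u \<in> L1 m" by (rule L1_pos_L1[OF u])
  have pos: "0 \<le> (\<integral>x. Q t u x \<partial>m)" if "0 \<le> t" for t
    using L1_pos_norm[OF semigroupD(2)[OF Q_semigroup that u]] L1_norm_nonneg by metis
  have "(\<integral>\<^sup>+x. laplace_kernel 1 pdmp_kernel (\<lambda>_. 1) x * ennreal (u x) \<partial>m)
    = (\<integral>\<^sup>+t. indicator {0..} t * ennreal (exp (- 1 * t)) * (\<integral>\<^sup>+x. pdmp_kernel t (\<lambda>_. 1) x * ennreal (u x) \<partial>m) \<partial>lborel)"
    by (rule sg.laplace_kernel_dual[OF kernel_family_m[OF kernel_family_pdmp] um one])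
  also have "\<dots> = (\<integral>\<^sup>+t. ennreal (indicator {0..} t *\<^sub>R (exp (- 1 * t) * (\<integral>x. Q t u x \<partial>m))) \<partial>lborel)"
  proof (rule nn_integral_cong)
    fix t :: real
    show "indicator {0..} t * ennreal (exp (- 1 * t)) * (\<integral>\<^sup>+x. pdmp_kernel t (\<lambda>_. 1) x * ennreal (u x) \<partial>m)
      = ennreal (indicator {0..} t *\<^sub>R (exp (- 1 * t) * (\<integral>x. Q t u x \<partial>m)))"
    proof (cases "0 \<le> t")
      case True
      note Qu = semigroupD(2)[OF Q_semigroup True u]
      have "(\<integral>\<^sup>+x. pdmp_kernel t (\<lambda>_. 1) x * ennreal (u x) \<partial>m) = ennreal (\<integral>x. Q t u x \<partial>m)"
        using predual_ofD(3)[OF predual_Q[OF True] u one] L1_pos_nn_integral[OF Qu] L1_pos_norm[OF Qu] by simp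
      then show ?thesis using True pos by (simp add: ennreal_mult')
    qed simp
  qed
  also have "\<dots> = ennreal (laplace 1 (\<lambda>t. \<integral>x. Q t u x \<partial>m))"
    unfolding laplace_def set_lebesgue_integral_def[of lborel]
    using laplace_semigroup_mass_bound(2)[OF Q_semigroup zero_less_one uL] pos
    by (intro nn_integral_eq_integral) (auto simp: set_integrable_def indicator_def)
  finally show ?thesis ..
qed

lemma laplace_Q_le_perturbed:
  assumes Q': "perturbed_semigroup m \<phi> P S Q'" and u: "u \<in> L1_pos m"
  shows "laplace 1 (\<lambda>t. \<integral>x. Q t u x \<partial>m) \<le> laplace 1 (\<lambda>t. \<integral>x. Q' t u x \<partial>m)"
proof -
  have one: "(\<lambda>_. 1) \<in> borel_measurable M" by simp
  have um[measurable]: "u \<in> borel_measurable m" using u by (auto simp: L1_pos_def L1_def)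
  have sgQ: "substochastic_semigroup m Q'" using Q' by (simp add: perturbed_semigroup_def)
  let ?V = "\<lambda>N. laplace_kernel 1 (truncated_kernel N) (\<lambda>_. 1)"
  have Vm[measurable]: "?V N \<in> borel_measurable m" for N
    unfolding measurable_m by (rule truncated_kernel_laplace_measurable[OF one])
  have "(\<integral>\<^sup>+x. laplace_kernel 1 pdmp_kernel (\<lambda>_. 1) x * ennreal (u x) \<partial>m) = (\<integral>\<^sup>+x. (\<Squnion>N. ?V N x * ennreal (u x)) \<partial>m)"
    by (intro nn_integral_cong) (simp add: space_m laplace_pdmp_kernel_SUP[OF _ one] SUP_mult_right_ennreal)
  also have "\<dots> = (\<Squnion>N. \<integral>\<^sup>+x. ?V N x * ennreal (u x) \<partial>m)"
  proof (rule nn_integral_monotone_convergence_SUP)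
    show "incseq (\<lambda>N x. ?V N x * ennreal (u x))"
      unfolding laplace_kernel_def
      by (intro incseq_SucI le_funI mult_right_mono nn_integral_mono mult_left_mono truncated_kernel_mono_Suc) simp_all
  qed measurable
  also have "\<dots> \<le> ennreal (laplace 1 (\<lambda>t. \<integral>x. Q' t u x \<partial>m))"
    by (intro SUP_least truncated_kernel_le_perturbed Q' u)
  finally show ?thesis
    unfolding laplace_Q[OF u, symmetric] using laplace_mass_nonneg[OF sgQ u] by (simp only: ennreal_le_iff)
qed

lemma continuous_laplace_zero:
  fixes d :: "real \<Rightarrow> real"
  assumes c: "continuous_on {0..} d" and nn: "\<And>t. 0 \<le> t \<Longrightarrow> 0 \<le> d t"
    and i: "set_integrable lborel {0..} (\<lambda>t. exp (- 1 * t) * d t)" and z: "laplace 1 d \<le> 0" and t: "0 \<le> t"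
  shows "d t = 0"
proof (rule ccontr)
  assume ne: "d t \<noteq> 0"
  have "(LINT t:{0..}|lborel. exp (- 1 * t) * d t) = 0"
    using z nn unfolding laplace_def set_lebesgue_integral_def
    by (intro antisym integral_nonneg_AE AE_I2) (auto simp: indicator_def)
  then have "AE s in lborel. indicator {0..} s *\<^sub>R (exp (- 1 * s) * d s) = 0"
    using i nn unfolding set_lebesgue_integral_def set_integrable_def
    by (subst (asm) integral_nonneg_eq_0_iff_AE) (auto simp: indicator_def)
  then have ae: "AE s in lborel. 0 \<le> s \<longrightarrow> d s = 0" by eventually_elim auto
  from c t ne obtain e where e: "0 < e" "\<And>s. 0 \<le> s \<Longrightarrow> dist s t < e \<Longrightarrow> dist (d s) (d t) < \<bar>d t\<bar>"
    unfolding continuous_on_iff by (metis atLeast_iff zero_less_abs_iff)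
  from ae have "AE s in lborel. s \<notin> {t<..<t + e}"
  proof eventually_elim
    case (elim s)
    show ?case
    proof
      assume s: "s \<in> {t<..<t + e}"
      then have "dist (d s) (d t) < \<bar>d t\<bar>" using e(2)[of s] t by (simp add: dist_real_def)
      moreover have "d s = 0" using elim s t by simp
      ultimately show False by (simp add: dist_real_def)
    qed
  qed
  then have "{t<..<t + e} \<in> null_sets lborel"
    by (subst (asm) AE_iff_null_sets[symmetric]) auto
  then show False using e(1) by (simp add: null_sets_def)
qed

text \<open>
  Minimality gives one inequality almost everywhere for each time. The difference of the masses is
  therefore nonnegative and continuous in time, and its Laplace transform is at most zero; so it
  vanishes.
\<close>

theorem minimal_semigroup_eq:
  assumes PT: "minimal_semigroup m \<phi> P S PT" and u: "u \<in> L1_pos m" and t: "0 \<le> t"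
  shows "AE x in m. PT t u x = Q t u x"
proof -
  have pPT: "perturbed_semigroup m \<phi> P S PT"
    and le: "\<And>s. 0 \<le> s \<Longrightarrow> AE x in m. PT s u x \<le> Q s u x"
    using PT Q_perturbed u by (auto simp: minimal_semigroup_def)
  have sPT: "substochastic_semigroup m PT" using pPT by (simp add: perturbed_semigroup_def)
  have uL: "u \<in> L1 m" by (rule L1_pos_L1[OF u])
  let ?d = "\<lambda>s. (\<integral>x. Q s u x \<partial>m) - (\<integral>x. PT s u x \<partial>m)"
  have cont: "continuous_on {0..} (\<lambda>s. \<integral>x. R s u x \<partial>m)" if "substochastic_semigroup m R" for R
    using semigroup_set_integral_continuous[OF that uL sets.top] by (simp add: set_integral_UNIV_space)
  note iQ = laplace_semigroup_mass_bound(2)[OF Q_semigroup zero_less_one uL]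
  note iPT = laplace_semigroup_mass_bound(2)[OF sPT zero_less_one uL]
  have d_nonneg: "0 \<le> ?d s" if "0 \<le> s" for s
    using le[OF that] L1_pos_L1[OF semigroupD(2)[OF sPT that u]] L1_pos_L1[OF semigroupD(2)[OF Q_semigroup that u]]
    by (auto simp: L1_def intro!: integral_mono_AE)
  have "?d t = 0"
  proof (rule continuous_laplace_zero[OF _ d_nonneg _ _ t])
    show "continuous_on {0..} ?d" by (intro continuous_intros cont sPT Q_semigroup)
    show "set_integrable lborel {0..} (\<lambda>s. exp (- 1 * s) * ?d s)"
      unfolding right_diff_distrib by (rule set_integral_diff(1)[OF iQ iPT])
    have "laplace 1 ?d = laplace 1 (\<lambda>s. \<integral>x. Q s u x \<partial>m) - laplace 1 (\<lambda>s. \<integral>x. PT s u x \<partial>m)"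
      unfolding laplace_def right_diff_distrib by (rule set_integral_diff(2)[OF iQ iPT])
    then show "laplace 1 ?d \<le> 0" using laplace_Q_le_perturbed[OF pPT u] by simp
  qed
  then show ?thesis
    using le[OF t] by (intro L1_pos_eq_of_le semigroupD(2)[OF sPT t u] semigroupD(2)[OF Q_semigroup t u]) simp_all
qed

theorem minimal_semigroup_process:
  assumes PT: "minimal_semigroup m \<phi> P S PT" and u: "u \<in> L1_pos m" and t: "0 \<le> t" and B: "B \<in> sets M"
  shows "(LINT x:B|m. PT t u x) = (\<integral>x. measure W {\<omega> \<in> space W. pdmp_process \<pi> \<phi> \<kappa> \<epsilon> \<theta> x t \<omega> \<in> Some ` B \<and>
                            ereal t < explosion_time \<pi> \<phi> \<kappa> \<epsilon> \<theta> x \<omega>} * u x \<partial>m)"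
proof -
  have uL: "u \<in> L1 m" by (rule L1_pos_L1[OF u])
  have Bm: "B \<in> sets m" using B by (simp add: sets_m)
  have sPT: "substochastic_semigroup m PT" using PT by (simp add: minimal_semigroup_def perturbed_semigroup_def)
  have "(LINT x:B|m. PT t u x) = (LINT x:B|m. Q t u x)"
    unfolding set_lebesgue_integral_def
    using minimal_semigroup_eq[OF PT u t] L1_indicator_integrable[OF semigroupD(3)[OF sPT t uL] Bm]
      L1_indicator_integrable[OF semigroupD(3)[OF Q_semigroup t uL] Bm]
    by (intro integral_cong_AE) (auto elim: eventually_mono)
  also have "\<dots> = (\<integral>x. enn2real (pdmp_kernel t (indicator B) x) * u x \<partial>m)"
    by (rule predual_set_integral[OF predual_Q[OF t] kernel_m[OF kernel_operator_pdmp[OF t]] uL Bm])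
  also have "\<dots> = (\<integral>x. measure W {\<omega> \<in> space W. pdmp_process \<pi> \<phi> \<kappa> \<epsilon> \<theta> x t \<omega> \<in> Some ` B \<and>
                            ereal t < explosion_time \<pi> \<phi> \<kappa> \<epsilon> \<theta> x \<omega>} * u x \<partial>m)"
    by (intro Bochner_Integration.integral_cong refl) (simp add: space_m process_law[OF _ B t, symmetric])
  finally show ?thesis .
qed

section \<open>The transition operator of the embedded chain\<close>

lemma discounted_jump_tendsto:
  assumes x: "x \<in> E" and l: "l \<longlonglongrightarrow> 0" "\<And>n. 0 < l n"
  shows "(\<lambda>n. enn2real (discounted_jump (l n) (\<lambda>_. 1) x)) \<longlonglongrightarrow> 1"
proof -
  interpret p: prob_space "jump_law x" by (rule prob_space_jump_law[OF x])
  have ae: "AE z in jump_law x. norm (exp (- l n * fst z)) \<le> 1" for n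
    using jump_law_time_nonneg[OF x] by eventually_elim (use l(2)[of n] in simp)
  have eq: "enn2real (discounted_jump (l n) (\<lambda>_. 1) x) = (\<integral>z. exp (- l n * fst z) \<partial>jump_law x)" for n
  proof -
    have "discounted_jump (l n) (\<lambda>_. 1) x = ennreal (\<integral>z. exp (- l n * fst z) \<partial>jump_law x)"
      unfolding discounted_jump_def using ae[of n]
      by (simp, intro nn_integral_eq_integral p.integrable_const_bound[of _ 1]) auto
    then show ?thesis by (simp add: integral_nonneg_AE)
  qed
  have "(\<lambda>n. \<integral>z. exp (- l n * fst z) \<partial>jump_law x) \<longlonglongrightarrow> (\<integral>z. 1 \<partial>jump_law x)"
  proof (rule integral_dominated_convergence[where w="\<lambda>_. 1"])
    show "AE z in jump_law x. (\<lambda>n. exp (- l n * fst z)) \<longlonglongrightarrow> 1"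
    proof (rule AE_I2)
      fix z :: "real \<times> 'a"
      have "(\<lambda>n. exp (- l n * fst z)) \<longlonglongrightarrow> exp (- 0 * fst z)" by (intro tendsto_intros l)
      then show "(\<lambda>n. exp (- l n * fst z)) \<longlonglongrightarrow> 1" by simp
    qed
  qed (use ae in \<open>simp_all\<close>)
  then show ?thesis unfolding eq by (simp add: p.prob_space)
qed

text \<open>
  Since \<open>discounted_jump l \<le> discounted_jump 0\<close>, the distance is controlled by the missing mass.
\<close>

lemma T_embedded_bound:
  assumes l: "0 < l" and u: "u \<in> L1_pos m"
  shows "L1_norm m (\<lambda>x. T l u x - embedded_operator u x)
    \<le> 2 * ((\<integral>x. u x \<partial>m) - (\<integral>x. enn2real (discounted_jump l (\<lambda>_. 1) x) * u x \<partial>m))"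
proof -
  note pT = predual_jump_resolvent[OF l]
  have uL: "u \<in> L1 m" by (rule L1_pos_L1[OF u])
  have l0: "0 \<le> l" using l by simp
  have mono: "discounted_jump l f x \<le> discounted_jump 0 f x" if "x \<in> E" for f x
    unfolding discounted_jump_def
  proof (rule nn_integral_mono_AE)
    show "AE z in jump_law x. ennreal (exp (- l * fst z)) * f (snd z) \<le> ennreal (exp (- 0 * fst z)) * f (snd z)"
      using jump_law_time_nonneg[OF that] by eventually_elim (use l in \<open>intro mult_right_mono ennreal_leI, auto\<close>)
  qed
  have "L1_norm m (\<lambda>x. T l u x - embedded_operator u x) \<le> 2 * ((\<integral>x. embedded_operator u x \<partial>m) - (\<integral>x. T l u x \<partial>m))"
    using mono by (intro L1_norm_diff_dominated[OF pT predual_embedded u]) (simp add: space_m)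
  also have "(\<integral>x. T l u x \<partial>m) = (\<integral>x. enn2real (discounted_jump l (\<lambda>_. 1) x) * u x \<partial>m)"
    using predual_integral[OF pT kernel_m[OF kernel_operator_discounted_jump[OF l0]] uL, of "\<lambda>_. 1" 1] by simp
  also have "(\<integral>x. embedded_operator u x \<partial>m) = (\<integral>x. enn2real (discounted_jump 0 (\<lambda>_. 1) x) * u x \<partial>m)"
    using predual_integral[OF predual_embedded kernel_m[OF kernel_operator_discounted_jump[OF order_refl]] uL, of "\<lambda>_. 1" 1] by simp
  also have "\<dots> = (\<integral>x. u x \<partial>m)"
    by (intro Bochner_Integration.integral_cong) (simp_all add: space_m discounted_jump_0_one)
  finally show ?thesis .
qed

lemma T_tendsto_pos:
  assumes u: "u \<in> L1_pos m"
  shows "((\<lambda>l. L1_norm m (\<lambda>x. T l u x - embedded_operator u x)) \<longlongrightarrow> 0) (at_right 0)"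
proof (rule tendsto_at_right_sequentially[of 0 1])
  fix l :: "nat \<Rightarrow> real" assume l: "\<And>n. 0 < l n" "l \<longlonglongrightarrow> 0"
  have uL: "u \<in> L1 m" by (rule L1_pos_L1[OF u])
  have l0: "0 \<le> l n" for n using l(1)[of n] by simp
  have um[measurable]: "u \<in> borel_measurable m" using uL by (auto simp: L1_def)
  have one: "(\<lambda>_. 1) \<in> borel_measurable m" by simp
  have dm[measurable]: "discounted_jump (l n) (\<lambda>_. 1) \<in> borel_measurable m" for n
    using kernel_operator_measurable[OF kernel_m[OF kernel_operator_discounted_jump[OF l0]] one] .
  have "(\<lambda>n. \<integral>x. enn2real (discounted_jump (l n) (\<lambda>_. 1) x) * u x \<partial>m) \<longlonglongrightarrow> (\<integral>x. u x \<partial>m)"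
  proof (rule integral_dominated_convergence[where w="\<lambda>x. \<bar>u x\<bar>"])
    show "AE x in m. (\<lambda>n. enn2real (discounted_jump (l n) (\<lambda>_. 1) x) * u x) \<longlonglongrightarrow> u x"
    proof (rule AE_I2)
      fix x assume "x \<in> space m"
      then have "(\<lambda>n. enn2real (discounted_jump (l n) (\<lambda>_. 1) x) * u x) \<longlonglongrightarrow> 1 * u x"
        by (intro tendsto_intros discounted_jump_tendsto l) (simp add: space_m)
      then show "(\<lambda>n. enn2real (discounted_jump (l n) (\<lambda>_. 1) x) * u x) \<longlonglongrightarrow> u x" by simp
    qed
    show "AE x in m. norm (enn2real (discounted_jump (l n) (\<lambda>_. 1) x) * u x) \<le> \<bar>u x\<bar>" for n
    proof (rule AE_I2)
      fix x assume "x \<in> space m"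
      then have "enn2real (discounted_jump (l n) (\<lambda>_. 1) x) \<le> 1"
        using discounted_jump_one_le[OF _ l0, of x n] by (intro enn2real_leI) (simp_all add: space_m)
      then show "norm (enn2real (discounted_jump (l n) (\<lambda>_. 1) x) * u x) \<le> \<bar>u x\<bar>"
        by (simp add: abs_mult mult_left_le_one_le)
    qed
  qed (use uL in \<open>auto simp: L1_def\<close>)
  then have "(\<lambda>n. 2 * ((\<integral>x. u x \<partial>m) - (\<integral>x. enn2real (discounted_jump (l n) (\<lambda>_. 1) x) * u x \<partial>m)))
     \<longlonglongrightarrow> 2 * ((\<integral>x. u x \<partial>m) - (\<integral>x. u x \<partial>m))"
    by (intro tendsto_intros)
  then have lim: "(\<lambda>n. 2 * ((\<integral>x. u x \<partial>m) - (\<integral>x. enn2real (discounted_jump (l n) (\<lambda>_. 1) x) * u x \<partial>m))) \<longlonglongrightarrow> 0"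
    by simp
  show "(\<lambda>n. L1_norm m (\<lambda>x. T (l n) u x - embedded_operator u x)) \<longlonglongrightarrow> 0"
    by (rule tendsto_sandwich[OF _ _ tendsto_const lim])
      (intro always_eventually allI L1_norm_nonneg T_embedded_bound l u)+
qed simp

lemma embedded_is_jump_limit:
  assumes u: "u \<in> L1 m"
  shows "is_jump_limit m \<phi> P S u (embedded_operator u)"
  unfolding is_jump_limit_def
proof
  note up = L1_pos_parts(1)[OF u] and un = L1_pos_parts(2)[OF u]
  let ?p = "\<lambda>x. max 0 (u x)" and ?n = "\<lambda>x. max 0 (- u x)"
  note LK = predual_ofD(1)[OF predual_embedded]
  show "embedded_operator u \<in> L1 m" by (rule L1_operatorD(1)[OF LK u])
  have lim: "((\<lambda>l. L1_norm m (\<lambda>x. T l ?p x - embedded_operator ?p x) + L1_norm m (\<lambda>x. T l ?n x - embedded_operator ?n x)) \<longlongrightarrow> 0) (at_right 0)"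
    using tendsto_add[OF T_tendsto_pos[OF up] T_tendsto_pos[OF un]] by simp
  show "((\<lambda>l. L1_norm m (\<lambda>x. T l u x - embedded_operator u x)) \<longlongrightarrow> 0) (at_right 0)"
  proof (rule tendsto_sandwich[OF _ _ tendsto_const lim])
    show "\<forall>\<^sub>F l in at_right 0. 0 \<le> L1_norm m (\<lambda>x. T l u x - embedded_operator u x)" by (simp add: L1_norm_nonneg)
    show "\<forall>\<^sub>F l in at_right 0. L1_norm m (\<lambda>x. T l u x - embedded_operator u x)
      \<le> L1_norm m (\<lambda>x. T l ?p x - embedded_operator ?p x) + L1_norm m (\<lambda>x. T l ?n x - embedded_operator ?n x)"
      using eventually_at_right_less[of "0::real"]
    proof eventually_elim
      case (elim l)
      note LT = predual_ofD(1)[OF predual_jump_resolvent[OF elim]]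
      have D: "(\<lambda>x. T l v x - embedded_operator v x) \<in> L1 m" if "v \<in> L1 m" for v
        by (intro L1_diff L1_operatorD(1)[OF LT] L1_operatorD(1)[OF LK] that)
      have "L1_norm m (\<lambda>x. T l u x - embedded_operator u x)
        = L1_norm m (\<lambda>x. (T l ?p x - embedded_operator ?p x) - (T l ?n x - embedded_operator ?n x))"
      proof (rule L1_norm_cong_AE[OF D[OF u] L1_diff[OF D[OF L1_pos_L1[OF up]] D[OF L1_pos_L1[OF un]]]])
        show "AE x in m. T l u x - embedded_operator u x = (T l ?p x - embedded_operator ?p x) - (T l ?n x - embedded_operator ?n x)"
          using L1_operator_parts[OF LT u] L1_operator_parts[OF LK u] by eventually_elim linarith
      qed
      also have "\<dots> \<le> L1_norm m (\<lambda>x. T l ?p x - embedded_operator ?p x) + L1_norm m (\<lambda>x. T l ?n x - embedded_operator ?n x)"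
        by (rule L1_norm_triangle_diff[OF D[OF L1_pos_L1[OF up]] D[OF L1_pos_L1[OF un]]])
      finally show ?case .
    qed
  qed
qed

lemma jump_limit_embedded:
  assumes u: "u \<in> L1 m"
  shows "is_jump_limit m \<phi> P S u (jump_limit m \<phi> P S u)"
    and "AE x in m. jump_limit m \<phi> P S u x = embedded_operator u x"
proof -
  let ?v = "jump_limit m \<phi> P S u" and ?k = "embedded_operator u"
  note k = embedded_is_jump_limit[OF u]
  show v: "is_jump_limit m \<phi> P S u ?v" unfolding jump_limit_def by (rule someI[of _ ?k]) (rule k)
  have vL: "?v \<in> L1 m" and kL: "?k \<in> L1 m" using v k by (auto simp: is_jump_limit_def)
  have lim: "((\<lambda>l. L1_norm m (\<lambda>x. T l u x - ?k x) + L1_norm m (\<lambda>x. T l u x - ?v x)) \<longlongrightarrow> 0) (at_right 0)"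
    using tendsto_add[of "\<lambda>l. L1_norm m (\<lambda>x. T l u x - ?k x)" 0 _ "\<lambda>l. L1_norm m (\<lambda>x. T l u x - ?v x)" 0] v k
    by (simp add: is_jump_limit_def)
  have "\<forall>\<^sub>F l in at_right 0. L1_norm m (\<lambda>x. ?v x - ?k x) \<le> L1_norm m (\<lambda>x. T l u x - ?k x) + L1_norm m (\<lambda>x. T l u x - ?v x)"
    using eventually_at_right_less[of "0::real"]
  proof eventually_elim
    case (elim l)
    have TL: "T l u \<in> L1 m" by (rule L1_operatorD(1)[OF predual_ofD(1)[OF predual_jump_resolvent[OF elim]] u])
    have "(\<lambda>x. ?v x - ?k x) = (\<lambda>x. (T l u x - ?k x) - (T l u x - ?v x))" by auto
    then show ?case
      using L1_norm_triangle_diff[OF L1_diff[OF TL kL] L1_diff[OF TL vL]] by simp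
  qed
  then have "L1_norm m (\<lambda>x. ?v x - ?k x) \<le> 0"
    using tendsto_lowerbound[OF lim] by simp
  then show "AE x in m. ?v x = ?k x" by (rule AE_eq_of_L1_norm[OF vL kL])
qed

theorem jump_limit_transition: "transition_operator m (jump_limit m \<phi> P S) (embedded_kernel \<pi> \<phi> J)"
  unfolding transition_operator_def stochastic_operator_def
proof (intro conjI ballI)
  let ?K = "jump_limit m \<phi> P S"
  have pK: "predual_of m (discounted_jump 0) ?K"
    by (rule predual_of_cong[OF predual_embedded _ jump_limit_embedded(2)])
      (use jump_limit_embedded(1) in \<open>auto simp: is_jump_limit_def\<close>)
  show "L1_operator m ?K" by (rule predual_ofD(1)[OF pK])
  fix u assume "u \<in> densities m"
  then have u: "u \<in> L1_pos m" and n: "L1_norm m u = 1" by (auto simp: densities_def)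
  note Ku = predual_ofD(2)[OF pK u]
  have "ennreal (L1_norm m (?K u)) = (\<integral>\<^sup>+x. discounted_jump 0 (\<lambda>_. 1) x * ennreal (u x) \<partial>m)"
    using predual_ofD(3)[OF pK u, of "\<lambda>_. 1"] L1_pos_nn_integral[OF Ku] by simp
  also have "\<dots> = (\<integral>\<^sup>+x. ennreal (u x) \<partial>m)"
    by (intro nn_integral_cong) (simp add: space_m discounted_jump_0_one)
  also have "\<dots> = ennreal 1" using L1_pos_nn_integral[OF u] n by simp
  finally have "L1_norm m (?K u) = 1" by (simp add: L1_norm_nonneg)
  then show "?K u \<in> densities m" using Ku by (simp add: densities_def)
next
  let ?K = "jump_limit m \<phi> P S"
  have pK: "predual_of m (discounted_jump 0) ?K"
    by (rule predual_of_cong[OF predual_embedded _ jump_limit_embedded(2)])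
      (use jump_limit_embedded(1) in \<open>auto simp: is_jump_limit_def\<close>)
  fix B u assume B: "B \<in> sets m" and u: "u \<in> densities m"
  have uL: "u \<in> L1 m" using u by (simp add: densities_def L1_pos_def)
  have BM: "B \<in> sets M" using B by (simp add: sets_m)
  have "(LINT x:B|m. ?K u x) = (\<integral>x. enn2real (discounted_jump 0 (indicator B) x) * u x \<partial>m)"
    by (rule predual_set_integral[OF pK kernel_m[OF kernel_operator_discounted_jump[OF order_refl]] uL B])
  also have "\<dots> = (\<integral>x. embedded_kernel \<pi> \<phi> J x B * u x \<partial>m)"
    by (intro Bochner_Integration.integral_cong) (simp_all add: space_m embedded_kernel_eq[OF _ BM])
  finally show "(\<integral>x. embedded_kernel \<pi> \<phi> J x B * u x \<partial>m) = (LINT x:B|m. ?K u x)" ..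
qed

section \<open>The adjoint and the explosion time\<close>

text \<open>
  Test with indicators times a strictly positive integrable function, which exists because
  \<open>m\<close> is \<open>\<sigma>\<close>-finite.
\<close>

lemma Linf_eq_of_pairings:
  assumes g: "g \<in> Linf m" and h: "h \<in> Linf m"
    and eq: "\<And>u. u \<in> L1 m \<Longrightarrow> (\<integral>x. u x * g x \<partial>m) = (\<integral>x. u x * h x \<partial>m)"
  shows "AE x in m. g x = h x"
proof -
  obtain w :: "'a \<Rightarrow> real" where w: "w \<in> borel_measurable m" "\<And>x. 0 < w x" "integrable m w"
    using sg.obtain_positive_integrable_function by metis
  have int: "integrable m (\<lambda>x. w x * f x)" if "f \<in> Linf m" for f
  proof -
    from that obtain c where c: "f \<in> borel_measurable m" "AE x in m. \<bar>f x\<bar> \<le> c" by (auto simp: Linf_def)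
    show ?thesis
    proof (rule Bochner_Integration.integrable_bound)
      show "integrable m (\<lambda>x. c * w x)" using w by simp
      show "(\<lambda>x. w x * f x) \<in> borel_measurable m" using w(1) c(1) by simp
      show "AE x in m. norm (w x * f x) \<le> norm (c * w x)"
        using c(2)
      proof eventually_elim
        case (elim x)
        then show ?case using w(2)[of x] by (simp add: abs_mult mult.commute[of "w x"] mult_right_mono)
      qed
    qed
  qed
  have "AE x in m. w x * g x = w x * h x"
  proof (rule AE_eq_of_set_integrals)
    show "(\<lambda>x. w x * g x) \<in> L1 m" "(\<lambda>x. w x * h x) \<in> L1 m" using int g h by (simp_all add: L1_def)
    fix B assume B: "B \<in> sets m"
    have "(\<lambda>x. indicator B x * w x) \<in> L1 m" using L1_indicator_integrable[of w m B] w B by (simp add: L1_def)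
    from eq[OF this] show "(LINT x:B|m. w x * g x) = (LINT x:B|m. w x * h x)"
      by (simp add: set_lebesgue_integral_def mult.assoc)
  qed
  then show ?thesis
  proof eventually_elim
    case (elim x)
    then show ?case using w(2)[of x] by simp
  qed
qed

lemma adjoint_eq:
  assumes R: "predual_of m V R" and V: "kernel_operator m 1 V"
    and f: "f \<in> borel_measurable m" "\<And>x. 0 \<le> f x \<and> f x \<le> 1"
    and g: "g \<in> Linf m" "AE x in m. g x = f x"
  shows "adjoint_Linf m R g \<in> Linf m"
    and "AE x in m. adjoint_Linf m R g x = enn2real (V (\<lambda>y. ennreal (f y)) x)"
proof -
  let ?h = "\<lambda>x. enn2real (V (\<lambda>y. ennreal (f y)) x)"
  let ?A = "\<lambda>h. h \<in> Linf m \<and> (\<forall>u\<in>L1 m. (\<integral>x. R u x * g x \<partial>m) = (\<integral>x. u x * h x \<partial>m))"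
  have ef: "(\<lambda>y. ennreal (f y)) \<in> borel_measurable m" using f(1) by simp
  have hL: "?h \<in> Linf m"
    unfolding Linf_def
  proof (intro CollectI conjI exI AE_I2)
    show "?h \<in> borel_measurable m" using kernel_operator_measurable[OF V ef] by simp
    fix x assume x: "x \<in> space m"
    have "V (\<lambda>y. ennreal (f y)) x \<le> 1 * ennreal 1"
      by (rule kernel_operator_bound[OF V x ef]) (use f(2) in \<open>simp add: ennreal_le_1\<close>)
    then have "enn2real (V (\<lambda>y. ennreal (f y)) x) \<le> 1" by (intro enn2real_leI) simp_all
    then show "\<bar>?h x\<bar> \<le> 1" by simp
  qed
  have "?A ?h"
  proof (intro conjI ballI hL)
    fix u assume u: "u \<in> L1 m"
    have "(\<integral>x. R u x * g x \<partial>m) = (\<integral>x. f x * R u x \<partial>m)"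
      using g f(1) L1_operatorD(1)[OF predual_ofD(1)[OF R] u]
      by (intro integral_cong_AE) (auto simp: Linf_def L1_def elim!: eventually_mono)
    also have "\<dots> = (\<integral>x. ?h x * u x \<partial>m)" by (rule predual_integral[OF R V u f])
    finally show "(\<integral>x. R u x * g x \<partial>m) = (\<integral>x. u x * ?h x \<partial>m)" by (simp add: mult.commute)
  qed
  then have A: "?A (adjoint_Linf m R g)" unfolding adjoint_Linf_def by (rule someI[of ?A])
  then show "adjoint_Linf m R g \<in> Linf m" by simp
  show "AE x in m. adjoint_Linf m R g x = ?h x"
    using A \<open>?A ?h\<close> by (intro Linf_eq_of_pairings) auto
qed

lemma discounted_funpow:
  assumes l: "0 \<le> l"
  shows "(discounted_jump l ^^ n) (\<lambda>_. 1) \<in> borel_measurable M"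
    and "x \<in> E \<Longrightarrow> (discounted_jump l ^^ n) (\<lambda>_. 1) x \<le> 1"
proof (induction n arbitrary: x)
  note K = kernel_operator_discounted_jump[OF l]
  case (Suc n)
  { case 1 show ?case using kernel_operator_measurable[OF K Suc(1)] by simp }
  { case 2 show ?case
      using kernel_operator_bound[OF K in_space_M[OF 2] Suc(1), of 1] Suc(2) by simp }
qed simp_all

text \<open>
  The adjoint is a choice that is unique only almost everywhere, so the induction carries
  along both boundedness and the value almost everywhere.
\<close>

lemma adjoint_funpow:
  assumes l: "0 < l"
  shows "(adjoint_Linf m (T l) ^^ n) (\<lambda>_. 1) \<in> Linf m"
    and "AE x in m. (adjoint_Linf m (T l) ^^ n) (\<lambda>_. 1) x = enn2real ((discounted_jump l ^^ n) (\<lambda>_. 1) x)"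
proof (induction n)
  case 0
  { case 1 show ?case by (auto simp: Linf_def intro!: exI[of _ 1]) }
  { case 2 show ?case by simp }
next
  case (Suc n)
  have l0: "0 \<le> l" using l by simp
  note K = kernel_m[OF kernel_operator_discounted_jump[OF l0]]
  let ?c = "(discounted_jump l ^^ n) (\<lambda>_. 1)"
  \<comment> \<open>The default value outside \<open>E\<close> gives bounds that hold everywhere.\<close>
  define f where "f x = (if x \<in> E then enn2real (?c x) else 0)" for x
  have cm: "?c \<in> borel_measurable m" unfolding measurable_m by (rule discounted_funpow[OF l0])
  have fm: "f \<in> borel_measurable m"
  proof -
    have "(\<lambda>x. enn2real (?c x)) \<in> borel_measurable m" using cm by simp
    then show ?thesis by (rule measurable_cong[THEN iffD1, rotated]) (simp add: f_def space_m)
  qed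
  have f01: "0 \<le> f x \<and> f x \<le> 1" for x
    using discounted_funpow(2)[OF l0, of x n] by (auto simp: f_def intro: enn2real_leI)
  have AEf: "AE x in m. (adjoint_Linf m (T l) ^^ n) (\<lambda>_. 1) x = f x"
    using Suc(2) AE_space by eventually_elim (simp add: f_def space_m)
  note adj = adjoint_eq[OF predual_jump_resolvent[OF l] K fm f01 Suc(1) AEf]
  { case 1 show ?case using adj(1) by simp }
  { case 2
    have eq: "discounted_jump l (\<lambda>y. ennreal (f y)) x = discounted_jump l ?c x" if "x \<in> space m" for x
    proof (rule kernel_operator_cong[OF K that _ cm])
      show "(\<lambda>y. ennreal (f y)) \<in> borel_measurable m" using fm by simp
      fix y assume "y \<in> space m"
      then have "?c y \<le> 1" "y \<in> E" using discounted_funpow(2)[OF l0] by (simp_all add: space_m)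
      moreover have "?c y < \<top>" using \<open>?c y \<le> 1\<close> by (rule le_less_trans) simp
      ultimately show "ennreal (f y) = ?c y" by (simp add: f_def)
    qed
    show ?case using adj(2) AE_space by eventually_elim (simp add: eq) }
qed

theorem adjoint_limit:
  assumes l: "0 < l"
  shows "AE x in m. (\<lambda>n. (adjoint_Linf m (T l) ^^ n) (\<lambda>_. 1) x)
     \<longlonglongrightarrow> (\<integral>\<omega>. exp_neg (ereal l * explosion_time \<pi> \<phi> \<kappa> \<epsilon> \<theta> x \<omega>) \<partial>W)"
proof -
  have "AE x in m. \<forall>n. (adjoint_Linf m (T l) ^^ n) (\<lambda>_. 1) x = enn2real ((discounted_jump l ^^ n) (\<lambda>_. 1) x)"
    using adjoint_funpow(2)[OF l] by (simp add: AE_all_countable)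
  then show ?thesis
    using AE_space
  proof eventually_elim
    case (elim x)
    then show ?case using discounted_chain_limit[OF _ l, of x] by (simp add: space_m)
  qed
qed

end

theorem theorem5p2:
  fixes E :: "'a::polish_space set"
    and \<pi> :: "real \<Rightarrow> 'a \<Rightarrow> 'a"
    and \<phi> :: "'a \<Rightarrow> real"
    and J :: "'a \<Rightarrow> 'a set \<Rightarrow> real"
    and W :: "'w measure"
    and \<kappa> :: "real \<Rightarrow> 'a \<Rightarrow> 'a"
    and \<epsilon> \<theta> :: "nat \<Rightarrow> 'w \<Rightarrow> real"
    and m :: "'a measure"
    and P :: "('a \<Rightarrow> real) \<Rightarrow> ('a \<Rightarrow> real)"
    and S PT :: "real \<Rightarrow> ('a \<Rightarrow> real) \<Rightarrow> ('a \<Rightarrow> real)"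
  assumes "pdmp_construction E \<pi> \<phi> J W \<kappa> \<epsilon> \<theta>"
    and "pdmp_semigroup E \<pi> \<phi> J m P S"
    and "minimal_semigroup m \<phi> P S PT"
  shows
    "(\<forall>l>0. AE x in m.
        (\<lambda>n. (adjoint_Linf m (jump_resolvent m \<phi> P S l) ^^ n) (\<lambda>_. 1) x)
        \<longlonglongrightarrow> (\<integral>\<omega>. exp_neg (ereal l * explosion_time \<pi> \<phi> \<kappa> \<epsilon> \<theta> x \<omega>) \<partial>W)) \<and>
     (\<forall>B\<in>sets (borel_on E). \<forall>u \<in> generator_dom m S \<inter> L1_pos m. \<forall>t>0.
        (LINT x:B|m. PT t u x) =
        (\<integral>x. measure W {\<omega> \<in> space W. pdmp_process \<pi> \<phi> \<kappa> \<epsilon> \<theta> x t \<omega> \<in> Some ` B \<and>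
                            ereal t < explosion_time \<pi> \<phi> \<kappa> \<epsilon> \<theta> x \<omega>} * u x \<partial>m)) \<and>
     ((\<forall>u\<in>L1 m. is_jump_limit m \<phi> P S u (jump_limit m \<phi> P S u)) \<and>
      transition_operator m (jump_limit m \<phi> P S) (embedded_kernel \<pi> \<phi> J) \<and>
      (\<forall>x\<in>E. markov_process_with_kernel W (borel_on E)
         (\<lambda>n \<omega>. pdmp_process \<pi> \<phi> \<kappa> \<epsilon> \<theta> x (jump_time \<pi> \<phi> \<kappa> \<epsilon> \<theta> x n \<omega>) \<omega>)
         (embedded_kernel \<pi> \<phi> J)))"
proof -
  interpret pdmp_with_semigroup E \<pi> \<phi> J W \<kappa> \<epsilon> \<theta> m P S
    using assms(1,2) by (rule pdmp_with_semigroup.intro)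
  show ?thesis
    using adjoint_limit minimal_semigroup_process[OF assms(3)] jump_limit_embedded(1) jump_limit_transition
      embedded_chain_markov
    by (intro conjI allI ballI impI) auto
qed

end
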